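(* Let $c\in(1,6/5)$. There exist $N_{0}=N_{0}(c)>0$ and $\delta=\delta(c)>0$ such that for every $N>N_{0}$ and for all sets $\mathcal{A},\mathcal{B}\subseteq[N/2,N)\cap\mathbb{N}$ with \[ |\mathcal{A}||\mathcal{B}|\gg N^{2-2\delta}, \] the equation \[ ab=[n^{c}],\qquad a\in\mathcal{A},\ b\in\mathcal{B},\ n\in\mathbb{N}, \] has a solution.
   Context: $\mathbb{N}$ denotes the set of positive integers, $[x]$ denotes the integer part of the real number $x$, and $|\mathcal{S}|$ denotes the cardinality of a finite set $\mathcal{S}$. The notation $U\gg V$ means $U\geq CV$ for some positive constant $C$ not depending on $N$, $\mathcal{A}$ or $\mathcal{B}$. *)

theory Defs
  imports Complex_Main
begin

end

theory Submission
  imports Defs "HOL-Complex_Analysis.Complex_Analysis" "HOL-Real_Asymp.Real_Asymp" "HOL-Library.Discrete_Functions"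
begin

text \<open>
  Put \<open>\<gamma> = 1/c\<close>. If \<open>m = a b\<close> is not of the form \<open>\<lfloor>n\<^sup>c\<rfloor>\<close>, then no integer lies between \<open>m\<^sup>\<gamma>\<close> and
  \<open>(m + 1)\<^sup>\<gamma>\<close>, an interval of length \<open>\<gg> N\<close> to the power \<open>2\<gamma> - 2\<close>. If this happens for all
  \<open>(a, b) \<in> A \<times> B\<close>, a power of the Fejer kernel shows that
  \<open>|A||B| \<le> 4 \<Sum>\<^sub>h |\<Sum>\<^sub>a \<Sum>\<^sub>b e(h a\<^sup>\<gamma> b\<^sup>\<gamma>)|\<close>, where \<open>h\<close> runs up to \<open>N\<close> to the power \<open>2 - 2\<gamma> + \<epsilon>\<close>.
  The Cauchy-Schwarz inequality and the double large sieve bound the right-hand side by the number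
  of nearly equal products \<open>h a\<^sup>\<gamma> \<approx> h' a'\<^sup>\<gamma>\<close>, which is essentially diagonal, and the additive
  energy of the sequence \<open>b\<^sup>\<gamma>\<close>, smoothed at scale \<open>1/X\<close>.

  The energy is \<open>\<ll> N\<close> to the power \<open>2 + \<epsilon>\<close> (a theorem of Robert and Sargos). It is comparable to a
  fourth moment of \<open>\<Sum> e(u b\<^sup>\<gamma>)\<close> over \<open>u \<le> X\<close>. On each dyadic range of \<open>u\<close> the van der Corput B-process
  (truncated Poisson summation followed by stationary phase) turns the sum into a shorter
  sum with the exponent \<open>\<gamma>/(\<gamma> - 1)\<close> in place of \<open>\<gamma>\<close>; as this substitution is an involution, an
  induction on the dyadic level closes.
  The total is a saving over \<open>N\<^sup>2\<close> exactly when \<open>\<gamma> > 5/6\<close>.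
\<close>

section \<open>Oscillatory integrals\<close>

text \<open>Exponent count: with \<open>H\<close> about \<open>N powr (2 - 2 * \<gamma>)\<close>
  there are \<open>H N\<close> points \<open>h a\<^sup>\<gamma>\<close>. The sieve bounds the sum of
  squares over them by the root of (near pairs, \<open>H N\<close>) times (cells,
  \<open>H N powr (2 * \<gamma>)\<close>) times (energy, \<open>N\<^sup>2\<close>). Cauchy-Schwarz
  leaves \<open>H N powr (5/4 + \<gamma>/2)\<close>, that is
  \<open>N powr (13/4 - 3 * \<gamma>/2)\<close>. Two obstacles shape the energy bound. At relative
  tolerance \<open>N powr (-2)\<close>, where random quadruples match the diagonal, the phase
  \<open>T\<close> reaches \<open>N\<^sup>2\<close> and the dual length \<open>T / N\<close> reaches
  \<open>N\<close>: an induction on length would not descend. So the moment stops at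
  \<open>T\<close> about \<open>N powr (2 - \<kappa>)\<close>. This costs
  \<open>N powr \<kappa>\<close>, but the dual length drops to about
  \<open>N powr (1 - \<kappa>)\<close>, and the hypothesis with exponent \<open>2 + \<kappa>\<close>
  returns \<open>N powr (2 + \<kappa> - \<kappa>\<^sup>2)\<close>. The saving absorbs constants and
  logarithms and halves the inductive constant. Moreover the end points of the dual sum move with
  the integration variable, so no mean value bound applies directly; a Rademacher-Menshov majorant,
  free of end points, replaces the sum.\<close>

definition ec :: "real \<Rightarrow> complex" where "ec x = cis (2 * pi * x)"

lemma ec_add: "ec (x + y) = ec x * ec y"
  by (simp add: ec_def cis_mult distrib_left)

lemma ec_diff: "ec (x - y) = ec x * cnj (ec y)"
  by (simp add: ec_def cis_mult cis_cnj right_diff_distrib)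

lemma ec_0 [simp]: "ec 0 = 1"
  by (simp add: ec_def)

lemma ec_minus: "ec (- x) = cnj (ec x)"
  by (simp add: ec_def cis_cnj)

lemma norm_ec [simp]: "norm (ec x) = 1"
  by (simp add: ec_def)

lemma Re_ec: "Re (ec x) = cos (2 * pi * x)"
  by (simp add: ec_def)

lemma ec_of_int [simp]: "ec (of_int n) = 1"
  using cis_multiple_2pi[of "of_int n"] by (simp add: ec_def)

lemma ec_mult_of_nat: "ec (of_nat n * x) = ec x ^ n"
  by (simp add: ec_def Complex.DeMoivre algebra_simps)

lemma continuous_on_ec [continuous_intros]:
  "continuous_on S f \<Longrightarrow> continuous_on S (\<lambda>x. ec (f x))"
  unfolding ec_def by (intro continuous_intros)

lemma ec_has_vector_derivative:
  assumes "(q has_real_derivative q1) (at x within S)"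
  shows "((\<lambda>x. ec (q x)) has_vector_derivative (2 * pi * \<i> * q1 * ec (q x))) (at x within S)"
proof -
  have "((\<lambda>x. cis (2 * pi * q x)) has_derivative (\<lambda>h. (2 * pi * (q1 * h)) *\<^sub>R (\<i> * cis (2 * pi * q x)))) (at x within S)"
    using assms unfolding has_field_derivative_def
    by (auto intro!: derivative_eq_intros)
  thus ?thesis
    unfolding ec_def has_vector_derivative_def
    by (rule has_derivative_eq_rhs) (auto simp: scaleR_conv_of_real algebra_simps)
qed

text \<open>Write \<open>ec q\<close> as its derivative over \<open>2 * pi * \<i> * q1\<close> and
  integrate by parts. The remaining integrand is at most \<open>\<bar>q2\<bar> / q1^2\<close> over
  \<open>2 * pi\<close>; as \<open>q2\<close> keeps one sign, it integrates to the total change of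
  \<open>1 / q1\<close>. The boundary terms are kept explicit because the Poisson tails need
  cancellation among them.\<close>

lemma osc_integral_by_parts:
  fixes q q1 q2 :: "real \<Rightarrow> real"
  assumes ab: "a \<le> b"
    and q: "\<And>x. x \<in> {a..b} \<Longrightarrow> (q has_real_derivative q1 x) (at x)"
    and q1: "\<And>x. x \<in> {a..b} \<Longrightarrow> (q1 has_real_derivative q2 x) (at x)"
    and q2: "continuous_on {a..b} q2"
    and nz: "\<And>x. x \<in> {a..b} \<Longrightarrow> q1 x \<noteq> 0"
    and sgn: "(\<forall>x\<in>{a..b}. q2 x \<ge> 0) \<or> (\<forall>x\<in>{a..b}. q2 x \<le> 0)"
  shows "norm (integral {a..b} (\<lambda>x. ec (q x)) - (ec (q b) / (2*pi*\<i>*q1 b) - ec (q a) / (2*pi*\<i>*q1 a)))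
           \<le> \<bar>1 / q1 b - 1 / q1 a\<bar> / (2*pi)"
proof -
  have cq: "continuous_on {a..b} q" and cq1: "continuous_on {a..b} q1"
    by (auto intro!: continuous_at_imp_continuous_on DERIV_isCont q q1)
  define G where "G = (\<lambda>x. ec (q x) * of_real (1 / q1 x) / (2*pi*\<i>))"
  define K where "K = (\<lambda>x. ec (q x) * of_real (q2 x / (q1 x)^2) / (2*pi*\<i>))"
  have dinv: "((\<lambda>x. 1 / q1 x) has_real_derivative - (q2 x / (q1 x)^2)) (at x within {a..b})" if "x \<in> {a..b}" for x
    using DERIV_inverse_fun[OF has_field_derivative_at_within[OF q1[OF that], of "{a..b}"] nz[OF that]]
    by (simp add: field_simps power2_eq_square)
  have dG: "(G has_vector_derivative (ec (q x) - K x)) (at x within {a..b})" if x: "x \<in> {a..b}" for x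
  proof -
    have 1: "((\<lambda>x. complex_of_real (1 / q1 x)) has_vector_derivative complex_of_real (- (q2 x / (q1 x)^2))) (at x within {a..b})"
      by (rule has_vector_derivative_of_real[OF dinv[OF x]])
    have 2: "((\<lambda>x. ec (q x)) has_vector_derivative (2 * pi * \<i> * q1 x * ec (q x))) (at x within {a..b})"
      by (rule ec_has_vector_derivative[OF has_field_derivative_at_within[OF q[OF x]]])
    have 3: "(G has_vector_derivative ((ec (q x) * complex_of_real (- (q2 x / (q1 x)^2)) + (2 * pi * \<i> * q1 x * ec (q x)) * complex_of_real (1 / q1 x)) / (2*pi*\<i>))) (at x within {a..b})"
      unfolding G_def by (intro has_vector_derivative_divide has_vector_derivative_mult 1 2)
    have 4: "(ec (q x) * complex_of_real (- (q2 x / (q1 x)^2)) + (2 * pi * \<i> * q1 x * ec (q x)) * complex_of_real (1 / q1 x)) / (2*pi*\<i>) = ec (q x) - K x"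
      using nz[OF x] by (simp add: K_def field_simps)
    show ?thesis using 3 unfolding 4 .
  qed
  have FTC: "((\<lambda>x. ec (q x) - K x) has_integral (G b - G a)) {a..b}"
    by (rule fundamental_theorem_of_calculus[OF ab dG])
  have ie: "(\<lambda>x. ec (q x)) integrable_on {a..b}"
    by (intro integrable_continuous_real continuous_intros cq)
  have cont: "continuous_on {a..b} (\<lambda>x. q2 x / (q1 x)^2)"
    by (intro continuous_intros q2 cq1) (use nz in auto)
  have iK: "K integrable_on {a..b}"
    unfolding K_def by (intro integrable_continuous_real continuous_intros cq cont) simp
  have eq: "integral {a..b} (\<lambda>x. ec (q x)) - (G b - G a) = integral {a..b} K"
    using integral_unique[OF FTC] integral_diff[OF ie iK] by (simp add: algebra_simps)
  have F2: "((\<lambda>x. q2 x / (q1 x)^2) has_integral (1 / q1 a - 1 / q1 b)) {a..b}"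
    using has_integral_neg[OF fundamental_theorem_of_calculus[OF ab, of "\<lambda>x. 1 / q1 x" "\<lambda>x. - (q2 x / (q1 x)^2)"]]
      dinv by (simp add: has_real_derivative_iff_has_vector_derivative)
  have F3: "((\<lambda>x. \<bar>q2 x\<bar> / (q1 x)^2) has_integral \<bar>1 / q1 b - 1 / q1 a\<bar>) {a..b}"
    using sgn
  proof
    assume s: "\<forall>x\<in>{a..b}. q2 x \<ge> 0"
    have "((\<lambda>x. \<bar>q2 x\<bar> / (q1 x)^2) has_integral (1 / q1 a - 1 / q1 b)) {a..b}"
      by (rule has_integral_eq[OF _ F2]) (use s in auto)
    moreover from this have "1 / q1 a - 1 / q1 b \<ge> 0"
      by (rule has_integral_nonneg) auto
    moreover from calculation(2) have "\<bar>1 / q1 b - 1 / q1 a\<bar> = 1 / q1 a - 1 / q1 b" by linarith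
    ultimately show ?thesis by presburger
  next
    assume s: "\<forall>x\<in>{a..b}. q2 x \<le> 0"
    have "((\<lambda>x. \<bar>q2 x\<bar> / (q1 x)^2) has_integral - (1 / q1 a - 1 / q1 b)) {a..b}"
      by (rule has_integral_eq[OF _ has_integral_neg[OF F2]]) (use s in auto)
    moreover from this have "- (1 / q1 a - 1 / q1 b) \<ge> 0"
      by (rule has_integral_nonneg) auto
    moreover from calculation(2) have "\<bar>1 / q1 b - 1 / q1 a\<bar> = - (1 / q1 a - 1 / q1 b)" by linarith
    ultimately show ?thesis by presburger
  qed
  have F4: "((\<lambda>x. \<bar>q2 x\<bar> / (q1 x)^2 / (2*pi)) has_integral \<bar>1 / q1 b - 1 / q1 a\<bar> / (2*pi)) {a..b}"
    by (rule has_integral_divide[OF F3])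
  have "norm (integral {a..b} K) \<le> \<bar>1 / q1 b - 1 / q1 a\<bar> / (2*pi)"
    using integral_norm_bound_integral[OF iK has_integral_integrable[OF F4]] integral_unique[OF F4]
    by (simp add: K_def norm_mult norm_divide norm_power)
  thus ?thesis unfolding eq[symmetric] by (simp add: G_def mult_ac)
qed

text \<open>Van der Corput's first-derivative test: the two boundary terms and the change of
  \<open>1 / q1\<close> are each at most \<open>1 / l\<close> over \<open>2 * pi\<close>, and
  \<open>3 / (2 * pi) < 1\<close>.\<close>

lemma osc_integral_first_deriv:
  fixes q q1 q2 :: "real \<Rightarrow> real"
  assumes ab: "a \<le> b"
    and q: "\<And>x. x \<in> {a..b} \<Longrightarrow> (q has_real_derivative q1 x) (at x)"
    and q1: "\<And>x. x \<in> {a..b} \<Longrightarrow> (q1 has_real_derivative q2 x) (at x)"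
    and q2: "continuous_on {a..b} q2"
    and big: "(\<forall>x\<in>{a..b}. q1 x \<ge> l) \<or> (\<forall>x\<in>{a..b}. q1 x \<le> - l)" and l: "l > 0"
    and sgn: "(\<forall>x\<in>{a..b}. q2 x \<ge> 0) \<or> (\<forall>x\<in>{a..b}. q2 x \<le> 0)"
  shows "norm (integral {a..b} (\<lambda>x. ec (q x))) \<le> 1 / l"
proof -
  have nz: "q1 x \<noteq> 0" if "x \<in> {a..b}" for x
    using big l that by force
  have A: "\<bar>1 / q1 x\<bar> \<le> 1 / l" if "x \<in> {a..b}" for x
  proof -
    have "\<bar>q1 x\<bar> \<ge> l" using big that by force
    thus ?thesis using l by (simp add: frac_le)
  qed
  have B: "\<bar>1 / q1 b - 1 / q1 a\<bar> \<le> 1 / l"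
    using big
  proof
    assume s: "\<forall>x\<in>{a..b}. q1 x \<ge> l"
    have "1 / q1 a > 0" "1 / q1 b > 0" using s l ab by (force intro!: divide_pos_pos)+
    thus ?thesis using A[of a] A[of b] ab by (smt (verit) atLeastAtMost_iff)
  next
    assume s: "\<forall>x\<in>{a..b}. q1 x \<le> - l"
    have "1 / q1 a < 0" "1 / q1 b < 0" using s l ab by (force intro!: divide_pos_neg)+
    thus ?thesis using A[of a] A[of b] ab by (smt (verit) atLeastAtMost_iff)
  qed
  have C: "norm (ec (q x) / (2*pi*\<i>*q1 x)) \<le> 1 / l / (2*pi)" if "x \<in> {a..b}" for x
    using divide_right_mono[OF A[OF that], of "2*pi"] by (simp add: norm_divide norm_mult mult_ac)
  have "norm (integral {a..b} (\<lambda>x. ec (q x)))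
      \<le> norm (integral {a..b} (\<lambda>x. ec (q x)) - (ec (q b) / (2*pi*\<i>*q1 b) - ec (q a) / (2*pi*\<i>*q1 a)))
        + (norm (ec (q b) / (2*pi*\<i>*q1 b)) + norm (ec (q a) / (2*pi*\<i>*q1 a)))"
    by (smt (verit) norm_triangle_ineq4 norm_triangle_sub)
  also have "\<dots> \<le> 1 / l / (2*pi) + (1 / l / (2*pi) + 1 / l / (2*pi))"
  proof (intro add_mono)
    show "norm (integral {a..b} (\<lambda>x. ec (q x)) - (ec (q b) / (2*pi*\<i>*q1 b) - ec (q a) / (2*pi*\<i>*q1 a))) \<le> 1 / l / (2*pi)"
      using osc_integral_by_parts[OF ab q q1 q2 nz sgn] divide_right_mono[OF B, of "2*pi"] by simp
  qed (use C[of a] C[of b] ab in auto)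
  also have "\<dots> = (1 / l) * (3 / (2 * pi))" by (simp add: field_simps)
  also have "\<dots> \<le> 1 / l * 1"
    by (intro mult_left_mono) (use pi_gt3 l in auto)
  finally show ?thesis by simp
qed

text \<open>Since \<open>q1\<close> decreases at rate at least \<open>l\<close>, the hypothesis
  \<open>side\<close> keeps its zero out of the interior. A piece of length
  \<open>1 / sqrt l\<close> at the end where \<open>q1\<close> may be small is estimated trivially;
  on the rest \<open>\<bar>q1\<bar> \<ge> sqrt l\<close> and the first-derivative test
  applies.\<close>

lemma osc_integral_second_deriv_aux:
  fixes q q1 q2 :: "real \<Rightarrow> real"
  assumes ab: "a \<le> b"
    and q: "\<And>x. x \<in> {a..b} \<Longrightarrow> (q has_real_derivative q1 x) (at x)"
    and q1: "\<And>x. x \<in> {a..b} \<Longrightarrow> (q1 has_real_derivative q2 x) (at x)"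
    and q2: "continuous_on {a..b} q2"
    and l: "l > 0" and sgn: "\<And>x. x \<in> {a..b} \<Longrightarrow> q2 x \<le> - l"
    and side: "q1 a \<le> 0 \<or> q1 b \<ge> 0"
  shows "norm (integral {a..b} (\<lambda>x. ec (q x))) \<le> 2 / sqrt l"
proof -
  have cq: "continuous_on {a..b} q"
    by (auto intro!: continuous_at_imp_continuous_on DERIV_isCont q)
  have int: "(\<lambda>x. ec (q x)) integrable_on {a..b}"
    by (intro integrable_continuous_real continuous_intros cq)
  have triv: "norm (integral {c..d} (\<lambda>x. ec (q x))) \<le> d - c" if "a \<le> c" "c \<le> d" "d \<le> b" for c d
  proof -
    have "((\<lambda>x. ec (q x)) has_integral integral {c..d} (\<lambda>x. ec (q x))) (cbox c d)"
      using integrable_integral integrable_on_subinterval[OF int, of c d] that by auto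
    from has_integral_bound[OF _ this, of 1] show ?thesis using that by simp
  qed
  define r where "r = 1 / sqrt l"
  have r: "r > 0" "l * r = sqrt l" "1 / sqrt l = r"
    using l by (simp_all add: r_def real_div_sqrt)
  have dec: "q1 y - q1 x \<le> - l * (y - x)" if "a \<le> x" "x \<le> y" "y \<le> b" for x y
  proof (cases "x = y")
    case False
    hence "x < y" using that by simp
    have "\<exists>z>x. z < y \<and> q1 y - q1 x = (y - x) * q2 z"
      by (rule MVT2[OF \<open>x < y\<close>], rule q1) (use that in auto)
    then obtain z where z: "x < z" "z < y" "q1 y - q1 x = (y - x) * q2 z" by blast
    have "(y - x) * q2 z \<le> (y - x) * (- l)" using sgn[of z] z that by (intro mult_left_mono) auto
    thus ?thesis using z by (simp add: algebra_simps)
  qed simp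
  have fd: "norm (integral {c..d} (\<lambda>x. ec (q x))) \<le> r"
    if "a \<le> c" "c \<le> d" "d \<le> b" "(\<forall>x\<in>{c..d}. q1 x \<ge> sqrt l) \<or> (\<forall>x\<in>{c..d}. q1 x \<le> - sqrt l)" for c d
  proof -
    have s: "(\<forall>x\<in>{c..d}. q2 x \<ge> 0) \<or> (\<forall>x\<in>{c..d}. q2 x \<le> 0)"
      using sgn l that by (smt (verit) atLeastAtMost_iff)
    have "norm (integral {c..d} (\<lambda>x. ec (q x))) \<le> 1 / sqrt l"
      by (rule osc_integral_first_deriv[where ?q1.0=q1 and ?q2.0=q2])
         (use that l s q q1 in \<open>auto intro: continuous_on_subset[OF q2]\<close>)
    thus ?thesis by (simp add: r)
  qed
  consider "b - a \<le> r" | "b - a > r" "q1 a \<le> 0" | "b - a > r" "q1 b \<ge> 0"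
    using side by linarith
  hence "norm (integral {a..b} (\<lambda>x. ec (q x))) \<le> 2 * r"
  proof cases
    case 1
    thus ?thesis using triv[of a b] ab r by simp
  next
    case 2
    have "norm (integral {a+r..b} (\<lambda>x. ec (q x))) \<le> r"
    proof (rule fd)
      have "q1 x \<le> - sqrt l" if "x \<in> {a+r..b}" for x
      proof -
        have "l * r \<le> l * (x - a)" using that l by (intro mult_left_mono) auto
        thus ?thesis using dec[of a x] that r 2 by auto
      qed
      thus "(\<forall>x\<in>{a+r..b}. q1 x \<ge> sqrt l) \<or> (\<forall>x\<in>{a+r..b}. q1 x \<le> - sqrt l)" by blast
    qed (use 2 r in auto)
    moreover have "norm (integral {a..a+r} (\<lambda>x. ec (q x))) \<le> r"
      using triv[of a "a+r"] 2 r by simp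
    moreover have "integral {a..a+r} (\<lambda>x. ec (q x)) + integral {a+r..b} (\<lambda>x. ec (q x)) = integral {a..b} (\<lambda>x. ec (q x))"
      by (rule Henstock_Kurzweil_Integration.integral_combine) (use 2 r int in auto)
    ultimately show ?thesis by (smt (verit) norm_triangle_ineq)
  next
    case 3
    have "norm (integral {a..b-r} (\<lambda>x. ec (q x))) \<le> r"
    proof (rule fd)
      have "q1 x \<ge> sqrt l" if "x \<in> {a..b-r}" for x
      proof -
        have "l * r \<le> l * (b - x)" using that l by (intro mult_left_mono) auto
        thus ?thesis using dec[of x b] that r 3 by auto
      qed
      thus "(\<forall>x\<in>{a..b-r}. q1 x \<ge> sqrt l) \<or> (\<forall>x\<in>{a..b-r}. q1 x \<le> - sqrt l)" by blast
    qed (use 3 r in auto)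
    moreover have "norm (integral {b-r..b} (\<lambda>x. ec (q x))) \<le> r"
      using triv[of "b-r" b] 3 r by simp
    moreover have "integral {a..b-r} (\<lambda>x. ec (q x)) + integral {b-r..b} (\<lambda>x. ec (q x)) = integral {a..b} (\<lambda>x. ec (q x))"
      by (rule Henstock_Kurzweil_Integration.integral_combine) (use 3 r int in auto)
    ultimately show ?thesis by (smt (verit) norm_triangle_ineq)
  qed
  thus ?thesis by (simp add: r_def)
qed

text \<open>If \<open>q1\<close> changes sign inside, the interval is split at the zero; each half
  is a one-sided case, hence \<open>4\<close> in place of \<open>2\<close>.\<close>

lemma osc_integral_second_deriv:
  fixes q q1 q2 :: "real \<Rightarrow> real"
  assumes ab: "a \<le> b"
    and q: "\<And>x. x \<in> {a..b} \<Longrightarrow> (q has_real_derivative q1 x) (at x)"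
    and q1: "\<And>x. x \<in> {a..b} \<Longrightarrow> (q1 has_real_derivative q2 x) (at x)"
    and q2: "continuous_on {a..b} q2"
    and l: "l > 0" and sgn: "\<And>x. x \<in> {a..b} \<Longrightarrow> q2 x \<le> - l"
  shows "norm (integral {a..b} (\<lambda>x. ec (q x))) \<le> 4 / sqrt l"
proof (cases "q1 a \<le> 0 \<or> q1 b \<ge> 0")
  case True
  have "norm (integral {a..b} (\<lambda>x. ec (q x))) \<le> 2 / sqrt l"
    by (rule osc_integral_second_deriv_aux[OF ab q q1 q2 l sgn True])
  also have "\<dots> \<le> 4 / sqrt l" using l by (intro divide_right_mono) auto
  finally show ?thesis .
next
  case False
  have cq: "continuous_on {a..b} q" and cq1: "continuous_on {a..b} q1"
    by (auto intro!: continuous_at_imp_continuous_on DERIV_isCont q q1)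
  have int: "(\<lambda>x. ec (q x)) integrable_on {a..b}"
    by (intro integrable_continuous_real continuous_intros cq)
  obtain c where c: "a \<le> c" "c \<le> b" "q1 c = 0"
    using IVT2'[of q1 b 0 a] False ab cq1 by auto
  have "norm (integral {a..c} (\<lambda>x. ec (q x))) \<le> 2 / sqrt l"
    by (rule osc_integral_second_deriv_aux[where ?q1.0=q1 and ?q2.0=q2])
       (use c l sgn q q1 in \<open>auto intro: continuous_on_subset[OF q2]\<close>)
  moreover have "norm (integral {c..b} (\<lambda>x. ec (q x))) \<le> 2 / sqrt l"
    by (rule osc_integral_second_deriv_aux[where ?q1.0=q1 and ?q2.0=q2])
       (use c l sgn q q1 in \<open>auto intro: continuous_on_subset[OF q2]\<close>)
  moreover have "integral {a..c} (\<lambda>x. ec (q x)) + integral {c..b} (\<lambda>x. ec (q x)) = integral {a..b} (\<lambda>x. ec (q x))"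
    by (rule Henstock_Kurzweil_Integration.integral_combine) (use c int in auto)
  moreover have "4 / sqrt l = 2 / sqrt l + 2 / sqrt l" by simp
  ultimately show ?thesis by (smt (verit) norm_triangle_ineq)
qed

section \<open>Truncated Poisson summation\<close>

lemma abel_summation_bound:
  fixes z :: "nat \<Rightarrow> 'a::real_normed_vector" and w :: "nat \<Rightarrow> real"
  assumes part: "\<And>m. m \<le> n \<Longrightarrow> norm (\<Sum>i<m. z i) \<le> B"
    and dec: "\<And>i. Suc i < n \<Longrightarrow> w (Suc i) \<le> w i" and nonneg: "\<And>i. i < n \<Longrightarrow> 0 \<le> w i"
    and n: "0 < n"
  shows "norm (\<Sum>i<n. w i *\<^sub>R z i) \<le> w 0 * B"
proof -
  define S where "S = (\<lambda>m. \<Sum>i<m. z i)"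
  have id: "(\<Sum>i<Suc k. w i *\<^sub>R z i) = w k *\<^sub>R S (Suc k) + (\<Sum>i<k. (w i - w (Suc i)) *\<^sub>R S (Suc i))" for k
    by (induction k) (simp_all add: S_def algebra_simps)
  obtain k where k: "n = Suc k" using n gr0_implies_Suc by blast
  have "norm (\<Sum>i<n. w i *\<^sub>R z i) \<le> norm (w k *\<^sub>R S (Suc k)) + (\<Sum>i<k. norm ((w i - w (Suc i)) *\<^sub>R S (Suc i)))"
    unfolding k id by (intro order_trans[OF norm_triangle_ineq] add_left_mono norm_sum)
  also have "\<dots> \<le> w k * B + (\<Sum>i<k. (w i - w (Suc i)) * B)"
  proof (intro add_mono sum_mono)
    have S: "norm (S m) \<le> B" if "m \<le> n" for m using part[OF that] by (simp add: S_def)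
    show "norm (w k *\<^sub>R S (Suc k)) \<le> w k * B"
      using S[of "Suc k"] nonneg[of k] k by (simp add: mult_left_mono)
    show "norm ((w i - w (Suc i)) *\<^sub>R S (Suc i)) \<le> (w i - w (Suc i)) * B" if "i \<in> {..<k}" for i
      using S[of "Suc i"] dec[of i] k that by (simp add: mult_left_mono)
  qed
  also have "\<dots> = w 0 * B"
    by (simp only: sum_distrib_right[symmetric] sum_lessThan_telescope') (simp add: algebra_simps)
  finally show ?thesis .
qed

lemma sin_ge_half:
  fixes y :: real
  assumes "0 \<le> y" "y \<le> pi / 2"
  shows "y / 2 \<le> sin y"
proof (cases "y \<le> pi / 3")
  case True
  show ?thesis
  proof (cases "y = 0")
    case False
    hence "0 < y" using assms by simp
    have "\<exists>z>0. z < y \<and> sin y - sin 0 = (y - 0) * cos z"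
      by (rule MVT2[OF \<open>0 < y\<close>]) (auto intro: DERIV_sin)
    then obtain z where z: "0 < z" "z < y" "sin y = y * cos z" by auto
    have "cos (pi / 3) \<le> cos z"
      using z True pi_gt_zero by (intro cos_monotone_0_pi_le) auto
    hence "y * (1 / 2) \<le> y * cos z" using \<open>0 < y\<close> by (intro mult_left_mono) (auto simp: cos_60)
    thus ?thesis using z by simp
  qed simp
next
  case False
  have "sin (pi / 3) \<le> sin y" using False assms by (intro sin_monotone_2pi_le) auto
  moreover have "sqrt 3 \<ge> 1.7" by (rule real_le_rsqrt) (simp add: power2_eq_square)
  ultimately show ?thesis using assms pi_less_4 pi_approx by (simp add: sin_60)
qed

lemma abs_sin_pi_ge:
  fixes x :: real
  assumes "\<bar>x\<bar> \<le> 1 / 2"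
  shows "\<bar>x\<bar> \<le> \<bar>sin (pi * x)\<bar>"
proof -
  have "pi * \<bar>x\<bar> / 2 \<le> sin (pi * \<bar>x\<bar>)"
    using assms by (intro sin_ge_half) auto
  moreover have "sin (pi * \<bar>x\<bar>) \<le> \<bar>sin (pi * x)\<bar>" by (cases "x \<ge> 0") auto
  moreover have "2 * \<bar>x\<bar> \<le> pi * \<bar>x\<bar>" using pi_gt3 by (intro mult_right_mono) auto
  ultimately show ?thesis by linarith
qed

section \<open>The Dirichlet kernel and its pointwise convergence\<close>

definition dker :: "nat \<Rightarrow> real \<Rightarrow> complex" where
  "dker V x = (\<Sum>v\<in>{- int V..int V}. ec (of_int v * x))"

lemma dker_mult_sin: "of_real (sin (pi * x)) * dker V x = of_real (sin (real (2 * V + 1) * pi * x))"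
proof (induction V)
  case 0
  show ?case by (simp add: dker_def)
next
  case (Suc V)
  have "{- int (Suc V)..int (Suc V)} = insert (- int (Suc V)) (insert (int (Suc V)) {- int V..int V})" by auto
  hence "dker (Suc V) x = dker V x + (ec (- (real (Suc V) * x)) + ec (real (Suc V) * x))"
    by (simp add: dker_def algebra_simps)
  also have "ec (- (real (Suc V) * x)) + ec (real (Suc V) * x) = of_real (2 * cos (2 * pi * (real (Suc V) * x)))"
    by (simp add: ec_def complex_eq_iff)
  finally have "of_real (sin (pi * x)) * dker (Suc V) x
      = of_real (sin (real (2 * V + 1) * pi * x) + 2 * (sin (pi * x) * cos (2 * pi * (real (Suc V) * x))))"
    by (simp only: distrib_left Suc.IH) (simp add: algebra_simps)
  also have "2 * (sin (pi * x) * cos (2 * pi * (real (Suc V) * x))) = sin (real (2 * Suc V + 1) * pi * x) - sin (real (2 * V + 1) * pi * x)"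
  proof -
    have 1: "real (2 * Suc V + 1) * pi * x = 2 * pi * (real (Suc V) * x) + pi * x"
      and 2: "real (2 * V + 1) * pi * x = 2 * pi * (real (Suc V) * x) - pi * x"
      by (simp_all add: algebra_simps)
    show ?thesis unfolding 1 2 sin_add sin_diff by simp
  qed
  finally show ?case by simp
qed

lemma continuous_on_dker [continuous_intros]: "continuous_on S (dker V)"
  unfolding dker_def[abs_def] by (intro continuous_intros)

lemma dker_shift: "dker V (x + of_int n) = dker V x"
proof -
  have "ec (of_int v * (x + of_int n)) = ec (of_int v * x)" for v
    using ec_of_int[of "v * n"] by (simp add: distrib_left ec_add)
  thus ?thesis by (simp add: dker_def)
qed

lemma integral_ec_int_multiple:
  "((\<lambda>x. ec (of_int v * x)) has_integral (if v = 0 then 1 else 0)) {-1/2..1/2}"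
proof (cases "v = 0")
  case True
  have "((\<lambda>x. 1::complex) has_integral measure lborel (cbox (-1/2) (1/2::real)) *\<^sub>R 1) (cbox (-1/2) (1/2::real))"
    by (rule has_integral_const)
  thus ?thesis using True by simp
next
  case False
  have "((\<lambda>x. ec (of_int v * x)) has_integral ec (of_int v * (1/2)) / (2 * pi * \<i> * of_int v) - ec (of_int v * (-1/2)) / (2 * pi * \<i> * of_int v)) {-1/2..1/2}"
  proof (rule fundamental_theorem_of_calculus)
    fix x :: real
    have "((\<lambda>x. ec (of_int v * x)) has_vector_derivative (2 * pi * \<i> * of_int v * ec (of_int v * x))) (at x within {-1/2..1/2})"
      using ec_has_vector_derivative[of "\<lambda>x. of_int v * x" "of_int v" x "{-1/2..1/2}"] DERIV_cmult_Id[of "of_int v::real"] by simp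
    from has_vector_derivative_divide[OF this, of "2 * pi * \<i> * of_int v"]
    show "((\<lambda>x. ec (of_int v * x) / (2 * pi * \<i> * of_int v)) has_vector_derivative ec (of_int v * x)) (at x within {-1/2..1/2})"
      using False by simp
  qed simp
  moreover have "ec (of_int v * (1/2)) = ec (of_int v * (-1/2))"
  proof -
    have "ec (of_int v * (1/2)) = ec (of_int v * (-1/2) + of_int v)" by simp
    thus ?thesis by (simp only: ec_add ec_of_int mult_1_right)
  qed
  ultimately show ?thesis using False by simp
qed

lemma integral_dker: "(dker V has_integral 1) {-1/2..1/2}"
proof -
  have "((\<lambda>x. \<Sum>v\<in>{- int V..int V}. ec (of_int v * x)) has_integral (\<Sum>v\<in>{- int V..int V}. (if v = 0 then 1 else 0))) {-1/2..1/2}"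
    by (intro has_integral_sum integral_ec_int_multiple) auto
  thus ?thesis by (simp add: dker_def[abs_def])
qed

text \<open>One integration by parts puts the frequency into the denominator. The frequencies
  \<open>(2 * V + 1) * pi\<close> are those in the numerator of the Dirichlet kernel.\<close>

lemma riemann_lebesgue_C1:
  fixes H H' :: "real \<Rightarrow> complex"
  assumes ab: "a \<le> b"
    and H: "\<And>x. x \<in> {a..b} \<Longrightarrow> (H has_vector_derivative H' x) (at x within {a..b})"
    and H': "continuous_on {a..b} H'"
  shows "(\<lambda>V. integral {a..b} (\<lambda>x. H x * of_real (sin (real (2 * V + 1) * pi * x)))) \<longlonglongrightarrow> 0"
proof -
  have cH: "continuous_on {a..b} H"
    using H has_vector_derivative_continuous continuous_on_eq_continuous_within by blast
  define C where "C = norm (H a) + norm (H b) + integral {a..b} (\<lambda>x. norm (H' x))"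
  have bound: "norm (integral {a..b} (\<lambda>x. H x * of_real (sin (w * x)))) \<le> C / w" if w: "w > 0" for w
  proof -
    define G where "G = (\<lambda>x. H x * of_real (- cos (w * x) / w))"
    have dG: "(G has_vector_derivative (H x * of_real (sin (w * x)) + H' x * of_real (- cos (w * x) / w))) (at x within {a..b})" if "x \<in> {a..b}" for x
    proof -
      have "((\<lambda>x. - cos (w * x) / w) has_real_derivative sin (w * x)) (at x within {a..b})"
        using w by (auto intro!: derivative_eq_intros)
      from has_vector_derivative_mult[OF H[OF that] has_vector_derivative_of_real[OF this]]
      show ?thesis by (simp add: G_def)
    qed
    have FTC: "((\<lambda>x. H x * of_real (sin (w * x)) + H' x * of_real (- cos (w * x) / w)) has_integral (G b - G a)) {a..b}"
      by (rule fundamental_theorem_of_calculus[OF ab dG])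
    have i1: "(\<lambda>x. H x * of_real (sin (w * x))) integrable_on {a..b}"
      by (intro integrable_continuous_real continuous_intros cH)
    have i2: "(\<lambda>x. H' x * of_real (- cos (w * x) / w)) integrable_on {a..b}"
      by (intro integrable_continuous_real continuous_intros H') (use w in auto)
    have i3: "(\<lambda>x. norm (H' x) / w) integrable_on {a..b}"
      by (intro integrable_continuous_real continuous_intros H') (use w in auto)
    have eq: "integral {a..b} (\<lambda>x. H x * of_real (sin (w * x))) = G b - G a - integral {a..b} (\<lambda>x. H' x * of_real (- cos (w * x) / w))"
    proof -
      have "integral {a..b} (\<lambda>x. H x * of_real (sin (w * x))) + integral {a..b} (\<lambda>x. H' x * of_real (- cos (w * x) / w))
        = integral {a..b} (\<lambda>x. H x * of_real (sin (w * x)) + H' x * of_real (- cos (w * x) / w))"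
        by (rule Henstock_Kurzweil_Integration.integral_add[OF i1 i2, symmetric])
      also have "\<dots> = G b - G a" by (rule integral_unique[OF FTC])
      finally show ?thesis by (simp only: eq_diff_eq)
    qed
    have n1: "norm (H x * of_real (- cos (w * x) / w)) \<le> norm (H x) / w" for H :: "real \<Rightarrow> complex" and x
    proof -
      have "norm (H x) * (\<bar>cos (w * x)\<bar> / w) \<le> norm (H x) * (1 / w)"
        using w by (intro mult_left_mono divide_right_mono) auto
      thus ?thesis using w by (simp add: norm_mult norm_divide)
    qed
    have "norm (integral {a..b} (\<lambda>x. H' x * of_real (- cos (w * x) / w))) \<le> integral {a..b} (\<lambda>x. norm (H' x) / w)"
      by (rule integral_norm_bound_integral[OF i2 i3]) (rule n1)
    also have "\<dots> = integral {a..b} (\<lambda>x. norm (H' x)) / w" by simp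
    finally have n2: "norm (integral {a..b} (\<lambda>x. H' x * of_real (- cos (w * x) / w))) \<le> integral {a..b} (\<lambda>x. norm (H' x)) / w" .
    have "norm (integral {a..b} (\<lambda>x. H x * of_real (sin (w * x)))) \<le> norm (G b) + norm (G a) + norm (integral {a..b} (\<lambda>x. H' x * of_real (- cos (w * x) / w)))"
      unfolding eq by (smt (verit) norm_triangle_ineq4)
    also have "\<dots> \<le> norm (H b) / w + norm (H a) / w + integral {a..b} (\<lambda>x. norm (H' x)) / w"
      unfolding G_def by (intro add_mono n1 n2)
    finally show ?thesis by (simp add: C_def add_divide_distrib algebra_simps)
  qed
  show ?thesis
  proof (rule Lim_null_comparison)
    show "\<forall>\<^sub>F V in sequentially. norm (integral {a..b} (\<lambda>x. H x * of_real (sin (real (2 * V + 1) * pi * x)))) \<le> C / (real (2 * V + 1) * pi)"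
      by (intro always_eventually allI bound) auto
    show "(\<lambda>V. C / (real (2 * V + 1) * pi)) \<longlonglongrightarrow> 0"
      by real_asymp
  qed
qed

text \<open>The kernel has integral 1, so it suffices to treat \<open>F - F 0\<close>. This is at
  most a constant times \<open>\<bar>x\<bar>\<close>, while the kernel is at most
  \<open>1 / \<bar>sin (pi * x)\<bar>\<close>, hence at most \<open>1 / \<bar>x\<bar>\<close>. The
  product is thus bounded uniformly in \<open>V\<close>: a short interval about 0 contributes
  little, and the two outer pieces tend to 0 by Riemann-Lebesgue.\<close>

lemma dirichlet_kernel_tendsto:
  fixes F F' :: "real \<Rightarrow> complex"
  assumes F: "\<And>x. x \<in> {-1/2..1/2} \<Longrightarrow> (F has_vector_derivative F' x) (at x within {-1/2..1/2})"
    and F': "continuous_on {-1/2..1/2} F'"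
  shows "(\<lambda>V. integral {-1/2..1/2} (\<lambda>x. F x * dker V x)) \<longlonglongrightarrow> F 0"
proof -
  let ?I = "{-1/2..1/2::real}"
  have cF: "continuous_on ?I F"
    using F has_vector_derivative_continuous continuous_on_eq_continuous_within by blast
  obtain B where B: "\<And>x. x \<in> ?I \<Longrightarrow> norm (F' x) \<le> B" "B > 0"
    using compact_imp_bounded[OF compact_continuous_image[OF F']] bounded_pos
    by (metis compact_Icc image_eqI)
  have lip: "norm (F x - F 0) \<le> B * \<bar>x\<bar>" if "x \<in> ?I" for x
  proof -
    have on: "onorm (\<lambda>h. h *\<^sub>R F' y) \<le> B" if "y \<in> ?I" for y
    proof (rule onorm_le)
      show "norm (h *\<^sub>R F' y) \<le> B * norm h" for h
        using mult_right_mono[OF B(1)[OF that], of "\<bar>h\<bar>"] by (simp add: mult.commute)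
    qed
    have "norm (F x - F 0) \<le> B * norm (x - 0)"
      by (rule differentiable_bound[of ?I F "\<lambda>x h. h *\<^sub>R F' x" B])
         (use F on that in \<open>auto simp: has_vector_derivative_def\<close>)
    thus ?thesis by simp
  qed
  define G where "G = (\<lambda>V x. (F x - F 0) * dker V x)"
  have cG: "continuous_on S (G V)" if "S \<subseteq> ?I" for S V
    unfolding G_def by (intro continuous_intros continuous_on_subset[OF cF] that)
  have iG: "G V integrable_on {c..d}" if "{c..d} \<subseteq> ?I" for c d V
    by (intro integrable_continuous_real cG that)
  have nG: "norm (G V x) \<le> B" if x: "x \<in> ?I" for V x
  proof (cases "x = 0")
    case False
    have sn: "\<bar>x\<bar> \<le> \<bar>sin (pi * x)\<bar>" using x by (intro abs_sin_pi_ge) auto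
    have "\<bar>sin (pi * x)\<bar> * norm (dker V x) = norm (of_real (sin (pi * x)) * dker V x)"
      by (simp add: norm_mult)
    also have "\<dots> \<le> 1" by (simp add: dker_mult_sin)
    finally have 1: "\<bar>sin (pi * x)\<bar> * norm (dker V x) \<le> 1" .
    have "norm (G V x) \<le> B * \<bar>x\<bar> * norm (dker V x)"
      using lip[OF x] by (simp add: G_def norm_mult mult_right_mono)
    also have "\<dots> \<le> B * (\<bar>sin (pi * x)\<bar> * norm (dker V x))"
      using sn B by (simp add: mult_left_mono mult_right_mono)
    also have "\<dots> \<le> B * 1" using 1 B by (intro mult_left_mono) auto
    finally show ?thesis by simp
  qed (use B in \<open>auto simp: G_def\<close>)
  have mid: "norm (integral {-r..r} (G V)) \<le> 2 * r * B" if r: "0 \<le> r" "r \<le> 1/2" for r V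
  proof -
    have "(G V has_integral integral {-r..r} (G V)) (cbox (-r) r)"
      using integrable_integral[OF iG[of "-r" r V]] r by auto
    from has_integral_bound[OF _ this, of B] nG B r show ?thesis by (auto simp: mult_ac)
  qed
  have side: "(\<lambda>V. integral {c..d} (G V)) \<longlonglongrightarrow> 0" if cd: "c \<le> d" "{c..d} \<subseteq> ?I" "0 \<notin> {c..d}" for c d
  proof -
    have nz: "sin (pi * x) \<noteq> 0" if "x \<in> {c..d}" for x
      using abs_sin_pi_ge[of x] that cd by force
    define H where "H = (\<lambda>x. (F x - F 0) * of_real (1 / sin (pi * x)))"
    define H' where "H' = (\<lambda>x. (F x - F 0) * of_real (- (pi * cos (pi * x)) / (sin (pi * x))^2) + F' x * of_real (1 / sin (pi * x)))"
    have "(\<lambda>V. integral {c..d} (\<lambda>x. H x * of_real (sin (real (2 * V + 1) * pi * x)))) \<longlonglongrightarrow> 0"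
    proof (rule riemann_lebesgue_C1[where H' = H'])
      fix x assume x: "x \<in> {c..d}"
      have 1: "((\<lambda>x. F x - F 0) has_vector_derivative F' x) (at x within {c..d})"
        using has_vector_derivative_within_subset[OF F cd(2)] x cd
        by (auto intro!: derivative_eq_intros)
      have 2: "((\<lambda>x. 1 / sin (pi * x)) has_real_derivative (- (pi * cos (pi * x)) / (sin (pi * x))^2)) (at x within {c..d})"
        using nz[OF x] by (auto intro!: derivative_eq_intros simp: power2_eq_square)
      show "(H has_vector_derivative H' x) (at x within {c..d})"
        unfolding H_def H'_def by (rule has_vector_derivative_mult[OF 1 has_vector_derivative_of_real[OF 2]])
    next
      show "continuous_on {c..d} H'"
        unfolding H'_def using nz
        by (intro continuous_intros continuous_on_subset[OF cF] continuous_on_subset[OF F'] cd) auto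
    qed (use cd in auto)
    moreover have "integral {c..d} (\<lambda>x. H x * of_real (sin (real (2 * V + 1) * pi * x))) = integral {c..d} (G V)" for V
    proof (intro integral_cong)
      fix x assume x: "x \<in> {c..d}"
      have "H x * of_real (sin (real (2 * V + 1) * pi * x)) = (F x - F 0) * (of_real (1 / sin (pi * x)) * of_real (sin (pi * x))) * dker V x"
        unfolding H_def dker_mult_sin[symmetric] by (simp only: mult_ac)
      also have "of_real (1 / sin (pi * x)) * of_real (sin (pi * x)) = (1::complex)"
        using nz[OF x] by simp
      finally show "H x * of_real (sin (real (2 * V + 1) * pi * x)) = G V x" by (simp add: G_def)
    qed
    ultimately show ?thesis by simp
  qed
  have split: "integral ?I (G V) = integral {-1/2..-r} (G V) + integral {-r..r} (G V) + integral {r..1/2} (G V)" if r: "0 < r" "r < 1/2" for r V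
  proof -
    have "integral {-1/2..-r} (G V) + integral {-r..1/2} (G V) = integral ?I (G V)"
      by (rule Henstock_Kurzweil_Integration.integral_combine) (use r iG[of "-1/2" "1/2"] in auto)
    moreover have "integral {-r..r} (G V) + integral {r..1/2} (G V) = integral {-r..1/2} (G V)"
      by (rule Henstock_Kurzweil_Integration.integral_combine) (use r iG[of "-r" "1/2"] in auto)
    ultimately show ?thesis by (simp only: add.assoc)
  qed
  have lim: "(\<lambda>V. integral ?I (G V)) \<longlonglongrightarrow> 0"
  proof (rule LIMSEQ_I)
    fix e :: real assume e: "e > 0"
    define r where "r = min (1/4) (e / (8 * B))"
    have r: "0 < r" "r < 1/2" using e B by (auto simp: r_def)
    have "r * B \<le> e / (8 * B) * B" using B by (intro mult_right_mono) (auto simp: r_def)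
    hence rB: "2 * r * B \<le> e / 4" using B by simp
    have s1: "(\<lambda>V. integral {-1/2..-r} (G V)) \<longlonglongrightarrow> 0" and s2: "(\<lambda>V. integral {r..1/2} (G V)) \<longlonglongrightarrow> 0"
      by (intro side; use r in auto)+
    obtain N1 where N1: "\<And>V. V \<ge> N1 \<Longrightarrow> norm (integral {-1/2..-r} (G V)) < e / 4"
      using LIMSEQ_D[OF s1, of "e/4"] e by auto
    obtain N2 where N2: "\<And>V. V \<ge> N2 \<Longrightarrow> norm (integral {r..1/2} (G V)) < e / 4"
      using LIMSEQ_D[OF s2, of "e/4"] e by auto
    show "\<exists>no. \<forall>V\<ge>no. norm (integral ?I (G V) - 0) < e"
    proof (intro exI[of _ "max N1 N2"] allI impI)
      fix V assume "V \<ge> max N1 N2"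
      hence a: "norm (integral {-1/2..-r} (G V)) < e / 4" "norm (integral {r..1/2} (G V)) < e / 4"
        using N1 N2 by auto
      have b: "norm (integral {-r..r} (G V)) \<le> e / 4" using mid[of r V] r rB by linarith
      have "norm (integral ?I (G V)) \<le> norm (integral {-1/2..-r} (G V)) + norm (integral {-r..r} (G V)) + norm (integral {r..1/2} (G V))"
        unfolding split[OF r] by (intro order_trans[OF norm_triangle_ineq] add_right_mono norm_triangle_ineq)
      thus "norm (integral ?I (G V) - 0) < e" using a b e by simp
    qed
  qed
  have eq: "integral ?I (\<lambda>x. F x * dker V x) = integral ?I (G V) + F 0" for V
  proof -
    have "integral ?I (G V) = integral ?I (\<lambda>x. F x * dker V x - F 0 * dker V x)"
      by (simp add: G_def algebra_simps)
    also have "\<dots> = integral ?I (\<lambda>x. F x * dker V x) - integral ?I (\<lambda>x. F 0 * dker V x)"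
      by (intro Henstock_Kurzweil_Integration.integral_diff integrable_continuous_real continuous_intros cF)
    also have "integral ?I (\<lambda>x. F 0 * dker V x) = F 0"
      using integral_dker[of V] by (simp add: integral_unique)
    finally show ?thesis by simp
  qed
  show ?thesis unfolding eq using tendsto_add[OF lim tendsto_const[of "F 0"]] by simp
qed

text \<open>The kernel has period 1, so the pointwise limit applies on the unit interval around each
  integer. End points at half-integers keep every integer in the interior, and no term is
  halved.\<close>

lemma dirichlet_kernel_tendsto_sum:
  fixes F F' :: "real \<Rightarrow> complex" and A B :: nat
  assumes AB: "A \<le> B"
    and F: "\<And>x. x \<in> {real A - 1/2..real B - 1/2} \<Longrightarrow> (F has_vector_derivative F' x) (at x)"
    and F': "continuous_on {real A - 1/2..real B - 1/2} F'"
  shows "(\<lambda>V. integral {real A - 1/2..real B - 1/2} (\<lambda>x. F x * dker V x)) \<longlonglongrightarrow> (\<Sum>n\<in>{A..<B}. F (real n))"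
  using AB F F'
proof (induction B rule: dec_induct)
  case base
  show ?case by simp
next
  case (step n)
  have cF: "continuous_on {real A - 1/2..real (Suc n) - 1/2} F"
    by (intro continuous_at_imp_continuous_on ballI has_vector_derivative_continuous[OF step.prems(1)])
  have 1: "(\<lambda>V. integral {real A - 1/2..real n - 1/2} (\<lambda>x. F x * dker V x)) \<longlonglongrightarrow> (\<Sum>n\<in>{A..<n}. F (real n))"
    by (rule step.IH[OF step.prems(1) continuous_on_subset[OF step.prems(2)]]) auto
  have 2: "(\<lambda>V. integral {real n - 1/2..real n + 1/2} (\<lambda>x. F x * dker V x)) \<longlonglongrightarrow> F (real n)"
  proof -
    have eq: "integral {-1/2..1/2} (\<lambda>x. F (x + real n) * dker V x) = integral {real n - 1/2..real n + 1/2} (\<lambda>x. F x * dker V x)" for V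
      using integral_shift_real_ivl[of "real n - 1/2" "real n" "real n + 1/2" "\<lambda>x. F x * dker V x"]
        dker_shift[of V _ "int n"] by simp
    have "(\<lambda>V. integral {-1/2..1/2} (\<lambda>x. F (x + real n) * dker V x)) \<longlonglongrightarrow> F (0 + real n)"
    proof (rule dirichlet_kernel_tendsto[where F' = "\<lambda>x. F' (x + real n)"])
      fix x :: real assume x: "x \<in> {-1/2..1/2}"
      have "(F has_vector_derivative F' (x + real n)) (at (x + real n))"
        by (rule step.prems(1)) (use x step.hyps in auto)
      hence "((F \<circ> (\<lambda>x. x + real n)) has_vector_derivative (1 *\<^sub>R F' (x + real n))) (at x)"
        by (intro vector_diff_chain_at) (auto intro!: derivative_eq_intros)
      thus "((\<lambda>x. F (x + real n)) has_vector_derivative F' (x + real n)) (at x within {-1/2..1/2})"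
        by (simp add: o_def has_vector_derivative_at_within)
    next
      show "continuous_on {-1/2..1/2} (\<lambda>x. F' (x + real n))"
        by (rule continuous_on_compose2[OF step.prems(2)]) (use step.hyps in \<open>auto intro!: continuous_intros\<close>)
    qed
    thus ?thesis unfolding eq by simp
  qed
  have split: "integral {real A - 1/2..real (Suc n) - 1/2} (\<lambda>x. F x * dker V x)
      = integral {real A - 1/2..real n - 1/2} (\<lambda>x. F x * dker V x) + integral {real n - 1/2..real n + 1/2} (\<lambda>x. F x * dker V x)" for V
  proof -
    have "integral {real A - 1/2..real n - 1/2} (\<lambda>x. F x * dker V x) + integral {real n - 1/2..real (Suc n) - 1/2} (\<lambda>x. F x * dker V x)
      = integral {real A - 1/2..real (Suc n) - 1/2} (\<lambda>x. F x * dker V x)"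
      by (rule Henstock_Kurzweil_Integration.integral_combine)
         (use step.hyps in \<open>auto intro!: integrable_continuous_real continuous_intros cF[simplified]\<close>)
    thus ?thesis by (simp add: add.commute)
  qed
  show ?case unfolding split using tendsto_add[OF 1 2] step.hyps by simp
qed

section \<open>Tails of the Poisson series\<close>

lemma alternating_recip_bound:
  fixes t :: real
  assumes "1 \<le> t"
  shows "norm (\<Sum>j<J. of_real (1 / (t + real j)) * (-1::complex) ^ j) \<le> 1"
proof (cases "J = 0")
  case False
  have S: "(\<Sum>i<m. (-1::complex) ^ i) = (if even m then 0 else 1)" for m by (induction m) auto
  have "norm (\<Sum>j<J. (1 / (t + real j)) *\<^sub>R (-1::complex) ^ j) \<le> 1 / (t + real 0) * 1"
    by (rule abel_summation_bound) (use assms False S in \<open>auto simp: frac_le\<close>)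
  also have "\<dots> \<le> 1" using assms by simp
  finally show ?thesis by (simp add: scaleR_conv_of_real)
qed simp

text \<open>A summand factors as \<open>1 / (t + j)\<close> times \<open>D / (t + D + j)\<close>,
  which decreases in \<open>t\<close> and increases in \<open>D\<close>. The worst case is
  \<open>t = 1\<close>, \<open>D = n\<close>, where the sum telescopes into harmonic
  numbers.\<close>

lemma sum_recip_diff_bound:
  fixes t D :: real
  assumes "1 \<le> t" "0 \<le> D" "D \<le> real n"
  shows "(\<Sum>j<J. 1 / (t + real j) - 1 / (t + D + real j)) \<le> harm n"
proof -
  have "(\<Sum>j<J. 1 / (t + real j) - 1 / (t + D + real j)) \<le> (\<Sum>j<J. 1 / (1 + real j) - 1 / (1 + real n + real j))"
  proof (rule sum_mono)
    fix j
    have "1 / (t + real j) - 1 / (t + D + real j) = (1 / (t + real j)) * (D / (t + D + real j))"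
      using assms by (simp add: field_simps)
    also have "\<dots> \<le> (1 / (1 + real j)) * (real n / (1 + real n + real j))"
    proof (rule mult_mono)
      have "D * (1 + real n + real j) \<le> real n * (1 + D + real j)"
        using assms mult_right_mono[of D "real n" "1 + real j"] by (simp add: algebra_simps)
      also have "\<dots> \<le> real n * (t + D + real j)" using assms by (intro mult_left_mono) auto
      finally show "D / (t + D + real j) \<le> real n / (1 + real n + real j)"
        using assms by (simp add: divide_simps)
    qed (use assms in \<open>auto simp: frac_le\<close>)
    also have "\<dots> = 1 / (1 + real j) - 1 / (1 + real n + real j)"
      by (simp add: field_simps)
    finally show "1 / (t + real j) - 1 / (t + D + real j) \<le> 1 / (1 + real j) - 1 / (1 + real n + real j)" .
  qed
  also have "\<dots> = harm J - harm (n + J) + harm n"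
    by (induction J) (simp_all add: harm_Suc harm_expand(1) inverse_eq_divide algebra_simps)
  also have "\<dots> \<le> harm n" using harm_mono[of J "n + J"] by simp
  finally show ?thesis .
qed

text \<open>Integrating each term by parts leaves end point contributions of size about
  \<open>1 / j\<close>, not absolutely summable. Because \<open>a\<close> and \<open>b\<close> are
  half-integers these alternate in sign along the tail and stay bounded; the remainders are
  differences of reciprocals and obey a harmonic bound. The sign \<open>\<sigma>\<close> selects the
  upper or the lower tail, and the bound is uniform in \<open>J\<close>.\<close>

lemma poisson_tail_bound:
  fixes g g1 g2 :: "real \<Rightarrow> real" and A B :: nat and p \<sigma> :: int
  defines "a \<equiv> real A - 1/2" and "b \<equiv> real B - 1/2"
  assumes AB: "A \<le> B"
    and g: "\<And>x. x \<in> {a..b} \<Longrightarrow> (g has_real_derivative g1 x) (at x)"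
    and g1: "\<And>x. x \<in> {a..b} \<Longrightarrow> (g1 has_real_derivative g2 x) (at x)"
    and g2: "continuous_on {a..b} g2"
    and neg: "\<And>x. x \<in> {a..b} \<Longrightarrow> g2 x \<le> 0"
    and \<sigma>: "\<sigma> = 1 \<or> \<sigma> = -1"
    and far: "\<And>x. x \<in> {a..b} \<Longrightarrow> of_int \<sigma> * (of_int p - g1 x) \<ge> 1"
    and n: "g1 a - g1 b \<le> real n"
  shows "norm (\<Sum>j<J. integral {a..b} (\<lambda>x. ec (g x - of_int (p + \<sigma> * int j) * x))) \<le> 1 + harm n"
proof -
  have ab: "a \<le> b" using AB by (simp add: a_def b_def)
  have ss: "of_int \<sigma> * of_int \<sigma> = (1::real)" using \<sigma> by auto
  define s where "s = (\<lambda>x. of_int \<sigma> * (of_int p - g1 x))"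
  define v where "v = (\<lambda>j. real_of_int (p + \<sigma> * int j))"
  have s1: "s x \<ge> 1" if "x \<in> {a..b}" for x using far[OF that] by (simp add: s_def)
  have q1: "g1 x - v j = - of_int \<sigma> * (s x + real j)" for x j
    using \<sigma> by (auto simp: s_def v_def algebra_simps)
  have inv: "1 / (g1 x - v j) = - of_int \<sigma> / (s x + real j)" for x j
    unfolding q1 using \<sigma> by (auto simp: divide_simps)
  have dec: "g1 b \<le> g1 a"
    by (rule DERIV_nonpos_imp_nonincreasing[OF ab]) (use g1 neg in force)
  define D where "D = g1 a - g1 b"
  have D: "0 \<le> D" "D \<le> real n" using dec n by (auto simp: D_def)
  define Bd where "Bd = (\<lambda>x j. ec (g x - v j * x) / (2*pi*\<i> * of_real (g1 x - v j)))"
  \<comment> \<open>At a half-integer, passing to the next frequency multiplies the exponential by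
    \<open>ec (- \<sigma> * x) = -1\<close>.\<close>
  have half: "ec (g x - v j * x) = ec (g x - of_int p * x) * (-1) ^ j"
    if "x = a \<or> x = b" for x j
  proof -
    have "x = of_int (int A) - 1/2 \<or> x = of_int (int B) - 1/2"
      using that by (auto simp: a_def b_def)
    then obtain N :: int where N: "x = of_int N - 1/2" by blast
    have "ec (of_int (- \<sigma>) * x) = -1"
    proof -
      have "ec (1/2) = -1" by (simp add: ec_def)
      moreover have "ec (-1/2) = -1" by (simp add: ec_def complex_eq_iff)
      moreover have "of_int (- \<sigma>) * x = of_int (- \<sigma> * N) + (of_int \<sigma> * (1/2) :: real)"
        unfolding N by (simp add: algebra_simps)
      ultimately show ?thesis using \<sigma> by (auto simp only: ec_add ec_of_int) auto
    qed
    moreover have "g x - v j * x = (g x - of_int p * x) + real j * (of_int (- \<sigma>) * x)"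
      by (simp add: v_def algebra_simps)
    ultimately show ?thesis by (simp only: ec_add ec_mult_of_nat)
  qed
  have Bd: "norm (\<Sum>j<J. Bd x j) \<le> 1 / (2 * pi)" if x: "x = a \<or> x = b" for x
  proof -
    have "Bd x j = ec (g x - of_int p * x) * (- of_int \<sigma>) / (2*pi*\<i>) * (of_real (1 / (s x + real j)) * (-1) ^ j)" for j
    proof -
      have "Bd x j = ec (g x - v j * x) / (2*pi*\<i>) * of_real (1 / (g1 x - v j))"
        by (simp add: Bd_def)
      also have "\<dots> = ec (g x - of_int p * x) * (-1)^j / (2*pi*\<i>) * of_real (- of_int \<sigma> / (s x + real j))"
        by (simp only: half[OF x] inv)
      finally show ?thesis by (simp add: mult_ac)
    qed
    hence "(\<Sum>j<J. Bd x j) = ec (g x - of_int p * x) * (- of_int \<sigma>) / (2*pi*\<i>) * (\<Sum>j<J. of_real (1 / (s x + real j)) * (-1) ^ j)"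
      by (simp only: sum_distrib_left)
    hence "norm (\<Sum>j<J. Bd x j) = 1 / (2 * pi) * norm (\<Sum>j<J. of_real (1 / (s x + real j)) * (-1::complex) ^ j)"
      using \<sigma> by (auto simp: norm_mult norm_divide)
    also have "\<dots> \<le> 1 / (2 * pi) * 1"
      by (intro mult_left_mono alternating_recip_bound s1) (use x ab in auto)
    finally show ?thesis by simp
  qed
  define E where "E = (\<lambda>j. integral {a..b} (\<lambda>x. ec (g x - v j * x)) - (Bd b j - Bd a j))"
  \<comment> \<open>The distance \<open>s\<close> from the frequency to the derivative is monotone
    on the interval, so its minimum \<open>t\<close> is attained at one end, and
    \<open>t + D\<close> is its value at the other.\<close>
  define t where "t = min (s a) (s b)"
  have t1: "t \<ge> 1" using s1[of a] s1[of b] ab by (auto simp: t_def)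
  have E: "norm (E j) \<le> (1 / (t + real j) - 1 / (t + D + real j)) / (2 * pi)" for j
  proof -
    have "norm (E j) \<le> \<bar>1 / (g1 b - v j) - 1 / (g1 a - v j)\<bar> / (2*pi)"
      unfolding E_def Bd_def
    proof (rule osc_integral_by_parts[where ?q2.0 = g2, OF ab _ _ g2])
      fix x assume x: "x \<in> {a..b}"
      show "((\<lambda>x. g x - v j * x) has_real_derivative g1 x - v j) (at x)"
        using g[OF x] by (auto intro!: derivative_eq_intros)
      show "((\<lambda>x. g1 x - v j) has_real_derivative g2 x) (at x)"
        using g1[OF x] by (auto intro!: derivative_eq_intros)
      show "g1 x - v j \<noteq> 0" unfolding q1 using s1[OF x] \<sigma> by auto
    qed (use neg in auto)
    also have "\<bar>1 / (g1 b - v j) - 1 / (g1 a - v j)\<bar> = \<bar>1 / (s b + real j) - 1 / (s a + real j)\<bar>"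
      unfolding inv using \<sigma> by auto
    also have "\<dots> = 1 / (t + real j) - 1 / (t + D + real j)"
    proof (cases "s a \<le> s b")
      case True
      hence tt: "t = s a" "t + D = s b" using \<sigma> dec by (auto simp: t_def D_def s_def)
      have "1 / (s b + real j) \<le> 1 / (s a + real j)" using True t1 tt by (intro frac_le) auto
      thus ?thesis unfolding tt(2) unfolding tt(1) by simp
    next
      case False
      hence tt: "t = s b" "t + D = s a" using \<sigma> dec by (auto simp: t_def D_def s_def)
      have "1 / (s a + real j) \<le> 1 / (s b + real j)" using False t1 tt by (intro frac_le) auto
      thus ?thesis unfolding tt(2) unfolding tt(1) by simp
    qed
    finally show ?thesis .
  qed
  have "(\<Sum>j<J. integral {a..b} (\<lambda>x. ec (g x - v j * x))) = (\<Sum>j<J. Bd b j) - (\<Sum>j<J. Bd a j) + (\<Sum>j<J. E j)"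
    by (simp add: E_def sum_subtractf)
  hence "norm (\<Sum>j<J. integral {a..b} (\<lambda>x. ec (g x - v j * x))) \<le> norm (\<Sum>j<J. Bd b j) + norm (\<Sum>j<J. Bd a j) + norm (\<Sum>j<J. E j)"
    by (metis (no_types, lifting) add_right_mono norm_triangle_ineq norm_triangle_ineq4 order_trans)
  also have "\<dots> \<le> 1 / (2 * pi) + 1 / (2 * pi) + harm n / (2 * pi)"
  proof (intro add_mono)
    have "norm (\<Sum>j<J. E j) \<le> (\<Sum>j<J. (1 / (t + real j) - 1 / (t + D + real j)) / (2 * pi))"
      by (intro order_trans[OF norm_sum] sum_mono E)
    also have "\<dots> = (\<Sum>j<J. (1 / (t + real j) - 1 / (t + D + real j))) / (2 * pi)"
      by (simp only: sum_divide_distrib)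
    also have "\<dots> \<le> harm n / (2 * pi)"
      by (intro divide_right_mono sum_recip_diff_bound t1 D) auto
    finally show "norm (\<Sum>j<J. E j) \<le> harm n / (2 * pi)" .
  qed (use Bd in auto)
  also have "\<dots> \<le> 1 + harm n"
  proof -
    have "2 * pi \<ge> 2" using pi_gt3 by simp
    hence "1 / (2 * pi) \<le> 1 / 2" by (intro frac_le) auto
    moreover have "harm n / (2 * pi) \<le> harm n / (1::real)"
      by (rule divide_left_mono) (use \<open>2 * pi \<ge> 2\<close> harm_nonneg[of n, where 'a = real] in auto)
    ultimately show ?thesis by linarith
  qed
  finally show ?thesis by (simp only: v_def)
qed

text \<open>Integration against the Dirichlet kernel exhibits the sum as the limit of symmetric
  partial sums of the Fourier integrals \<open>T\<close>. Frequencies below \<open>m1\<close> or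
  above \<open>m2\<close> keep distance at least 1 from the range of \<open>g1\<close>, and the
  bound for them is uniform in \<open>V\<close>, so it survives the limit.\<close>

lemma truncated_poisson:
  fixes g g1 g2 :: "real \<Rightarrow> real" and A B :: nat and m1 m2 :: int
  defines "a \<equiv> real A - 1/2" and "b \<equiv> real B - 1/2"
  assumes AB: "A \<le> B"
    and g: "\<And>x. x \<in> {a..b} \<Longrightarrow> (g has_real_derivative g1 x) (at x)"
    and g1: "\<And>x. x \<in> {a..b} \<Longrightarrow> (g1 has_real_derivative g2 x) (at x)"
    and g2: "continuous_on {a..b} g2"
    and neg: "\<And>x. x \<in> {a..b} \<Longrightarrow> g2 x \<le> 0"
    and m: "of_int m1 \<le> g1 b" "g1 a \<le> of_int m2"
    and n: "g1 a - g1 b \<le> real n"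
  shows "norm ((\<Sum>n\<in>{A..<B}. ec (g (real n))) - (\<Sum>m\<in>{m1..m2}. integral {a..b} (\<lambda>x. ec (g x - of_int m * x)))) \<le> 2 + 2 * harm n"
proof -
  have ab: "a \<le> b" using AB by (simp add: a_def b_def)
  have cg: "continuous_on {a..b} g" and cg1: "continuous_on {a..b} g1"
    by (auto intro!: continuous_at_imp_continuous_on DERIV_isCont g g1)
  define T where "T = (\<lambda>m::int. integral {a..b} (\<lambda>x. ec (g x - of_int m * x)))"
  have mono: "g1 y \<le> g1 x" if "x \<in> {a..b}" "y \<in> {a..b}" "x \<le> y" for x y
    by (rule DERIV_nonpos_imp_nonincreasing[OF that(3)]) (use g1 neg that in force)
  have m12: "m1 \<le> m2"
  proof -
    have "of_int m1 \<le> (of_int m2 :: real)" using m mono[of a b] ab by auto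
    thus ?thesis by simp
  qed
  have T1: "norm (\<Sum>j<J. T (m2 + 1 + 1 * int j)) \<le> 1 + harm n" for J
    unfolding T_def
  proof (rule poisson_tail_bound[where A = A and B = B and ?g2.0 = g2 and ?g1.0 = g1, folded a_def b_def])
    fix x assume "x \<in> {a..b}"
    thus "1 \<le> of_int 1 * (of_int (m2 + 1) - g1 x)" using mono[of a x] m ab by auto
  qed (use AB g g1 g2 neg n in auto)
  have T2: "norm (\<Sum>j<J. T (m1 - 1 + (-1) * int j)) \<le> 1 + harm n" for J
    unfolding T_def
  proof (rule poisson_tail_bound[where A = A and B = B and ?g2.0 = g2 and ?g1.0 = g1, folded a_def b_def])
    fix x assume "x \<in> {a..b}"
    thus "1 \<le> of_int (-1) * (of_int (m1 - 1) - g1 x)" using mono[of x b] m ab by auto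
  qed (use AB g g1 g2 neg n in auto)
  have L: "integral {a..b} (\<lambda>x. ec (g x) * dker V x) = (\<Sum>v\<in>{- int V..int V}. T v)" for V
  proof -
    have d: "dker V x = (\<Sum>v\<in>{- int V..int V}. ec (- of_int v * x))" for x
      unfolding dker_def by (rule sum.reindex_bij_witness[of _ uminus uminus]) auto
    have "integral {a..b} (\<lambda>x. ec (g x) * dker V x) = integral {a..b} (\<lambda>x. \<Sum>v\<in>{- int V..int V}. ec (g x - of_int v * x))"
      unfolding d sum_distrib_left ec_add[symmetric] by simp
    also have "\<dots> = (\<Sum>v\<in>{- int V..int V}. T v)"
      unfolding T_def by (rule integral_sum) (auto intro!: integrable_continuous_real continuous_intros cg)
    finally show ?thesis .
  qed
  have lim: "(\<lambda>V. \<Sum>v\<in>{- int V..int V}. T v) \<longlonglongrightarrow> (\<Sum>n\<in>{A..<B}. ec (g (real n)))"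
    unfolding L[symmetric]
  proof (rule dirichlet_kernel_tendsto_sum[OF AB, folded a_def b_def])
    fix x assume "x \<in> {a..b}"
    thus "((\<lambda>x. ec (g x)) has_vector_derivative (2 * pi * \<i> * g1 x * ec (g x))) (at x)"
      by (intro ec_has_vector_derivative g)
  next
    show "continuous_on {a..b} (\<lambda>x. 2 * pi * \<i> * g1 x * ec (g x))"
      by (intro continuous_intros cg cg1)
  qed
  have bd: "norm ((\<Sum>v\<in>{- int V..int V}. T v) - (\<Sum>m\<in>{m1..m2}. T m)) \<le> 2 + 2 * harm n"
    if V: "int V \<ge> \<bar>m1\<bar>" "int V \<ge> \<bar>m2\<bar>" for V
  proof -
    have set: "{- int V..int V} = ({- int V..m1 - 1} \<union> {m2 + 1..int V}) \<union> {m1..m2}" using V m12 by auto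
    have "(\<Sum>v\<in>{- int V..int V}. T v) = (\<Sum>v\<in>{- int V..m1 - 1}. T v) + (\<Sum>v\<in>{m2 + 1..int V}. T v) + (\<Sum>m\<in>{m1..m2}. T m)"
      unfolding set using m12 by (subst sum.union_disjoint; (subst sum.union_disjoint)?) auto
    moreover have "(\<Sum>v\<in>{- int V..m1 - 1}. T v) = (\<Sum>j<nat (int V + m1). T (m1 - 1 + (-1) * int j))"
      by (rule sum.reindex_bij_witness[of _ "\<lambda>j. m1 - 1 + (-1) * int j" "\<lambda>v. nat (m1 - 1 - v)"]) (use V in auto)
    moreover have "(\<Sum>v\<in>{m2 + 1..int V}. T v) = (\<Sum>j<nat (int V - m2). T (m2 + 1 + 1 * int j))"
      by (rule sum.reindex_bij_witness[of _ "\<lambda>j. m2 + 1 + 1 * int j" "\<lambda>v. nat (v - m2 - 1)"]) (use V in auto)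
    ultimately show ?thesis
      using T1[of "nat (int V - m2)"] T2[of "nat (int V + m1)"]
      by (smt (verit) add_diff_cancel_right' norm_triangle_ineq)
  qed
  have "norm ((\<Sum>n\<in>{A..<B}. ec (g (real n))) - (\<Sum>m\<in>{m1..m2}. T m)) \<le> 2 + 2 * harm n"
  proof (rule Lim_norm_ubound[OF _ tendsto_diff[OF lim tendsto_const]])
    show "\<forall>\<^sub>F V in sequentially. norm ((\<Sum>v\<in>{- int V..int V}. T v) - (\<Sum>m\<in>{m1..m2}. T m)) \<le> 2 + 2 * harm n"
      unfolding eventually_sequentially
      by (rule exI[of _ "nat (max \<bar>m1\<bar> \<bar>m2\<bar>)"]) (use bd in auto)
  qed simp
  thus ?thesis by (simp only: T_def)
qed

section \<open>Stationary phase for power phases\<close>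

text \<open>The phase has derivative \<open>- 2 * y\<close>, so by the first-derivative test the
  piece from \<open>Z\<close> to \<open>Z'\<close> is at most \<open>1 / Z\<close>; the partial
  integrals are Cauchy with this rate.\<close>

lemma fresnel_limit:
  obtains L :: complex where "\<And>Z. Z > 0 \<Longrightarrow> norm (integral {0..Z} (\<lambda>y. ec (- (y^2))) - L) \<le> 1 / Z"
proof -
  define fr where "fr = (\<lambda>Z::real. integral {0..Z} (\<lambda>y. ec (- (y^2))))"
  have diff: "norm (fr Z' - fr Z) \<le> 1 / Z" if Z: "0 < Z" "Z \<le> Z'" for Z Z'
  proof -
    have "integral {0..Z} (\<lambda>y. ec (- (y^2))) + integral {Z..Z'} (\<lambda>y. ec (- (y^2))) = integral {0..Z'} (\<lambda>y. ec (- (y^2)))"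
      by (rule Henstock_Kurzweil_Integration.integral_combine)
         (use Z in \<open>auto intro!: integrable_continuous_real continuous_intros\<close>)
    hence "fr Z' - fr Z = integral {Z..Z'} (\<lambda>y. ec (- (y^2)))" by (simp add: fr_def algebra_simps)
    moreover have "norm (integral {Z..Z'} (\<lambda>y. ec (- (y^2)))) \<le> 1 / Z"
    proof (rule osc_integral_first_deriv[where ?q1.0 = "\<lambda>y. - 2 * y" and ?q2.0 = "\<lambda>_. - 2"])
      show "(\<forall>y\<in>{Z..Z'}. - 2 * y \<ge> Z) \<or> (\<forall>y\<in>{Z..Z'}. - 2 * y \<le> - Z)" using Z by auto
    qed (use Z in \<open>auto intro!: derivative_eq_intros continuous_intros\<close>)
    ultimately show ?thesis by simp
  qed
  have "Cauchy (\<lambda>n. fr (real (Suc n)))"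
  proof (rule metric_CauchyI)
    fix e :: real assume e: "e > 0"
    obtain M where M: "real (Suc M) > 1 / e" using reals_Archimedean2 by (metis less_Suc_eq of_nat_less_iff order_less_trans)
    have key: "dist (fr (real (Suc m))) (fr (real (Suc n))) < e" if "M \<le> m" "m \<le> n" for m n
    proof -
      have "norm (fr (real (Suc n)) - fr (real (Suc m))) \<le> 1 / real (Suc m)" using that by (intro diff) auto
      also have "\<dots> \<le> 1 / real (Suc M)" using that by (intro frac_le) auto
      also have "\<dots> < e" using M e by (simp add: field_simps)
      finally show ?thesis by (simp add: dist_norm norm_minus_commute)
    qed
    show "\<exists>M. \<forall>m\<ge>M. \<forall>n\<ge>M. dist (fr (real (Suc m))) (fr (real (Suc n))) < e"
    proof (intro exI[of _ M] allI impI)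
      fix m n assume "M \<le> m" "M \<le> n"
      thus "dist (fr (real (Suc m))) (fr (real (Suc n))) < e"
        using key[of m n] key[of n m] by (cases "m \<le> n") (auto simp: dist_commute)
    qed
  qed
  then obtain L where L: "(\<lambda>n. fr (real (Suc n))) \<longlonglongrightarrow> L" by (auto simp: Cauchy_convergent_iff convergent_def)
  have "norm (fr Z - L) \<le> 1 / Z" if Z: "Z > 0" for Z
  proof -
    have "(\<lambda>n. fr (real (Suc n)) - fr Z) \<longlonglongrightarrow> L - fr Z" by (intro tendsto_intros L)
    moreover have "\<forall>\<^sub>F n in sequentially. norm (fr (real (Suc n)) - fr Z) \<le> 1 / Z"
    proof -
      obtain n0 where "real n0 \<ge> Z" using real_arch_simple by blast
      thus ?thesis unfolding eventually_sequentially using Z by (intro exI[of _ n0]) (auto intro!: diff)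
    qed
    ultimately have "norm (L - fr Z) \<le> 1 / Z" by (intro Lim_norm_ubound) auto
    thus ?thesis by (simp add: norm_minus_commute)
  qed
  thus ?thesis using that[of L] by (simp add: fr_def)
qed

lemma fresnel_scaled:
  fixes t v :: real
  assumes "t > 0" "v \<ge> 0"
  shows "integral {0..v} (\<lambda>y. ec (- (t * y^2))) = integral {0..sqrt t * v} (\<lambda>y. ec (- (y^2))) / sqrt t"
proof -
  have "((\<lambda>x. sqrt t *\<^sub>R ec (- ((sqrt t * x)^2))) has_integral (integral {sqrt t * 0..sqrt t * v} (\<lambda>y. ec (- (y^2))))) {0..v}"
    by (rule has_integral_substitution[where c = 0 and d = "sqrt t * v"])
       (use assms in \<open>auto intro!: continuous_intros derivative_eq_intros mult_left_mono\<close>)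
  hence "integral {0..v} (\<lambda>x. of_real (sqrt t) * ec (- (t * x^2))) = integral {0..sqrt t * v} (\<lambda>y. ec (- (y^2)))"
    using assms integral_unique[of "\<lambda>x. of_real (sqrt t) * ec (- (t * x^2))"] by (simp only: scaleR_conv_of_real power_mult_distrib real_sqrt_pow2 less_imp_le mult_zero_right)
  thus ?thesis using assms by (simp add: field_simps)
qed

text \<open>The phase is already \<open>- (y u)^2\<close>. The identity \<open>eq\<close> splits the
  integrand in two: the part with \<open>\<kappa> * y1 u\<close> becomes a Fresnel integral in the
  variable \<open>y\<close>, and the part with \<open>2 * y u * y1 u\<close>, a multiple of the
  derivative of the phase, integrates by parts against \<open>W\<close> to order
  \<open>1 / t\<close>. Truncating the Fresnel integrals at \<open>y a\<close> and
  \<open>y b\<close> costs \<open>1 / (t * \<bar>y a\<bar>)\<close> and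
  \<open>1 / (t * \<bar>y b\<bar>)\<close>, which the linear bounds on \<open>y\<close> turn into
  the terms \<open>1 / (-a)\<close> and \<open>1 / b\<close>.\<close>

lemma stationary_phase_model:
  fixes y y1 :: "real \<Rightarrow> real" and W W1 :: "real \<Rightarrow> complex"
  assumes r: "r > 0" and c: "c > 0"
    and y: "\<And>u. u \<in> {-r..r} \<Longrightarrow> (y has_real_derivative y1 u) (at u)"
    and y1: "continuous_on {-r..r} y1"
    and y0: "y 0 = 0"
    and ypos: "\<And>u. 0 \<le> u \<Longrightarrow> u \<le> r \<Longrightarrow> c * u \<le> y u"
    and yneg: "\<And>u. -r \<le> u \<Longrightarrow> u \<le> 0 \<Longrightarrow> y u \<le> c * u"
    and W: "\<And>u. u \<in> {-r..r} \<Longrightarrow> (W has_vector_derivative W1 u) (at u)"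
    and W1: "continuous_on {-r..r} W1"
    and eq: "\<And>u. u \<in> {-r..r} \<Longrightarrow> 1 = of_real (\<kappa> * y1 u) - of_real (2 * y u * y1 u) * W u"
  obtains L :: complex and C :: real where "C > 0"
    "\<And>t a b. t > 0 \<Longrightarrow> -r \<le> a \<Longrightarrow> a < 0 \<Longrightarrow> 0 < b \<Longrightarrow> b \<le> r \<Longrightarrow>
       norm (integral {a..b} (\<lambda>u. ec (- (t * (y u)^2))) - L / sqrt t) \<le> C / t * (1 + 1 / (-a) + 1 / b)"
proof -
  obtain L0 :: complex where L0: "\<And>Z. Z > 0 \<Longrightarrow> norm (integral {0..Z} (\<lambda>y. ec (- (y^2))) - L0) \<le> 1 / Z"
    using fresnel_limit by blast
  have cy: "continuous_on {-r..r} y" by (auto intro!: continuous_at_imp_continuous_on DERIV_isCont y)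
  have cW: "continuous_on {-r..r} W"
    by (intro continuous_at_imp_continuous_on ballI has_vector_derivative_continuous[OF W])
  obtain B where B: "\<And>u. u \<in> {-r..r} \<Longrightarrow> norm (W u) \<le> B" "B > 0"
    using compact_imp_bounded[OF compact_continuous_image[OF cW]] bounded_pos by (metis compact_Icc image_eqI)
  obtain B1 where B1: "\<And>u. u \<in> {-r..r} \<Longrightarrow> norm (W1 u) \<le> B1" "B1 > 0"
    using compact_imp_bounded[OF compact_continuous_image[OF W1]] bounded_pos by (metis compact_Icc image_eqI)
  define C where "C = \<bar>\<kappa>\<bar> / c + 2 * B + 2 * r * B1"
  have Cpos: "C > 0" using B B1 r c by (simp add: C_def add_nonneg_pos)
  show thesis
  \<comment> \<open>The factor \<open>2\<close> counts the half-line Fresnel integrals on the left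
    and on the right of the stationary point.\<close>
  proof (rule that[of C "2 * of_real \<kappa> * L0"])
    fix t a b :: real
    assume t: "t > 0" and a: "-r \<le> a" "a < 0" and b: "0 < b" "b \<le> r"
    let ?f = "\<lambda>s. ec (- (t * s^2))"
    have sub: "{a..b} \<subseteq> {-r..r}" using a b by auto
    have fr: "norm (integral {0..v} ?f - L0 / sqrt t) \<le> 1 / (t * v)" if v: "v > 0" for v
    proof -
      have "integral {0..v} ?f - L0 / sqrt t = (integral {0..sqrt t * v} (\<lambda>y. ec (- (y^2))) - L0) / sqrt t"
        using t v by (subst fresnel_scaled) (auto simp: diff_divide_distrib)
      hence "norm (integral {0..v} ?f - L0 / sqrt t) = norm (integral {0..sqrt t * v} (\<lambda>y. ec (- (y^2))) - L0) / sqrt t"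
        using t by (simp add: norm_divide)
      also have "\<dots> \<le> 1 / (sqrt t * v) / sqrt t"
        using t v by (intro divide_right_mono L0) auto
      also have "\<dots> = 1 / (t * v)" using t by (simp add: field_simps)
      finally show ?thesis .
    qed
    have ya: "y a \<le> c * a" and yb: "c * b \<le> y b" using yneg[of a] ypos[of b] a b by auto
    have ca: "c * a < 0" using c a by (simp add: mult_pos_neg)
    have cb: "c * b > 0" using c b by simp
    have S1: "((\<lambda>u. y1 u *\<^sub>R ?f (y u)) has_integral integral {0..y b} ?f) {0..b}"
    proof -
      have ge: "y u \<ge> 0" if "u \<in> {0..b}" for u
        using ypos[of u] that b c by (smt (verit) atLeastAtMost_iff mult_nonneg_nonneg)
      have img: "compact (y ` {0..b})" using cy b by (intro compact_continuous_image continuous_on_subset[OF cy]) auto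
      obtain d where d: "\<And>u. u \<in> {0..b} \<Longrightarrow> \<bar>y u\<bar> \<le> d"
        using compact_imp_bounded[OF img] unfolding bounded_iff by (metis image_eqI real_norm_def)
      have "((\<lambda>u. y1 u *\<^sub>R ?f (y u)) has_integral integral {y 0..y b} ?f) {0..b}"
        by (rule has_integral_substitution[where c = "-d" and d = d])
           (use d b yb cb y0 in \<open>auto simp: abs_le_iff intro!: continuous_intros has_field_derivative_at_within[OF y]\<close>, force+)
      thus ?thesis by (simp add: y0)
    qed
    have S2: "((\<lambda>u. y1 u *\<^sub>R ?f (y u)) has_integral integral {0..- y a} ?f) {a..0}"
    proof -
      have img: "compact (y ` {a..0})" using cy a r by (intro compact_continuous_image continuous_on_subset[OF cy]) auto
      obtain d where d: "\<And>u. u \<in> {a..0} \<Longrightarrow> \<bar>y u\<bar> \<le> d"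
        using compact_imp_bounded[OF img] unfolding bounded_iff by (metis image_eqI real_norm_def)
      have "((\<lambda>u. y1 u *\<^sub>R ?f (y u)) has_integral integral {y a..y 0} ?f) {a..0}"
        by (rule has_integral_substitution[where c = "-d" and d = d])
           (use d a r ya ca y0 in \<open>auto simp: abs_le_iff intro!: continuous_intros has_field_derivative_at_within[OF y]\<close>, force+)
      moreover have "integral {y a..0} ?f = integral {0..- y a} ?f"
        using Henstock_Kurzweil_Integration.integral_reflect_real[of "0" "y a" ?f] by simp
      ultimately show ?thesis by (simp add: y0)
    qed
    have S: "((\<lambda>u. y1 u *\<^sub>R ?f (y u)) has_integral integral {0..- y a} ?f + integral {0..y b} ?f) {a..b}"
      by (rule has_integral_combine[OF _ _ S2 S1]) (use a b in auto)
    define G where "G = (\<lambda>u. ?f (y u) * W u / (2 * pi * \<i> * t))"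
    define K where "K = (\<lambda>u. ?f (y u) * W1 u / (2 * pi * \<i> * t))"
    have dG: "(G has_vector_derivative (K u - of_real (2 * y u * y1 u) * (?f (y u) * W u))) (at u within {a..b})" if u: "u \<in> {a..b}" for u
    proof -
      have u': "u \<in> {-r..r}" using u sub by auto
      have "((\<lambda>u. - (t * (y u)^2)) has_real_derivative (- (t * (2 * y u * y1 u)))) (at u within {a..b})"
        using has_field_derivative_at_within[OF y[OF u'], of "{a..b}"] by (auto intro!: derivative_eq_intros)
      from has_vector_derivative_divide[OF has_vector_derivative_mult[OF ec_has_vector_derivative[OF this] has_vector_derivative_at_within[OF W[OF u']]], of "2 * pi * \<i> * t"]
      have "(G has_vector_derivative ((?f (y u) * W1 u + 2 * pi * \<i> * of_real (- (t * (2 * y u * y1 u))) * ?f (y u) * W u) / (2 * pi * \<i> * t))) (at u within {a..b})"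
        by (simp only: G_def)
      moreover have "(?f (y u) * W1 u + 2 * pi * \<i> * of_real (- (t * (2 * y u * y1 u))) * ?f (y u) * W u) / (2 * pi * \<i> * t)
         = K u - of_real (2 * y u * y1 u) * (?f (y u) * W u)"
        using t by (simp add: K_def field_simps)
      ultimately show ?thesis by simp
    qed
    have FTC: "((\<lambda>u. K u - of_real (2 * y u * y1 u) * (?f (y u) * W u)) has_integral (G b - G a)) {a..b}"
      by (rule fundamental_theorem_of_calculus[OF _ dG]) (use a b in auto)
    have iK: "K integrable_on {a..b}"
      unfolding K_def by (intro integrable_continuous_real continuous_intros continuous_on_subset[OF cy sub] continuous_on_subset[OF W1 sub]) (use t in auto)
    have ieq: "((\<lambda>u. ?f (y u)) has_integral of_real \<kappa> * (integral {0..- y a} ?f + integral {0..y b} ?f) + ((G b - G a) - integral {a..b} K)) {a..b}"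
    proof (rule has_integral_eq)
      show "((\<lambda>u. of_real \<kappa> * (y1 u *\<^sub>R ?f (y u)) + ((K u - of_real (2 * y u * y1 u) * (?f (y u) * W u)) - K u)) has_integral
          of_real \<kappa> * (integral {0..- y a} ?f + integral {0..y b} ?f) + ((G b - G a) - integral {a..b} K)) {a..b}"
        by (intro has_integral_add has_integral_diff has_integral_mult_right S FTC integrable_integral iK)
      fix u assume u: "u \<in> {a..b}"
      have "?f (y u) = (of_real (\<kappa> * y1 u) - of_real (2 * y u * y1 u) * W u) * ?f (y u)"
        using eq[of u] u sub by auto
      thus "of_real \<kappa> * (y1 u *\<^sub>R ?f (y u)) + ((K u - of_real (2 * y u * y1 u) * (?f (y u) * W u)) - K u) = ?f (y u)"
        by (simp add: scaleR_conv_of_real algebra_simps)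
    qed
    have nG: "norm (G u) \<le> B / t" if "u \<in> {a..b}" for u
    proof -
      have "norm (G u) = norm (W u) / (2 * pi * t)" using t by (simp add: G_def norm_mult norm_divide)
      also have "\<dots> \<le> B / (1 * t)"
        using B that sub t pi_gt3 by (intro frac_le mult_right_mono) auto
      finally show ?thesis by simp
    qed
    have nK: "norm (integral {a..b} K) \<le> 2 * r * B1 / t"
    proof -
      have "(K has_integral integral {a..b} K) (cbox a b)" using iK by (simp add: integrable_integral)
      moreover have "norm (K u) \<le> B1 / t" if "u \<in> {a..b}" for u
      proof -
        have "norm (K u) = norm (W1 u) / (2 * pi * t)" using t by (simp add: K_def norm_mult norm_divide)
        also have "\<dots> \<le> B1 / (1 * t)"
          using B1 that sub t pi_gt3 by (intro frac_le mult_right_mono) auto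
        finally show ?thesis by simp
      qed
      ultimately have "norm (integral {a..b} K) \<le> B1 / t * measure lborel (cbox a b)"
        using t B1 by (intro has_integral_bound) auto
      also have "\<dots> \<le> B1 / t * (2 * r)" using a b t B1 by (intro mult_left_mono) auto
      finally show ?thesis by (simp add: mult_ac)
    qed
    have "integral {a..b} (\<lambda>u. ?f (y u)) - 2 * of_real \<kappa> * L0 / sqrt t
       = of_real \<kappa> * ((integral {0..- y a} ?f - L0 / sqrt t) + (integral {0..y b} ?f - L0 / sqrt t)) + (G b - G a - integral {a..b} K)"
      using integral_unique[OF ieq] by (simp add: algebra_simps)
    also have "norm \<dots> \<le> \<bar>\<kappa>\<bar> * (norm (integral {0..- y a} ?f - L0 / sqrt t) + norm (integral {0..y b} ?f - L0 / sqrt t)) + (norm (G b) + norm (G a) + norm (integral {a..b} K))"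
    proof -
      have "norm (of_real \<kappa> * (p + q) + (x - z - w)) \<le> \<bar>\<kappa>\<bar> * (norm p + norm q) + (norm x + norm z + norm w)" for p q x z w :: complex
      proof -
        have "norm (of_real \<kappa> * (p + q)) \<le> \<bar>\<kappa>\<bar> * (norm p + norm q)"
          by (simp add: norm_mult mult_left_mono norm_triangle_ineq)
        moreover have "norm (x - z - w) \<le> norm x + norm z + norm w" by (smt (verit) norm_triangle_ineq4)
        ultimately show ?thesis by (smt (verit) norm_triangle_ineq)
      qed
      thus ?thesis .
    qed
    also have "\<dots> \<le> \<bar>\<kappa>\<bar> * (1 / (t * (c * (- a))) + 1 / (t * (c * b))) + (B / t + B / t + 2 * r * B1 / t)"
    proof (intro add_mono mult_left_mono nG nK)
      have "norm (integral {0..- y a} ?f - L0 / sqrt t) \<le> 1 / (t * (- y a))" using ya ca by (intro fr) auto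
      also have "\<dots> \<le> 1 / (t * (c * (- a)))" using ya ca t mult_pos_neg[OF t ca] by (intro frac_le mult_left_mono) auto
      finally show "norm (integral {0..- y a} ?f - L0 / sqrt t) \<le> 1 / (t * (c * (- a)))" .
      have "norm (integral {0..y b} ?f - L0 / sqrt t) \<le> 1 / (t * (y b))" using yb cb by (intro fr) auto
      also have "\<dots> \<le> 1 / (t * (c * b))" using yb cb t by (intro frac_le mult_left_mono) auto
      finally show "norm (integral {0..y b} ?f - L0 / sqrt t) \<le> 1 / (t * (c * b))" .
    qed (use a b in auto)
    also have "\<dots> = (\<bar>\<kappa>\<bar> / c) / t * (1 / (-a) + 1 / b) + (2 * B + 2 * r * B1) / t * 1"
    proof -
      have "1 / (t * (c * x)) = 1 / c / t * (1 / x)" for x :: real by simp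
      thus ?thesis by (simp only: distrib_left) (simp add: add_divide_distrib mult_ac)
    qed
    also have "\<dots> \<le> (\<bar>\<kappa>\<bar> / c) / t * (1 + 1 / (-a) + 1 / b) + (2 * B + 2 * r * B1) / t * (1 + 1 / (-a) + 1 / b)"
    proof (intro add_mono mult_left_mono)
      have "1 / (-a) > 0" "1 / b > 0" using a b by (auto intro!: divide_pos_pos simp del: minus_divide_right)
      thus "1 \<le> 1 + 1 / (-a) + 1 / b" by linarith
    qed (use c t B B1 r in \<open>auto intro!: divide_nonneg_pos\<close>)
    also have "\<dots> = C / t * (1 + 1 / (-a) + 1 / b)" by (simp add: C_def add_divide_distrib algebra_simps)
    finally show "norm (integral {a..b} (\<lambda>u. ?f (y u)) - 2 * of_real \<kappa> * L0 / sqrt t) \<le> C / t * (1 + 1 / (-a) + 1 / b)" .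
  qed (use Cpos in auto)
qed


text \<open>The power phase normalised at its stationary point: value and derivative vanish at
  \<open>s = 1\<close>, and for \<open>\<alpha> < 1\<close> the factor \<open>sgn \<alpha>\<close>
  makes it concave whatever the sign of \<open>\<alpha>\<close>.\<close>

definition pphase :: "real \<Rightarrow> real \<Rightarrow> real" where
  "pphase \<alpha> s = sgn \<alpha> * (s powr \<alpha> - \<alpha> * s - (1 - \<alpha>))"

text \<open>A holomorphic Morse lemma. Extended to the unit disc, minus the phase has a double zero
  at 0, so near 0 it is the square of \<open>Y w = w * G w\<close> with \<open>G\<close> free of
  zeros. For the root with \<open>G 0 > 0\<close>, the function \<open>Y\<close> is real and
  increasing on the real axis and serves as the change of variable in the model lemma. Working with
  holomorphic functions makes every auxiliary quotient smooth at no cost.\<close>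

lemma power_stationary_phase_local:
  fixes \<alpha> :: real
  assumes \<alpha>: "\<alpha> < 1" "\<alpha> \<noteq> 0"
  obtains r C :: real and L :: complex where "0 < r" "r < 1/2" "0 < C"
    "\<And>t a b. t > 0 \<Longrightarrow> -r \<le> a \<Longrightarrow> a < 0 \<Longrightarrow> 0 < b \<Longrightarrow> b \<le> r \<Longrightarrow>
       norm (integral {a..b} (\<lambda>u. ec (t * pphase \<alpha> (u + 1))) - L / sqrt t) \<le> C / t * (1 + 1 / (-a) + 1 / b)"
proof -
  define a :: complex where "a = of_real \<alpha>"
  define s :: complex where "s = of_real (sgn \<alpha>)"
  define K where "K = (\<lambda>z::complex. - s * ((1 + z) powr a - a * z - 1))"
  define K1 where "K1 = (\<lambda>z::complex. - s * (a * (1 + z) powr (a - 1) - a))"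
  \<comment> \<open>\<open>A\<close> is half the second derivative at 0 of \<open>K\<close>, which
    is minus the phase: to leading order \<open>K z\<close> is \<open>A * z^2\<close>.\<close>
  define A where "A = \<bar>\<alpha>\<bar> * (1 - \<alpha>) / 2"
  have A: "A > 0" using \<alpha> by (simp add: A_def)
  have nonpos: "1 + z \<notin> \<real>\<^sub>\<le>\<^sub>0" if "z \<in> ball 0 1" for z :: complex
  proof -
    have "\<bar>Re z\<bar> < 1" using abs_Re_le_cmod[of z] that by (simp add: dist_norm)
    thus ?thesis by (auto simp: complex_nonpos_Reals_iff)
  qed
  have dP: "((\<lambda>z. (1 + z) powr w) has_field_derivative (w * (1 + z) powr (w - 1))) (at z)" if "z \<in> ball 0 1" for z w :: complex
  proof -
    have "((\<lambda>z. 1 + z) has_field_derivative 1) (at z)" by (auto intro!: derivative_eq_intros)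
    from DERIV_chain2[OF has_field_derivative_powr[OF nonpos[OF that], of w] this]
    show ?thesis by simp
  qed
  have dK: "(K has_field_derivative K1 z) (at z)" if "z \<in> ball 0 1" for z
  proof -
    have "((\<lambda>z. - s * ((1 + z) powr a - a * z - 1)) has_field_derivative (- s * (a * (1 + z) powr (a - 1) - a * 1 - 0))) (at z)"
      by (intro DERIV_cmult DERIV_diff dP that DERIV_ident DERIV_const)
    thus ?thesis by (simp add: K_def[abs_def] K1_def)
  qed
  have dK1: "(K1 has_field_derivative (2 * of_real A)) (at 0)"
  proof -
    have "(K1 has_field_derivative (- s * (a * ((a - 1) * (1 + 0) powr (a - 1 - 1))))) (at 0)"
      unfolding K1_def using dP[of 0 "a - 1"] by (auto intro!: derivative_eq_intros)
    moreover have "- s * (a * ((a - 1) * (1 + 0) powr (a - 1 - 1))) = 2 * of_real A"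
      using \<alpha> by (auto simp: s_def a_def A_def sgn_if abs_if algebra_simps)
    ultimately show ?thesis by simp
  qed
  have holK: "K holomorphic_on ball 0 1"
    unfolding holomorphic_on_def field_differentiable_def using dK has_field_derivative_at_within by blast
  have K0: "K 0 = 0" "K1 0 = 0" by (simp_all add: K_def K1_def)
  have derK: "deriv K z = K1 z" if "z \<in> ball 0 1" for z using dK[OF that] by (rule DERIV_imp_deriv)
  have der2: "(deriv ^^ 2) K 0 = 2 * of_real A"
  proof -
    have "(deriv ^^ 2) K 0 = deriv (deriv K) 0" by (simp add: eval_nat_numeral)
    also have "\<dots> = deriv K1 0"
    proof (rule deriv_cong_ev)
      show "\<forall>\<^sub>F x in nhds 0. deriv K x = K1 x"
        unfolding eventually_nhds by (intro exI[of _ "ball 0 1"]) (auto simp: derK)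
    qed simp
    also have "\<dots> = 2 * of_real A" by (rule DERIV_imp_deriv[OF dK1])
    finally show ?thesis .
  qed
  obtain g r0 where r0: "0 < r0" and holg: "g holomorphic_on ball 0 r0"
    and gK: "\<And>w. w \<in> ball 0 r0 \<Longrightarrow> K w - K 0 = ((w - 0) * g w) ^ 2"
    and gnz: "\<And>w. w \<in> ball 0 r0 \<Longrightarrow> g w \<noteq> 0"
  proof (rule holomorphic_factor_order_of_zero_strong[OF holK open_ball, of 0 2])
    show "(deriv ^^ 2) K 0 \<noteq> 0" using der2 A by simp
    show "(deriv ^^ i) K 0 = 0" if "0 < i" "i < 2" for i
    proof -
      have "i = 1" using that by simp
      thus ?thesis using derK[of 0] K0 by simp
    qed
  qed auto
  define r1 where "r1 = min r0 1"
  have r1: "0 < r1" "r1 \<le> r0" "r1 \<le> 1" using r0 by (auto simp: r1_def)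
  have holg1: "g holomorphic_on ball 0 r1" using r1 by (intro holomorphic_on_subset[OF holg]) auto
  have dg: "(g has_field_derivative deriv g w) (at w)" if "w \<in> ball 0 r1" for w
    by (rule holomorphic_derivI[OF holg1 open_ball that])
  have holdg: "deriv g holomorphic_on ball 0 r1" by (rule holomorphic_deriv[OF holg1 open_ball])
  have K1eq: "K1 w = w * (2 * g w * (g w + w * deriv g w))" if w: "w \<in> ball 0 r1" for w
  proof (rule DERIV_unique)
    show "(K has_field_derivative K1 w) (at w)" using w r1 by (intro dK) auto
    have "((\<lambda>w. (w * g w)^2) has_field_derivative w * (2 * g w * (g w + w * deriv g w))) (at w)"
      using dg[OF w] by (auto intro!: derivative_eq_intros simp: algebra_simps power2_eq_square)
    thus "(K has_field_derivative w * (2 * g w * (g w + w * deriv g w))) (at w)"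
      by (rule has_field_derivative_transform_within_open[where S = "ball 0 r1"])
         (use gK K0 r1 w in \<open>auto simp: dist_norm\<close>)
  qed
  \<comment> \<open>From \<open>K1 w = w * h w\<close> the derivative of \<open>K1\<close> at 0 is
    \<open>h 0 = 2 * (g 0)^2\<close>, to be compared with \<open>2 * A\<close>.\<close>
  have g0: "(g 0)^2 = of_real A"
  proof -
    define h where "h = (\<lambda>w. 2 * g w * (g w + w * deriv g w))"
    have z: "0 \<in> ball 0 r1" using r1 by simp
    obtain h' where "(h has_field_derivative h') (at 0)"
    proof -
      have "h holomorphic_on ball 0 r1" unfolding h_def by (intro holomorphic_intros holg1 holdg)
      from holomorphic_derivI[OF this open_ball z] show ?thesis by (rule that)
    qed
    hence "((\<lambda>w. w * h w) has_field_derivative (h 0)) (at 0)"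
      by (auto intro!: derivative_eq_intros)
    hence "(K1 has_field_derivative h 0) (at 0)"
      by (rule has_field_derivative_transform_within_open[where S = "ball 0 r1"])
         (use K1eq r1 in \<open>auto simp: h_def\<close>)
    hence "h 0 = 2 * of_real A" using DERIV_unique dK1 by blast
    thus ?thesis by (simp add: h_def power2_eq_square)
  qed
  have g0nz: "g 0 \<noteq> 0" using gnz[of 0] r0 by simp
  define q where "q = sqrt A"
  have q: "q > 0" "q^2 = A" using A by (auto simp: q_def)
  \<comment> \<open>The factor \<open>q / g 0\<close> squares to 1; it only fixes the sign of the
    root.\<close>
  define G where "G = (\<lambda>w. of_real q / g 0 * g w)"
  have G0: "G 0 = of_real q" using g0nz by (simp add: G_def)
  have GK: "K w = (w * G w)^2" if "w \<in> ball 0 r1" for w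
  proof -
    have "(of_real q / g 0)^2 = 1" using g0 q A by (simp add: power_divide flip: of_real_power)
    moreover have "w * G w = (of_real q / g 0) * (w * g w)" by (simp add: G_def)
    hence "(w * G w)^2 = (of_real q / g 0)^2 * (w * g w)^2" by (simp only: power_mult_distrib)
    ultimately have "(w * G w)^2 = (w * g w)^2" by simp
    thus ?thesis using gK[of w] K0 that r1 by auto
  qed
  have Gnz: "G w \<noteq> 0" if "w \<in> ball 0 r1" for w
    using gnz[of w] g0nz that q r1 by (auto simp: G_def)
  have holG: "G holomorphic_on ball 0 r1" unfolding G_def by (intro holomorphic_intros holg1) (use g0nz in auto)
  define Y where "Y = (\<lambda>w. w * G w)"
  define Y1 where "Y1 = (\<lambda>w. G w + w * deriv G w)"
  have dY: "(Y has_field_derivative Y1 w) (at w)" if "w \<in> ball 0 r1" for w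
    unfolding Y_def Y1_def using holomorphic_derivI[OF holG open_ball that]
    by (auto intro!: derivative_eq_intros)
  have holY1: "Y1 holomorphic_on ball 0 r1"
    unfolding Y1_def by (intro holomorphic_intros holG holomorphic_deriv) auto
  have Y10: "Y1 0 = of_real q" by (simp add: Y1_def G0)
  define h where "h = (\<lambda>w. 1 - Y1 w / of_real q)"
  have holh: "h holomorphic_on ball 0 r1" unfolding h_def using q by (intro holomorphic_intros holY1) auto
  have h0: "h 0 = 0" using q by (simp add: h_def Y10)
  \<comment> \<open>\<open>h\<close> vanishes at 0 because \<open>Y1 0 = q\<close>; \<open>P\<close>
    is \<open>h w / w\<close> with the removable singularity filled in.\<close>
  define P where "P = (\<lambda>z. if z = 0 then deriv h 0 else (h z - h 0) / (z - 0))"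
  have holP: "P holomorphic_on ball 0 r1" unfolding P_def using r1 by (intro pole_lemma[OF holh]) auto
  have hP: "h w = w * P w" for w by (simp add: P_def h0)
  have "isCont Y1 0" "isCont G 0"
    using holomorphic_on_imp_continuous_on[OF holY1] holomorphic_on_imp_continuous_on[OF holG] r1
    by (auto simp: continuous_on_eq_continuous_at)
  then obtain d1 d2 where d: "d1 > 0" "d2 > 0"
    and d1: "\<And>w. norm w < d1 \<Longrightarrow> norm (Y1 w - of_real q) < q / 2"
    and d2: "\<And>w. norm w < d2 \<Longrightarrow> norm (G w - of_real q) < q / 2"
    using q unfolding continuous_at_eps_delta dist_norm Y10[symmetric] by (metis (no_types, lifting) G0 Y10 diff_zero half_gt_zero)
  define r2 where "r2 = min (min d1 d2) r1"
  have r2: "0 < r2" "r2 \<le> d1" "r2 \<le> d2" "r2 \<le> r1" using d r1 by (auto simp: r2_def)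
  have Y1nz: "Y1 w \<noteq> 0" if "w \<in> ball 0 r2" for w
    using d1[of w] that r2 q by auto
  \<comment> \<open>Solves \<open>1 = Y1 / q - 2 * Y * Y1 * WW\<close>, the identity demanded by the
    model lemma; the factor \<open>w\<close> common to \<open>Y\<close> and \<open>h\<close> has
    been cancelled.\<close>
  define WW where "WW = (\<lambda>w. - P w / (2 * G w * Y1 w))"
  have holW: "WW holomorphic_on ball 0 r2"
    unfolding WW_def using Y1nz Gnz r2
    by (intro holomorphic_intros holomorphic_on_subset[OF holP] holomorphic_on_subset[OF holG] holomorphic_on_subset[OF holY1]) auto
  have inb: "complex_of_real u \<in> ball 0 r2" if "\<bar>u\<bar> < r2" for u using that by simp
  have inb1: "complex_of_real u \<in> ball 0 r1" if "\<bar>u\<bar> < r2" for u using that r2 by simp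
  define Kr where "Kr = (\<lambda>u. - sgn \<alpha> * ((1 + u) powr \<alpha> - \<alpha> * u - 1))"
  have Kr: "K (of_real u) = of_real (Kr u)" if "\<bar>u\<bar> < r2" for u
  proof -
    have "1 + u \<ge> 0" using that r2 r1 by auto
    hence "complex_of_real (1 + u) powr of_real \<alpha> = of_real ((1 + u) powr \<alpha>)" by (rule powr_of_real)
    thus ?thesis by (simp add: K_def Kr_def s_def a_def)
  qed
  have ReG: "Re (G (of_real u)) > 0" if "\<bar>u\<bar> < r2" for u
  proof -
    have "norm (G (of_real u) - of_real q) < q / 2" using that r2 by (intro d2) auto
    moreover have "\<bar>Re (G (of_real u) - of_real q)\<bar> \<le> norm (G (of_real u) - of_real q)" by (rule abs_Re_le_cmod)
    ultimately show ?thesis using q by auto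
  qed
  \<comment> \<open>For \<open>u\<close> other than 0, the number \<open>u * G u\<close> has a real
    square and a nonzero real part, so it is real itself.\<close>
  have ImG: "Im (of_real u * G (of_real u)) = 0" if u: "\<bar>u\<bar> < r2" for u
  proof (cases "u = 0")
    case False
    have "Im ((of_real u * G (of_real u))^2) = 0"
      using GK[OF inb1[OF u]] Kr[OF u] by (metis Im_complex_of_real)
    hence "2 * (u * Re (G (of_real u))) * (u * Im (G (of_real u))) = 0" by (simp add: Im_power2)
    thus ?thesis using False ReG[OF u] by auto
  qed simp
  define y where "y = (\<lambda>u. Re (Y (of_real u)))"
  define y1 where "y1 = (\<lambda>u. Re (Y1 (of_real u)))"
  have Yy: "Y (of_real u) = of_real (y u)" if "\<bar>u\<bar> < r2" for u
    using ImG[OF that] by (simp add: y_def Y_def complex_eq_iff)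
  have vY: "((\<lambda>u. Y (of_real u)) has_vector_derivative Y1 (of_real u)) (at u)" if "\<bar>u\<bar> < r2" for u
    by (intro has_vector_derivative_real_field dY inb1 that)
  have dy: "(y has_real_derivative y1 u) (at u)" if "\<bar>u\<bar> < r2" for u
    using bounded_linear.has_vector_derivative[OF bounded_linear_Re vY[OF that]]
    by (simp add: y_def[abs_def] y1_def has_real_derivative_iff_has_vector_derivative)
  have Yy1: "Y1 (of_real u) = of_real (y1 u)" if u: "\<bar>u\<bar> < r2" for u
  proof -
    have 1: "((\<lambda>u. Im (Y (of_real u))) has_real_derivative Im (Y1 (of_real u))) (at u)"
      using bounded_linear.has_vector_derivative[OF bounded_linear_Im vY[OF u]]
      by (simp add: has_real_derivative_iff_has_vector_derivative)
    have 2: "((\<lambda>u. Im (Y (of_real u))) has_real_derivative 0) (at u)"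
      by (rule has_field_derivative_transform_within_open[OF DERIV_const[of 0], where S = "{-r2<..<r2}"])
         (use u Yy in \<open>auto simp: abs_less_iff\<close>)
    from DERIV_unique[OF 1 2] show ?thesis by (simp add: y1_def complex_eq_iff)
  qed
  have y1ge: "y1 u \<ge> q / 2" if "\<bar>u\<bar> < r2" for u
  proof -
    have "norm (Y1 (of_real u) - of_real q) < q / 2" using that r2 by (intro d1) auto
    moreover have "\<bar>Re (Y1 (of_real u) - of_real q)\<bar> \<le> norm (Y1 (of_real u) - of_real q)" by (rule abs_Re_le_cmod)
    ultimately show ?thesis by (auto simp: y1_def)
  qed
  define r where "r = r2 / 3"
  have r: "0 < r" "r < 1/2" "r < r2" using r2 r1 by (auto simp: r_def)
  have y0: "y 0 = 0" by (simp add: y_def Y_def)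
  have small: "\<bar>u\<bar> < r2" if "u \<in> {-r..r}" for u using that r by auto
  have dyi: "y v - y u \<ge> q / 2 * (v - u)" if "-r \<le> u" "u \<le> v" "v \<le> r" for u v
  proof (cases "u = v")
    case False
    hence uv: "u < v" using that by simp
    have "\<exists>z>u. z < v \<and> y v - y u = (v - u) * y1 z"
      by (rule MVT2[OF uv]) (intro dy small, use that in auto)
    then obtain z where z: "u < z" "z < v" "y v - y u = (v - u) * y1 z" by blast
    have "(v - u) * (q / 2) \<le> (v - u) * y1 z" using z that uv by (intro mult_left_mono y1ge small) auto
    thus ?thesis using z by (simp add: mult.commute)
  qed simp
  define W where "W = (\<lambda>u. WW (of_real u))"
  define W1 where "W1 = (\<lambda>u. deriv WW (of_real u))"
  have yk: "pphase \<alpha> (u + 1) = - ((y u)^2)" if "u \<in> {-r..r}" for u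
  proof -
    have u: "\<bar>u\<bar> < r2" by (rule small[OF that])
    have "complex_of_real (Kr u) = of_real ((y u)^2)"
      using GK[OF inb1[OF u]] Kr[OF u] Yy[OF u] by (simp add: Y_def)
    hence "Kr u = (y u)^2" using of_real_eq_iff by blast
    thus ?thesis by (simp add: Kr_def pphase_def algebra_simps)
  qed
  show thesis
  proof (rule stationary_phase_model[of r "q / 2" y y1 W W1 "1 / q"])
    show "0 < r" "0 < q / 2" "y 0 = 0" using r q y0 by auto
    show "(y has_real_derivative y1 u) (at u)" if "u \<in> {-r..r}" for u by (intro dy small that)
    show "continuous_on {-r..r} y1"
      unfolding y1_def
      by (intro continuous_intros continuous_on_compose2[OF holomorphic_on_imp_continuous_on[OF holY1]])
         (use small inb1 in auto)
    show "q / 2 * u \<le> y u" if "0 \<le> u" "u \<le> r" for u using dyi[of 0 u] that y0 r by simp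
    show "y u \<le> q / 2 * u" if "-r \<le> u" "u \<le> 0" for u using dyi[of u 0] that y0 r by simp
    show "(W has_vector_derivative W1 u) (at u)" if "u \<in> {-r..r}" for u
      unfolding W_def W1_def
      by (intro has_vector_derivative_real_field holomorphic_derivI[OF holW open_ball] inb small that)
    show "continuous_on {-r..r} W1"
      unfolding W1_def
      by (intro continuous_intros continuous_on_compose2[OF holomorphic_on_imp_continuous_on[OF holomorphic_deriv[OF holW open_ball]]])
         (use small inb in auto)
    show "1 = of_real (1 / q * y1 u) - of_real (2 * y u * y1 u) * W u" if "u \<in> {-r..r}" for u
    proof -
      have u: "\<bar>u\<bar> < r2" by (rule small[OF that])
      have nz: "G (of_real u) \<noteq> 0" "Y1 (of_real u) \<noteq> 0" using Gnz[OF inb1[OF u]] Y1nz[OF inb[OF u]] by auto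
      have "of_real (1 / q * y1 u) - of_real (2 * y u * y1 u) * W u = Y1 (of_real u) / of_real q - 2 * Y (of_real u) * Y1 (of_real u) * W u"
        by (simp add: Yy[OF u] Yy1[OF u])
      also have "2 * Y (of_real u) * Y1 (of_real u) * W u = - (of_real u * P (of_real u))"
        using nz by (simp add: W_def WW_def Y_def)
      also have "Y1 (of_real u) / of_real q - - (of_real u * P (of_real u)) = 1"
        unfolding hP[symmetric] by (simp add: h_def)
      finally show ?thesis by simp
    qed
  next
    fix L :: complex and C :: real
    assume C: "0 < C" and L: "\<And>t a b. t > 0 \<Longrightarrow> -r \<le> a \<Longrightarrow> a < 0 \<Longrightarrow> 0 < b \<Longrightarrow> b \<le> r \<Longrightarrow>
       norm (integral {a..b} (\<lambda>u. ec (- (t * (y u)^2))) - L / sqrt t) \<le> C / t * (1 + 1 / (-a) + 1 / b)"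
    show thesis
    proof (rule that[of r C L])
      fix t a b :: real
      assume H: "t > 0" "-r \<le> a" "a < 0" "0 < b" "b \<le> r"
      have "integral {a..b} (\<lambda>u. ec (t * pphase \<alpha> (u + 1))) = integral {a..b} (\<lambda>u. ec (- (t * (y u)^2)))"
        by (rule integral_cong) (use H yk in auto)
      thus "norm (integral {a..b} (\<lambda>u. ec (t * pphase \<alpha> (u + 1))) - L / sqrt t) \<le> C / t * (1 + 1 / (-a) + 1 / b)"
        using L[OF H] by simp
    qed (use C r in auto)
  qed
qed

text \<open>Away from the neighbourhood of radius \<open>r\<close> around 1 the derivative of the
  phase has size at least \<open>l\<close>, so the first-derivative test bounds these ranges by
  \<open>1 / (t * l)\<close>. The range from \<open>1/4\<close> to \<open>4\<close> contains every
  ratio of two points between \<open>N / 2\<close> and \<open>2 * N\<close>.\<close>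

lemma power_stationary_phase:
  fixes \<alpha> :: real
  assumes \<alpha>: "\<alpha> < 1" "\<alpha> \<noteq> 0"
  obtains C :: real and L :: complex where "C > 0"
    "\<And>t a b. t > 0 \<Longrightarrow> 1/4 \<le> a \<Longrightarrow> a < 1 \<Longrightarrow> 1 < b \<Longrightarrow> b \<le> 4 \<Longrightarrow>
       norm (integral {a..b} (\<lambda>s. ec (t * pphase \<alpha> s)) - L / sqrt t) \<le> C / t * (1 + 1 / (1 - a) + 1 / (b - 1))"
proof -
  obtain r C0 :: real and L :: complex where H: "0 < r" "r < 1/2" and C0: "0 < C0"
    and L: "\<And>t a b. t > 0 \<Longrightarrow> -r \<le> a \<Longrightarrow> a < 0 \<Longrightarrow> 0 < b \<Longrightarrow> b \<le> r \<Longrightarrow>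
       norm (integral {a..b} (\<lambda>u. ec (t * pphase \<alpha> (u + 1))) - L / sqrt t) \<le> C0 / t * (1 + 1 / (-a) + 1 / b)"
    using power_stationary_phase_local[OF \<alpha>] by blast
  define k1 where "k1 = (\<lambda>s. \<bar>\<alpha>\<bar> * (s powr (\<alpha> - 1) - 1))"
  define k2 where "k2 = (\<lambda>s. \<bar>\<alpha>\<bar> * ((\<alpha> - 1) * s powr (\<alpha> - 2)))"
  have sa: "sgn \<alpha> * \<alpha> = \<bar>\<alpha>\<bar>" by (simp add: abs_sgn mult.commute)
  have d1: "(pphase \<alpha> has_real_derivative k1 s) (at s)" if "s > 0" for s
  proof -
    have "(pphase \<alpha> has_real_derivative (sgn \<alpha> * (\<alpha> * s powr (\<alpha> - 1) - \<alpha>))) (at s)"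
      unfolding pphase_def[abs_def] using that by (auto intro!: derivative_eq_intros)
    thus ?thesis by (simp add: k1_def sa[symmetric] algebra_simps)
  qed
  have d2: "(k1 has_real_derivative k2 s) (at s)" if "s > 0" for s
    unfolding k1_def k2_def using that by (auto intro!: derivative_eq_intros)
  have k2neg: "k2 s \<le> 0" for s
    using \<alpha> by (auto simp: k2_def mult_nonneg_nonpos mult_nonpos_nonneg)
  have far: "norm (integral {c..d} (\<lambda>s. ec (t * pphase \<alpha> s))) \<le> 1 / (t * l)"
    if t: "t > 0" and l: "l > 0" and cd: "0 < c" "c \<le> d" and big: "(\<forall>s\<in>{c..d}. k1 s \<ge> l) \<or> (\<forall>s\<in>{c..d}. k1 s \<le> - l)" for t l c d
  proof (rule osc_integral_first_deriv[where ?q1.0 = "\<lambda>s. t * k1 s" and ?q2.0 = "\<lambda>s. t * k2 s"])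
    show "(\<forall>x\<in>{c..d}. t * l \<le> t * k1 x) \<or> (\<forall>x\<in>{c..d}. t * k1 x \<le> - (t * l))"
      using big t by (auto simp: mult_left_mono) (metis atLeastAtMost_iff less_imp_le mult_left_mono mult_minus_right)
    show "(\<forall>x\<in>{c..d}. 0 \<le> t * k2 x) \<or> (\<forall>x\<in>{c..d}. t * k2 x \<le> 0)"
      using k2neg t by (auto simp: mult_nonneg_nonpos)
    show "continuous_on {c..d} (\<lambda>s. t * k2 s)"
      unfolding k2_def using cd by (intro continuous_intros) auto
  qed (use t l cd d1 d2 in \<open>auto intro!: DERIV_cmult\<close>)
  define l where "l = min (k1 (1 - r)) (- k1 (1 + r))"
  have dec: "k1 s' < k1 s" if "0 < s" "s < s'" for s s'
    using that \<alpha> powr_less_mono2_neg[of "\<alpha> - 1" s s'] by (simp add: k1_def)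
  have k11: "k1 1 = 0" by (simp add: k1_def)
  have l: "l > 0" using dec[of "1 - r" 1] dec[of 1 "1 + r"] H(1,2) by (simp add: l_def k11)
  have cont: "continuous_on {a..b} (\<lambda>s. ec (t * pphase \<alpha> s))" if "a > 0" for a b t
    using that by (intro continuous_intros continuous_at_imp_continuous_on ballI DERIV_isCont[OF d1]) auto
  define C where "C = C0 * (1 + 2 / r) + 2 / l"
  have C: "C > 0" using C0 l H(1) by (auto simp: C_def intro!: add_pos_pos mult_pos_pos)
  show thesis
  proof (rule that[OF C, of L])
    fix t a b :: real assume t: "t > 0" and a: "1/4 \<le> a" "a < 1" and b: "1 < b" "b \<le> 4"
    define a' where "a' = max a (1 - r)"
    define b' where "b' = min b (1 + r)"
    have a': "a \<le> a'" "a' < 1" "1 - r \<le> a'" using a H(1) by (auto simp: a'_def)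
    have b': "b' \<le> b" "1 < b'" "b' \<le> 1 + r" using b H(1) by (auto simp: b'_def)
    let ?f = "\<lambda>s. ec (t * pphase \<alpha> s)"
    have i1: "norm (integral {a..a'} ?f) \<le> 1 / (t * l)"
    proof (cases "a = a'")
      case True thus ?thesis using t l by simp
    next
      case False
      hence aa: "a' = 1 - r" "a < 1 - r" using a' by (auto simp: a'_def max_def split: if_splits)
      show ?thesis
      proof (rule far[OF t l])
        have "l \<le> k1 s" if "s \<in> {a..a'}" for s
          using that dec[of s "1 - r"] a aa by (cases "s = 1 - r") (auto simp: l_def)
        thus "(\<forall>s\<in>{a..a'}. l \<le> k1 s) \<or> (\<forall>s\<in>{a..a'}. k1 s \<le> - l)" by blast
      qed (use a aa in auto)
    qed
    have i2: "norm (integral {b'..b} ?f) \<le> 1 / (t * l)"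
    proof (cases "b = b'")
      case True thus ?thesis using t l by simp
    next
      case False
      hence bb: "b' = 1 + r" "b > 1 + r" using b' by (auto simp: b'_def min_def split: if_splits)
      show ?thesis
      proof (rule far[OF t l])
        have "k1 s \<le> - l" if "s \<in> {b'..b}" for s
          using that dec[of "1 + r" s] b bb H(1) by (cases "s = 1 + r") (auto simp: l_def)
        thus "(\<forall>s\<in>{b'..b}. l \<le> k1 s) \<or> (\<forall>s\<in>{b'..b}. k1 s \<le> - l)" by blast
      qed (use b b' bb in auto)
    qed
    have split: "integral {a..b} ?f = integral {a..a'} ?f + integral {a'..b'} ?f + integral {b'..b} ?f"
    proof -
      have "integral {a..a'} ?f + integral {a'..b} ?f = integral {a..b} ?f"
        by (rule Henstock_Kurzweil_Integration.integral_combine) (use a a' b in \<open>auto intro!: integrable_continuous_real cont\<close>)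
      moreover have "integral {a'..b'} ?f + integral {b'..b} ?f = integral {a'..b} ?f"
        by (rule Henstock_Kurzweil_Integration.integral_combine) (use a a' b b' in \<open>auto intro!: integrable_continuous_real cont\<close>)
      ultimately show ?thesis by (simp add: add.assoc)
    qed
    have mid: "integral {a'..b'} ?f = integral {a'-1..b'-1} (\<lambda>u. ?f (u + 1))"
      by (rule integral_shift_real_ivl[symmetric])
    have m: "norm (integral {a'..b'} ?f - L / sqrt t) \<le> C0 / t * (1 + 1 / (1 - a') + 1 / (b' - 1))"
      unfolding mid using L[OF t, of "a' - 1" "b' - 1"] a' b' by simp
    have ia: "1 / (1 - a') \<le> 1 / (1 - a) + 1 / r"
      using a H(1) by (auto simp: a'_def max_def)
    have ib: "1 / (b' - 1) \<le> 1 / (b - 1) + 1 / r"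
      using b H(1) by (auto simp: b'_def min_def)
    define X where "X = 1 + 1 / (1 - a) + 1 / (b - 1)"
    have X: "X \<ge> 1" using a b by (simp add: X_def)
    have "norm (integral {a..b} ?f - L / sqrt t) \<le> norm (integral {a..a'} ?f) + norm (integral {a'..b'} ?f - L / sqrt t) + norm (integral {b'..b} ?f)"
      unfolding split by (smt (verit) add_diff_eq diff_add_eq norm_triangle_ineq)
    also have "\<dots> \<le> 1 / (t * l) + C0 / t * (X + 2 / r) + 1 / (t * l)"
    proof -
      have "1 + 1 / (1 - a') + 1 / (b' - 1) \<le> X + 2 / r" using ia ib by (simp add: X_def)
      hence "norm (integral {a'..b'} ?f - L / sqrt t) \<le> C0 / t * (X + 2 / r)"
        using C0 t by (intro order_trans[OF m] mult_left_mono) auto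
      thus ?thesis using i1 i2 by linarith
    qed
    also have "\<dots> = (C0 * (X + 2 / r) + 2 / l) / t" using t l by (simp add: field_simps)
    also have "\<dots> \<le> (C0 * (X + 2 / r * X) + 2 / l * X) / t"
    proof (intro divide_right_mono add_mono mult_left_mono)
      show "2 / r \<le> 2 / r * X" using mult_left_mono[OF X, of "2 / r"] H(1) by simp
      show "2 / l \<le> 2 / l * X" using mult_left_mono[OF X, of "2 / l"] l by simp
    qed (use C0 t in auto)
    also have "\<dots> = C / t * X" by (simp add: C_def algebra_simps add_divide_distrib)
    finally show "norm (integral {a..b} ?f - L / sqrt t) \<le> C / t * (1 + 1 / (1 - a) + 1 / (b - 1))"
      by (simp only: X_def)
  qed
qed

section \<open>Mean values of exponential sums and additive energy\<close>

lemma norm_sum_ec_square: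
  fixes c :: "'a \<Rightarrow> complex" and \<phi> :: "'a \<Rightarrow> real"
  shows "complex_of_real ((norm (\<Sum>p\<in>P. c p * ec (x * \<phi> p)))\<^sup>2)
     = (\<Sum>p\<in>P. \<Sum>p'\<in>P. c p * cnj (c p') * ec (x * (\<phi> p - \<phi> p')))"
proof -
  have "complex_of_real ((norm (\<Sum>p\<in>P. c p * ec (x * \<phi> p)))\<^sup>2)
     = (\<Sum>p\<in>P. c p * ec (x * \<phi> p)) * cnj (\<Sum>p\<in>P. c p * ec (x * \<phi> p))"
    by (rule complex_norm_square)
  also have "\<dots> = (\<Sum>p\<in>P. \<Sum>p'\<in>P. (c p * ec (x * \<phi> p)) * cnj (c p' * ec (x * \<phi> p')))"
    by (simp add: sum_product)
  also have "\<dots> = (\<Sum>p\<in>P. \<Sum>p'\<in>P. c p * cnj (c p') * ec (x * (\<phi> p - \<phi> p')))"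
    by (intro sum.cong refl) (simp add: right_diff_distrib ec_diff mult_ac)
  finally show ?thesis .
qed

lemma tent_integral_half:
  fixes X y :: real
  assumes X: "X > 0" and y: "y \<noteq> 0"
  shows "((\<lambda>u. of_real (1 - u / X) * ec (u * y)) has_integral
           (ec (X * y) - 1) / ((2 * pi * \<i> * y)^2 * X) - 1 / (2 * pi * \<i> * y)) {0..X}"
proof -
  define w where "w = 2 * pi * \<i> * complex_of_real y"
  have w: "w \<noteq> 0" using y by (simp add: w_def)
  define G where "G = (\<lambda>u. of_real (1 - u / X) * (ec (u * y) / w) + ec (u * y) / (w^2 * X))"
  have "((\<lambda>u. of_real (1 - u / X) * ec (u * y)) has_integral (G X - G 0)) {0..X}"
  proof (rule fundamental_theorem_of_calculus)
    fix u assume "u \<in> {0..X}"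
    have e: "((\<lambda>u. ec (u * y)) has_vector_derivative (w * ec (u * y))) (at u within {0..X})"
    proof -
      have "((\<lambda>u. u * y) has_real_derivative y) (at u within {0..X})" by (auto intro!: derivative_eq_intros)
      from ec_has_vector_derivative[OF this] show ?thesis by (simp add: w_def)
    qed
    have l: "((\<lambda>u. complex_of_real (1 - u / X)) has_vector_derivative complex_of_real (- (1 / X))) (at u within {0..X})"
      by (rule has_vector_derivative_of_real) (use X in \<open>auto intro!: derivative_eq_intros\<close>)
    have "(G has_vector_derivative (of_real (1 - u / X) * (w * ec (u * y) / w) + of_real (- (1 / X)) * (ec (u * y) / w) + w * ec (u * y) / (w^2 * X))) (at u within {0..X})"
      unfolding G_def by (intro has_vector_derivative_add has_vector_derivative_mult has_vector_derivative_divide l e)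
    moreover have "of_real (1 - u / X) * (w * ec (u * y) / w) + of_real (- (1 / X)) * (ec (u * y) / w) + w * ec (u * y) / (w^2 * X) = of_real (1 - u / X) * ec (u * y)"
      using w X by (simp add: field_simps power2_eq_square)
    ultimately show "(G has_vector_derivative of_real (1 - u / X) * ec (u * y)) (at u within {0..X})" by simp
  qed (use X in simp)
  moreover have "G X - G 0 = (ec (X * y) - 1) / (w^2 * X) - 1 / w"
    using X w by (simp add: G_def field_simps)
  ultimately show ?thesis by (simp add: w_def)
qed

text \<open>The transform of the tent is a Fejer kernel. Its two halves are complex conjugates, so
  the purely imaginary terms of order \<open>1 / y\<close> cancel and a decay of order
  \<open>1 / (X * y^2)\<close> remains; the trivial bound \<open>X\<close> covers small
  \<open>X * y\<close>.\<close>

lemma tent_integral_bound: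
  fixes X y :: real
  assumes X: "X > 0"
  shows "norm (integral {-X..X} (\<lambda>u. of_real (1 - \<bar>u\<bar> / X) * ec (u * y))) \<le> 2 * X / (1 + (X * y)\<^sup>2)"
proof -
  let ?f = "\<lambda>u. complex_of_real (1 - \<bar>u\<bar> / X) * ec (u * y)"
  have int: "?f integrable_on {a..b}" for a b
    by (intro integrable_continuous_real continuous_intros) (use X in auto)
  have split: "integral {-X..X} ?f = integral {-X..0} ?f + integral {0..X} ?f"
    by (rule Henstock_Kurzweil_Integration.integral_combine[symmetric]) (use X int in auto)
  have neg: "integral {-X..0} ?f = cnj (integral {0..X} ?f)"
  proof -
    have "integral {-X..0} ?f = integral {-X..-0} (\<lambda>u. cnj (?f (- u)))"
      by (simp add: ec_minus)
    also have "\<dots> = integral {0..X} (\<lambda>u. cnj (?f u))"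
      by (rule Henstock_Kurzweil_Integration.integral_reflect_real)
    also have "\<dots> = cnj (integral {0..X} ?f)"
      by (rule integral_cnj[symmetric])
    finally show ?thesis .
  qed
  have triv: "norm (integral {-X..X} ?f) \<le> X"
  proof -
    have 1: "((\<lambda>u. 1 - u / X) has_integral X / 2) {0..X}"
    proof -
      have "((\<lambda>u. 1 - u / X) has_integral ((X - X^2 / (2 * X)) - (0 - 0^2 / (2 * X)))) {0..X}"
        by (rule fundamental_theorem_of_calculus)
           (use X in \<open>auto intro!: derivative_eq_intros simp flip: has_real_derivative_iff_has_vector_derivative\<close>)
      thus ?thesis using X by (simp add: power2_eq_square field_simps)
    qed
    have "norm (integral {0..X} ?f) \<le> integral {0..X} (\<lambda>u. 1 - u / X)"
    proof (rule integral_norm_bound_integral[OF int has_integral_integrable[OF 1]])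
      fix u assume "u \<in> {0..X}"
      hence "\<bar>u\<bar> = u" "u / X \<le> 1" using X by auto
      thus "norm (?f u) \<le> 1 - u / X" by (simp only: norm_mult norm_of_real norm_ec) simp
    qed
    also have "\<dots> = X / 2" using 1 by (rule integral_unique)
    finally have "norm (integral {0..X} ?f) \<le> X / 2" .
    thus ?thesis unfolding split neg using norm_triangle_ineq[of "cnj (integral {0..X} ?f)" "integral {0..X} ?f"] by simp
  qed
  define z where "z = (X * y)\<^sup>2"
  show ?thesis
  proof (cases "z \<le> 1")
    case True
    have "X * (1 + z) \<le> 2 * X" using True X by (simp add: algebra_simps)
    hence "X \<le> 2 * X / (1 + z)" using X by (simp add: z_def field_simps add_pos_nonneg)
    thus ?thesis using triv by (simp add: z_def)
  next
    case False
    hence y: "y \<noteq> 0" by (auto simp: z_def)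
    have "integral {0..X} ?f = integral {0..X} (\<lambda>u. of_real (1 - u / X) * ec (u * y))"
      by (intro integral_cong) auto
    also have "\<dots> = (ec (X * y) - 1) / ((2 * pi * \<i> * y)^2 * X) - 1 / (2 * pi * \<i> * y)"
      by (rule integral_unique[OF tent_integral_half[OF X y]])
    finally have I: "integral {0..X} ?f = (ec (X * y) - 1) / ((2 * pi * \<i> * y)^2 * X) - 1 / (2 * pi * \<i> * y)" .
    have "integral {-X..X} ?f = ((ec (X * y) - 1) + cnj (ec (X * y) - 1)) / ((2 * pi * \<i> * y)^2 * X)"
    proof -
      define D where "D = (2 * pi * \<i> * y)^2 * X"
      define q where "q = 1 / (2 * pi * \<i> * y)"
      define E where "E = ec (X * y) - 1"
      have c: "cnj D = D" "cnj q = - q" by (simp_all add: D_def q_def power_mult_distrib)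
      have "cnj (E / D - q) + (E / D - q) = (E + cnj E) / D"
        by (simp add: c add_divide_distrib)
      thus ?thesis unfolding split neg I by (simp only: D_def q_def E_def)
    qed
    hence "norm (integral {-X..X} ?f) = norm ((ec (X * y) - 1) + cnj (ec (X * y) - 1)) / ((2 * pi * y)^2 * X)"
      using X by (simp add: norm_divide norm_mult norm_power power_mult_distrib)
    also have "\<dots> \<le> 4 / ((2 * pi * y)^2 * X)"
    proof (intro divide_right_mono)
      have "norm (ec (X * y) - 1) \<le> 2" using norm_triangle_ineq4[of "ec (X * y)" 1] by simp
      thus "norm ((ec (X * y) - 1) + cnj (ec (X * y) - 1)) \<le> 4"
        using norm_triangle_ineq[of "ec (X * y) - 1" "cnj (ec (X * y) - 1)"] by (simp only: complex_mod_cnj)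
    qed (use X in auto)
    also have "\<dots> = X / (pi^2 * z)"
      using X y by (simp add: z_def field_simps power2_eq_square)
    also have "\<dots> \<le> X / z"
    proof (rule divide_left_mono)
      have "1 \<le> pi^2" using pi_gt3 by (simp add: one_le_power)
      thus "z \<le> pi^2 * z" using mult_right_mono[of 1 "pi^2" z] False by simp
    qed (use X False in auto)
    also have "\<dots> \<le> 2 * X / (1 + z)"
      using X False by (simp add: field_simps)
    finally show ?thesis by (simp add: z_def)
  qed
qed

text \<open>Twice the tent on \<open>{-X..X}\<close> majorises the indicator of the central window
  of length \<open>X\<close>. Expanding the square puts the transform of the tent on each pair of
  frequencies.\<close>

lemma mean_square_window_centered:
  fixes c :: "'a \<Rightarrow> complex" and \<phi> :: "'a \<Rightarrow> real"
  assumes X: "X > 0"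
  shows "integral {-X/2..X/2} (\<lambda>x. (norm (\<Sum>p\<in>P. c p * ec (x * \<phi> p)))\<^sup>2)
     \<le> 4 * X * (\<Sum>p\<in>P. \<Sum>p'\<in>P. norm (c p) * norm (c p') / (1 + (X * (\<phi> p - \<phi> p'))\<^sup>2))"
proof -
  define g where "g = (\<lambda>x. (norm (\<Sum>p\<in>P. c p * ec (x * \<phi> p)))\<^sup>2)"
  have cg: "continuous_on S g" for S unfolding g_def by (intro continuous_intros)
  define k where "k = (\<lambda>u. 1 - \<bar>u\<bar> / X)"
  have ck: "continuous_on S k" for S unfolding k_def by (intro continuous_intros) (use X in auto)
  have kn: "k u \<ge> 0" if "u \<in> {-X..X}" for u using that X by (auto simp: k_def field_simps)
  have ik: "(\<lambda>u. k u * g u) integrable_on {a..b}" for a b by (intro integrable_continuous_real continuous_intros ck cg)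
  have "integral {-X/2..X/2} g \<le> integral {-X/2..X/2} (\<lambda>u. 2 * (k u * g u))"
  proof (rule integral_le)
    fix u assume "u \<in> {-X/2..X/2}"
    hence "\<bar>u\<bar> / X \<le> 1 / 2" using X by (auto simp: field_simps)
    hence "1 - 1 / 2 \<le> k u" unfolding k_def by (rule diff_left_mono)
    hence "1 \<le> 2 * k u" by simp
    from mult_right_mono[OF this, of "g u"] show "g u \<le> 2 * (k u * g u)" by (simp add: g_def mult_ac)
  qed (auto intro!: integrable_continuous_real continuous_intros ck cg)
  also have "\<dots> = 2 * integral {-X/2..X/2} (\<lambda>u. k u * g u)" by simp
  also have "integral {-X/2..X/2} (\<lambda>u. k u * g u) \<le> integral {-X..X} (\<lambda>u. k u * g u)"
    by (rule integral_subset_le) (use X ik kn in \<open>auto simp: g_def\<close>)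
  also have "integral {-X..X} (\<lambda>u. k u * g u) = norm (integral {-X..X} (\<lambda>u. complex_of_real (k u * g u)))"
  proof -
    have "integral {-X..X} (\<lambda>u. complex_of_real (k u * g u)) = of_real (integral {-X..X} (\<lambda>u. k u * g u))"
      by (rule integral_unique, rule has_integral_of_real, rule integrable_integral[OF ik])
    moreover have "integral {-X..X} (\<lambda>u. k u * g u) \<ge> 0"
      by (rule integral_nonneg[OF ik]) (use kn in \<open>auto simp: g_def\<close>)
    ultimately show ?thesis by simp
  qed
  also have "integral {-X..X} (\<lambda>u. complex_of_real (k u * g u))
     = (\<Sum>p\<in>P. \<Sum>p'\<in>P. c p * cnj (c p') * integral {-X..X} (\<lambda>u. of_real (1 - \<bar>u\<bar> / X) * ec (u * (\<phi> p - \<phi> p'))))"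
  proof -
    have "complex_of_real (k u * g u) = (\<Sum>p\<in>P. \<Sum>p'\<in>P. c p * cnj (c p') * (of_real (k u) * ec (u * (\<phi> p - \<phi> p'))))" for u
      unfolding g_def of_real_mult norm_sum_ec_square by (simp add: sum_distrib_left mult_ac)
    hence "integral {-X..X} (\<lambda>u. complex_of_real (k u * g u)) = integral {-X..X} (\<lambda>u. \<Sum>p\<in>P. \<Sum>p'\<in>P. c p * cnj (c p') * (of_real (k u) * ec (u * (\<phi> p - \<phi> p'))))"
      by simp
    also have "\<dots> = (\<Sum>p\<in>P. \<Sum>p'\<in>P. integral {-X..X} (\<lambda>u. c p * cnj (c p') * (of_real (k u) * ec (u * (\<phi> p - \<phi> p')))))"
    proof (cases "finite P")
      case True
      thus ?thesis by (simp add: integral_sum integrable_continuous_real continuous_intros ck)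
    qed simp
    finally show ?thesis by (simp add: k_def)
  qed
  also have "norm \<dots> \<le> (\<Sum>p\<in>P. \<Sum>p'\<in>P. norm (c p) * norm (c p') * (2 * X / (1 + (X * (\<phi> p - \<phi> p'))\<^sup>2)))"
    by (intro order_trans[OF norm_sum] sum_mono)
       (simp only: norm_mult complex_mod_cnj, intro mult_left_mono tent_integral_bound X, simp)
  also have "2 * \<dots> = 4 * X * (\<Sum>p\<in>P. \<Sum>p'\<in>P. norm (c p) * norm (c p') / (1 + (X * (\<phi> p - \<phi> p'))\<^sup>2))"
    by (simp add: sum_distrib_left mult_ac)
  finally show ?thesis by (simp add: g_def)
qed

text \<open>Translating the window only multiplies each coefficient by a number of modulus
  1.\<close>

lemma mean_square_window:
  fixes c :: "'a \<Rightarrow> complex" and \<phi> :: "'a \<Rightarrow> real"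
  assumes X: "X > 0"
  shows "integral {X0..X0+X} (\<lambda>x. (norm (\<Sum>p\<in>P. c p * ec (x * \<phi> p)))\<^sup>2)
     \<le> 4 * X * (\<Sum>p\<in>P. \<Sum>p'\<in>P. norm (c p) * norm (c p') / (1 + (X * (\<phi> p - \<phi> p'))\<^sup>2))"
proof -
  define m where "m = X0 + X / 2"
  have "integral {X0..X0+X} (\<lambda>x. (norm (\<Sum>p\<in>P. c p * ec (x * \<phi> p)))\<^sup>2)
     = integral {X0 - m..X0 + X - m} (\<lambda>x. (norm (\<Sum>p\<in>P. c p * ec ((x + m) * \<phi> p)))\<^sup>2)"
    by (rule integral_shift_real_ivl[symmetric])
  also have "\<dots> = integral {-X/2..X/2} (\<lambda>x. (norm (\<Sum>p\<in>P. (c p * ec (m * \<phi> p)) * ec (x * \<phi> p)))\<^sup>2)"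
  proof -
    have b: "X0 - m = -X/2" "X0 + X - m = X/2" by (simp_all add: m_def)
    show ?thesis unfolding b distrib_right ec_add by (simp only: mult_ac)
  qed
  also have "\<dots> \<le> 4 * X * (\<Sum>p\<in>P. \<Sum>p'\<in>P. norm (c p * ec (m * \<phi> p)) * norm (c p' * ec (m * \<phi> p')) / (1 + (X * (\<phi> p - \<phi> p'))\<^sup>2))"
    by (rule mean_square_window_centered[OF X])
  finally show ?thesis by (simp add: norm_mult)
qed

text \<open>For \<open>\<bar>a\<bar> \<ge> 2\<close> the crude bound
  \<open>\<bar>sin a / a\<bar> \<le> 1 / 2\<close> is enough, and \<open>40\<close> comes from
  \<open>(2 * pi)^2 \<le> 40\<close>. For smaller \<open>a\<close> the Maclaurin polynomial with a
  remainder of order five is used.\<close>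

lemma sinc_lower:
  fixes a :: real
  assumes "a \<noteq> 0"
  shows "2 / a^2 * (1 - sin a / a) \<ge> 1 / (40 * (1 + (a / (2 * pi))^2))"
proof -
  have den: "1 + (a / (2 * pi))^2 \<ge> 1" by simp
  show ?thesis
  proof (cases "\<bar>a\<bar> \<ge> 2")
    case True
    have "\<bar>sin a / a\<bar> \<le> 1 / 2"
      unfolding abs_divide by (rule frac_le) (use True in auto)
    hence "1 - sin a / a \<ge> 1 / 2" by linarith
    hence "2 / a^2 * (1 - sin a / a) \<ge> 2 / a^2 * (1 / 2)" by (intro mult_left_mono) auto
    moreover have "1 / a^2 \<ge> 1 / (40 * (1 + (a / (2 * pi))^2))"
    proof (rule frac_le)
      have p: "(2 * pi)^2 \<le> 8^2" using pi_less_4 by (intro power_mono) auto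
      have "a^2 / 8^2 \<le> a^2 / (2 * pi)^2" using p by (intro divide_left_mono) auto
      hence "a^2 / 64 \<le> (a / (2 * pi))^2" by (simp add: power_divide)
      moreover have "(2 * pi)^2 \<le> 40"
      proof -
        have "pi \<le> 3.15" using pi_approx by simp
        hence "pi^2 \<le> 3.15^2" by (intro power_mono) auto
        thus ?thesis by (simp add: power_mult_distrib power2_eq_square)
      qed
      hence "a^2 / 40 \<le> a^2 / (2 * pi)^2" by (intro divide_left_mono) auto
      ultimately show "a^2 \<le> 40 * (1 + (a / (2 * pi))^2)" by (simp add: power_divide)
    qed (use assms in auto)
    ultimately show ?thesis by simp
  next
    case False
    define b where "b = \<bar>a\<bar>"
    have b: "0 < b" "b < 2" using assms False by (auto simp: b_def)
    have eq: "2 / a^2 * (1 - sin a / a) = 2 / b^2 * (1 - sin b / b)"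
      by (auto simp: b_def abs_if)
    have "\<bar>sin b - (\<Sum>m<5. sin_coeff m * b ^ m)\<bar> \<le> inverse (fact 5) * \<bar>b\<bar> ^ 5"
      by (rule Maclaurin_sin_bound)
    moreover have "(\<Sum>m<5. sin_coeff m * b ^ m) = b - b^3 / 6"
    proof -
      have "(\<Sum>m<5. h m) = h 0 + h 1 + h 2 + h 3 + h 4" for h :: "nat \<Rightarrow> real"
        by (simp add: eval_nat_numeral)
      thus ?thesis by (simp add: sin_coeff_def fact_numeral)
    qed
    ultimately have "\<bar>sin b - (b - b^3 / 6)\<bar> \<le> b^5 / 120"
      using b by (simp add: fact_numeral)
    hence "sin b \<le> b - b^3 / 6 + b^5 / 120" by linarith
    hence "sin b / b \<le> (b - b^3 / 6 + b^5 / 120) / b" using b by (intro divide_right_mono) auto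
    also have "\<dots> = 1 - b^2 / 6 + b^4 / 120" using b by (simp add: field_simps eval_nat_numeral)
    finally have "1 - sin b / b \<ge> b^2 / 6 - b^4 / 120" by simp
    moreover have "b^4 / 120 \<le> b^2 * 4 / 120"
    proof -
      have "b^2 \<le> 2^2" using b by (intro power_mono) auto
      hence "b^2 * b^2 \<le> b^2 * 4" by (intro mult_left_mono) auto
      thus ?thesis by (simp add: eval_nat_numeral)
    qed
    moreover have "b^2 \<ge> 0" by simp
    ultimately have "1 - sin b / b \<ge> b^2 / 10" by linarith
    hence "2 / b^2 * (1 - sin b / b) \<ge> 2 / b^2 * (b^2 / 10)" by (intro mult_left_mono) auto
    hence "2 / b^2 * (1 - sin b / b) \<ge> 1 / 5" using b by simp
    moreover have "1 / (40 * (1 + (a / (2 * pi))^2)) \<le> 1 / 40" using den by (intro frac_le) auto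
    ultimately show ?thesis unfolding eq by linarith
  qed
qed

text \<open>The weight \<open>(1 - x / X)^2\<close> is chosen because its cosine transform is
  strictly positive and nowhere smaller than a constant times \<open>X / (1 + (X * y)^2)\<close>.
  The transform of the tent has zeros and could not give a lower bound of this kind.\<close>

lemma quadratic_kernel_integral:
  fixes X y :: real
  assumes X: "X > 0"
  obtains I where "((\<lambda>x. (1 - x / X)\<^sup>2 * cos (2 * pi * (x * y))) has_integral I) {0..X}"
    "X / (40 * (1 + (X * y)\<^sup>2)) \<le> I"
proof (cases "y = 0")
  case True
  have "((\<lambda>x. (1 - x / X)\<^sup>2) has_integral ((- X / 3 * (1 - X / X)^3) - (- X / 3 * (1 - 0 / X)^3))) {0..X}"
    by (rule fundamental_theorem_of_calculus)
       (use X in \<open>auto intro!: derivative_eq_intros simp: power2_eq_square simp flip: has_real_derivative_iff_has_vector_derivative\<close>)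
  thus ?thesis using True X that[of "X / 3"] by simp
next
  case False
  define w where "w = 2 * pi * y"
  have w: "w \<noteq> 0" using False by (simp add: w_def)
  define G where "G = (\<lambda>x. (1 - x / X)\<^sup>2 * sin (w * x) / w - 2 * (1 - x / X) * cos (w * x) / (w^2 * X) - 2 * sin (w * x) / (w^3 * X^2))"
  have a: "((\<lambda>x. (1 - x / X)\<^sup>2 * cos (w * x)) has_integral (G X - G 0)) {0..X}"
  proof (rule fundamental_theorem_of_calculus)
    fix x assume "x \<in> {0..X}"
    have "(G has_real_derivative ((1 - x / X)\<^sup>2 * cos (w * x))) (at x within {0..X})"
      unfolding G_def using X w
      by (auto intro!: derivative_eq_intros simp: field_simps power2_eq_square power3_eq_cube)
    thus "(G has_vector_derivative ((1 - x / X)\<^sup>2 * cos (w * x))) (at x within {0..X})"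
      by (simp add: has_real_derivative_iff_has_vector_derivative)
  qed (use X in simp)
  have b: "G X - G 0 = X * (2 / (w * X)^2 * (1 - sin (w * X) / (w * X)))"
    using X w by (simp add: G_def field_simps power2_eq_square power3_eq_cube)
  have c: "X * (1 / (40 * (1 + (w * X / (2 * pi))^2))) \<le> X * (2 / (w * X)^2 * (1 - sin (w * X) / (w * X)))"
    using X w by (intro mult_left_mono sinc_lower) auto
  have d: "w * X / (2 * pi) = X * y" by (simp add: w_def)
  have e: "w * x = 2 * pi * (x * y)" for x by (simp add: w_def)
  show ?thesis
  proof (rule that)
    show "((\<lambda>x. (1 - x / X)\<^sup>2 * cos (2 * pi * (x * y))) has_integral (G X - G 0)) {0..X}"
      using a by (simp only: e)
    have "X / (40 * (1 + (X * y)\<^sup>2)) = X * (1 / (40 * (1 + (w * X / (2 * pi))^2)))" by (simp add: d)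
    also note c
    finally show "X / (40 * (1 + (X * y)\<^sup>2)) \<le> G X - G 0" by (simp only: b)
  qed
qed

text \<open>The converse of the window bound: insert the weight
  \<open>(1 - x / X)^2 \<le> 1\<close>, expand the square, and apply the positive lower bound for
  its transform to each pair.\<close>

lemma mean_square_lower:
  fixes \<phi> :: "'a \<Rightarrow> real"
  assumes X: "X > 0"
  shows "(\<Sum>p\<in>P. \<Sum>p'\<in>P. 1 / (1 + (X * (\<phi> p - \<phi> p'))\<^sup>2))
     \<le> 40 / X * integral {0..X} (\<lambda>x. (norm (\<Sum>p\<in>P. ec (x * \<phi> p)))\<^sup>2)"
proof (cases "finite P")
  case True
  define g where "g = (\<lambda>x. (norm (\<Sum>p\<in>P. ec (x * \<phi> p)))\<^sup>2)"
  have cg: "continuous_on S g" for S unfolding g_def by (intro continuous_intros)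
  have geq: "g x = (\<Sum>p\<in>P. \<Sum>p'\<in>P. cos (2 * pi * (x * (\<phi> p - \<phi> p'))))" for x
  proof -
    have "complex_of_real (g x) = (\<Sum>p\<in>P. \<Sum>p'\<in>P. ec (x * (\<phi> p - \<phi> p')))"
      using norm_sum_ec_square[of "\<lambda>_. 1" x \<phi> P] by (simp add: g_def)
    hence "g x = Re (\<Sum>p\<in>P. \<Sum>p'\<in>P. ec (x * (\<phi> p - \<phi> p')))" by (metis Re_complex_of_real)
    thus ?thesis by (simp add: Re_ec)
  qed
  have "\<exists>I. \<forall>y. ((\<lambda>x. (1 - x / X)\<^sup>2 * cos (2 * pi * (x * y))) has_integral I y) {0..X} \<and> X / (40 * (1 + (X * y)\<^sup>2)) \<le> I y"
  proof (rule choice, rule allI)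
    fix y
    show "\<exists>I. ((\<lambda>x. (1 - x / X)\<^sup>2 * cos (2 * pi * (x * y))) has_integral I) {0..X} \<and> X / (40 * (1 + (X * y)\<^sup>2)) \<le> I"
      by (rule quadratic_kernel_integral[OF X, of y]) blast
  qed
  then obtain I where I: "\<And>y. ((\<lambda>x. (1 - x / X)\<^sup>2 * cos (2 * pi * (x * y))) has_integral I y) {0..X}"
    "\<And>y. X / (40 * (1 + (X * y)\<^sup>2)) \<le> I y" by blast
  have "((\<lambda>x. \<Sum>p\<in>P. \<Sum>p'\<in>P. (1 - x / X)\<^sup>2 * cos (2 * pi * (x * (\<phi> p - \<phi> p')))) has_integral (\<Sum>p\<in>P. \<Sum>p'\<in>P. I (\<phi> p - \<phi> p'))) {0..X}"
    by (intro has_integral_sum True I)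
  hence k: "((\<lambda>x. (1 - x / X)\<^sup>2 * g x) has_integral (\<Sum>p\<in>P. \<Sum>p'\<in>P. I (\<phi> p - \<phi> p'))) {0..X}"
    by (simp add: geq sum_distrib_left)
  have "(\<Sum>p\<in>P. \<Sum>p'\<in>P. X / (40 * (1 + (X * (\<phi> p - \<phi> p'))\<^sup>2))) \<le> (\<Sum>p\<in>P. \<Sum>p'\<in>P. I (\<phi> p - \<phi> p'))"
    by (intro sum_mono I)
  also have "\<dots> \<le> integral {0..X} g"
  proof (rule has_integral_le[OF k integrable_integral])
    show "g integrable_on {0..X}" by (intro integrable_continuous_real cg)
    fix x assume x: "x \<in> {0..X}"
    have "(1 - x / X)\<^sup>2 \<le> 1^2" using x X by (intro power_mono) (auto simp: field_simps)
    from mult_right_mono[OF this, of "g x"] show "(1 - x / X)\<^sup>2 * g x \<le> g x" by (simp add: g_def)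
  qed
  also have "(\<Sum>p\<in>P. \<Sum>p'\<in>P. X / (40 * (1 + (X * (\<phi> p - \<phi> p'))\<^sup>2))) = X / 40 * (\<Sum>p\<in>P. \<Sum>p'\<in>P. 1 / (1 + (X * (\<phi> p - \<phi> p'))\<^sup>2))"
    by (simp add: sum_distrib_left)
  finally show ?thesis using X by (simp add: g_def field_simps)
qed simp

text \<open>Additive energy with a Cauchy weight in place of the sharp condition that two pair sums
  differ by at most \<open>1 / X\<close>. Both kernels above yield this weight, so for unit
  coefficients the energy agrees up to constants with the fourth moment over the window
  \<open>{0..X}\<close>, divided by \<open>X\<close>.\<close>

definition quad_energy :: "('a \<Rightarrow> real) \<Rightarrow> 'a set \<Rightarrow> real \<Rightarrow> real" where
  "quad_energy \<phi> I X = (\<Sum>p\<in>I \<times> I. \<Sum>p'\<in>I \<times> I.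
     1 / (1 + (X * ((\<phi> (fst p) + \<phi> (snd p)) - (\<phi> (fst p') + \<phi> (snd p'))))\<^sup>2))"

lemma sum_ec_power2:
  "(\<Sum>n\<in>I. c n * ec (x * \<phi> n))\<^sup>2 = (\<Sum>p\<in>I \<times> I. (c (fst p) * c (snd p)) * ec (x * (\<phi> (fst p) + \<phi> (snd p))))"
  unfolding power2_eq_square sum_product sum.cartesian_product
  by (intro sum.cong refl) (auto simp: distrib_left ec_add mult_ac)

lemma norm_power4: "norm (z::complex) ^ 4 = (norm (z\<^sup>2))\<^sup>2"
  by (simp add: norm_power flip: power_mult)

text \<open>The fourth power is the squared modulus of a sum over pairs with frequencies
  \<open>\<phi> (fst p) + \<phi> (snd p)\<close>, to which the mean square bound applies.\<close>

lemma fourth_moment_window: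
  fixes c :: "'a \<Rightarrow> complex" and \<phi> :: "'a \<Rightarrow> real"
  assumes X: "X > 0" and c: "\<And>n. n \<in> I \<Longrightarrow> norm (c n) \<le> K"
  shows "integral {X0..X0+X} (\<lambda>x. norm (\<Sum>n\<in>I. c n * ec (x * \<phi> n)) ^ 4) \<le> 4 * X * K ^ 4 * quad_energy \<phi> I X"
proof -
  have "integral {X0..X0+X} (\<lambda>x. norm (\<Sum>n\<in>I. c n * ec (x * \<phi> n)) ^ 4)
     \<le> 4 * X * (\<Sum>p\<in>I \<times> I. \<Sum>p'\<in>I \<times> I. norm (c (fst p) * c (snd p)) * norm (c (fst p') * c (snd p')) / (1 + (X * ((\<phi> (fst p) + \<phi> (snd p)) - (\<phi> (fst p') + \<phi> (snd p'))))\<^sup>2))"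
    unfolding norm_power4 sum_ec_power2 by (rule mean_square_window[OF X])
  also have "\<dots> \<le> 4 * X * (\<Sum>p\<in>I \<times> I. \<Sum>p'\<in>I \<times> I. K ^ 4 * (1 / (1 + (X * ((\<phi> (fst p) + \<phi> (snd p)) - (\<phi> (fst p') + \<phi> (snd p'))))\<^sup>2)))"
  proof (intro mult_left_mono sum_mono)
    fix p p' assume p: "p \<in> I \<times> I" "p' \<in> I \<times> I"
    have K: "K \<ge> 0" using order_trans[OF norm_ge_zero c[of "fst p"]] p by (auto simp: mem_Times_iff)
    have "norm (c (fst p) * c (snd p)) * norm (c (fst p') * c (snd p')) \<le> (K * K) * (K * K)"
      using p K by (auto simp: norm_mult mem_Times_iff intro!: mult_mono c)
    also have "\<dots> = K ^ 4" by (simp add: eval_nat_numeral)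
    finally show "norm (c (fst p) * c (snd p)) * norm (c (fst p') * c (snd p')) / (1 + (X * ((\<phi> (fst p) + \<phi> (snd p)) - (\<phi> (fst p') + \<phi> (snd p'))))\<^sup>2)
      \<le> K ^ 4 * (1 / (1 + (X * ((\<phi> (fst p) + \<phi> (snd p)) - (\<phi> (fst p') + \<phi> (snd p'))))\<^sup>2))"
      by (simp add: divide_right_mono)
  qed (use X in auto)
  finally show ?thesis by (simp add: quad_energy_def sum_distrib_left mult_ac)
qed

lemma quad_energy_le_fourth_moment:
  assumes X: "X > 0"
  shows "quad_energy \<phi> I X \<le> 40 / X * integral {0..X} (\<lambda>x. norm (\<Sum>n\<in>I. ec (x * \<phi> n)) ^ 4)"
proof -
  have "(\<Sum>n\<in>I. ec (x * \<phi> n))\<^sup>2 = (\<Sum>p\<in>I \<times> I. ec (x * (\<phi> (fst p) + \<phi> (snd p))))" for x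
    using sum_ec_power2[of "\<lambda>_. 1" x \<phi> I] by simp
  thus ?thesis
    unfolding quad_energy_def norm_power4
    using mean_square_lower[OF X, of "\<lambda>p. \<phi> (fst p) + \<phi> (snd p)" "I \<times> I"] by simp
qed

lemma quad_energy_nonneg: "quad_energy \<phi> I X \<ge> 0"
  unfolding quad_energy_def by (intro sum_nonneg divide_nonneg_nonneg) auto

lemma quad_energy_antimono:
  assumes "0 \<le> X" "X \<le> X'"
  shows "quad_energy \<phi> I X' \<le> quad_energy \<phi> I X"
  unfolding quad_energy_def
proof (intro sum_mono frac_le)
  fix p p'
  show "1 + (X * (\<phi> (fst p) + \<phi> (snd p) - (\<phi> (fst p') + \<phi> (snd p'))))\<^sup>2 \<le> 1 + (X' * (\<phi> (fst p) + \<phi> (snd p) - (\<phi> (fst p') + \<phi> (snd p'))))\<^sup>2"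
    using assms by (auto simp: power_mult_distrib intro!: mult_right_mono power_mono)
qed (auto intro: add_pos_nonneg)

text \<open>Together with antitonicity: changing \<open>X\<close> by a bounded factor changes the
  energy by a bounded factor.\<close>

lemma quad_energy_scale:
  assumes "0 < X" "X \<le> X'"
  shows "quad_energy \<phi> I X \<le> (X' / X)\<^sup>2 * quad_energy \<phi> I X'"
  unfolding quad_energy_def sum_distrib_left
proof (intro sum_mono)
  fix p p'
  define y where "y = \<phi> (fst p) + \<phi> (snd p) - (\<phi> (fst p') + \<phi> (snd p'))"
  have "(X / X')\<^sup>2 \<le> 1" using assms by (simp add: power_le_one)
  hence "(X / X')\<^sup>2 * (1 + (X' * y)\<^sup>2) \<le> 1 + (X * y)\<^sup>2"
    using assms by (simp add: distrib_left power_mult_distrib power_divide)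
  hence "1 / (1 + (X * y)\<^sup>2) \<le> 1 / ((X / X')\<^sup>2 * (1 + (X' * y)\<^sup>2))"
    using assms by (intro frac_le) (auto intro!: mult_pos_pos add_pos_nonneg)
  also have "\<dots> = (X' / X)\<^sup>2 * (1 / (1 + (X' * y)\<^sup>2))" by (simp add: power_divide)
  finally show "1 / (1 + (X * (\<phi> (fst p) + \<phi> (snd p) - (\<phi> (fst p') + \<phi> (snd p'))))\<^sup>2)
    \<le> (X' / X)\<^sup>2 * (1 / (1 + (X' * (\<phi> (fst p) + \<phi> (snd p) - (\<phi> (fst p') + \<phi> (snd p'))))\<^sup>2))"
    by (simp only: y_def)
qed

lemma quad_energy_le_card: "quad_energy \<phi> I X \<le> real (card I) ^ 4"
proof -
  have "quad_energy \<phi> I X \<le> (\<Sum>p\<in>I \<times> I. \<Sum>p'\<in>I \<times> I. 1)"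
    unfolding quad_energy_def by (intro sum_mono) (simp add: add_pos_nonneg)
  also have "\<dots> = real (card I) ^ 4" by (simp add: card_cartesian_product eval_nat_numeral)
  finally show ?thesis .
qed

text \<open>All weights are non-negative and quadruples inside different blocks are different; the
  quadruples that mix blocks are dropped.\<close>

lemma quad_energy_disjoint_family:
  assumes fin: "finite I" "finite L" and sub: "\<And>l. l \<in> L \<Longrightarrow> B l \<subseteq> I"
    and disj: "\<And>l l'. l \<in> L \<Longrightarrow> l' \<in> L \<Longrightarrow> l \<noteq> l' \<Longrightarrow> B l \<inter> B l' = {}"
  shows "(\<Sum>l\<in>L. quad_energy \<phi> (B l) X) \<le> quad_energy \<phi> I X"
proof -
  define f where "f = (\<lambda>q::('a \<times> 'a) \<times> ('a \<times> 'a). 1 / (1 + (X * ((\<phi> (fst (fst q)) + \<phi> (snd (fst q))) - (\<phi> (fst (snd q)) + \<phi> (snd (snd q)))))\<^sup>2))"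
  have eq: "quad_energy \<phi> S X = sum f ((S \<times> S) \<times> (S \<times> S))" for S
    unfolding quad_energy_def f_def by (subst sum.cartesian_product) (simp add: case_prod_unfold)
  have finB: "finite (B l)" if "l \<in> L" for l using sub[OF that] fin finite_subset by blast
  have "(\<Sum>l\<in>L. quad_energy \<phi> (B l) X) = sum f (\<Union>l\<in>L. (B l \<times> B l) \<times> (B l \<times> B l))"
    unfolding eq
  proof (rule sum.UNION_disjoint[symmetric])
    show "\<forall>i\<in>L. \<forall>j\<in>L. i \<noteq> j \<longrightarrow> (B i \<times> B i) \<times> B i \<times> B i \<inter> (B j \<times> B j) \<times> B j \<times> B j = {}"
      using disj by blast
  qed (use fin finB in auto)
  also have "\<dots> \<le> sum f ((I \<times> I) \<times> (I \<times> I))"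
    by (rule sum_mono2) (use fin sub in \<open>auto simp: f_def intro!: divide_nonneg_nonneg, (blast+)?\<close>)
  finally show ?thesis by (simp only: eq)
qed

section \<open>Maximal partial sums through dyadic blocks\<close>

lemma sum_power4_le:
  fixes x :: "'a \<Rightarrow> real"
  assumes "finite A"
  shows "(\<Sum>a\<in>A. x a) ^ 4 \<le> real (card A) ^ 3 * (\<Sum>a\<in>A. x a ^ 4)"
proof -
  have cs: "(\<Sum>a\<in>A. y a)\<^sup>2 \<le> real (card A) * (\<Sum>a\<in>A. (y a)\<^sup>2)" for y :: "'a \<Rightarrow> real"
    using sum_squared_le_sum_of_squares[of y A] by (simp add: mult.commute)
  have "(\<Sum>a\<in>A. x a) ^ 4 = ((\<Sum>a\<in>A. x a)\<^sup>2)\<^sup>2" by simp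
  also have "\<dots> \<le> (real (card A) * (\<Sum>a\<in>A. (x a)\<^sup>2))\<^sup>2" by (intro power_mono cs) auto
  also have "\<dots> = real (card A) ^ 2 * (\<Sum>a\<in>A. (x a)\<^sup>2)\<^sup>2" by (simp add: power_mult_distrib)
  also have "\<dots> \<le> real (card A) ^ 2 * (real (card A) * (\<Sum>a\<in>A. ((x a)\<^sup>2)\<^sup>2))" by (intro mult_left_mono cs) auto
  also have "\<dots> = real (card A) ^ 3 * (\<Sum>a\<in>A. x a ^ 4)" by (simp add: eval_nat_numeral mult_ac)
  finally show ?thesis .
qed

text \<open>The binary expansion of \<open>p\<close> cuts \<open>{..<p}\<close> into at most one
  dyadic block of each length \<open>2^j\<close>, and a single block sum is at most the fourth root
  of the sum of fourth powers over all blocks of that length. The induction on \<open>k\<close>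
  strips the leading binary digit.\<close>

lemma rademacher_menshov_aux:
  fixes z :: "nat \<Rightarrow> complex"
  assumes "p < 2 ^ k"
  shows "norm (\<Sum>i<p. z i) \<le> (\<Sum>j<k. root 4 (\<Sum>l<2^(k-j). norm (\<Sum>i\<in>{l*2^j..<(l+1)*2^j}. z i) ^ 4))"
  using assms
proof (induction k arbitrary: p z)
  case (Suc k)
  define E where "E = (\<lambda>k j (z :: nat \<Rightarrow> complex). \<Sum>l<2^(k-j). norm (\<Sum>i\<in>{l*2^j..<(l+1)*2^j}. z i) ^ 4)"
  \<comment> \<open>Blocks of length \<open>2^j\<close> in the doubled range are those of its two
    halves, the right half being read as the sequence shifted by \<open>2^k\<close>.\<close>
  have dbl: "E (Suc k) j z = E k j z + E k j (\<lambda>i. z (i + 2^k))" if "j < k" for j and z :: "nat \<Rightarrow> complex"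
  proof -
    define a where "a = (2::nat)^(k-j)"
    have 2: "(2::nat) ^ (Suc k - j) = a + a" using that by (simp add: a_def Suc_diff_le less_imp_le mult_2)
    have ak: "a * 2^j = 2^k" using that by (simp add: a_def flip: power_add)
    have sp: "(\<Sum>l<a+a. h l) = (\<Sum>l<a. h l) + (\<Sum>l<a. h (l + a))" for h :: "nat \<Rightarrow> real"
      by (simp add: lessThan_atLeast0 sum.atLeastLessThan_concat[of 0 a "a+a", symmetric]
           sum.shift_bounds_nat_ivl[of h 0 a a, simplified, symmetric])
    have blk: "(\<Sum>i\<in>{(l+a)*2^j..<(l+a+1)*2^j}. z i) = (\<Sum>i\<in>{l*2^j..<(l+1)*2^j}. z (i + 2^k))" for l
      using sum.shift_bounds_nat_ivl[of z "l*2^j" "2^k" "(l+1)*2^j"] ak by (simp add: distrib_right algebra_simps)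
    show ?thesis unfolding E_def 2 sp blk by (simp add: a_def)
  qed
  have En: "E k j z \<ge> 0" for k j z unfolding E_def by (intro sum_nonneg) auto
  have Ek: "E (Suc k) k z \<ge> norm (\<Sum>i<2^k. z i) ^ 4"
    by (simp add: E_def lessThan_atLeast0 eval_nat_numeral)
  show ?case
  proof (cases "p < 2 ^ k")
    case True
    have "norm (\<Sum>i<p. z i) \<le> (\<Sum>j<k. root 4 (E k j z))" using Suc.IH[OF True] by (simp add: E_def)
    also have "\<dots> \<le> (\<Sum>j<k. root 4 (E (Suc k) j z))"
      by (intro sum_mono) (use En in \<open>auto simp: dbl\<close>)
    also have "\<dots> \<le> (\<Sum>j<Suc k. root 4 (E (Suc k) j z))" using En by simp
    finally show ?thesis by (simp only: E_def)
  next
    case False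
    define p' where "p' = p - 2^k"
    have p': "p = p' + 2^k" "p' < 2^k" using False Suc.prems by (auto simp: p'_def)
    have "(\<Sum>i<p. z i) = (\<Sum>i<2^k. z i) + (\<Sum>i<p'. z (i + 2^k))"
      unfolding p'(1) lessThan_atLeast0
      using sum.atLeastLessThan_concat[of 0 "2^k" "p' + 2^k" z] sum.shift_bounds_nat_ivl[of z 0 "2^k" p']
      by simp
    hence "norm (\<Sum>i<p. z i) \<le> norm (\<Sum>i<2^k. z i) + norm (\<Sum>i<p'. z (i + 2^k))"
      by (simp add: norm_triangle_ineq)
    also have "norm (\<Sum>i<p'. z (i + 2^k)) \<le> (\<Sum>j<k. root 4 (E k j (\<lambda>i. z (i + 2^k))))"
      using Suc.IH[OF p'(2), of "\<lambda>i. z (i + 2^k)"] by (simp add: E_def)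
    also have "\<dots> \<le> (\<Sum>j<k. root 4 (E (Suc k) j z))"
      by (intro sum_mono) (use En in \<open>auto simp: dbl\<close>)
    also have "norm (\<Sum>i<2^k. z i) \<le> root 4 (E (Suc k) k z)"
    proof -
      have "norm (\<Sum>i<2^k. z i) = root 4 (norm (\<Sum>i<2^k. z i) ^ 4)" by (simp add: real_root_power_cancel)
      also have "\<dots> \<le> root 4 (E (Suc k) k z)" using Ek by simp
      finally show ?thesis .
    qed
    finally have "norm (\<Sum>i<p. z i) \<le> (\<Sum>j<Suc k. root 4 (E (Suc k) j z))" by simp
    thus ?thesis by (simp only: E_def)
  qed
qed simp

text \<open>The right side does not depend on \<open>p\<close>: it dominates all partial sums at
  once, for a power of \<open>k\<close>. This permits integration when the length of the sum varies
  with the integration variable.\<close>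

lemma rademacher_menshov:
  fixes z :: "nat \<Rightarrow> complex"
  assumes "p \<le> 2 ^ k"
  shows "norm (\<Sum>i<p. z i) ^ 4 \<le> real (k + 1) ^ 3 * (\<Sum>j\<le>k. \<Sum>l<2^(k-j). norm (\<Sum>i\<in>{l*2^j..<(l+1)*2^j}. z i) ^ 4)"
proof -
  define E where "E = (\<lambda>j. \<Sum>l<2^(k-j). norm (\<Sum>i\<in>{l*2^j..<(l+1)*2^j}. z i) ^ 4)"
  have En: "E j \<ge> 0" for j unfolding E_def by (intro sum_nonneg) auto
  have "norm (\<Sum>i<p. z i) ^ 4 \<le> real (k + 1) ^ 3 * (\<Sum>j\<le>k. E j)"
  proof (cases "p = 2^k")
    case True
    have "norm (\<Sum>i<p. z i) ^ 4 = E k" by (simp add: True E_def lessThan_atLeast0)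
    also have "\<dots> \<le> (\<Sum>j\<le>k. E j)" using En by (intro member_le_sum) auto
    also have "\<dots> = 1 * (\<Sum>j\<le>k. E j)" by simp
    also have "\<dots> \<le> real (k + 1) ^ 3 * (\<Sum>j\<le>k. E j)"
      using En by (intro mult_right_mono one_le_power sum_nonneg) auto
    finally show ?thesis .
  next
    case False
    hence "p < 2^k" using assms by simp
    from rademacher_menshov_aux[OF this, of z]
    have "norm (\<Sum>i<p. z i) \<le> (\<Sum>j<k. root 4 (E j))" by (simp add: E_def)
    hence "norm (\<Sum>i<p. z i) ^ 4 \<le> (\<Sum>j<k. root 4 (E j)) ^ 4" by (intro power_mono) auto
    also have "\<dots> \<le> real (card {..<k}) ^ 3 * (\<Sum>j<k. root 4 (E j) ^ 4)" by (rule sum_power4_le) simp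
    also have "\<dots> = real k ^ 3 * (\<Sum>j<k. E j)" using En by simp
    also have "\<dots> \<le> real (k + 1) ^ 3 * (\<Sum>j\<le>k. E j)"
      using En by (intro mult_mono power_mono sum_mono2 sum_nonneg) auto
    finally show ?thesis .
  qed
  thus ?thesis by (simp only: E_def)
qed

section \<open>The van der Corput B-process for power sums\<close>

locale power_sum =
  fixes \<alpha> x :: real and N :: nat
  assumes \<alpha>: "\<alpha> < 1" "\<alpha> \<noteq> 0" and x: "x > 0" and N: "N \<ge> 1"
begin

definition T :: real where "T = x * real N powr \<alpha>"
text \<open>The sign makes \<open>g\<close> concave for both signs of \<open>\<alpha>\<close>; for
  negative \<open>\<alpha>\<close> it replaces the exponential sum by its complex conjugate.\<close>

definition g :: "real \<Rightarrow> real" where "g y = sgn \<alpha> * x * y powr \<alpha>"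
definition g1 :: "real \<Rightarrow> real" where "g1 y = \<bar>\<alpha>\<bar> * x * y powr (\<alpha> - 1)"
definition g2 :: "real \<Rightarrow> real" where "g2 y = - (\<bar>\<alpha>\<bar> * (1 - \<alpha>) * x * y powr (\<alpha> - 2))"
definition a :: real where "a = real N - 1/2"
definition b :: real where "b = real (2 * N) - 1/2"
text \<open>The stationary point of \<open>g y - m * y\<close>, that is, the solution of
  \<open>g1 y = m\<close>.\<close>

definition xs :: "real \<Rightarrow> real" where "xs m = (\<bar>\<alpha>\<bar> * x / m) powr (1 / (1 - \<alpha>))"
definition \<tau> :: "real \<Rightarrow> real" where "\<tau> m = x * xs m powr \<alpha>"
text \<open>The critical value \<open>g (xs m) - m * xs m\<close>.\<close>

definition \<theta> :: "real \<Rightarrow> real" where "\<theta> m = sgn \<alpha> * (1 - \<alpha>) * \<tau> m"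
text \<open>Up to a constant factor, the inverse square root of \<open>\<bar>g2\<bar>\<close> at the
  stationary point.\<close>

definition w :: "real \<Rightarrow> real" where "w m = xs m / sqrt (\<tau> m)"

section \<open>Derivatives, stationary points and single frequencies\<close>

lemma sgn_mult: "sgn \<alpha> * \<alpha> = \<bar>\<alpha>\<bar>" by (simp add: abs_sgn mult.commute)

lemma ab: "real N / 2 \<le> a" "a < b" "b \<le> 2 * real N" "0 < a" "0 < b"
  using N by (auto simp: a_def b_def)

lemma T_pos: "T > 0" using x N by (simp add: T_def)

lemma g_deriv: "y > 0 \<Longrightarrow> (g has_real_derivative g1 y) (at y)"
proof -
  assume y: "y > 0"
  have "(g has_real_derivative (sgn \<alpha> * x * (\<alpha> * y powr (\<alpha> - 1)))) (at y)"
    unfolding g_def[abs_def] using y by (auto intro!: derivative_eq_intros)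
  moreover have "sgn \<alpha> * x * (\<alpha> * y powr (\<alpha> - 1)) = g1 y"
    unfolding g1_def sgn_mult[symmetric] by (simp add: mult_ac)
  ultimately show ?thesis by simp
qed

lemma g1_deriv: "y > 0 \<Longrightarrow> (g1 has_real_derivative g2 y) (at y)"
proof -
  assume y: "y > 0"
  have "(g1 has_real_derivative (\<bar>\<alpha>\<bar> * x * ((\<alpha> - 1) * y powr (\<alpha> - 1 - 1)))) (at y)"
    unfolding g1_def[abs_def] using y by (auto intro!: derivative_eq_intros)
  moreover have "\<bar>\<alpha>\<bar> * x * ((\<alpha> - 1) * y powr (\<alpha> - 1 - 1)) = g2 y"
    unfolding g2_def by (simp add: algebra_simps)
  ultimately show ?thesis by simp
qed

lemma g2_cont: "0 < c \<Longrightarrow> continuous_on {c..d} g2"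
  unfolding g2_def[abs_def] by (intro continuous_intros) auto

lemma g1_strict: "0 < y \<Longrightarrow> y < z \<Longrightarrow> g1 z < g1 y"
  unfolding g1_def using \<alpha> x powr_less_mono2_neg[of "\<alpha> - 1" y z] by simp

lemma scale: "x * (k * real N) powr s = k powr s * T * real N powr (s - \<alpha>)" if "k > 0"
  using N that by (simp add: T_def powr_mult powr_diff)

lemma g2_bounds:
  assumes "real N / 2 \<le> y" "y \<le> 2 * real N"
  shows "g2 y \<le> - (\<bar>\<alpha>\<bar> * (1 - \<alpha>) * 2 powr (\<alpha> - 2) * (T / real N ^ 2))"
    "- (\<bar>\<alpha>\<bar> * (1 - \<alpha>) * 2 powr (2 - \<alpha>) * (T / real N ^ 2)) \<le> g2 y"
proof -
  have y: "y > 0" using assms N by linarith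
  have N2: "real N powr (- 2) = 1 / real N ^ 2" using N by (simp add: powr_minus_divide powr_numeral)
  have e1: "x * (2 * real N) powr (\<alpha> - 2) = 2 powr (\<alpha> - 2) * (T / real N ^ 2)"
    using scale[of 2 "\<alpha> - 2"] N2 by simp
  have e2: "x * ((1/2) * real N) powr (\<alpha> - 2) = 2 powr (2 - \<alpha>) * (T / real N ^ 2)"
  proof -
    have "(1/2::real) powr (\<alpha> - 2) = 2 powr (2 - \<alpha>)"
      using powr_minus[of "2::real" "\<alpha> - 2"] by (simp add: powr_divide inverse_eq_divide)
    thus ?thesis using scale[of "1/2" "\<alpha> - 2"] N2 by simp
  qed
  have "(2 * real N) powr (\<alpha> - 2) \<le> y powr (\<alpha> - 2)"
    using \<alpha> y assms N by (intro powr_mono2') auto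
  hence "x * (2 * real N) powr (\<alpha> - 2) \<le> x * y powr (\<alpha> - 2)" using x by simp
  hence "\<bar>\<alpha>\<bar> * (1 - \<alpha>) * (x * (2 * real N) powr (\<alpha> - 2)) \<le> \<bar>\<alpha>\<bar> * (1 - \<alpha>) * (x * y powr (\<alpha> - 2))"
    by (rule mult_left_mono) (use \<alpha> in auto)
  thus "g2 y \<le> - (\<bar>\<alpha>\<bar> * (1 - \<alpha>) * 2 powr (\<alpha> - 2) * (T / real N ^ 2))"
    unfolding e1 by (simp add: g2_def mult.assoc)
  have "y powr (\<alpha> - 2) \<le> ((1/2) * real N) powr (\<alpha> - 2)"
    using \<alpha> y assms N by (intro powr_mono2') auto
  hence "x * y powr (\<alpha> - 2) \<le> x * ((1/2) * real N) powr (\<alpha> - 2)" using x by simp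
  hence "\<bar>\<alpha>\<bar> * (1 - \<alpha>) * (x * y powr (\<alpha> - 2)) \<le> \<bar>\<alpha>\<bar> * (1 - \<alpha>) * (x * ((1/2) * real N) powr (\<alpha> - 2))"
    by (rule mult_left_mono) (use \<alpha> in auto)
  thus "- (\<bar>\<alpha>\<bar> * (1 - \<alpha>) * 2 powr (2 - \<alpha>) * (T / real N ^ 2)) \<le> g2 y"
    unfolding e2 by (simp add: g2_def mult.assoc)
qed

lemma g2_neg: "g2 y \<le> 0" using \<alpha> x by (simp add: g2_def)

lemma U_le: "g1 a \<le> \<bar>\<alpha>\<bar> * 2 powr (1 - \<alpha>) * (T / real N)"
proof -
  have "a powr (\<alpha> - 1) \<le> ((1/2) * real N) powr (\<alpha> - 1)"
    using \<alpha> ab N by (intro powr_mono2') auto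
  hence "x * a powr (\<alpha> - 1) \<le> x * ((1/2) * real N) powr (\<alpha> - 1)" using x by simp
  also have "\<dots> = (1/2) powr (\<alpha> - 1) * T * real N powr (- 1)" using scale[of "1/2" "\<alpha> - 1"] by simp
  also have "(1/2::real) powr (\<alpha> - 1) = 2 powr (1 - \<alpha>)"
    using powr_minus[of "2::real" "\<alpha> - 1"] by (simp add: powr_divide inverse_eq_divide)
  also have "2 powr (1 - \<alpha>) * T * real N powr (- 1) = 2 powr (1 - \<alpha>) * (T / real N)"
    using N by (simp add: powr_minus_divide)
  finally have "\<bar>\<alpha>\<bar> * (x * a powr (\<alpha> - 1)) \<le> \<bar>\<alpha>\<bar> * (2 powr (1 - \<alpha>) * (T / real N))"
    by (intro mult_left_mono) auto
  thus ?thesis by (simp add: g1_def mult.assoc)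
qed

lemma V_ge: "\<bar>\<alpha>\<bar> * 2 powr (\<alpha> - 1) * (T / real N) \<le> g1 b"
proof -
  have "(2 * real N) powr (\<alpha> - 1) \<le> b powr (\<alpha> - 1)"
    using \<alpha> ab N by (intro powr_mono2') auto
  hence "x * (2 * real N) powr (\<alpha> - 1) \<le> x * b powr (\<alpha> - 1)" using x by simp
  moreover have "x * (2 * real N) powr (\<alpha> - 1) = 2 powr (\<alpha> - 1) * (T / real N)"
    using scale[of 2 "\<alpha> - 1"] N by (simp add: powr_minus_divide)
  ultimately have "\<bar>\<alpha>\<bar> * (2 powr (\<alpha> - 1) * (T / real N)) \<le> \<bar>\<alpha>\<bar> * (x * b powr (\<alpha> - 1))"
    by (intro mult_left_mono) auto
  thus ?thesis by (simp add: g1_def mult.assoc)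
qed

lemma V_pos: "g1 b > 0" using \<alpha> x ab by (simp add: g1_def)

lemma xs_pos: "m > 0 \<Longrightarrow> xs m > 0" using \<alpha> x by (simp add: xs_def)

lemma g1_xs: "m > 0 \<Longrightarrow> g1 (xs m) = m"
proof -
  assume m: "m > 0"
  have p: "\<bar>\<alpha>\<bar> * x / m > 0" using m \<alpha> x by simp
  have e: "1 / (1 - \<alpha>) * (\<alpha> - 1) = - 1" using \<alpha> by (simp add: field_simps)
  have "xs m powr (\<alpha> - 1) = (\<bar>\<alpha>\<bar> * x / m) powr (- 1)"
    unfolding xs_def powr_powr e ..
  also have "\<dots> = m / (\<bar>\<alpha>\<bar> * x)" using p m x by (simp add: powr_minus_divide abs_mult)
  finally show ?thesis using \<alpha> x by (simp add: g1_def)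
qed

lemma xs_bounds:
  assumes "g1 b < m" "m < g1 a"
  shows "a < xs m" "xs m < b"
proof -
  have m: "m > 0" using assms V_pos by linarith
  show "a < xs m" using g1_strict[of "xs m" a] xs_pos[OF m] g1_xs[OF m] assms by (cases "xs m = a") force+
  show "xs m < b" using g1_strict[of b "xs m"] ab g1_xs[OF m] assms by (cases "xs m = b") force+
qed

lemma \<tau>_pos: "\<tau> m > 0" if "m > 0" using x xs_pos[OF that] by (simp add: \<tau>_def zero_less_mult_iff)

lemma xs_le_N:
  assumes "g1 b < m" "m < g1 a"
  shows "xs m \<le> 2 * real N" "real N / 2 \<le> xs m"
  using xs_bounds[OF assms] ab by auto

lemma xs_div_\<tau>:
  assumes "g1 b < m" "m < g1 a"
  shows "xs m / \<tau> m \<le> 2 powr (1 - \<alpha>) * (real N / T)"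
    "xs m ^ 2 / \<tau> m \<le> 2 powr (2 - \<alpha>) * (real N ^ 2 / T)"
    "w m \<le> 2 powr (1 - \<alpha>/2) * (real N / sqrt T)"
proof -
  have m: "m > 0" using assms V_pos by linarith
  have p: "xs m > 0" by (rule xs_pos[OF m])
  have gen: "xs m powr s / x \<le> 2 powr s * (real N powr (s + \<alpha>) / T)" if "s \<ge> 0" for s
  proof -
    have "xs m powr s \<le> (2 * real N) powr s"
      using that p xs_le_N[OF assms] by (intro powr_mono2) auto
    hence "xs m powr s / x \<le> (2 * real N) powr s / x" using x by (intro divide_right_mono) auto
    also have "\<dots> = 2 powr s * (real N powr (s + \<alpha>) / T)"
      using N x by (simp add: T_def powr_mult powr_add)
    finally show ?thesis .
  qed
  have "xs m / \<tau> m = xs m powr (1 - \<alpha>) / x" using p x by (simp add: \<tau>_def powr_diff)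
  thus "xs m / \<tau> m \<le> 2 powr (1 - \<alpha>) * (real N / T)" using gen[of "1 - \<alpha>"] \<alpha> N by simp
  have "xs m ^ 2 / \<tau> m = xs m powr (2 - \<alpha>) / x" using p x by (simp add: \<tau>_def powr_diff powr_numeral)
  thus "xs m ^ 2 / \<tau> m \<le> 2 powr (2 - \<alpha>) * (real N ^ 2 / T)" using gen[of "2 - \<alpha>"] \<alpha> N by (simp add: powr_numeral)
  have "(w m)^2 = xs m ^ 2 / \<tau> m" using \<tau>_pos[OF m] by (simp add: w_def power_divide)
  also have "\<dots> \<le> 2 powr (2 - \<alpha>) * (real N ^ 2 / T)" by fact
  also have "\<dots> = (2 powr (1 - \<alpha>/2) * (real N / sqrt T))^2"
  proof -
    have "(2 powr (1 - \<alpha>/2))^2 = (2::real) powr (2 - \<alpha>)"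
      by (simp add: power2_eq_square flip: powr_add)
    thus ?thesis using T_pos by (simp add: power_mult_distrib power_divide)
  qed
  finally show "w m \<le> 2 powr (1 - \<alpha>/2) * (real N / sqrt T)"
    by (rule power2_le_imp_le) (use T_pos in auto)
qed

lemma w_nonneg: "w m \<ge> 0" if "m > 0" using xs_pos[OF that] \<tau>_pos[OF that] by (simp add: w_def)

text \<open>Needed for removing the amplitudes by partial summation. Up to a constant
  \<open>w m\<close> is the power \<open>1 - \<alpha>/2 > 0\<close> of \<open>xs m\<close>, and
  \<open>xs m\<close> decreases in \<open>m\<close>.\<close>

lemma w_antimono:
  assumes "0 < m" "m \<le> m'"
  shows "w m' \<le> w m"
proof -
  have m': "m' > 0" using assms by simp
  have weq: "w m = xs m powr (1 - \<alpha>/2) / sqrt x" if "m > 0" for m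
  proof -
    have "sqrt (\<tau> m) = sqrt x * xs m powr (\<alpha>/2)"
      unfolding \<tau>_def real_sqrt_mult using xs_pos[OF that] by (simp add: powr_half_sqrt[symmetric] powr_powr)
    thus ?thesis using xs_pos[OF that] by (simp add: w_def powr_diff)
  qed
  have "xs m' \<le> xs m"
    unfolding xs_def using assms \<alpha> x by (intro powr_mono2 divide_left_mono) auto
  hence "xs m' powr (1 - \<alpha>/2) \<le> xs m powr (1 - \<alpha>/2)"
    using \<alpha> xs_pos[OF m'] by (intro powr_mono2) auto
  thus ?thesis unfolding weq[OF assms(1)] weq[OF m'] using x by (intro divide_right_mono) auto
qed

text \<open>The Legendre transform of a power is again a power; this is the origin of the dual
  exponent \<open>\<alpha> / (\<alpha> - 1)\<close>.\<close>

lemma \<theta>_eq: "m > 0 \<Longrightarrow> \<theta> m = sgn \<alpha> * (((1 - \<alpha>) * \<bar>\<alpha>\<bar> powr (\<alpha> / (1 - \<alpha>)) * x powr (1 / (1 - \<alpha>))) * m powr (\<alpha> / (\<alpha> - 1)))"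
proof -
  assume m: "m > 0"
  have e: "1 / (1 - \<alpha>) * \<alpha> = \<alpha> / (1 - \<alpha>)" by simp
  have e2: "1 + \<alpha> / (1 - \<alpha>) = 1 / (1 - \<alpha>)" "\<alpha> / (\<alpha> - 1) = - (\<alpha> / (1 - \<alpha>))" using \<alpha> by (simp_all add: field_simps)
  have "xs m powr \<alpha> = (\<bar>\<alpha>\<bar> * x / m) powr (\<alpha> / (1 - \<alpha>))" unfolding xs_def powr_powr e ..
  also have "\<dots> = \<bar>\<alpha>\<bar> powr (\<alpha> / (1 - \<alpha>)) * x powr (\<alpha> / (1 - \<alpha>)) * m powr (\<alpha> / (\<alpha> - 1))"
    unfolding e2 using x m by (simp add: powr_divide powr_mult powr_minus_divide)
  finally have "\<tau> m = \<bar>\<alpha>\<bar> powr (\<alpha> / (1 - \<alpha>)) * (x powr 1 * x powr (\<alpha> / (1 - \<alpha>))) * m powr (\<alpha> / (\<alpha> - 1))"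
    using x by (simp add: \<tau>_def mult_ac)
  also have "x powr 1 * x powr (\<alpha> / (1 - \<alpha>)) = x powr (1 / (1 - \<alpha>))"
    unfolding powr_add[symmetric] e2 ..
  finally show ?thesis by (simp add: \<theta>_def mult_ac)
qed

text \<open>The substitution \<open>y = xs m * s\<close> moves the stationary point to 1 and turns
  the phase into \<open>\<theta> m + \<tau> m * pphase \<alpha> s\<close>.\<close>

lemma integral_rescale:
  assumes "g1 b < m" "m < g1 a"
  shows "integral {a..b} (\<lambda>y. ec (g y - m * y)) = of_real (xs m) * ec (\<theta> m) * integral {a / xs m..b / xs m} (\<lambda>s. ec (\<tau> m * pphase \<alpha> s))"
proof -
  have m: "m > 0" using assms V_pos by linarith
  define X where "X = xs m"
  have X: "X > 0" by (simp add: X_def xs_pos[OF m])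
  have mX: "m * X = \<bar>\<alpha>\<bar> * \<tau> m"
  proof -
    have "m * X = \<bar>\<alpha>\<bar> * x * X powr (\<alpha> - 1) * X" using g1_xs[OF m] by (simp add: g1_def X_def)
    also have "\<dots> = \<bar>\<alpha>\<bar> * (x * (X powr (\<alpha> - 1) * X powr 1))" using X by simp
    also have "X powr (\<alpha> - 1) * X powr 1 = X powr \<alpha>" by (simp only: powr_add[symmetric]) simp
    finally show ?thesis by (simp add: \<tau>_def X_def)
  qed
  have ph: "g y - m * y = \<theta> m + \<tau> m * pphase \<alpha> (y / X)" if "y > 0" for y
  proof -
    have "g y = sgn \<alpha> * (\<tau> m * (y / X) powr \<alpha>)"
      using that X by (simp add: g_def \<tau>_def X_def[symmetric] powr_divide)
    moreover have "m * y = sgn \<alpha> * (\<tau> m * (\<alpha> * (y / X)))"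
    proof -
      have "m * y = m * X * (y / X)" using X by simp
      also have "\<dots> = (sgn \<alpha> * \<alpha>) * \<tau> m * (y / X)" unfolding mX sgn_mult ..
      finally show ?thesis by (simp only: mult_ac)
    qed
    ultimately show ?thesis unfolding pphase_def \<theta>_def by (simp add: algebra_simps)
  qed
  let ?F = "\<lambda>s. ec (\<tau> m * pphase \<alpha> s)"
  have cF: "continuous_on {a / X..b / X} ?F"
  proof -
    have "0 < s" if "s \<in> {a / X..b / X}" for s
      using order_less_le_trans[OF divide_pos_pos[OF ab(4) X]] that by auto
    thus ?thesis unfolding pphase_def by (intro continuous_intros) force
  qed
  have "((\<lambda>y. (1 / X) *\<^sub>R ?F (y / X)) has_integral integral {a / X..b / X} ?F) {a..b}"
    by (rule has_integral_substitution[where c = "a / X" and d = "b / X"])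
       (use ab X cF in \<open>auto intro!: derivative_eq_intros divide_right_mono\<close>)
  hence "integral {a..b} (\<lambda>y. of_real (1 / X) * ?F (y / X)) = integral {a / X..b / X} ?F"
    by (simp only: scaleR_conv_of_real integral_unique)
  hence sub: "integral {a..b} (\<lambda>y. ?F (y / X)) = of_real X * integral {a / X..b / X} ?F"
    using X by (simp add: field_simps)
  have "integral {a..b} (\<lambda>y. ec (g y - m * y)) = integral {a..b} (\<lambda>y. ec (\<theta> m) * ?F (y / X))"
    by (intro integral_cong) (use ab ph in \<open>auto simp: ec_add\<close>)
  also have "\<dots> = ec (\<theta> m) * integral {a..b} (\<lambda>y. ?F (y / X))" by simp
  finally show ?thesis unfolding sub by (simp add: X_def mult_ac)
qed

text \<open>The second-derivative test, uniform in \<open>m\<close>. It serves the few frequencies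
  that are too near the ends of the derivative range, or outside it, for the stationary phase error
  to be controlled.\<close>

lemma integral_bound:
  "norm (integral {a..b} (\<lambda>y. ec (g y - m * y))) \<le> 4 / sqrt (\<bar>\<alpha>\<bar> * (1 - \<alpha>) * 2 powr (\<alpha> - 2)) * (real N / sqrt T)"
proof -
  define l where "l = \<bar>\<alpha>\<bar> * (1 - \<alpha>) * 2 powr (\<alpha> - 2) * (T / real N ^ 2)"
  have l: "l > 0" using \<alpha> T_pos N by (simp add: l_def)
  have "norm (integral {a..b} (\<lambda>y. ec (g y - m * y))) \<le> 4 / sqrt l"
  proof (rule osc_integral_second_deriv[where ?q1.0 = "\<lambda>y. g1 y - m" and ?q2.0 = g2])
    fix y assume y: "y \<in> {a..b}"
    hence y0: "y > 0" using ab by auto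
    show "((\<lambda>y. g y - m * y) has_real_derivative g1 y - m) (at y)"
      using g_deriv[OF y0] by (auto intro!: derivative_eq_intros)
    show "((\<lambda>y. g1 y - m) has_real_derivative g2 y) (at y)"
      using g1_deriv[OF y0] by (auto intro!: derivative_eq_intros)
    show "g2 y \<le> - l" unfolding l_def using y ab by (intro g2_bounds) auto
  qed (use ab l g2_cont in auto)
  also have "4 / sqrt l = 4 / sqrt (\<bar>\<alpha>\<bar> * (1 - \<alpha>) * 2 powr (\<alpha> - 2)) * (real N / sqrt T)"
    unfolding l_def real_sqrt_mult real_sqrt_divide using N by simp
  finally show ?thesis .
qed

text \<open>The stationary phase error involves the distances of \<open>xs m\<close> from the end
  points \<open>a\<close> and \<open>b\<close>. The mean value theorem for \<open>g1\<close> bounds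
  them below by rescaled distances of \<open>m\<close> from \<open>g1 a\<close> and
  \<open>g1 b\<close>, whose reciprocals add up harmonically over integers \<open>m\<close>.\<close>

lemma gap_left:
  assumes "g1 b < m" "m < g1 a"
  shows "xs m ^ 2 / \<tau> m * (1 / (xs m - a)) \<le> 2 powr (2 - \<alpha>) * (\<bar>\<alpha>\<bar> * (1 - \<alpha>) * 2 powr (2 - \<alpha>)) * (1 / (g1 a - m))"
    and "xs m ^ 2 / \<tau> m * (1 / (b - xs m)) \<le> 2 powr (2 - \<alpha>) * (\<bar>\<alpha>\<bar> * (1 - \<alpha>) * 2 powr (2 - \<alpha>)) * (1 / (m - g1 b))"
proof -
  define c2 where "c2 = \<bar>\<alpha>\<bar> * (1 - \<alpha>) * 2 powr (2 - \<alpha>)"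
  have c2: "c2 > 0" using \<alpha> by (simp add: c2_def)
  have m: "m > 0" using assms V_pos by linarith
  note xb = xs_bounds[OF assms]
  have mvt: "g1 y - g1 z \<le> c2 * (T / real N ^ 2) * (z - y)" if yz: "a \<le> y" "y < z" "z \<le> b" for y z
  proof -
    have "\<exists>t>y. t < z \<and> g1 z - g1 y = (z - y) * g2 t"
      by (rule MVT2[OF yz(2)]) (use yz ab in \<open>auto intro!: g1_deriv\<close>)
    then obtain t where t: "y < t" "t < z" "g1 z - g1 y = (z - y) * g2 t" by blast
    have "- (c2 * (T / real N ^ 2)) \<le> g2 t" unfolding c2_def using t yz ab by (intro g2_bounds) auto
    hence "(z - y) * (- (c2 * (T / real N ^ 2))) \<le> (z - y) * g2 t" using yz by (intro mult_left_mono) auto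
    thus ?thesis using t by (simp add: algebra_simps)
  qed
  have key: "xs m ^ 2 / \<tau> m * (1 / d) \<le> 2 powr (2 - \<alpha>) * c2 * (1 / e)"
    if "0 < d" "0 < e" "e \<le> c2 * (T / real N ^ 2) * d" for d e
  proof -
    define k where "k = c2 * (T / real N ^ 2)"
    have "1 / d \<le> k / e" using that(1,2) that(3)[folded k_def] by (simp add: field_simps)
    hence "1 / d \<le> c2 * (T / real N ^ 2) / e" by (simp only: k_def)
    hence "xs m ^ 2 / \<tau> m * (1 / d) \<le> 2 powr (2 - \<alpha>) * (real N ^ 2 / T) * (c2 * (T / real N ^ 2) / e)"
      using xs_div_\<tau>(2)[OF assms] that T_pos \<tau>_pos[OF m] by (intro mult_mono) auto
    also have "\<dots> = 2 powr (2 - \<alpha>) * c2 * (1 / e)" using T_pos N by simp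
    finally show ?thesis .
  qed
  show "xs m ^ 2 / \<tau> m * (1 / (xs m - a)) \<le> 2 powr (2 - \<alpha>) * (\<bar>\<alpha>\<bar> * (1 - \<alpha>) * 2 powr (2 - \<alpha>)) * (1 / (g1 a - m))"
    unfolding c2_def[symmetric]
    by (rule key) (use assms xb mvt[of a "xs m"] g1_xs[OF m] in auto)
  show "xs m ^ 2 / \<tau> m * (1 / (b - xs m)) \<le> 2 powr (2 - \<alpha>) * (\<bar>\<alpha>\<bar> * (1 - \<alpha>) * 2 powr (2 - \<alpha>)) * (1 / (m - g1 b))"
    unfolding c2_def[symmetric]
    by (rule key) (use assms xb mvt[of "xs m" b] g1_xs[OF m] in auto)
qed

lemma stationary_term:
  fixes L :: complex
  assumes st: "\<And>t a b. t > 0 \<Longrightarrow> 1/4 \<le> a \<Longrightarrow> a < 1 \<Longrightarrow> 1 < b \<Longrightarrow> b \<le> 4 \<Longrightarrow>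
       norm (integral {a..b} (\<lambda>s. ec (t * pphase \<alpha> s)) - L / sqrt t) \<le> C0 / t * (1 + 1 / (1 - a) + 1 / (b - 1))"
    and C0: "C0 > 0" and m: "g1 b < m" "m < g1 a"
  shows "norm (integral {a..b} (\<lambda>y. ec (g y - m * y)) - L * (of_real (w m) * ec (\<theta> m)))
     \<le> C0 * (2 powr (1 - \<alpha>) * (real N / T) + 2 powr (2 - \<alpha>) * (\<bar>\<alpha>\<bar> * (1 - \<alpha>) * 2 powr (2 - \<alpha>)) * (1 / (g1 a - m) + 1 / (m - g1 b)))"
proof -
  have m0: "m > 0" using m V_pos by linarith
  define X where "X = xs m"
  have X: "X > 0" by (simp add: X_def xs_pos[OF m0])
  have t: "\<tau> m > 0" by (rule \<tau>_pos[OF m0])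
  note xb = xs_bounds[OF m, folded X_def]
  note xN = xs_le_N[OF m, folded X_def]
  define I where "I = integral {a / X..b / X} (\<lambda>s. ec (\<tau> m * pphase \<alpha> s))"
  have I: "norm (I - L / sqrt (\<tau> m)) \<le> C0 / \<tau> m * (1 + 1 / (1 - a / X) + 1 / (b / X - 1))"
    unfolding I_def
  proof (rule st[OF t])
    have "X \<le> 4 * a" using xN ab by linarith
    thus "1/4 \<le> a / X" using X by (simp add: field_simps)
    have "b \<le> 4 * X" using xN ab by linarith
    thus "b / X \<le> 4" using X by (simp add: field_simps)
  qed (use xb X in auto)
  have "integral {a..b} (\<lambda>y. ec (g y - m * y)) - L * (of_real (w m) * ec (\<theta> m)) = of_real X * ec (\<theta> m) * (I - L / sqrt (\<tau> m))"
    unfolding integral_rescale[OF m] I_def w_def X_def by (simp add: algebra_simps)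
  hence "norm (integral {a..b} (\<lambda>y. ec (g y - m * y)) - L * (of_real (w m) * ec (\<theta> m))) = X * norm (I - L / sqrt (\<tau> m))"
    using X by (simp add: norm_mult)
  also have "\<dots> \<le> X * (C0 / \<tau> m * (1 + 1 / (1 - a / X) + 1 / (b / X - 1)))"
    using I X by (intro mult_left_mono) auto
  also have "\<dots> = C0 * (X / \<tau> m + X ^ 2 / \<tau> m * (1 / (X - a)) + X ^ 2 / \<tau> m * (1 / (b - X)))"
  proof -
    have "1 / (1 - a / X) = X * (1 / (X - a))" "1 / (b / X - 1) = X * (1 / (b - X))"
      using X xb by (simp_all add: field_simps)
    thus ?thesis by (simp add: algebra_simps power2_eq_square)
  qed
  also have "\<dots> \<le> C0 * (2 powr (1 - \<alpha>) * (real N / T) + 2 powr (2 - \<alpha>) * (\<bar>\<alpha>\<bar> * (1 - \<alpha>) * 2 powr (2 - \<alpha>)) * (1 / (g1 a - m))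
      + 2 powr (2 - \<alpha>) * (\<bar>\<alpha>\<bar> * (1 - \<alpha>) * 2 powr (2 - \<alpha>)) * (1 / (m - g1 b)))"
    unfolding X_def using C0 by (intro mult_left_mono add_mono xs_div_\<tau> gap_left m) auto
  finally show ?thesis by (simp only: distrib_left add.assoc)
qed

end

section \<open>Assembling the B-process\<close>

lemma harm_sum_right:
  fixes p q :: int and U :: real
  assumes "of_int q + 1 \<le> U"
  shows "(\<Sum>m\<in>{p..q}. 1 / (U - of_int m)) \<le> harm (nat (q - p + 1))"
proof -
  have "(\<Sum>m\<in>{p..q}. 1 / (U - of_int m)) \<le> (\<Sum>m\<in>{p..q}. 1 / (of_int q + 1 - of_int m))"
    using assms by (intro sum_mono frac_le) auto
  also have "\<dots> = (\<Sum>j<nat (q - p + 1). inverse (real (Suc j)))"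
    by (rule sum.reindex_bij_witness[of _ "\<lambda>j. q - int j" "\<lambda>m. nat (q - m)"]) (auto simp: inverse_eq_divide)
  finally show ?thesis by (simp add: harm_altdef)
qed

lemma harm_sum_left:
  fixes p q :: int and V :: real
  assumes "V + 1 \<le> of_int p"
  shows "(\<Sum>m\<in>{p..q}. 1 / (of_int m - V)) \<le> harm (nat (q - p + 1))"
proof -
  have "(\<Sum>m\<in>{p..q}. 1 / (of_int m - V)) \<le> (\<Sum>m\<in>{p..q}. 1 / (of_int m - of_int p + 1))"
    using assms by (intro sum_mono frac_le) auto
  also have "\<dots> = (\<Sum>j<nat (q - p + 1). inverse (real (Suc j)))"
    by (rule sum.reindex_bij_witness[of _ "\<lambda>j. p + int j" "\<lambda>m. nat (m - p)"]) (auto simp: inverse_eq_divide)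
  finally show ?thesis by (simp add: harm_altdef)
qed

context power_sum
begin

text \<open>Poisson summation leaves the frequencies in the derivative range. Those at distance at
  least 1 from its ends are evaluated by stationary phase with a harmonic total error; the boundedly
  many others are estimated by the second-derivative test and cost \<open>N / sqrt T\<close>
  each.\<close>

lemma van_der_corput_B:
  fixes L :: complex
  assumes st: "\<And>t a b. t > 0 \<Longrightarrow> 1/4 \<le> a \<Longrightarrow> a < 1 \<Longrightarrow> 1 < b \<Longrightarrow> b \<le> 4 \<Longrightarrow>
       norm (integral {a..b} (\<lambda>s. ec (t * pphase \<alpha> s)) - L / sqrt t) \<le> C0 / t * (1 + 1 / (1 - a) + 1 / (b - 1))"
    and C0: "C0 > 0"
  defines "K2 \<equiv> \<bar>\<alpha>\<bar> * 2 powr (1 - \<alpha>)"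
    and "D1 \<equiv> 4 / sqrt (\<bar>\<alpha>\<bar> * (1 - \<alpha>) * 2 powr (\<alpha> - 2))"
    and "D2 \<equiv> 2 powr (1 - \<alpha>/2)"
    and "D3 \<equiv> 2 powr (2 - \<alpha>) * (\<bar>\<alpha>\<bar> * (1 - \<alpha>) * 2 powr (2 - \<alpha>))"
  shows "norm ((\<Sum>n\<in>{N..<2*N}. ec (g (real n))) - L * (\<Sum>m\<in>{nat (\<lfloor>g1 b\<rfloor> + 1)..<nat \<lceil>g1 a\<rceil>}. of_real (w (real m)) * ec (\<theta> (real m))))
    \<le> (2 + 4 * D1 + 4 * (norm L * D2) + C0 * (K2 * 2 powr (1 - \<alpha>)) + 2 * (C0 * D3)) * (1 + harm (nat \<lceil>K2 * (T / real N)\<rceil>) + real N / sqrt T)"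
proof -
  define U where "U = g1 a"
  define V where "V = g1 b"
  define n0 where "n0 = nat \<lceil>K2 * (T / real N)\<rceil>"
  define Q where "Q = real N / sqrt T"
  have Q: "Q \<ge> 0" using T_pos by (simp add: Q_def)
  have VU: "0 < V" "V < U" using V_pos g1_strict[of a b] ab by (auto simp: U_def V_def)
  have Un0: "U \<le> real n0" using U_le by (simp add: U_def n0_def K2_def) linarith
  define Tm where "Tm = (\<lambda>m::int. integral {a..b} (\<lambda>y. ec (g y - of_int m * y)))"
  define Mm where "Mm = (\<lambda>m::int. of_real (w (of_int m)) * ec (\<theta> (of_int m)))"
  \<comment> \<open>\<open>Z\<close> holds the frequencies kept by Poisson summation,
    \<open>M\<close> those strictly inside the derivative range, which carry the main term, and
    \<open>G\<close> those at distance at least 1 from both ends, where the gap terms are summable.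
    At most four elements of \<open>Z\<close> lie outside \<open>G\<close>.\<close>
  define Z where "Z = {\<lfloor>V\<rfloor>..\<lceil>U\<rceil>}"
  define M where "M = {\<lfloor>V\<rfloor>+1..\<lceil>U\<rceil>-1}"
  define G where "G = {\<lceil>V\<rceil>+1..\<lfloor>U\<rfloor>-1}"
  have Min: "V < of_int m" "of_int m < U" if "m \<in> M" for m
    using that unfolding M_def by (auto; linarith)+
  have Gin: "V + 1 \<le> of_int m" "of_int m + 1 \<le> U" if "m \<in> G" for m
    using that unfolding G_def by (auto; linarith)+
  have GM: "G \<subseteq> M" "M \<subseteq> Z" unfolding G_def M_def Z_def by (auto; linarith)+
  have fin: "finite Z" "finite M" "finite G" by (auto simp: Z_def M_def G_def)
  have cardZG: "card (Z - G) \<le> 4"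
  proof -
    have "Z - G \<subseteq> {\<lfloor>V\<rfloor>, \<lfloor>V\<rfloor>+1, \<lceil>U\<rceil>-1, \<lceil>U\<rceil>}"
    proof
      fix m assume m: "m \<in> Z - G"
      have "\<lceil>V\<rceil> \<le> \<lfloor>V\<rfloor> + 1" "\<lceil>U\<rceil> \<le> \<lfloor>U\<rfloor> + 1" by linarith+
      thus "m \<in> {\<lfloor>V\<rfloor>, \<lfloor>V\<rfloor>+1, \<lceil>U\<rceil>-1, \<lceil>U\<rceil>}" using m by (auto simp: Z_def G_def)
    qed
    hence "card (Z - G) \<le> card {\<lfloor>V\<rfloor>, \<lfloor>V\<rfloor>+1, \<lceil>U\<rceil>-1, \<lceil>U\<rceil>}" by (rule card_mono[rotated]) simp
    also have "\<dots> \<le> 4" using card_length[of "[\<lfloor>V\<rfloor>, \<lfloor>V\<rfloor>+1, \<lceil>U\<rceil>-1, \<lceil>U\<rceil>]"] by simp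
    finally show ?thesis .
  qed
  have cardMG: "card (M - G) \<le> 4"
    using card_mono[of "Z - G" "M - G"] GM fin cardZG by fastforce
  have cardG: "nat (\<lfloor>U\<rfloor> - 1 - (\<lceil>V\<rceil> + 1) + 1) \<le> n0" "real (card G) \<le> U"
    unfolding G_def using VU Un0 by (auto simp: le_nat_iff) linarith+
  have TmD: "norm (Tm m) \<le> D1 * Q" for m unfolding Tm_def D1_def Q_def by (rule integral_bound)
  have MmD: "norm (Mm m) \<le> D2 * Q" if "m \<in> M" for m
  proof -
    have "w (of_int m) \<le> D2 * Q" unfolding D2_def Q_def
      using Min[OF that] by (intro xs_div_\<tau>) (auto simp: U_def V_def)
    moreover have "w (of_int m) \<ge> 0" using Min[OF that] VU by (intro w_nonneg) linarith
    ultimately show ?thesis by (simp add: Mm_def norm_mult)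
  qed
  have poi: "norm ((\<Sum>n\<in>{N..<2*N}. ec (g (real n))) - (\<Sum>m\<in>Z. Tm m)) \<le> 2 + 2 * harm n0"
    unfolding Z_def Tm_def a_def b_def
  proof (rule truncated_poisson[where ?g1.0 = g1 and ?g2.0 = g2])
    have a': "real N - 1/2 = a" and b': "real (2 * N) - 1/2 = b" by (simp_all add: a_def b_def)
    show "(g has_real_derivative g1 y) (at y)" if "y \<in> {real N - 1/2..real (2 * N) - 1/2}" for y
      using that ab unfolding a' b' by (intro g_deriv) auto
    show "(g1 has_real_derivative g2 y) (at y)" if "y \<in> {real N - 1/2..real (2 * N) - 1/2}" for y
      using that ab unfolding a' b' by (intro g1_deriv) auto
    show "continuous_on {real N - 1/2..real (2 * N) - 1/2} g2" unfolding a' b' using ab by (intro g2_cont)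
    show "of_int \<lfloor>V\<rfloor> \<le> g1 (real (2 * N) - 1/2)" unfolding b' V_def by linarith
    show "g1 (real N - 1/2) \<le> of_int \<lceil>U\<rceil>" unfolding a' U_def by linarith
    show "g1 (real N - 1/2) - g1 (real (2 * N) - 1/2) \<le> real n0"
      unfolding a' b' using VU Un0 by (simp add: U_def V_def)
  qed (use g2_neg in auto)
  have main: "norm ((\<Sum>m\<in>Z. Tm m) - L * (\<Sum>m\<in>M. Mm m)) \<le> (4 * D1 + 4 * (norm L * D2)) * Q + C0 * (K2 * 2 powr (1 - \<alpha>)) + 2 * (C0 * D3) * harm n0"
  proof -
    have "(\<Sum>m\<in>Z. Tm m) = (\<Sum>m\<in>Z - G. Tm m) + (\<Sum>m\<in>G. Tm m)"
      using GM fin by (intro sum.subset_diff) auto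
    moreover have "(\<Sum>m\<in>M. Mm m) = (\<Sum>m\<in>M - G. Mm m) + (\<Sum>m\<in>G. Mm m)"
      using GM fin by (intro sum.subset_diff) auto
    ultimately have "(\<Sum>m\<in>Z. Tm m) - L * (\<Sum>m\<in>M. Mm m) = (\<Sum>m\<in>Z - G. Tm m) - L * (\<Sum>m\<in>M - G. Mm m) + (\<Sum>m\<in>G. Tm m - L * Mm m)"
      by (simp add: algebra_simps sum_subtractf sum_distrib_left)
    hence "norm ((\<Sum>m\<in>Z. Tm m) - L * (\<Sum>m\<in>M. Mm m)) \<le> norm (\<Sum>m\<in>Z - G. Tm m) + norm L * norm (\<Sum>m\<in>M - G. Mm m) + norm (\<Sum>m\<in>G. Tm m - L * Mm m)"
      by (smt (verit) norm_mult norm_triangle_ineq norm_triangle_ineq4)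
    also have "\<dots> \<le> 4 * (D1 * Q) + norm L * (4 * (D2 * Q)) + (C0 * (K2 * 2 powr (1 - \<alpha>)) + 2 * (C0 * D3) * harm n0)"
    proof (intro add_mono mult_left_mono)
      have D: "D1 \<ge> 0" "D2 \<ge> 0" using \<alpha> by (auto simp: D1_def D2_def)
      have "norm (\<Sum>m\<in>Z - G. Tm m) \<le> real (card (Z - G)) * (D1 * Q)" by (rule sum_norm_bound) (rule TmD)
      also have "\<dots> \<le> 4 * (D1 * Q)" using cardZG D Q by (intro mult_right_mono) auto
      finally show "norm (\<Sum>m\<in>Z - G. Tm m) \<le> 4 * (D1 * Q)" .
      have "norm (\<Sum>m\<in>M - G. Mm m) \<le> real (card (M - G)) * (D2 * Q)" by (rule sum_norm_bound) (auto intro: MmD)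
      also have "\<dots> \<le> 4 * (D2 * Q)" using cardMG D Q by (intro mult_right_mono) auto
      finally show "norm (\<Sum>m\<in>M - G. Mm m) \<le> 4 * (D2 * Q)" .
      have "norm (\<Sum>m\<in>G. Tm m - L * Mm m) \<le> (\<Sum>m\<in>G. C0 * (2 powr (1 - \<alpha>) * (real N / T) + D3 * (1 / (U - of_int m) + 1 / (of_int m - V))))"
        unfolding Tm_def Mm_def D3_def U_def V_def
        by (intro order_trans[OF norm_sum] sum_mono stationary_term[OF st C0]) (use GM Min in \<open>auto simp: U_def V_def\<close>)
      also have "\<dots> = C0 * (real (card G) * (2 powr (1 - \<alpha>) * (real N / T)) + D3 * ((\<Sum>m\<in>G. 1 / (U - of_int m)) + (\<Sum>m\<in>G. 1 / (of_int m - V))))"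
        by (simp add: sum_distrib_left[symmetric] sum.distrib)
      also have "\<dots> \<le> C0 * (K2 * (T / real N) * (2 powr (1 - \<alpha>) * (real N / T)) + D3 * (harm n0 + harm n0))"
      proof (intro mult_left_mono add_mono mult_right_mono)
        show "real (card G) \<le> K2 * (T / real N)" using cardG U_le by (simp add: U_def K2_def)
        show "0 \<le> D3" using \<alpha> by (simp add: D3_def)
        have "(\<Sum>m\<in>G. 1 / (U - of_int m)) \<le> harm (nat (\<lfloor>U\<rfloor> - 1 - (\<lceil>V\<rceil> + 1) + 1))"
          unfolding G_def by (rule harm_sum_right) simp
        also have "\<dots> \<le> harm n0" by (rule harm_mono[OF cardG(1)])
        finally show "(\<Sum>m\<in>G. 1 / (U - of_int m)) \<le> harm n0" .
        have "(\<Sum>m\<in>G. 1 / (of_int m - V)) \<le> harm (nat (\<lfloor>U\<rfloor> - 1 - (\<lceil>V\<rceil> + 1) + 1))"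
          unfolding G_def by (rule harm_sum_left) simp
        also have "\<dots> \<le> harm n0" by (rule harm_mono[OF cardG(1)])
        finally show "(\<Sum>m\<in>G. 1 / (of_int m - V)) \<le> harm n0" .
      qed (use C0 T_pos in auto)
      also have "\<dots> = C0 * (K2 * 2 powr (1 - \<alpha>)) + 2 * (C0 * D3) * harm n0"
        using T_pos N by (simp add: algebra_simps)
      finally show "norm (\<Sum>m\<in>G. Tm m - L * Mm m) \<le> C0 * (K2 * 2 powr (1 - \<alpha>)) + 2 * (C0 * D3) * harm n0" .
    qed auto
    finally show ?thesis by (simp add: algebra_simps)
  qed
  have Meq: "(\<Sum>m\<in>{nat (\<lfloor>g1 b\<rfloor> + 1)..<nat \<lceil>g1 a\<rceil>}. of_real (w (real m)) * ec (\<theta> (real m))) = (\<Sum>m\<in>M. Mm m)"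
    using VU by (intro sum.reindex_bij_witness[of _ nat int]) (auto simp: M_def Mm_def U_def V_def; linarith)+
  have "norm ((\<Sum>n\<in>{N..<2*N}. ec (g (real n))) - L * (\<Sum>m\<in>M. Mm m)) \<le> (2 + 2 * harm n0) + ((4 * D1 + 4 * (norm L * D2)) * Q + C0 * (K2 * 2 powr (1 - \<alpha>)) + 2 * (C0 * D3) * harm n0)"
    using norm_triangle_mono[OF poi main] by simp
  also have "\<dots> \<le> (2 + 4 * D1 + 4 * (norm L * D2) + C0 * (K2 * 2 powr (1 - \<alpha>)) + 2 * (C0 * D3)) * (1 + harm n0 + Q)"
  proof -
    have pos: "D1 \<ge> 0" "norm L * D2 \<ge> 0" "C0 * (K2 * 2 powr (1 - \<alpha>)) \<ge> 0" "C0 * D3 \<ge> 0"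
      using \<alpha> C0 by (auto simp: D1_def D2_def D3_def K2_def)
    define h :: real where "h = harm n0"
    have h: "h \<ge> 0" by (simp add: h_def harm_nonneg)
    have gen: "(2 + 2 * h) + ((4 * d + 4 * e) * Q + k + 2 * f * h) \<le> (2 + 4 * d + 4 * e + k + 2 * f) * (1 + h + Q)"
      if "d \<ge> 0" "e \<ge> 0" "k \<ge> 0" "f \<ge> 0" for d e k f :: real
      using that h Q by (simp add: algebra_simps add_nonneg_nonneg mult_nonneg_nonneg)
    show ?thesis using gen[OF pos(1,2,3,4)] by (simp add: h_def)
  qed
  finally show ?thesis unfolding Meq n0_def Q_def .
qed

end

text \<open>The dual sum enters only through a bound \<open>Bd\<close> for all its interval sums
  within the dual range: partial summation against \<open>w\<close> produces such sums, and their
  end points depend on \<open>x\<close>. For negative \<open>\<alpha>\<close> both sides are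
  conjugated, which leaves the norms unchanged.\<close>

lemma power_sum_reflection:
  fixes \<alpha> :: real
  assumes \<alpha>: "\<alpha> < 1" "\<alpha> \<noteq> 0"
  obtains C where "C > 0"
    "\<And>N x Bd. N \<ge> 1 \<Longrightarrow> x > 0 \<Longrightarrow>
      (\<And>p q::nat. (\<And>m. m \<in> {p..<q} \<Longrightarrow> \<bar>\<alpha>\<bar> * 2 powr (\<alpha> - 1) * (x * real N powr \<alpha> / real N) \<le> real m \<and>
             real m \<le> \<bar>\<alpha>\<bar> * 2 powr (1 - \<alpha>) * (x * real N powr \<alpha> / real N)) \<Longrightarrow>
          norm (\<Sum>m\<in>{p..<q}. ec (((1 - \<alpha>) * \<bar>\<alpha>\<bar> powr (\<alpha> / (1 - \<alpha>)) * x powr (1 / (1 - \<alpha>))) * real m powr (\<alpha> / (\<alpha> - 1)))) \<le> Bd) \<Longrightarrow>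
      norm (\<Sum>n\<in>{N..<2*N}. ec (x * real n powr \<alpha>))
        \<le> C * (1 + harm (nat \<lceil>\<bar>\<alpha>\<bar> * 2 powr (1 - \<alpha>) * (x * real N powr \<alpha> / real N)\<rceil>) + real N / sqrt (x * real N powr \<alpha>) * (1 + Bd))"
proof -
  obtain C0 :: real and L :: complex where C0: "C0 > 0"
    and st: "\<And>t a b. t > 0 \<Longrightarrow> 1/4 \<le> a \<Longrightarrow> a < 1 \<Longrightarrow> 1 < b \<Longrightarrow> b \<le> 4 \<Longrightarrow>
       norm (integral {a..b} (\<lambda>s. ec (t * pphase \<alpha> s)) - L / sqrt t) \<le> C0 / t * (1 + 1 / (1 - a) + 1 / (b - 1))"
    using power_stationary_phase[OF \<alpha>] by blast
  define C1 where "C1 = 2 + 4 * (4 / sqrt (\<bar>\<alpha>\<bar> * (1 - \<alpha>) * 2 powr (\<alpha> - 2))) + 4 * (norm L * 2 powr (1 - \<alpha>/2))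
     + C0 * (\<bar>\<alpha>\<bar> * 2 powr (1 - \<alpha>) * 2 powr (1 - \<alpha>)) + 2 * (C0 * (2 powr (2 - \<alpha>) * (\<bar>\<alpha>\<bar> * (1 - \<alpha>) * 2 powr (2 - \<alpha>))))"
  have C1: "C1 \<ge> 2" unfolding C1_def using \<alpha> C0 by (simp add: add_nonneg_nonneg)
  define C2 where "C2 = norm L * 2 powr (1 - \<alpha>/2)"
  have C2: "C2 \<ge> 0" by (simp add: C2_def)
  show thesis
  proof (rule that[of "C1 + C2"])
    show "C1 + C2 > 0" using C1 C2 by simp
    fix N :: nat and x Bd :: real
    assume N: "N \<ge> 1" and x: "x > 0"
      and H: "\<And>p q::nat. (\<And>m. m \<in> {p..<q} \<Longrightarrow> \<bar>\<alpha>\<bar> * 2 powr (\<alpha> - 1) * (x * real N powr \<alpha> / real N) \<le> real m \<and>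
             real m \<le> \<bar>\<alpha>\<bar> * 2 powr (1 - \<alpha>) * (x * real N powr \<alpha> / real N)) \<Longrightarrow>
          norm (\<Sum>m\<in>{p..<q}. ec (((1 - \<alpha>) * \<bar>\<alpha>\<bar> powr (\<alpha> / (1 - \<alpha>)) * x powr (1 / (1 - \<alpha>))) * real m powr (\<alpha> / (\<alpha> - 1)))) \<le> Bd"
    interpret power_sum \<alpha> x N by unfold_locales (use \<alpha> x N in auto)
    define u where "u = (1 - \<alpha>) * \<bar>\<alpha>\<bar> powr (\<alpha> / (1 - \<alpha>)) * x powr (1 / (1 - \<alpha>))"
    have Bd: "Bd \<ge> 0" using H[of 0 0] by simp
    have VU: "0 < g1 b" "g1 b < g1 a" using V_pos g1_strict[of a b] ab by auto
    have cj: "norm (\<Sum>i\<in>I. ec (sgn \<alpha> * f i)) = norm (\<Sum>i\<in>I. ec (f i))" for I :: "nat set" and f :: "nat \<Rightarrow> real"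
    proof (cases "\<alpha> > 0")
      case False
      hence "sgn \<alpha> = -1" using \<alpha> by simp
      hence "(\<Sum>i\<in>I. ec (sgn \<alpha> * f i)) = cnj (\<Sum>i\<in>I. ec (f i))" by (simp add: ec_minus)
      thus ?thesis by (simp only: complex_mod_cnj)
    qed simp
    define p where "p = nat (\<lfloor>g1 b\<rfloor> + 1)"
    define q where "q = nat \<lceil>g1 a\<rceil>"
    have pq: "g1 b < real m" "real m < g1 a" if "m \<in> {p..<q}" for m
      using that VU unfolding p_def q_def by (auto; linarith)+
    have part: "norm (\<Sum>m\<in>{p..<q'}. ec (\<theta> (real m))) \<le> Bd" if "q' \<le> q" for q'
    proof -
      have "(\<Sum>m\<in>{p..<q'}. ec (\<theta> (real m))) = (\<Sum>m\<in>{p..<q'}. ec (sgn \<alpha> * (u * real m powr (\<alpha> / (\<alpha> - 1)))))"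
        using that pq VU by (intro sum.cong refl) (subst \<theta>_eq, force simp: u_def, simp add: u_def)
      hence "norm (\<Sum>m\<in>{p..<q'}. ec (\<theta> (real m))) = norm (\<Sum>m\<in>{p..<q'}. ec (u * real m powr (\<alpha> / (\<alpha> - 1))))"
        by (simp only: cj)
      also have "\<dots> \<le> Bd"
        unfolding u_def
      proof (rule H)
        fix m assume "m \<in> {p..<q'}"
        hence "m \<in> {p..<q}" using that by auto
        from pq[OF this] show "\<bar>\<alpha>\<bar> * 2 powr (\<alpha> - 1) * (x * real N powr \<alpha> / real N) \<le> real m \<and> real m \<le> \<bar>\<alpha>\<bar> * 2 powr (1 - \<alpha>) * (x * real N powr \<alpha> / real N)"
          using U_le V_ge by (auto simp: T_def)
      qed
      finally show ?thesis .
    qed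
    define Q where "Q = real N / sqrt T"
    have Q: "Q \<ge> 0" using T_pos by (simp add: Q_def)
    have S: "norm (\<Sum>m\<in>{p..<q}. of_real (w (real m)) * ec (\<theta> (real m))) \<le> 2 powr (1 - \<alpha>/2) * Q * Bd"
    proof (cases "p < q")
      case False
      thus ?thesis using Q Bd by simp
    next
      case True
      have sh: "(\<Sum>m\<in>{p..<p+k}. f m) = (\<Sum>i<k. f (p + i))" for f :: "nat \<Rightarrow> complex" and k
        using sum.shift_bounds_nat_ivl[of f 0 p k] by (simp add: lessThan_atLeast0 add.commute)
      have "norm (\<Sum>i<q-p. w (real (p + i)) *\<^sub>R ec (\<theta> (real (p + i)))) \<le> w (real (p + 0)) * Bd"
      proof (rule abel_summation_bound)
        show "norm (\<Sum>i<m. ec (\<theta> (real (p + i)))) \<le> Bd" if "m \<le> q - p" for m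
          using part[of "p + m"] that True unfolding sh by simp
        have p0: "real p > 0" using pq[of p] VU True by auto
        show "w (real (p + Suc i)) \<le> w (real (p + i))" for i using p0 by (intro w_antimono) auto
        show "0 \<le> w (real (p + i))" for i using p0 by (intro w_nonneg) auto
      qed (use True in auto)
      also have "\<dots> \<le> (2 powr (1 - \<alpha>/2) * Q) * Bd"
      proof -
        have "w (real p) \<le> 2 powr (1 - \<alpha>/2) * (real N / sqrt T)"
          by (rule xs_div_\<tau>(3)) (use pq[of p] True in auto)
        from mult_right_mono[OF this Bd] show ?thesis by (simp only: Q_def add_0_right)
      qed
      finally show ?thesis using sh[of "\<lambda>m. of_real (w (real m)) * ec (\<theta> (real m))" "q - p"] True by (simp add: scaleR_conv_of_real)
    qed
    define h where "h = (harm (nat \<lceil>\<bar>\<alpha>\<bar> * 2 powr (1 - \<alpha>) * (T / real N)\<rceil>) :: real)"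
    have h: "h \<ge> 0" by (simp add: h_def harm_nonneg)
    have "norm (\<Sum>n\<in>{N..<2*N}. ec (x * real n powr \<alpha>)) = norm (\<Sum>n\<in>{N..<2*N}. ec (g (real n)))"
      using cj[of "\<lambda>n. x * real n powr \<alpha>" "{N..<2*N}"] by (simp add: g_def mult.assoc)
    also have "\<dots> \<le> norm ((\<Sum>n\<in>{N..<2*N}. ec (g (real n))) - L * (\<Sum>m\<in>{p..<q}. of_real (w (real m)) * ec (\<theta> (real m)))) + norm L * norm (\<Sum>m\<in>{p..<q}. of_real (w (real m)) * ec (\<theta> (real m)))"
    proof -
      have "norm A \<le> norm (A - L * B) + norm L * norm B" for A B :: complex
        using norm_triangle_sub[of A "L * B"] by (simp add: norm_mult add.commute)
      thus ?thesis .
    qed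
    also have "\<dots> \<le> C1 * (1 + h + Q) + norm L * (2 powr (1 - \<alpha>/2) * Q * Bd)"
      unfolding C1_def h_def Q_def p_def q_def
      by (intro add_mono van_der_corput_B[OF st C0] mult_left_mono S[unfolded Q_def p_def q_def]) auto
    also have "\<dots> = C1 * (1 + h + Q) + C2 * (Q * Bd)" by (simp add: C2_def)
    also have "\<dots> \<le> (C1 + C2) * (1 + h + Q * (1 + Bd))"
      using C1 C2 h Q Bd by (simp add: algebra_simps add_nonneg_nonneg mult_nonneg_nonneg)
    finally show "norm (\<Sum>n\<in>{N..<2*N}. ec (x * real n powr \<alpha>))
        \<le> (C1 + C2) * (1 + harm (nat \<lceil>\<bar>\<alpha>\<bar> * 2 powr (1 - \<alpha>) * (x * real N powr \<alpha> / real N)\<rceil>) + real N / sqrt (x * real N powr \<alpha>) * (1 + Bd))"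
      by (simp only: h_def Q_def T_def)
  qed
qed

section \<open>The energy bound for powers\<close>

text \<open>The double sum of the Rademacher-Menshov inequality for the block from
  \<open>2^l\<close> to \<open>2^(l+1)\<close>. Up to powers of \<open>l + 1\<close> it dominates
  every interval sum inside the block, and it is a continuous function of \<open>u\<close> free of
  end points.\<close>

definition rm_sum :: "real \<Rightarrow> nat \<Rightarrow> real \<Rightarrow> real" where
  "rm_sum \<beta> l u = (\<Sum>j\<le>l. \<Sum>k<2^(l-j). norm (\<Sum>i\<in>{k*2^j..<(k+1)*2^j}. ec (u * real (i + 2^l) powr \<beta>)) ^ 4)"

lemma rm_sum_nonneg: "rm_sum \<beta> l u \<ge> 0"
  unfolding rm_sum_def by (intro sum_nonneg) auto

lemma continuous_on_rm_sum: "continuous_on S (rm_sum \<beta> l)"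
  unfolding rm_sum_def[abs_def] by (intro continuous_intros)

lemma power4_diff_le:
  fixes a b :: complex
  shows "norm (a - b) ^ 4 \<le> 8 * (norm a ^ 4 + norm b ^ 4)"
proof -
  have "norm (a - b) ^ 4 \<le> (norm a + norm b) ^ 4" by (intro power_mono norm_triangle_ineq4) auto
  also have "\<dots> = (\<Sum>i\<in>{False,True}. (if i then norm a else norm b)) ^ 4" by (simp add: add.commute)
  also have "\<dots> \<le> real (card {False,True}) ^ 3 * (\<Sum>i\<in>{False,True}. (if i then norm a else norm b) ^ 4)"
    by (rule sum_power4_le) simp
  also have "\<dots> = 8 * (norm a ^ 4 + norm b ^ 4)" by simp
  finally show ?thesis .
qed

text \<open>An interval sum is a difference of two initial sums: the fourth power of a difference
  costs the factor \<open>8\<close>, and the two majorants make \<open>16\<close>.\<close>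

lemma interval_sum_in_block:
  assumes "2 ^ l \<le> p" "p \<le> q" "q \<le> 2 ^ (l + 1)"
  shows "norm (\<Sum>m\<in>{p..<q}. ec (u * real m powr \<beta>)) ^ 4 \<le> 16 * real (l + 1) ^ 3 * rm_sum \<beta> l u"
proof -
  define z where "z = (\<lambda>i. ec (u * real (i + 2^l) powr \<beta>))"
  define p' where "p' = p - 2^l"
  define q' where "q' = q - 2^l"
  have pq: "p = p' + 2^l" "q = q' + 2^l" "p' \<le> q'" "q' \<le> 2^l" using assms by (auto simp: p'_def q'_def)
  have "(\<Sum>m\<in>{p..<q}. ec (u * real m powr \<beta>)) = (\<Sum>i\<in>{p'..<q'}. z i)"
    unfolding pq z_def by (rule sum.shift_bounds_nat_ivl)
  also have "\<dots> = (\<Sum>i<q'. z i) - (\<Sum>i<p'. z i)"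
    using sum.atLeastLessThan_concat[of 0 p' q' z] pq by (simp add: lessThan_atLeast0 algebra_simps)
  finally have "norm (\<Sum>m\<in>{p..<q}. ec (u * real m powr \<beta>)) ^ 4 \<le> 8 * (norm (\<Sum>i<q'. z i) ^ 4 + norm (\<Sum>i<p'. z i) ^ 4)"
    by (simp only: power4_diff_le)
  also have "\<dots> \<le> 8 * (real (l + 1) ^ 3 * rm_sum \<beta> l u + real (l + 1) ^ 3 * rm_sum \<beta> l u)"
    unfolding rm_sum_def z_def using pq by (intro mult_left_mono add_mono rademacher_menshov) auto
  also have "\<dots> = 16 * real (l + 1) ^ 3 * rm_sum \<beta> l u"
  proof -
    have "8 * (y + y) = 16 * y" for y :: real by simp
    thus ?thesis by (simp only: mult.assoc)
  qed
  finally show ?thesis .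
qed

lemma interval_sum_blocks:
  assumes fin: "finite Ls" and cov: "\<And>m. m \<in> {p..<q} \<Longrightarrow> \<exists>l\<in>Ls. 2^l \<le> m \<and> m < 2^(l+1)"
  shows "norm (\<Sum>m\<in>{p..<q}. ec (u * real m powr \<beta>)) ^ 4
     \<le> real (card Ls) ^ 3 * (\<Sum>l\<in>Ls. 16 * real (l + 1) ^ 3 * rm_sum \<beta> l u)"
proof -
  define B where "B = (\<lambda>l. {p..<q} \<inter> {2^l..<2^(l+1)})"
  have disj: "B l \<inter> B l' = {}" if "l \<noteq> l'" for l l'
  proof -
    have nn: "\<not> (2^l \<le> m \<and> m < 2^(l+1) \<and> 2^l' \<le> m \<and> m < 2^(l'+1))" for m :: nat
    proof
      assume H: "2^l \<le> m \<and> m < 2^(l+1) \<and> 2^l' \<le> m \<and> m < 2^(l'+1)"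
      have "(2::nat)^l < 2^(l'+1)" "(2::nat)^l' < 2^(l+1)" using H by auto
      hence "l < l' + 1" "l' < l + 1" by (auto simp only: power_strict_increasing_iff one_less_numeral_iff semiring_norm)
      thus False using that by simp
    qed
    show ?thesis
    proof (rule equals0I)
      fix m assume "m \<in> B l \<inter> B l'"
      thus False using nn[of m] by (simp add: B_def)
    qed
  qed
  have U: "{p..<q} = (\<Union>l\<in>Ls. B l)" using cov by (fastforce simp: B_def)
  have "(\<Sum>m\<in>{p..<q}. ec (u * real m powr \<beta>)) = (\<Sum>l\<in>Ls. \<Sum>m\<in>B l. ec (u * real m powr \<beta>))"
    unfolding U using fin disj by (intro sum.UNION_disjoint) (auto simp: B_def)
  hence "norm (\<Sum>m\<in>{p..<q}. ec (u * real m powr \<beta>)) ^ 4 \<le> (\<Sum>l\<in>Ls. norm (\<Sum>m\<in>B l. ec (u * real m powr \<beta>))) ^ 4"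
    by (intro power_mono) (auto intro: norm_sum)
  also have "\<dots> \<le> real (card Ls) ^ 3 * (\<Sum>l\<in>Ls. norm (\<Sum>m\<in>B l. ec (u * real m powr \<beta>)) ^ 4)"
    by (rule sum_power4_le[OF fin])
  also have "\<dots> \<le> real (card Ls) ^ 3 * (\<Sum>l\<in>Ls. 16 * real (l + 1) ^ 3 * rm_sum \<beta> l u)"
  proof (intro mult_left_mono sum_mono)
    fix l assume "l \<in> Ls"
    define p' where "p' = max p (2^l)"
    define q' where "q' = max p' (min q (2^(l+1)))"
    show "norm (\<Sum>m\<in>B l. ec (u * real m powr \<beta>)) ^ 4 \<le> 16 * real (l + 1) ^ 3 * rm_sum \<beta> l u"
    proof (cases "p' \<le> 2^(l+1)")
      case True
      have "B l = {p'..<q'}" by (auto simp: B_def p'_def q'_def)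
      thus ?thesis using interval_sum_in_block[of l p' q' u \<beta>] True by (simp add: p'_def q'_def)
    next
      case False
      hence "B l = {}" by (auto simp: B_def p'_def)
      thus ?thesis using rm_sum_nonneg[of \<beta> l u] by simp
    qed
  qed auto
  finally show ?thesis .
qed

text \<open>On each level \<open>j\<close> the blocks are disjoint, so their energies add up to at
  most that of the full block; the \<open>l + 1\<close> levels give the logarithmic factor.\<close>

lemma rm_sum_window:
  assumes Y: "Y > 0"
  shows "integral {Y0..Y0+Y} (rm_sum \<beta> l) \<le> 4 * Y * real (l + 1) * quad_energy (\<lambda>m. real m powr \<beta>) {2^l..<2^(l+1)} Y"
proof -
  define \<phi> where "\<phi> = (\<lambda>m::nat. real m powr \<beta>)"
  define Bk where "Bk = (\<lambda>j k. {k*2^j + 2^l..<(k+1)*2^j + 2^l :: nat})"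
  have blk: "(\<Sum>i\<in>{k*2^j..<(k+1)*2^j}. ec (u * real (i + 2^l) powr \<beta>)) = (\<Sum>m\<in>Bk j k. 1 * ec (u * \<phi> m))" for j k u
    unfolding Bk_def \<phi>_def mult_1 by (rule sum.shift_bounds_nat_ivl[symmetric])
  have "integral {Y0..Y0+Y} (rm_sum \<beta> l) = (\<Sum>j\<le>l. \<Sum>k<2^(l-j). integral {Y0..Y0+Y} (\<lambda>u. norm (\<Sum>m\<in>Bk j k. 1 * ec (u * \<phi> m)) ^ 4))"
    unfolding rm_sum_def[abs_def] blk
    by (simp add: integral_sum integrable_sum integrable_continuous_real continuous_intros)
  also have "\<dots> \<le> (\<Sum>j\<le>l. \<Sum>k<2^(l-j). 4 * Y * 1 ^ 4 * quad_energy \<phi> (Bk j k) Y)"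
    by (intro sum_mono fourth_moment_window Y) auto
  also have "\<dots> = 4 * Y * (\<Sum>j\<le>l. \<Sum>k<2^(l-j). quad_energy \<phi> (Bk j k) Y)"
    by (simp add: sum_distrib_left)
  also have "\<dots> \<le> 4 * Y * (\<Sum>j\<le>l. quad_energy \<phi> {2^l..<2^(l+1)} Y)"
  proof (intro mult_left_mono sum_mono quad_energy_disjoint_family)
    fix j k assume jk: "j \<in> {..l}" "k \<in> {..<(2::nat)^(l-j)}"
    have "(k + 1) * 2^j \<le> 2^(l-j) * (2::nat)^j" using jk by (intro mult_right_mono) auto
    also have "\<dots> = 2^l" using jk by (simp flip: power_add)
    finally show "Bk j k \<subseteq> {2^l..<2^(l+1)}" by (auto simp: Bk_def)
  next
    fix j k k' :: nat assume "k \<noteq> k'"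
    have "(k + 1) * 2^j \<le> k' * (2::nat)^j \<or> (k' + 1) * 2^j \<le> k * (2::nat)^j"
      using \<open>k \<noteq> k'\<close> by (cases "k < k'") (auto intro!: mult_right_mono simp del: mult_Suc)
    thus "Bk j k \<inter> Bk j k' = {}" by (auto simp: Bk_def)
  qed (use Y in auto)
  finally show ?thesis by (simp add: \<phi>_def algebra_simps)
qed

section \<open>Fourth moments over dyadic ranges of the parameter\<close>

lemma integral_power_substitution:
  fixes \<Psi> :: "real \<Rightarrow> real" and c s x0 :: real
  assumes \<Psi>: "continuous_on UNIV \<Psi>" and pos: "\<And>u. \<Psi> u \<ge> 0" and c: "c > 0" and s: "s > 0" and x0: "x0 > 0"
  shows "integral {x0..2*x0} (\<lambda>x. \<Psi> (c * x powr s)) \<le> 2 * x0 / (s * (c * x0 powr s)) * integral {c * x0 powr s..c * (2*x0) powr s} \<Psi>"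
proof -
  define u where "u = (\<lambda>x. c * x powr s)"
  define u1 where "u1 = (\<lambda>x. s * u x / x)"
  have u0: "u x0 > 0" using c x0 by (simp add: u_def)
  have mono: "u x \<le> u y" if "0 < x" "x \<le> y" for x y
    unfolding u_def using that c s by (intro mult_left_mono powr_mono2) auto
  have d: "(u has_real_derivative u1 x) (at x within {x0..2*x0})" if "x \<in> {x0..2*x0}" for x
  proof -
    have "x > 0" using that x0 by auto
    hence "(u has_real_derivative (c * (s * x powr (s - 1)))) (at x)"
      unfolding u_def by (auto intro!: derivative_eq_intros)
    moreover have "c * (s * x powr (s - 1)) = u1 x" using \<open>x > 0\<close> by (simp add: u1_def u_def powr_diff)
    ultimately show ?thesis by (metis has_field_derivative_at_within)
  qed
  have S: "((\<lambda>x. u1 x *\<^sub>R \<Psi> (u x)) has_integral (integral {u x0..u (2*x0)} \<Psi>)) {x0..2*x0}"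
    by (rule has_integral_substitution[where c = "u x0" and d = "u (2*x0)"])
       (use x0 mono d in \<open>auto intro: continuous_on_subset[OF \<Psi>]\<close>)
  have ge: "s * u x0 / (2 * x0) \<le> u1 x" if "x \<in> {x0..2*x0}" for x
    unfolding u1_def using that x0 s u0 mono[of x0 x] by (intro frac_le mult_left_mono) auto
  have cu: "continuous_on {x0..2*x0} (\<lambda>x. \<Psi> (u x))"
    using x0 unfolding u_def by (intro continuous_on_compose2[OF \<Psi>] continuous_intros) auto
  have "s * u x0 / (2 * x0) * integral {x0..2*x0} (\<lambda>x. \<Psi> (u x)) = integral {x0..2*x0} (\<lambda>x. s * u x0 / (2 * x0) * \<Psi> (u x))"
    by simp
  also have "\<dots> \<le> integral {u x0..u (2*x0)} \<Psi>"
  proof (rule has_integral_le[OF integrable_integral S])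
    show "(\<lambda>x. s * u x0 / (2 * x0) * \<Psi> (u x)) integrable_on {x0..2*x0}"
      by (intro integrable_continuous_real continuous_intros cu)
    show "s * u x0 / (2 * x0) * \<Psi> (u x) \<le> u1 x *\<^sub>R \<Psi> (u x)" if "x \<in> {x0..2*x0}" for x
      using mult_right_mono[OF ge[OF that] pos[of "u x"]] by simp
  qed
  finally have "s * u x0 / (2 * x0) * integral {x0..2*x0} (\<lambda>x. \<Psi> (u x)) \<le> integral {u x0..u (2*x0)} \<Psi>" .
  hence "2 * x0 / (s * u x0) * (s * u x0 / (2 * x0) * integral {x0..2*x0} (\<lambda>x. \<Psi> (u x))) \<le> 2 * x0 / (s * u x0) * integral {u x0..u (2*x0)} \<Psi>"
    using x0 s u0 by (intro mult_left_mono) auto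
  moreover have "2 * x0 / (s * u x0) * (s * u x0 / (2 * x0) * I) = I" for I
    using x0 s u0 by (simp add: field_simps)
  ultimately show ?thesis by (simp only: u_def)
qed

text \<open>With \<open>M = 2^l\<close>, the powers have size \<open>M powr \<beta>\<close>, so this
  scale is a relative tolerance \<open>M powr (-2)\<close>. It is the balance point: among
  \<open>M^4\<close> quadruples, about \<open>M^2\<close> are expected to satisfy such a condition
  by chance, as many as on the diagonal.\<close>

definition block_energy :: "real \<Rightarrow> nat \<Rightarrow> real" where
  "block_energy \<beta> l = quad_energy (\<lambda>m. real m powr \<beta>) {2^l..<2^(l+1)} ((2^l) powr (2 - \<beta>))"

lemma block_energy_nonneg: "block_energy \<beta> l \<ge> 0"
  unfolding block_energy_def by (rule quad_energy_nonneg)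

lemma harm_le_ln: "n > 0 \<Longrightarrow> harm n \<le> 1 + ln (real n)"
  using euler_mascheroni_sequence_decreasing[of 1 n] by (simp add: harm_expand)

text \<open>On this range \<open>x * n powr \<alpha>\<close> has size about \<open>T = 2^i\<close>,
  and the dual sum has length about \<open>T / N\<close>; \<open>Ls\<close> collects the dyadic
  levels it can meet. The condition \<open>T \<le> N^2\<close> keeps the dual length at most of
  order \<open>N\<close>, which makes the window of the dual parameter at least a constant times the
  scale in \<open>block_energy\<close>.\<close>

lemma dyadic_fourth_moment:
  fixes \<alpha> :: real
  assumes \<alpha>: "\<alpha> < 1" "\<alpha> \<noteq> 0"
  defines "\<beta> \<equiv> \<alpha> / (\<alpha> - 1)" and "K1 \<equiv> \<bar>\<alpha>\<bar> * 2 powr (\<alpha> - 1)" and "K2 \<equiv> \<bar>\<alpha>\<bar> * 2 powr (1 - \<alpha>)"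
  obtains C where "C > 0"
    "\<And>j i Ls. 2^i \<le> (2::real)^(2*j) \<Longrightarrow> finite Ls \<Longrightarrow>
       (\<And>l. l \<in> Ls \<longleftrightarrow> 2^l * 2^j \<le> 2 * K2 * 2^i \<and> K1 * 2^i \<le> 2 * 2^l * 2^j) \<Longrightarrow>
       integral {2^i * (2^j) powr (- \<alpha>)..2 * (2^i * (2^j) powr (- \<alpha>))} (\<lambda>x. norm (\<Sum>n\<in>{2^j..<2^(j+1)}. ec (x * real n powr \<alpha>)) ^ 4)
        \<le> C * (2^i * (2^j) powr (- \<alpha>)) * (real (1 + j) ^ 4 + 2^(4*j) / 4^i
            + 2^(4*j) / 4^i * real (card Ls) ^ 3 * (\<Sum>l\<in>Ls. real (l + 1) ^ 4 * block_energy \<beta> l))"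
proof (rule power_sum_reflection[OF \<alpha>, folded K1_def K2_def \<beta>_def])
  fix C0 :: real
  assume C0: "C0 > 0" and refl:
    "\<And>N x Bd. N \<ge> 1 \<Longrightarrow> x > 0 \<Longrightarrow>
      (\<And>p q::nat. (\<And>m. m \<in> {p..<q} \<Longrightarrow> K1 * (x * real N powr \<alpha> / real N) \<le> real m \<and>
             real m \<le> K2 * (x * real N powr \<alpha> / real N)) \<Longrightarrow>
          norm (\<Sum>m\<in>{p..<q}. ec (((1 - \<alpha>) * \<bar>\<alpha>\<bar> powr (\<alpha> / (1 - \<alpha>)) * x powr (1 / (1 - \<alpha>))) * real m powr \<beta>)) \<le> Bd) \<Longrightarrow>
      norm (\<Sum>n\<in>{N..<2*N}. ec (x * real n powr \<alpha>))
        \<le> C0 * (1 + harm (nat \<lceil>K2 * (x * real N powr \<alpha> / real N)\<rceil>) + real N / sqrt (x * real N powr \<alpha>) * (1 + Bd))"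
  define s where "s = 1 / (1 - \<alpha>)"
  have s: "s > 0" using \<alpha> by (simp add: s_def)
  define cu where "cu = (1 - \<alpha>) * \<bar>\<alpha>\<bar> powr (\<alpha> / (1 - \<alpha>))"
  have cu: "cu > 0" using \<alpha> by (simp add: cu_def)
  have K: "K1 > 0" "K2 > 0" using \<alpha> by (auto simp: K1_def K2_def)
  have b2: "2 - \<beta> = 1 + s" using \<alpha> by (simp add: \<beta>_def s_def field_simps)
  define cY where "cY = 2 powr s - 1"
  have cY: "cY > 0" using s by (simp add: cY_def)
  \<comment> \<open>A lower bound for the dual window \<open>Y\<close> divided by the scale
    \<open>X'\<close> of \<open>block_energy\<close>, uniform because
    \<open>T / N \<le> N\<close>.\<close>
  define c5 where "c5 = cY * cu / (2 * K2) powr (1 + s)"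
  have c5: "c5 > 0" using cY cu K by (simp add: c5_def)
  define C6 where "C6 = max 1 (1 / c5^2)"
  define H3 where "H3 = 2 + ln (2 * K2 + 1) + ln 2"
  have H3: "H3 \<ge> 1" using K by (simp add: H3_def add_nonneg_nonneg)
  define D where "D = 2 / s * cY * 4 * 16 * C6"
  have "C6 \<ge> 1" by (simp add: C6_def)
  hence D: "D > 0" using s cY by (simp add: D_def)
  define C where "C = C0 ^ 4 * 64 * (1 + H3 ^ 4 + D)"
  have Cpos: "C > 0" using C0 H3 D by (simp add: C_def add_nonneg_pos)
  show thesis
  proof (rule that[OF Cpos])
    fix j i :: nat and Ls :: "nat set"
    assume ij: "2^i \<le> (2::real)^(2*j)" and fin: "finite Ls"
      and Ls: "\<And>l. l \<in> Ls \<longleftrightarrow> 2^l * 2^j \<le> 2 * K2 * 2^i \<and> K1 * 2^i \<le> 2 * 2^l * (2::real)^j"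
    define N where "N = (2::nat)^j"
    have N: "N \<ge> 1" "real N = 2^j" "real N > 0" by (auto simp: N_def)
    define T where "T = (2::real)^i"
    have T: "T \<ge> 1" "T \<le> real N ^ 2" using ij by (auto simp: T_def N power_mult[symmetric] mult.commute)
    define x0 where "x0 = T * real N powr (- \<alpha>)"
    have x0: "x0 > 0" using T N by (simp add: x0_def)
    have x0T: "x0 * real N powr \<alpha> = T" using N by (simp add: x0_def powr_minus)
    define F where "F = (\<lambda>x. norm (\<Sum>n\<in>{2^j..<2^(j+1)}. ec (x * real n powr \<alpha>)))"
    \<comment> \<open>Dominates the fourth power of every admissible dual interval sum whatever its
      end points, and will depend on \<open>x\<close> only through
      \<open>u = cu * x powr s\<close>.\<close>
    define \<Psi> where "\<Psi> = (\<lambda>u. real (card Ls) ^ 3 * (\<Sum>l\<in>Ls. 16 * real (l + 1) ^ 3 * rm_sum \<beta> l u))"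
    have \<Psi>0: "\<Psi> u \<ge> 0" for u unfolding \<Psi>_def using rm_sum_nonneg by (intro mult_nonneg_nonneg sum_nonneg) auto
    have c\<Psi>: "continuous_on S \<Psi>" for S unfolding \<Psi>_def by (intro continuous_intros continuous_on_rm_sum)
    define Q4 where "Q4 = 2^(4*j) / (4::real)^i"
    have Q4: "Q4 = (real N / sqrt T) ^ 4" 
    proof -
      have "sqrt T ^ 4 = T ^ 2" using T by (simp add: power4_eq_xxxx power2_eq_square)
      moreover have "T ^ 2 = 4 ^ i" by (simp add: T_def power_mult[symmetric] power2_eq_square flip: power_mult_distrib)
      moreover have "real N ^ 4 = 2 ^ (4 * j)" by (simp add: N power_mult[symmetric] mult.commute)
      ultimately show ?thesis by (simp add: Q4_def power_divide)
    qed
    have pw: "F x ^ 4 \<le> C0 ^ 4 * 64 * (1 + (H3 * real (1 + j)) ^ 4 + Q4 + Q4 * \<Psi> (cu * x powr s))"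
      if x: "x \<in> {x0..2*x0}" for x
    proof -
      have xp: "x > 0" using x x0 by auto
      define t where "t = x * real N powr \<alpha>"
      have t: "T \<le> t" "t \<le> 2 * T"
        using x mult_right_mono[of x0 x "real N powr \<alpha>"] mult_right_mono[of x "2 * x0" "real N powr \<alpha>"] x0T by (auto simp: t_def)
      define Bd where "Bd = root 4 (\<Psi> (cu * x powr s))"
      have Bd: "Bd \<ge> 0" "Bd ^ 4 = \<Psi> (cu * x powr s)" using \<Psi>0 by (auto simp: Bd_def)
      define h where "h = (harm (nat \<lceil>K2 * (t / real N)\<rceil>) :: real)"
      have h0: "h \<ge> 0" by (simp add: h_def harm_nonneg)
      have h: "h \<le> H3 * real (1 + j)"
      proof -
        define n where "n = nat \<lceil>K2 * (t / real N)\<rceil>"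
        have kp: "K2 * (t / real N) > 0" using K t T N by simp
        have n0: "n > 0" using kp by (simp add: n_def)
        have "t / real N \<le> 2 * real N" using t T N by (simp add: divide_le_eq power2_eq_square)
        hence "K2 * (t / real N) \<le> K2 * (2 * real N)" using K by (intro mult_left_mono) auto
        hence "real n \<le> K2 * (2 * real N) + 1" unfolding n_def using kp by linarith
        also have "\<dots> \<le> (2 * K2 + 1) * 2^j" using N K by (simp add: algebra_simps)
        finally have "ln (real n) \<le> ln ((2 * K2 + 1) * 2^j)" using n0 K by simp
        also have "\<dots> = ln (2 * K2 + 1) + real j * ln 2" using K by (simp add: ln_mult ln_realpow)
        finally have "h \<le> 1 + ln (2 * K2 + 1) + real j * ln 2"
          using harm_le_ln[OF n0] by (simp add: h_def n_def)
        also have "\<dots> \<le> H3 * real (1 + j)"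
        proof -
          have "0 \<le> real j * (2 + ln (2 * K2 + 1))" using K by (intro mult_nonneg_nonneg) auto
          moreover have "ln 2 \<ge> (0::real)" by simp
          ultimately show ?thesis by (simp add: H3_def algebra_simps)
        qed
        finally show ?thesis .
      qed
      define Q where "Q = real N / sqrt t"
      have Q: "Q \<ge> 0" "Q ^ 4 \<le> Q4"
        unfolding Q4 Q_def using t T N by (auto intro!: power_mono divide_left_mono mult_pos_pos)
      have "F x \<le> C0 * (1 + h + Q * (1 + Bd))"
        unfolding F_def h_def Q_def t_def
      proof -
        have "norm (\<Sum>n\<in>{N..<2*N}. ec (x * real n powr \<alpha>)) \<le> C0 * (1 + harm (nat \<lceil>K2 * (x * real N powr \<alpha> / real N)\<rceil>) + real N / sqrt (x * real N powr \<alpha>) * (1 + Bd))"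
        proof (rule refl[OF N(1) xp])
          fix p q :: nat
          assume H: "\<And>m. m \<in> {p..<q} \<Longrightarrow> K1 * (x * real N powr \<alpha> / real N) \<le> real m \<and> real m \<le> K2 * (x * real N powr \<alpha> / real N)"
          have "norm (\<Sum>m\<in>{p..<q}. ec ((cu * x powr s) * real m powr \<beta>)) ^ 4 \<le> \<Psi> (cu * x powr s)"
            unfolding \<Psi>_def
          proof (rule interval_sum_blocks[OF fin])
            fix m assume "m \<in> {p..<q}"
            from H[OF this, folded t_def] have m: "K1 * (t / real N) \<le> real m" "real m \<le> K2 * (t / real N)" by auto
            have "K1 * (t / real N) > 0" using K t T N by simp
            hence m0: "m > 0" using m by (cases m) auto
            define l where "l = floor_log m"
            have l: "2^l \<le> m" "m < 2^(l+1)" using m0 floor_log_exp2_le[of m] floor_log_exp2_gt[of m] by (auto simp: l_def)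
            have l': "2^l \<le> real m" "real m < 2 * 2^l" using l by (metis of_nat_le_iff of_nat_power of_nat_numeral) (use l in \<open>simp flip: of_nat_less_iff[where 'a = real]\<close>)
            have "2^l \<le> K2 * (t / real N)" using l' m by linarith
            also have "\<dots> \<le> K2 * (2 * T / real N)" using K t N by (intro mult_left_mono divide_right_mono) auto
            finally have 1: "2^l * 2^j \<le> 2 * K2 * 2^i" using N by (simp add: T_def field_simps)
            have "K1 * (T / real N) \<le> K1 * (t / real N)" using K t N by (intro mult_left_mono divide_right_mono) auto
            hence "K1 * (T / real N) \<le> 2 * 2^l" using l' m by linarith
            hence 2: "K1 * 2^i \<le> 2 * 2^l * 2^j" using N by (simp add: T_def field_simps)
            show "\<exists>l\<in>Ls. 2^l \<le> m \<and> m < 2^(l+1)" using 1 2 l Ls by blast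
          qed
          hence "norm (\<Sum>m\<in>{p..<q}. ec ((cu * x powr s) * real m powr \<beta>)) ^ 4 \<le> Bd ^ 4" by (simp only: Bd)
          hence "norm (\<Sum>m\<in>{p..<q}. ec ((cu * x powr s) * real m powr \<beta>)) \<le> Bd"
            using Bd(1) by (simp add: power_mono_iff)
          thus "norm (\<Sum>m\<in>{p..<q}. ec (((1 - \<alpha>) * \<bar>\<alpha>\<bar> powr (\<alpha> / (1 - \<alpha>)) * x powr (1 / (1 - \<alpha>))) * real m powr \<beta>)) \<le> Bd"
            by (simp only: cu_def s_def)
        qed
        thus "norm (\<Sum>n\<in>{2^j..<2^(j+1)}. ec (x * real n powr \<alpha>)) \<le> C0 * (1 + harm (nat \<lceil>K2 * (x * real N powr \<alpha> / real N)\<rceil>) + real N / sqrt (x * real N powr \<alpha>) * (1 + Bd))"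
          by (simp add: N_def)
      qed
      hence "F x ^ 4 \<le> (C0 * (1 + h + Q * (1 + Bd))) ^ 4" by (intro power_mono) (auto simp: F_def)
      \<comment> \<open>Four terms \<open>1\<close>, \<open>h\<close>, \<open>Q\<close>,
        \<open>Q * Bd\<close>: the power mean inequality for fourth powers yields
        \<open>4^3 = 64\<close>.\<close>
      also have "\<dots> = C0 ^ 4 * (\<Sum>k<4::nat. [1, h, Q, Q * Bd] ! k) ^ 4"
        by (simp add: power_mult_distrib eval_nat_numeral algebra_simps)
      also have "\<dots> \<le> C0 ^ 4 * (real (card {..<4::nat}) ^ 3 * (\<Sum>k<4::nat. ([1, h, Q, Q * Bd] ! k) ^ 4))"
        using C0 by (intro mult_left_mono sum_power4_le) auto
      also have "\<dots> = C0 ^ 4 * 64 * (1 + h ^ 4 + Q ^ 4 + Q ^ 4 * \<Psi> (cu * x powr s))"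
        by (simp add: Bd(2)[symmetric] power_mult_distrib lessThan_nat_numeral lessThan_Suc add_ac)
      also have "\<dots> \<le> C0 ^ 4 * 64 * (1 + (H3 * real (1 + j)) ^ 4 + Q4 + Q4 * \<Psi> (cu * x powr s))"
        using C0 h h0 Q \<Psi>0 by (intro mult_left_mono add_mono power_mono mult_right_mono) auto
      finally show ?thesis .
    qed
    define u0 where "u0 = cu * x0 powr s"
    have u0: "u0 > 0" using cu x0 by (simp add: u0_def)
    define Y where "Y = cY * u0"
    have Y: "Y > 0" using cY u0 by (simp add: Y_def)
    have u1: "cu * (2 * x0) powr s = u0 + Y" using x0 by (simp add: Y_def u0_def cY_def powr_mult algebra_simps)
    \<comment> \<open>A window longer than the scale only lowers the energy; a shorter one is still
      at least \<open>c5\<close> times the scale and costs a factor \<open>1 / c5^2\<close>.\<close>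
    have en: "quad_energy (\<lambda>m. real m powr \<beta>) {2^l..<2^(l+1)} Y \<le> C6 * block_energy \<beta> l" if l: "l \<in> Ls" for l
    proof -
      define W where "W = T / real N"
      have W: "W > 0" "W \<le> real N" using T N by (auto simp: W_def divide_le_eq power2_eq_square)
      have "2^l * 2^j \<le> 2 * K2 * T" using l Ls by (auto simp: T_def)
      hence lW: "2^l \<le> 2 * K2 * W" using N by (simp add: W_def field_simps)
      define X' where "X' = (2^l :: real) powr (2 - \<beta>)"
      have X': "X' > 0" by (simp add: X'_def)
      have "x0 = W * real N powr (1 - \<alpha>)" using N by (simp add: x0_def W_def powr_diff powr_minus_divide)
      hence "x0 powr s = W powr s * real N" using W N \<alpha> by (simp add: powr_mult powr_powr s_def)
      hence Yeq: "Y = cY * cu * (W powr s * real N)" by (simp add: Y_def u0_def)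
      have "X' \<le> (2 * K2 * W) powr (1 + s)" unfolding X'_def b2 using lW s by (intro powr_mono2) auto
      also have "\<dots> = (2 * K2) powr (1 + s) * (W powr s * W)" using K W by (simp add: powr_mult powr_add)
      also have "\<dots> \<le> (2 * K2) powr (1 + s) * (W powr s * real N)" using W by (intro mult_left_mono) auto
      finally have "c5 * X' \<le> c5 * ((2 * K2) powr (1 + s) * (W powr s * real N))" using c5 by (intro mult_left_mono) auto
      also have "\<dots> = Y" unfolding Yeq c5_def using K by simp
      finally have c5Y: "c5 * X' \<le> Y" .
      show ?thesis
      proof (cases "X' \<le> Y")
        case True
        have "quad_energy (\<lambda>m. real m powr \<beta>) {2^l..<2^(l+1)} Y \<le> 1 * block_energy \<beta> l"
          unfolding block_energy_def X'_def[symmetric] mult_1 using True X' by (intro quad_energy_antimono) auto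
        also have "\<dots> \<le> C6 * block_energy \<beta> l" by (intro mult_right_mono block_energy_nonneg) (simp add: C6_def)
        finally show ?thesis .
      next
        case False
        have "quad_energy (\<lambda>m. real m powr \<beta>) {2^l..<2^(l+1)} Y \<le> (X' / Y)\<^sup>2 * block_energy \<beta> l"
          unfolding block_energy_def X'_def[symmetric] using False Y by (intro quad_energy_scale) auto
        also have "\<dots> \<le> (1 / c5)\<^sup>2 * block_energy \<beta> l"
        proof (intro mult_right_mono block_energy_nonneg power_mono)
          show "X' / Y \<le> 1 / c5" using c5Y c5 Y by (simp add: field_simps)
        qed (use X' Y in auto)
        also have "\<dots> \<le> C6 * block_energy \<beta> l" by (intro mult_right_mono block_energy_nonneg) (simp add: C6_def power_divide)
        finally show ?thesis .
      qed
    qed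
    define Sg where "Sg = real (card Ls) ^ 3 * (\<Sum>l\<in>Ls. real (l + 1) ^ 4 * block_energy \<beta> l)"
    have "integral {u0..u0 + Y} \<Psi> = real (card Ls) ^ 3 * (\<Sum>l\<in>Ls. 16 * real (l + 1) ^ 3 * integral {u0..u0 + Y} (rm_sum \<beta> l))"
      unfolding \<Psi>_def using fin by (simp add: integral_sum integrable_continuous_real continuous_intros continuous_on_rm_sum)
    also have "\<dots> \<le> real (card Ls) ^ 3 * (\<Sum>l\<in>Ls. 16 * real (l + 1) ^ 3 * (4 * Y * real (l + 1) * (C6 * block_energy \<beta> l)))"
    proof (intro mult_left_mono sum_mono)
      fix l assume l: "l \<in> Ls"
      have "integral {u0..u0 + Y} (rm_sum \<beta> l) \<le> 4 * Y * real (l + 1) * quad_energy (\<lambda>m. real m powr \<beta>) {2^l..<2^(l+1)} Y"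
        by (rule rm_sum_window[OF Y])
      also have "\<dots> \<le> 4 * Y * real (l + 1) * (C6 * block_energy \<beta> l)"
        using Y by (intro mult_left_mono en l) auto
      finally show "integral {u0..u0 + Y} (rm_sum \<beta> l) \<le> 4 * Y * real (l + 1) * (C6 * block_energy \<beta> l)" .
    qed auto
    also have "\<dots> = 64 * Y * C6 * Sg"
    proof -
      have "16 * a ^ 3 * (4 * Y * a * (C6 * b)) = 64 * Y * C6 * (a ^ 4 * b)" for a b :: real
        by (simp add: eval_nat_numeral algebra_simps)
      thus ?thesis unfolding Sg_def by (simp only: sum_distrib_left[symmetric]) (simp only: mult_ac)
    qed
    finally have I\<Psi>: "integral {u0..u0 + Y} \<Psi> \<le> 64 * Y * C6 * Sg" .
    have "integral {x0..2*x0} (\<lambda>x. \<Psi> (cu * x powr s)) \<le> 2 * x0 / (s * u0) * integral {u0..u0 + Y} \<Psi>"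
      using integral_power_substitution[OF c\<Psi> \<Psi>0 cu s x0] by (simp only: u1 u0_def[symmetric])
    also have "\<dots> \<le> 2 * x0 / (s * u0) * (64 * Y * C6 * Sg)"
      using x0 s u0 by (intro mult_left_mono I\<Psi>) auto
    also have "\<dots> = D * x0 * Sg" using u0 by (simp add: D_def Y_def)
    finally have Ix: "integral {x0..2*x0} (\<lambda>x. \<Psi> (cu * x powr s)) \<le> D * x0 * Sg" .
    have cF: "continuous_on S F" for S unfolding F_def by (intro continuous_intros)
    have cPx: "continuous_on {x0..2*x0} (\<lambda>x. \<Psi> (cu * x powr s))"
      using x0 by (intro continuous_on_compose2[OF c\<Psi>[of UNIV]] continuous_intros) auto
    have iPx: "(\<lambda>x. \<Psi> (cu * x powr s)) integrable_on {x0..2*x0}" by (rule integrable_continuous_real[OF cPx])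
    define A where "A = 1 + (H3 * real (1 + j)) ^ 4 + Q4"
    have Q40: "Q4 \<ge> 0" by (simp add: Q4_def)
    have Sg0: "Sg \<ge> 0" unfolding Sg_def by (intro mult_nonneg_nonneg sum_nonneg) (auto simp: block_energy_nonneg)
    have "integral {x0..2*x0} (\<lambda>x. F x ^ 4) \<le> integral {x0..2*x0} (\<lambda>x. C0 ^ 4 * 64 * (A + Q4 * \<Psi> (cu * x powr s)))"
      by (rule integral_le) (use pw in \<open>auto simp: A_def intro!: integrable_continuous_real continuous_intros cF cPx\<close>)
    also have "\<dots> = C0 ^ 4 * 64 * (A * x0 + Q4 * integral {x0..2*x0} (\<lambda>x. \<Psi> (cu * x powr s)))"
    proof -
      have "((\<lambda>x. C0 ^ 4 * 64 * (A + Q4 * \<Psi> (cu * x powr s))) has_integral C0 ^ 4 * 64 * (A * x0 + Q4 * integral {x0..2*x0} (\<lambda>x. \<Psi> (cu * x powr s)))) {x0..2*x0}"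
      proof (intro has_integral_mult_right has_integral_add)
        show "((\<lambda>x. A) has_integral A * x0) {x0..2*x0}"
          using has_integral_const_real[of A x0 "2*x0"] x0 by (simp add: mult.commute)
        show "((\<lambda>x. \<Psi> (cu * x powr s)) has_integral integral {x0..2*x0} (\<lambda>x. \<Psi> (cu * x powr s))) {x0..2*x0}"
          by (rule integrable_integral[OF iPx])
      qed
      thus ?thesis by (rule integral_unique)
    qed
    also have "\<dots> \<le> C0 ^ 4 * 64 * (A * x0 + Q4 * (D * x0 * Sg))"
      using C0 Q40 Ix by (intro mult_left_mono add_left_mono) auto
    also have "\<dots> \<le> C * x0 * (real (1 + j) ^ 4 + Q4 + Q4 * Sg)"
    proof -
      have 1: "1 \<le> real (1 + j) ^ 4" by (rule one_le_power) simp
      define J where "J = real (1 + j) ^ 4"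
      define h where "h = H3 ^ 4"
      have J: "J \<ge> 1" "h \<ge> 0" using 1 by (auto simp: J_def h_def)
      have pos: "h * Q4 \<ge> 0" "h * (Q4 * Sg) \<ge> 0" "D * J \<ge> 0" "D * Q4 \<ge> 0" "Q4 * Sg \<ge> 0"
        using J Q40 Sg0 D by auto
      have "(1 + h * J + Q4) + Q4 * (D * Sg) \<le> (1 + h + D) * (J + Q4 + Q4 * Sg)"
        using J pos by (simp add: algebra_simps)
      hence "C0 ^ 4 * 64 * x0 * ((1 + h * J + Q4) + Q4 * (D * Sg)) \<le> C0 ^ 4 * 64 * x0 * ((1 + h + D) * (J + Q4 + Q4 * Sg))"
        using C0 x0 by (intro mult_left_mono) auto
      moreover have "A = 1 + h * J + Q4" by (simp only: A_def h_def J_def power_mult_distrib)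
      moreover have "C = C0 ^ 4 * 64 * (1 + h + D)" by (simp only: C_def h_def)
      ultimately show ?thesis unfolding J_def[symmetric] by (simp add: algebra_simps)
    qed
    finally have "integral {x0..2*x0} (\<lambda>x. F x ^ 4) \<le> C * x0 * (real (1 + j) ^ 4 + Q4 + Q4 * Sg)" .
    thus "integral {2^i * (2^j) powr (- \<alpha>)..2 * (2^i * (2^j) powr (- \<alpha>))} (\<lambda>x. norm (\<Sum>n\<in>{2^j..<2^(j+1)}. ec (x * real n powr \<alpha>)) ^ 4)
        \<le> C * (2^i * (2^j) powr (- \<alpha>)) * (real (1 + j) ^ 4 + 2^(4*j) / 4^i
            + 2^(4*j) / 4^i * real (card Ls) ^ 3 * (\<Sum>l\<in>Ls. real (l + 1) ^ 4 * block_energy \<beta> l))"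
      by (simp only: F_def x0_def T_def N(2) Q4_def Sg_def mult.assoc)
  qed
qed

section \<open>Recursion on the dyadic level\<close>

lemma dyadic_range:
  fixes K1 K2 :: real and i j :: nat
  assumes K: "K1 > 0" "K2 > 0"
  defines "Ls \<equiv> {l::nat. 2^l * 2^j \<le> 2 * K2 * 2^i \<and> K1 * 2^i \<le> 2 * 2^l * (2::real)^j}"
  shows "finite Ls" "card Ls \<le> nat \<lfloor>4 * K2 / K1\<rfloor> + 1"
proof -
  have "Ls \<subseteq> {..nat \<lfloor>2 * K2 * 2^i\<rfloor>}"
  proof
    fix l assume l: "l \<in> Ls"
    have "real l \<le> 2^l" using of_nat_less_two_power[of l, where 'a = real] by linarith
    also have "\<dots> = 2^l * 1" by simp
    also have "\<dots> \<le> 2^l * 2^j" by (intro mult_left_mono) auto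
    also have "\<dots> \<le> 2 * K2 * 2^i" using l by (simp add: Ls_def)
    finally show "l \<in> {..nat \<lfloor>2 * K2 * 2^i\<rfloor>}" by (simp add: le_nat_iff le_floor_iff)
  qed
  thus fin: "finite Ls" using finite_subset by blast
  show "card Ls \<le> nat \<lfloor>4 * K2 / K1\<rfloor> + 1"
  proof (cases "Ls = {}")
    case False
    define l0 where "l0 = Min Ls"
    have l0: "l0 \<in> Ls" using fin False by (simp add: l0_def)
    have "Ls \<subseteq> {l0..l0 + nat \<lfloor>4 * K2 / K1\<rfloor>}"
    proof
      fix l assume l: "l \<in> Ls"
      have ge: "l0 \<le> l" using fin l by (simp add: l0_def)
      define d where "d = l - l0"
      have ld: "l = l0 + d" using ge by (simp add: d_def)
      have "2^d * (K1 * 2^i) \<le> 2^d * (2 * 2^l0 * 2^j)" using l0 by (intro mult_left_mono) (auto simp: Ls_def)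
      also have "\<dots> = 2 * (2^l * 2^j)" by (simp add: ld power_add)
      also have "\<dots> \<le> 2 * (2 * K2 * 2^i)" using l by (intro mult_left_mono) (auto simp: Ls_def)
      finally have "(2^d * K1) * 2^i \<le> (4 * K2) * 2^i" by (simp add: mult_ac)
      hence "2^d * K1 \<le> 4 * K2" by (rule mult_right_le_imp_le) simp
      hence "2^d \<le> 4 * K2 / K1" using K by (simp add: field_simps)
      hence "real d \<le> 4 * K2 / K1" using of_nat_less_two_power[of d, where 'a = real] by linarith
      hence "d \<le> nat \<lfloor>4 * K2 / K1\<rfloor>" by (simp add: le_nat_iff le_floor_iff)
      thus "l \<in> {l0..l0 + nat \<lfloor>4 * K2 / K1\<rfloor>}" using ld by simp
    qed
    hence "card Ls \<le> card {l0..l0 + nat \<lfloor>4 * K2 / K1\<rfloor>}" by (intro card_mono) auto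
    thus ?thesis by simp
  qed simp
qed

lemma integral_dyadic_split:
  fixes f :: "real \<Rightarrow> real"
  assumes f: "\<And>S. continuous_on S f" and a: "a > 0"
  shows "integral {0..2^n * a} f = integral {0..a} f + (\<Sum>i<n. integral {2^i * a..2 * (2^i * a)} f)"
proof (induction n)
  case (Suc n)
  have "integral {0..2^n * a} f + integral {2^n * a..2 * (2^n * a)} f = integral {0..2 * (2^n * a)} f"
    by (rule Henstock_Kurzweil_Integration.integral_combine) (use a in \<open>auto intro!: integrable_continuous_real f\<close>)
  thus ?case using Suc by (simp add: mult.assoc)
qed simp

text \<open>The window stops at phases of size about \<open>P = N powr (2 - \<kappa>)\<close>. After
  division by the window length, the range next to 0 and the terms \<open>N^4 / T\<close> contribute
  about \<open>N^4 / P = N powr (2 + \<kappa>)\<close>, which goes into \<open>C\<close>. Only the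
  dual terms carry \<open>K\<close>, and for \<open>j\<close> beyond \<open>j0\<close> they keep no
  more than half of it.\<close>

lemma energy_step:
  fixes \<alpha> \<kappa> :: real
  assumes \<alpha>: "\<alpha> < 1" "\<alpha> \<noteq> 0" and \<kappa>: "0 < \<kappa>" "\<kappa> \<le> 1"
  defines "\<beta> \<equiv> \<alpha> / (\<alpha> - 1)"
  obtains C j0 where "C > 0"
    "\<And>j K. j \<ge> j0 \<Longrightarrow> K \<ge> 0 \<Longrightarrow> (\<And>l. l < j \<Longrightarrow> block_energy \<beta> l \<le> K * (2^l) powr (2 + \<kappa>)) \<Longrightarrow>
        block_energy \<alpha> j \<le> (C + K / 2) * (2^j) powr (2 + \<kappa>)"
proof -
  define K1 where "K1 = \<bar>\<alpha>\<bar> * 2 powr (\<alpha> - 1)"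
  define K2 where "K2 = \<bar>\<alpha>\<bar> * 2 powr (1 - \<alpha>)"
  have K12: "K1 > 0" "K2 > 0" using \<alpha> by (auto simp: K1_def K2_def)
  define Ls where "Ls = (\<lambda>j i::nat. {l::nat. 2^l * 2^j \<le> 2 * K2 * 2^i \<and> K1 * 2^i \<le> 2 * 2^l * (2::real)^j})"
  define c where "c = real (nat \<lfloor>4 * K2 / K1\<rfloor> + 1)"
  have c: "c \<ge> 1" by (simp add: c_def)
  have finL: "finite (Ls j i)" and cardL: "real (card (Ls j i)) \<le> c" for j i
    using dyadic_range[OF K12, of j i] by (auto simp: Ls_def c_def of_nat_le_iff[symmetric, where 'a = real] simp del: of_nat_le_iff)
  define k3 where "k3 = (2 * K2 + 1) ^ 3"
  have k3: "k3 > 0" using K12 by (simp add: k3_def)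
  obtain C where C: "C > 0" and dy:
    "\<And>j i. 2^i \<le> (2::real)^(2*j) \<Longrightarrow>
       integral {2^i * (2^j) powr (- \<alpha>)..2 * (2^i * (2^j) powr (- \<alpha>))} (\<lambda>x. norm (\<Sum>n\<in>{2^j..<2^(j+1)}. ec (x * real n powr \<alpha>)) ^ 4)
        \<le> C * (2^i * (2^j) powr (- \<alpha>)) * (real (1 + j) ^ 4 + 2^(4*j) / 4^i
            + 2^(4*j) / 4^i * real (card (Ls j i)) ^ 3 * (\<Sum>l\<in>Ls j i. real (l + 1) ^ 4 * block_energy \<beta> l))"
  proof -
    have "\<exists>C>0. \<forall>j i. 2^i \<le> (2::real)^(2*j) \<longrightarrow>
       integral {2^i * (2^j) powr (- \<alpha>)..2 * (2^i * (2^j) powr (- \<alpha>))} (\<lambda>x. norm (\<Sum>n\<in>{2^j..<2^(j+1)}. ec (x * real n powr \<alpha>)) ^ 4)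
        \<le> C * (2^i * (2^j) powr (- \<alpha>)) * (real (1 + j) ^ 4 + 2^(4*j) / 4^i
            + 2^(4*j) / 4^i * real (card (Ls j i)) ^ 3 * (\<Sum>l\<in>Ls j i. real (l + 1) ^ 4 * block_energy \<beta> l))"
    proof (rule dyadic_fourth_moment[OF \<alpha>, folded K1_def K2_def \<beta>_def])
      fix C :: real
      assume C: "0 < C" and dy: "\<And>j i Ls. 2^i \<le> (2::real)^(2*j) \<Longrightarrow> finite Ls \<Longrightarrow>
       (\<And>l. l \<in> Ls \<longleftrightarrow> 2^l * 2^j \<le> 2 * K2 * 2^i \<and> K1 * 2^i \<le> 2 * 2^l * 2^j) \<Longrightarrow>
       integral {2^i * (2^j) powr (- \<alpha>)..2 * (2^i * (2^j) powr (- \<alpha>))} (\<lambda>x. norm (\<Sum>n\<in>{2^j..<2^(j+1)}. ec (x * real n powr \<alpha>)) ^ 4)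
        \<le> C * (2^i * (2^j) powr (- \<alpha>)) * (real (1 + j) ^ 4 + 2^(4*j) / 4^i
            + 2^(4*j) / 4^i * real (card Ls) ^ 3 * (\<Sum>l\<in>Ls. real (l + 1) ^ 4 * block_energy \<beta> l))"
      show ?thesis
        by (intro exI[of _ C] conjI C allI impI dy finL) (auto simp: Ls_def)
    qed
    thus ?thesis using that by blast
  qed
  define Bc where "Bc = 40 * (C * (c ^ 4 * k3))"
  have Bc: "Bc > 0" using C c k3 by (simp add: Bc_def)
  \<comment> \<open>The saving in the dual term, from \<open>(2 - \<kappa>) + (2 - \<kappa>) *
    \<kappa> = 2 + \<kappa> - \<kappa>^2\<close>; it has to beat the fourth power of the logarithm
    and the constant \<open>2 * Bc\<close>.\<close>
  define \<delta> where "\<delta> = \<kappa>\<^sup>2"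
  have \<delta>: "\<delta> > 0" using \<kappa> by (simp add: \<delta>_def)
  have "(\<lambda>j::nat. (1 + real j) ^ 4 * 2 powr (- (\<delta> * real j))) \<longlonglongrightarrow> 0" using \<delta> by real_asymp
  hence ev1: "\<forall>\<^sub>F j in sequentially. (1 + real j) ^ 4 * 2 powr (- (\<delta> * real j)) < 1 / (2 * Bc)"
    using Bc by (intro order_tendstoD(2)) auto
  \<comment> \<open>With \<open>N powr \<kappa> > 2\<close> all dyadic ranges stay below
    \<open>N^2\<close>; with \<open>N powr \<kappa> > 2 * K2\<close> the dual length
    \<open>2 * K2 * P / N\<close> is below \<open>N\<close>, so every dual level is smaller than
    \<open>j\<close>.\<close>
  have "filterlim (\<lambda>j::nat. 2 powr (\<kappa> * real j)) at_top sequentially" using \<kappa> by real_asymp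
  hence ev2: "\<forall>\<^sub>F j in sequentially. 2 powr (\<kappa> * real j) > max 2 (2 * K2)"
    by (simp only: filterlim_at_top_dense)
  have "(\<lambda>j::nat. (1 + real j) ^ 4 * 2 powr (- (2 * real j))) \<longlonglongrightarrow> 0" by real_asymp
  hence ev3: "\<forall>\<^sub>F j in sequentially. (1 + real j) ^ 4 * 2 powr (- (2 * real j)) < 1"
    by (intro order_tendstoD(2)) auto
  obtain j0 where j0: "\<And>j. j \<ge> j0 \<Longrightarrow> (1 + real j) ^ 4 * 2 powr (- (\<delta> * real j)) < 1 / (2 * Bc) \<and> 2 powr (\<kappa> * real j) > max 2 (2 * K2) \<and> (1 + real j) ^ 4 * 2 powr (- (2 * real j)) < 1"
    using eventually_conj[OF ev1 eventually_conj[OF ev2 ev3]] unfolding eventually_sequentially by blast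
  show thesis
  proof (rule that[of "40 * (1 + 3 * C)" j0])
    show "40 * (1 + 3 * C) > 0" using C by simp
    fix j :: nat and K :: real
    assume j: "j \<ge> j0" and K: "K \<ge> 0" and IH: "\<And>l. l < j \<Longrightarrow> block_energy \<beta> l \<le> K * (2^l) powr (2 + \<kappa>)"
    define N where "N = (2::real)^j"
    have N: "N \<ge> 1" by (simp add: N_def)
    have Np: "N powr s = 2 powr (s * real j)" for s
      by (simp add: N_def powr_realpow[symmetric] powr_powr mult.commute)
    have J: "(1 + real j) ^ 4 * N powr (- \<delta>) < 1 / (2 * Bc)" "N powr \<kappa> > 2" "N powr \<kappa> > 2 * K2" "(1 + real j) ^ 4 * N powr (- 2) < 1"
      using j0[OF j] by (auto simp: Np)
    \<comment> \<open>The number of dyadic ranges, rounded up so that \<open>2^im\<close> lies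
      between \<open>P\<close> and \<open>2 * P\<close>.\<close>
    define im where "im = nat \<lceil>(2 - \<kappa>) * real j\<rceil>"
    define P where "P = N powr (2 - \<kappa>)"
    have P1: "P \<ge> 1" unfolding P_def using N \<kappa> by (intro ge_one_powr_ge_zero) auto
    have nn: "(2 - \<kappa>) * real j \<ge> 0" using \<kappa> by simp
    have im1: "P \<le> 2^im"
    proof -
      have "2 powr ((2 - \<kappa>) * real j) \<le> 2 powr real im" unfolding im_def using nn by (intro powr_mono) linarith+
      thus ?thesis by (simp add: P_def Np powr_realpow)
    qed
    have imi: "2^i \<le> P" if "i < im" for i
    proof -
      have "real i \<le> (2 - \<kappa>) * real j" using that unfolding im_def by linarith
      hence "2 powr real i \<le> 2 powr ((2 - \<kappa>) * real j)" by (intro powr_mono) auto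
      thus ?thesis by (simp add: P_def Np powr_realpow)
    qed
    have im2: "2^im \<le> 2 * P"
    proof (cases im)
      case 0 thus ?thesis using P1 by simp
    next
      case (Suc i) thus ?thesis using imi[of i] by simp
    qed
    have PN: "P * N powr \<kappa> = N^2"
    proof -
      have "P * N powr \<kappa> = N powr 2" unfolding P_def powr_add[symmetric] by simp
      thus ?thesis using N by (simp add: powr_numeral)
    qed
    have PN2: "2 * P \<le> N^2" using mult_left_mono[of 2 "N powr \<kappa>" P] J P1 PN by simp
    define a where "a = N powr (- \<alpha>)"
    have a: "a > 0" using N by (simp add: a_def)
    define X where "X = 2^im * a"
    have X: "X > 0" using a by (simp add: X_def)
    define F where "F = (\<lambda>x. norm (\<Sum>n\<in>{2^j..<2^(j+1)}. ec (x * real n powr \<alpha>)))"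
    have cF: "continuous_on S (\<lambda>x. F x ^ 4)" for S unfolding F_def by (intro continuous_intros)
    have be: "block_energy \<alpha> j \<le> 40 / X * integral {0..X} (\<lambda>x. F x ^ 4)"
    proof -
      have "X \<le> N^2 * a" using im2 PN2 a by (simp add: X_def)
      also have "\<dots> = N powr (2 - \<alpha>)" using N by (simp add: a_def powr_diff powr_minus_divide powr_numeral)
      finally have "block_energy \<alpha> j \<le> quad_energy (\<lambda>m. real m powr \<alpha>) {2^j..<2^(j+1)} X"
        unfolding block_energy_def N_def[symmetric] using X by (intro quad_energy_antimono) auto
      also have "\<dots> \<le> 40 / X * integral {0..X} (\<lambda>x. F x ^ 4)"
        unfolding F_def by (rule quad_energy_le_fourth_moment[OF X])
      finally show ?thesis .
    qed
    \<comment> \<open>Up to \<open>x = a\<close>, where the phase has size about 1, the trivial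
      bound is used.\<close>
    have F0: "integral {0..a} (\<lambda>x. F x ^ 4) \<le> N^4 * a"
    proof -
      have "F x \<le> N" for x
      proof -
        have "F x \<le> (\<Sum>n\<in>{2^j..<2^(j+1)}. norm (ec (x * real n powr \<alpha>)))" unfolding F_def by (rule norm_sum)
        thus ?thesis by (simp add: N_def)
      qed
      hence "F x ^ 4 \<le> N^4" for x by (intro power_mono) (auto simp: F_def)
      hence "integral {0..a} (\<lambda>x. F x ^ 4) \<le> integral {0..a} (\<lambda>x. N^4)"
        by (intro integral_le integrable_continuous_real cF) auto
      thus ?thesis using a by (simp add: mult.commute)
    qed
    define E3 where "E3 = c ^ 4 * k3 * (real (1 + j) ^ 4 * K) * (N powr (2 - \<kappa>) * P powr \<kappa>)"
    have Fi: "integral {2^i * a..2 * (2^i * a)} (\<lambda>x. F x ^ 4) \<le> C * a * (2^i * real (1 + j) ^ 4 + N^4 * (1/2)^i + 2^i * E3)" if i: "i < im" for i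
    proof -
      have i2: "2^i \<le> (2::real)^(2*j)"
      proof -
        have "2^i \<le> P" by (rule imi[OF i])
        also have "\<dots> \<le> N^2" using PN2 P1 by simp
        finally show ?thesis by (simp add: N_def power_mult[symmetric] mult.commute)
      qed
      define W where "W = 2^i / N"
      have W: "W > 0" using N by (simp add: W_def)
      have Sle: "(\<Sum>l\<in>Ls j i. real (l + 1) ^ 4 * block_energy \<beta> l) \<le> c * (real (1 + j) ^ 4 * (K * (k3 * W powr (2 + \<kappa>))))"
      proof -
        have "real (l + 1) ^ 4 * block_energy \<beta> l \<le> real (1 + j) ^ 4 * (K * (k3 * W powr (2 + \<kappa>)))" if l: "l \<in> Ls j i" for l
        proof -
          have "2^l * N \<le> 2 * K2 * 2^i" using l by (simp add: Ls_def N_def)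
          hence lW: "2^l \<le> 2 * K2 * W" using N by (simp add: W_def field_simps)
          have "2^l * N \<le> 2 * K2 * P" using \<open>2^l * N \<le> 2 * K2 * 2^i\<close> imi[OF i] K12 mult_left_mono[of "2^i" P "2 * K2"] by linarith
          also have "\<dots> < N powr \<kappa> * P" using J P1 by (intro mult_strict_right_mono) auto
          also have "\<dots> = N * N" using PN by (simp add: mult.commute power2_eq_square)
          finally have "2^l < N" using N by simp
          hence lj: "l < j" by (simp add: N_def)
          have "block_energy \<beta> l \<le> K * (2^l) powr (2 + \<kappa>)" by (rule IH[OF lj])
          also have "\<dots> \<le> K * (k3 * W powr (2 + \<kappa>))"
          proof (intro mult_left_mono K)
            have "(2^l) powr (2 + \<kappa>) \<le> (2 * K2 * W) powr (2 + \<kappa>)" using lW \<kappa> by (intro powr_mono2) auto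
            also have "\<dots> = (2 * K2) powr (2 + \<kappa>) * W powr (2 + \<kappa>)" using K12 W by (simp add: powr_mult)
            also have "\<dots> \<le> k3 * W powr (2 + \<kappa>)"
            proof (intro mult_right_mono)
              have "(2 * K2) powr (2 + \<kappa>) \<le> (2 * K2 + 1) powr (2 + \<kappa>)" using K12 \<kappa> by (intro powr_mono2) auto
              also have "\<dots> \<le> (2 * K2 + 1) powr 3" using K12 \<kappa> by (intro powr_mono) auto
              finally show "(2 * K2) powr (2 + \<kappa>) \<le> k3" using K12 by (simp add: k3_def powr_numeral)
            qed simp
            finally show "(2^l) powr (2 + \<kappa>) \<le> k3 * W powr (2 + \<kappa>)" .
          qed
          finally show ?thesis using lj by (intro mult_mono power_mono block_energy_nonneg) auto
        qed
        hence "(\<Sum>l\<in>Ls j i. real (l + 1) ^ 4 * block_energy \<beta> l) \<le> real (card (Ls j i)) * (real (1 + j) ^ 4 * (K * (k3 * W powr (2 + \<kappa>))))"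
          by (rule sum_bounded_above)
        also have "\<dots> \<le> c * (real (1 + j) ^ 4 * (K * (k3 * W powr (2 + \<kappa>))))"
          using K k3 by (intro mult_right_mono cardL) auto
        finally show ?thesis .
      qed
      have Wp: "2^(4*j) / 4^i * W powr (2 + \<kappa>) \<le> N powr (2 - \<kappa>) * P powr \<kappa>"
      proof -
        have "W powr (2 + \<kappa>) = (2^i) powr 2 * (2^i) powr \<kappa> / (N powr 2 * N powr \<kappa>)"
          unfolding W_def using N by (simp add: powr_divide powr_add)
        also have "(2^i) powr 2 = (4::real)^i" by (simp add: powr_numeral power2_eq_square flip: power_mult_distrib)
        finally have "2^(4*j) / 4^i * W powr (2 + \<kappa>) = N^4 * (2^i) powr \<kappa> / (N powr 2 * N powr \<kappa>)"
          by (simp add: N_def power_mult[symmetric] mult.commute)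
        also have "\<dots> = N powr (2 - \<kappa>) * (2^i) powr \<kappa>"
        proof -
          have "N^4 = N powr (2 - \<kappa>) * (N powr 2 * N powr \<kappa>)"
            unfolding powr_add[symmetric] using N by (simp add: powr_numeral)
          thus ?thesis using N by simp
        qed
        also have "\<dots> \<le> N powr (2 - \<kappa>) * P powr \<kappa>" using imi[OF i] \<kappa> by (intro mult_left_mono powr_mono2) auto
        finally show ?thesis .
      qed
      have "2^(4*j) / 4^i * real (card (Ls j i)) ^ 3 * (\<Sum>l\<in>Ls j i. real (l + 1) ^ 4 * block_energy \<beta> l)
         \<le> 2^(4*j) / 4^i * c ^ 3 * (c * (real (1 + j) ^ 4 * (K * (k3 * W powr (2 + \<kappa>)))))"
        by (intro mult_mono Sle power_mono cardL sum_nonneg mult_nonneg_nonneg block_energy_nonneg) (use c in auto)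
      also have "\<dots> = c ^ 4 * k3 * (real (1 + j) ^ 4 * K) * (2^(4*j) / 4^i * W powr (2 + \<kappa>))"
      proof -
        have "q * c ^ 3 * (c * (x * (K * (k3 * z)))) = c ^ 4 * k3 * (x * K) * (q * z)" for q x z :: real
          by (simp add: eval_nat_numeral algebra_simps)
        thus ?thesis .
      qed
      also have "\<dots> \<le> E3" unfolding E3_def using c k3 K by (intro mult_left_mono Wp) auto
      finally have third: "2^(4*j) / 4^i * real (card (Ls j i)) ^ 3 * (\<Sum>l\<in>Ls j i. real (l + 1) ^ 4 * block_energy \<beta> l) \<le> E3" .
      have "integral {2^i * a..2 * (2^i * a)} (\<lambda>x. F x ^ 4) \<le> C * (2^i * a) * (real (1 + j) ^ 4 + 2^(4*j) / 4^i
            + 2^(4*j) / 4^i * real (card (Ls j i)) ^ 3 * (\<Sum>l\<in>Ls j i. real (l + 1) ^ 4 * block_energy \<beta> l))"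
        using dy[OF i2] unfolding F_def a_def N_def .
      also have "\<dots> \<le> C * (2^i * a) * (real (1 + j) ^ 4 + 2^(4*j) / 4^i + E3)"
        using third C a by (intro mult_left_mono) auto
      also have "\<dots> = C * a * (2^i * real (1 + j) ^ 4 + N^4 * (1/2)^i + 2^i * E3)"
      proof -
        have h: "(2::real)^i * (2^(4*j) / 4^i) = N^4 * (1/2)^i"
        proof -
          have "(4::real)^i = 2^i * 2^i" by (simp flip: power_mult_distrib)
          moreover have "N^4 = 2^(4*j)" by (simp add: N_def power_mult[symmetric] mult.commute)
          ultimately show ?thesis by (simp add: power_divide)
        qed
        have "C * (2^i * a) * (q + r + E3) = C * a * (2^i * q + 2^i * r + 2^i * E3)" for q r by (simp add: algebra_simps)
        thus ?thesis unfolding h[symmetric] .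
      qed
      finally show ?thesis .
    qed
    have E3: "E3 \<ge> 0" unfolding E3_def using c k3 K by auto
    have "integral {0..X} (\<lambda>x. F x ^ 4) = integral {0..a} (\<lambda>x. F x ^ 4) + (\<Sum>i<im. integral {2^i * a..2 * (2^i * a)} (\<lambda>x. F x ^ 4))"
      unfolding X_def by (rule integral_dyadic_split[OF cF a])
    also have "\<dots> \<le> N^4 * a + (\<Sum>i<im. C * a * (2^i * real (1 + j) ^ 4 + N^4 * (1/2)^i + 2^i * E3))"
      by (intro add_mono F0 sum_mono Fi) auto
    also have "\<dots> = N^4 * a + C * a * ((\<Sum>i<im. 2^i) * real (1 + j) ^ 4 + N^4 * (\<Sum>i<im. (1/2)^i) + (\<Sum>i<im. 2^i) * E3)"
      by (simp only: sum_distrib_left[symmetric] sum_distrib_right[symmetric] sum.distrib)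
    also have "\<dots> \<le> N^4 * a + C * a * (2^im * real (1 + j) ^ 4 + N^4 * 2 + 2^im * E3)"
    proof -
      have s1: "(\<Sum>i<im. (2::real)^i) \<le> 2^im" by (induction im) auto
      have s2: "(\<Sum>i<im. (1/2::real)^i) \<le> 2" using geometric_sum[of "1/2::real" im] by simp
      show ?thesis using s1 s2 C a E3 N by (intro add_mono mult_left_mono mult_right_mono) auto
    qed
    finally have I: "integral {0..X} (\<lambda>x. F x ^ 4) \<le> N^4 * a + C * a * (2^im * real (1 + j) ^ 4 + N^4 * 2 + 2^im * E3)" .
    have "block_energy \<alpha> j \<le> 40 / X * (N^4 * a + C * a * (2^im * real (1 + j) ^ 4 + N^4 * 2 + 2^im * E3))"
      using X by (intro order_trans[OF be] mult_left_mono I) auto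
    also have "\<dots> = 40 * ((1 + 2 * C) * (N^4 / 2^im) + C * real (1 + j) ^ 4 + C * E3)"
      using a by (simp add: X_def field_simps)
    also have "\<dots> \<le> 40 * ((1 + 2 * C) * N powr (2 + \<kappa>) + C * N powr (2 + \<kappa>) + C * E3)"
    proof (intro mult_left_mono add_mono order_refl)
      have "N^4 / 2^im \<le> N^4 / P" using im1 P1 by (intro divide_left_mono) auto
      also have "N^4 / P = N powr (2 + \<kappa>)"
      proof -
        have "N^4 = P * N powr (2 + \<kappa>)" unfolding P_def powr_add[symmetric] using N by (simp add: powr_numeral)
        thus ?thesis using P1 by simp
      qed
      finally show "N^4 / 2^im \<le> N powr (2 + \<kappa>)" .
      have "real (1 + j) ^ 4 \<le> N^2" using J(4) N by (simp add: powr_minus_divide powr_numeral field_simps)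
      also have "\<dots> = N powr 2" using N by (simp add: powr_numeral)
      also have "\<dots> \<le> N powr (2 + \<kappa>)" using N \<kappa> by (intro powr_mono) auto
      finally show "real (1 + j) ^ 4 \<le> N powr (2 + \<kappa>)" .
    qed (use C in auto)
    also have "\<dots> = 40 * (1 + 3 * C) * N powr (2 + \<kappa>) + 40 * (C * E3)" by (simp add: algebra_simps)
    also have "40 * (C * E3) \<le> K / 2 * N powr (2 + \<kappa>)"
    proof -
      have "P powr \<kappa> = N powr ((2 - \<kappa>) * \<kappa>)" by (simp add: P_def powr_powr)
      hence "N powr (2 - \<kappa>) * P powr \<kappa> = N powr (2 - \<kappa> + (2 - \<kappa>) * \<kappa>)" by (simp add: powr_add)
      also have "2 - \<kappa> + (2 - \<kappa>) * \<kappa> = - \<delta> + (2 + \<kappa>)" by (simp add: \<delta>_def power2_eq_square algebra_simps)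
      finally have e: "N powr (2 - \<kappa>) * P powr \<kappa> = N powr (- \<delta>) * N powr (2 + \<kappa>)" by (simp only: powr_add)
      have "40 * (C * E3) = Bc * (real (1 + j) ^ 4 * N powr (- \<delta>)) * (K * N powr (2 + \<kappa>))"
        unfolding E3_def e Bc_def by (simp only: mult_ac)
      also have "\<dots> \<le> Bc * (1 / (2 * Bc)) * (K * N powr (2 + \<kappa>))"
        using J(1) Bc K by (intro mult_right_mono mult_left_mono) auto
      also have "\<dots> = K / 2 * N powr (2 + \<kappa>)" using Bc by simp
      finally show ?thesis .
    qed
    finally show "block_energy \<alpha> j \<le> (40 * (1 + 3 * C) + K / 2) * (2^j) powr (2 + \<kappa>)"
      unfolding N_def[symmetric] by (simp add: algebra_simps)
  qed
qed

text \<open>The recursion is run for \<open>\<alpha>\<close> and its dual \<open>\<beta>\<close>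
  simultaneously, each exponent drawing on the other at lower levels.\<close>

theorem block_energy_bound:
  fixes \<alpha> \<kappa> :: real
  assumes \<alpha>: "\<alpha> < 1" "\<alpha> \<noteq> 0" and \<kappa>: "0 < \<kappa>" "\<kappa> \<le> 1"
  obtains K where "K > 0" "\<And>j. block_energy \<alpha> j \<le> K * (2^j) powr (2 + \<kappa>)"
proof -
  define \<beta> where "\<beta> = \<alpha> / (\<alpha> - 1)"
  have \<beta>: "\<beta> < 1" "\<beta> \<noteq> 0" "\<beta> / (\<beta> - 1) = \<alpha>" using \<alpha> by (auto simp: \<beta>_def field_simps)
  obtain C1 j1 where C1: "C1 > 0" and s1: "\<And>j K. j \<ge> j1 \<Longrightarrow> K \<ge> 0 \<Longrightarrow> (\<And>l. l < j \<Longrightarrow> block_energy \<beta> l \<le> K * (2^l) powr (2 + \<kappa>)) \<Longrightarrow>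
        block_energy \<alpha> j \<le> (C1 + K / 2) * (2^j) powr (2 + \<kappa>)"
    using energy_step[OF \<alpha> \<kappa>] unfolding \<beta>_def by metis
  obtain C2 j2 where C2: "C2 > 0" and s2: "\<And>j K. j \<ge> j2 \<Longrightarrow> K \<ge> 0 \<Longrightarrow> (\<And>l. l < j \<Longrightarrow> block_energy \<alpha> l \<le> K * (2^l) powr (2 + \<kappa>)) \<Longrightarrow>
        block_energy \<beta> j \<le> (C2 + K / 2) * (2^j) powr (2 + \<kappa>)"
    using energy_step[OF \<beta>(1,2) \<kappa>, unfolded \<beta>(3)] by metis
  define j0 where "j0 = max j1 j2"
  \<comment> \<open>The first summand gives \<open>C1 + K / 2 \<le> K\<close> and
    \<open>C2 + K / 2 \<le> K\<close>; the power of 2 covers the levels below \<open>j0\<close> by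
    the trivial bound, the fourth power of the block length.\<close>
  define K where "K = 2 * (C1 + C2) + 2^(4*j0)"
  have K: "K > 0" using C1 C2 zero_less_power[of "2::real" "4*j0"] by (simp add: K_def add_pos_pos)
  have "block_energy \<alpha> j \<le> K * (2^j) powr (2 + \<kappa>) \<and> block_energy \<beta> j \<le> K * (2^j) powr (2 + \<kappa>)" for j
  proof (induction j rule: less_induct)
    case (less j)
    have pw: "(2^j) powr (2 + \<kappa>) \<ge> (1::real)" using \<kappa> by (intro ge_one_powr_ge_zero) auto
    show ?case
    proof (cases "j \<ge> j0")
      case True
      have "block_energy \<alpha> j \<le> (C1 + K / 2) * (2^j) powr (2 + \<kappa>)"
        using s1[of j K] True less K by (auto simp: j0_def)
      moreover have "block_energy \<beta> j \<le> (C2 + K / 2) * (2^j) powr (2 + \<kappa>)"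
        using s2[of j K] True less K by (auto simp: j0_def)
      moreover have "C1 + K / 2 \<le> K" "C2 + K / 2 \<le> K" using C1 C2 by (auto simp: K_def)
      hence "(C1 + K / 2) * (2^j) powr (2 + \<kappa>) \<le> K * (2^j) powr (2 + \<kappa>)" "(C2 + K / 2) * (2^j) powr (2 + \<kappa>) \<le> K * (2^j) powr (2 + \<kappa>)"
        by (intro mult_right_mono; simp)+
      ultimately show ?thesis by linarith
    next
      case False
      have "block_energy \<gamma> j \<le> K * (2^j) powr (2 + \<kappa>)" for \<gamma>
      proof -
        have "block_energy \<gamma> j \<le> real (card {2^j..<2^(j+1)::nat}) ^ 4" unfolding block_energy_def by (rule quad_energy_le_card)
        also have "\<dots> = 2^(4*j)" by (simp add: power_mult[symmetric] mult.commute)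
        also have "\<dots> \<le> 2^(4*j0)" using False by (intro power_increasing) auto
        also have "\<dots> \<le> K" using C1 C2 by (simp add: K_def)
        also have "K = K * 1" by simp
        also have "\<dots> \<le> K * (2^j) powr (2 + \<kappa>)" using pw K by (intro mult_left_mono) auto
        finally show ?thesis .
      qed
      thus ?thesis by simp
    qed
  qed
  thus thesis using that[OF K] by blast
qed

section \<open>Counting nearly equal products\<close>

lemma card_spaced_le:
  fixes R :: "real set"
  assumes fin: "finite R" and \<delta>: "\<delta> > 0" and l: "l \<ge> 0"
    and sp: "\<And>r s. r \<in> R \<Longrightarrow> s \<in> R \<Longrightarrow> r \<noteq> s \<Longrightarrow> \<delta> \<le> \<bar>r - s\<bar>"
    and diam: "\<And>r s. r \<in> R \<Longrightarrow> s \<in> R \<Longrightarrow> \<bar>r - s\<bar> \<le> l"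
  shows "real (card R) \<le> 1 + l / \<delta>"
proof (cases "R = {}")
  case True thus ?thesis using l \<delta> by simp
next
  case False
  define m where "m = Min R"
  have m: "m \<in> R" "\<And>r. r \<in> R \<Longrightarrow> m \<le> r" using fin False by (auto simp: m_def)
  define f where "f = (\<lambda>r. nat \<lfloor>(r - m) / \<delta>\<rfloor>)"
  have inj: "inj_on f R"
  proof (rule inj_onI, rule ccontr)
    fix r s assume rs: "r \<in> R" "s \<in> R" "f r = f s" "r \<noteq> s"
    have "(r - m) / \<delta> \<ge> 0" "(s - m) / \<delta> \<ge> 0" using m rs \<delta> by auto
    hence "\<lfloor>(r - m) / \<delta>\<rfloor> = \<lfloor>(s - m) / \<delta>\<rfloor>" using rs by (simp add: f_def eq_nat_nat_iff)
    hence "\<bar>(r - m) / \<delta> - (s - m) / \<delta>\<bar> < 1" by linarith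
    hence "\<bar>(r - s) / \<delta>\<bar> < 1" by (simp add: diff_divide_distrib)
    hence "\<bar>r - s\<bar> < \<delta>" using \<delta> by (simp add: abs_divide)
    thus False using sp[of r s] rs by simp
  qed
  have "f ` R \<subseteq> {..nat \<lfloor>l / \<delta>\<rfloor>}"
  proof
    fix k assume "k \<in> f ` R"
    then obtain r where r: "r \<in> R" "k = f r" by blast
    have "r - m \<le> l" using diam[of r m] m r by auto
    hence "(r - m) / \<delta> \<le> l / \<delta>" using \<delta> by (intro divide_right_mono) auto
    thus "k \<in> {..nat \<lfloor>l / \<delta>\<rfloor>}" using r by (simp add: f_def nat_mono floor_mono)
  qed
  hence "card R \<le> card {..nat \<lfloor>l / \<delta>\<rfloor>}"
    using card_image[OF inj] card_mono[of "{..nat \<lfloor>l / \<delta>\<rfloor>}" "f ` R"] by simp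
  also have "real (card {..nat \<lfloor>l / \<delta>\<rfloor>}) \<le> 1 + l / \<delta>" using l \<delta> by simp
  finally show ?thesis by simp
qed

lemma card_multiples_le:
  fixes M :: real
  assumes e: "e > 0" and M: "M \<ge> 0"
  shows "finite {a::nat. e dvd a \<and> 0 < a \<and> real a \<le> M}" "real (card {a::nat. e dvd a \<and> 0 < a \<and> real a \<le> M}) \<le> M / real e"
proof -
  have sub: "{a::nat. e dvd a \<and> 0 < a \<and> real a \<le> M} \<subseteq> (\<lambda>k. e * k) ` {1..nat \<lfloor>M / real e\<rfloor>}"
  proof
    fix a assume "a \<in> {a::nat. e dvd a \<and> 0 < a \<and> real a \<le> M}"
    then obtain k where k: "a = e * k" "0 < a" "real a \<le> M" by auto
    have "real k \<le> M / real e" using k e by (simp add: field_simps)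
    hence "k \<le> nat \<lfloor>M / real e\<rfloor>" by (simp add: le_nat_iff le_floor_iff)
    thus "a \<in> (\<lambda>k. e * k) ` {1..nat \<lfloor>M / real e\<rfloor>}" using k by auto
  qed
  show "finite {a::nat. e dvd a \<and> 0 < a \<and> real a \<le> M}" by (rule finite_subset[OF sub]) simp
  have "card {a::nat. e dvd a \<and> 0 < a \<and> real a \<le> M} \<le> card {1..nat \<lfloor>M / real e\<rfloor>}"
    using surj_card_le[OF _ sub] by simp
  also have "real (card {1..nat \<lfloor>M / real e\<rfloor>}) \<le> M / real e" using M by simp
  finally show "real (card {a::nat. e dvd a \<and> 0 < a \<and> real a \<le> M}) \<le> M / real e" by simp
qed

text \<open>The equation reads \<open>a / c = b / d\<close>; equal fractions have the same reduced
  form, so equal gcds force equal terms.\<close>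

lemma cross_product_gcd_eq:
  fixes a b c d :: nat
  assumes "a * d = b * c" "gcd a c = gcd b d" "gcd a c > 0"
  shows "a = b" "c = d"
proof -
  define g where "g = gcd a c"
  have g: "gcd b d = g" "g > 0" using assms by (auto simp: g_def)
  have "a * gcd b d = b * gcd a c"
    using assms(1) by (metis gcd_mult_distrib_nat mult.commute)
  thus "a = b" unfolding g(1) g_def[symmetric] using g(2) by simp
  have "c * gcd b d = d * gcd a c"
    using assms(1) by (metis gcd_mult_distrib_nat mult.commute)
  thus "c = d" unfolding g(1) g_def[symmetric] using g(2) by simp
qed

lemma powr_diff_lower:
  fixes \<gamma> r s :: real
  assumes \<gamma>: "0 < \<gamma>" "\<gamma> < 1" and r: "0 < r" "r \<le> 2" and s: "0 < s" "s \<le> 2"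
  shows "\<gamma> / 2 * \<bar>r - s\<bar> \<le> \<bar>r powr \<gamma> - s powr \<gamma>\<bar>"
proof -
  have *: "\<gamma> / 2 * (y - x) \<le> y powr \<gamma> - x powr \<gamma>" if xy: "0 < x" "x < y" "y \<le> 2" for x y :: real
  proof -
    have "\<exists>z>x. z < y \<and> y powr \<gamma> - x powr \<gamma> = (y - x) * (\<gamma> * z powr (\<gamma> - 1))"
      by (rule MVT2[OF xy(2)]) (use xy in \<open>auto intro!: derivative_eq_intros\<close>)
    then obtain z where z: "x < z" "z < y" "y powr \<gamma> - x powr \<gamma> = (y - x) * (\<gamma> * z powr (\<gamma> - 1))" by blast
    have "(1/2::real) = 2 powr (-1)" by (simp add: powr_minus_divide)
    also have "\<dots> \<le> 2 powr (\<gamma> - 1)" using \<gamma> by (intro powr_mono) auto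
    also have "\<dots> \<le> z powr (\<gamma> - 1)" using z xy \<gamma> by (intro powr_mono2') auto
    finally have "(y - x) * (\<gamma> * (1/2)) \<le> (y - x) * (\<gamma> * z powr (\<gamma> - 1))"
      using xy \<gamma> by (intro mult_left_mono) auto
    thus ?thesis using z by (simp add: mult_ac)
  qed
  consider "r < s" | "r = s" | "s < r" by linarith
  thus ?thesis
  proof cases
    case 1
    have "\<gamma> / 2 * (s - r) \<le> s powr \<gamma> - r powr \<gamma>" using *[of r s] 1 r s by auto
    moreover have "0 \<le> \<gamma> / 2 * (s - r)" using 1 \<gamma> by simp
    ultimately show ?thesis using 1 by simp
  next
    case 3
    have "\<gamma> / 2 * (r - s) \<le> r powr \<gamma> - s powr \<gamma>" using *[of s r] 3 r s by auto
    moreover have "0 \<le> \<gamma> / 2 * (r - s)" using 3 \<gamma> by simp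
    ultimately show ?thesis using 3 by simp
  qed simp
qed

text \<open>Division by \<open>h' * a powr \<gamma>\<close> separates the variables: a fraction of
  the \<open>h\<close>s against a power of a fraction of the \<open>a\<close>s. The constant
  combines \<open>\<Delta> \<le> 1 / (4 * N powr \<gamma>)\<close> with
  \<open>N powr \<gamma> \<le> 2 * a powr \<gamma>\<close>, where \<open>a \<ge> N / 2\<close> is
  used.\<close>

lemma near_products_ratio:
  fixes \<gamma> N \<Delta> :: real and h h' a a' :: nat
  assumes N: "N > 0" and \<gamma>: "0 < \<gamma>" "\<gamma> < 1" and \<Delta>: "\<Delta> * N powr \<gamma> \<le> 1/4"
    and a: "N / 2 \<le> real a" and h': "h' > 0"
    and near: "\<bar>real h * real a powr \<gamma> - real h' * real a' powr \<gamma>\<bar> \<le> \<Delta>"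
  shows "\<bar>real h / real h' - (real a' / real a) powr \<gamma>\<bar> \<le> N powr (- 2 * \<gamma>) / 2 / real h'"
proof -
  have a0: "real a > 0" using a N by linarith
  have ap: "real a powr \<gamma> > 0" using a0 by simp
  have "real h / real h' - (real a' / real a) powr \<gamma> = (real h * real a powr \<gamma> - real h' * real a' powr \<gamma>) / (real h' * real a powr \<gamma>)"
    using h' a0 by (simp add: powr_divide field_simps)
  hence "\<bar>real h / real h' - (real a' / real a) powr \<gamma>\<bar> = \<bar>real h * real a powr \<gamma> - real h' * real a' powr \<gamma>\<bar> / (real h' * real a powr \<gamma>)"
    using h' ap by (simp add: abs_divide abs_mult)
  also have "\<dots> \<le> \<Delta> / (real h' * real a powr \<gamma>)" using near h' ap by (intro divide_right_mono) auto
  also have "\<dots> = \<Delta> / real a powr \<gamma> / real h'" by simp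
  also have "\<dots> \<le> N powr (- 2 * \<gamma>) / 2 / real h'"
  proof (intro divide_right_mono)
    have "N powr \<gamma> \<le> 2 * real a powr \<gamma>"
    proof -
      have "N powr \<gamma> \<le> (2 * real a) powr \<gamma>" using a N \<gamma> by (intro powr_mono2) auto
      also have "\<dots> = 2 powr \<gamma> * real a powr \<gamma>" by (simp add: powr_mult)
      also have "\<dots> \<le> 2 powr 1 * real a powr \<gamma>" using \<gamma> by (intro mult_right_mono powr_mono) auto
      finally show ?thesis by simp
    qed
    have NN: "N powr \<gamma> > 0" using N by simp
    have "\<Delta> \<le> 1 / 4 / N powr \<gamma>" using \<Delta> NN by (simp add: field_simps)
    hence "\<Delta> / real a powr \<gamma> \<le> (1 / 4 / N powr \<gamma>) / real a powr \<gamma>" using ap by (intro divide_right_mono) auto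
    also have "\<dots> \<le> (1 / 4 / N powr \<gamma>) / (N powr \<gamma> / 2)"
      using \<open>N powr \<gamma> \<le> 2 * real a powr \<gamma>\<close> NN ap by (intro divide_left_mono) auto
    also have "\<dots> = N powr (- 2 * \<gamma>) / 2"
    proof -
      have "N powr (- 2 * \<gamma>) = 1 / (N powr \<gamma> * N powr \<gamma>)"
        by (simp add: powr_minus_divide flip: powr_add)
      thus ?thesis by simp
    qed
    finally show "\<Delta> / real a powr \<gamma> \<le> N powr (- 2 * \<gamma>) / 2" .
  qed simp
  finally show ?thesis .
qed

text \<open>The solutions are sorted by \<open>d = gcd h h'\<close> and \<open>e = gcd a a'\<close>.
  One count fixes the \<open>a\<close>s: two distinct fractions \<open>h / h'\<close> differ by at
  least \<open>1 / H^2\<close>, and \<open>H^2 < N powr (2 * \<gamma>)\<close> forbids both being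
  near the same target, which leaves \<open>(N / e)^2\<close>. The other fixes the \<open>h\<close>s
  and uses the spacing of the fractions \<open>a' / a\<close>. Neither alone is of order
  \<open>H N\<close> when \<open>H\<close> and \<open>N\<close> differ; their combination is, up to
  logarithms.\<close>

lemma near_products_count:
  fixes \<gamma> N \<Delta> :: real and H :: nat
  assumes N: "N \<ge> 1" and \<gamma>: "1/2 \<le> \<gamma>" "\<gamma> < 1" and \<Delta>: "\<Delta> * N powr \<gamma> \<le> 1/4"
    and H: "H \<ge> 1" "real H ^ 2 < N powr (2 * \<gamma>)"
  defines "S \<equiv> {(h, a, h', a'). h \<in> {1..H} \<and> h' \<in> {1..H} \<and> N / 2 \<le> real a \<and> real a < N \<and> N / 2 \<le> real a' \<and> real a' < N \<and>
      \<bar>real h * real a powr \<gamma> - real h' * real a' powr \<gamma>\<bar> \<le> \<Delta>}"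
  shows "finite S" "real (card S) \<le> 5 * (harm H)^2 * harm (nat \<lfloor>N\<rfloor>) * (real H * N)"
proof -
  define n where "n = nat \<lfloor>N\<rfloor>"
  have an: "a \<le> n" if "real a < N" for a :: nat using that unfolding n_def by linarith
  have "S \<subseteq> {1..H} \<times> {..n} \<times> {1..H} \<times> {..n}" using an by (auto simp: S_def)
  thus fin: "finite S" by (rule finite_subset) auto
  define \<epsilon> where "\<epsilon> = N powr (- 2 * \<gamma>) / 2"
  have \<epsilon>: "\<epsilon> > 0" using N by (simp add: \<epsilon>_def)
  define Sde where "Sde = (\<lambda>d e. {(h, a, h', a'). (h, a, h', a') \<in> S \<and> gcd h h' = d \<and> gcd a a' = e})"
  have finde: "finite (Sde d e)" for d e by (rule finite_subset[OF _ fin]) (auto simp: Sde_def)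
  have ratio: "\<bar>real h / real h' - (real a' / real a) powr \<gamma>\<bar> \<le> \<epsilon> / real h'" if "(h, a, h', a') \<in> S" for h a h' a'
    unfolding \<epsilon>_def using that N \<gamma> by (intro near_products_ratio[OF _ _ _ \<Delta>]) (auto simp: S_def)
  have apos: "0 < a" "0 < a'" "0 < h" "0 < h'" if "(h, a, h', a') \<in> S" for h a h' a'
    using that N by (auto simp: S_def intro!: Nat.gr0I)
  \<comment> \<open>Chosen so that the diameter \<open>4 * \<epsilon> / (\<gamma> * h')\<close> of
    the admissible ratios, divided by their spacing \<open>e^2 / N^2\<close>, equals
    \<open>Z / (h' * e^2)\<close>.\<close>
  define Z where "Z = 2 * N powr (2 - 2 * \<gamma>) / \<gamma>"
  have Z: "Z \<ge> 0" using N \<gamma> by (simp add: Z_def)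
  \<comment> \<open>Given the reduced fraction of the \<open>a\<close>s, the reduced fraction of the \<open>h\<close>s is determined.\<close>
  have b1: "real (card (Sde d e)) \<le> (N / real e)^2" if d: "d > 0" and e: "e > 0" for d e
  proof -
    define M where "M = {a::nat. e dvd a \<and> 0 < a \<and> real a \<le> N}"
    have finM: "finite M" and cM: "real (card M) \<le> N / real e" using card_multiples_le[OF e, of N] N by (auto simp: M_def)
    define f where "f = (\<lambda>(h::nat, a::nat, h'::nat, a'::nat). (a, a'))"
    have "inj_on f (Sde d e)"
    proof (rule inj_onI, clarsimp simp: f_def)
      fix h1 h1' h2 h2' a a'
      assume 1: "(h1, a, h1', a') \<in> Sde d e" and 2: "(h2, a, h2', a') \<in> Sde d e"
      have S1: "(h1, a, h1', a') \<in> S" "gcd h1 h1' = d" and S2: "(h2, a, h2', a') \<in> S" "gcd h2 h2' = d" using 1 2 by (auto simp: Sde_def)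
      have p: "0 < h1'" "0 < h2'" "h1' \<le> H" "h2' \<le> H" using S1 S2 by (auto simp: S_def)
      have "h1 * h2' = h2 * h1'"
      proof (rule ccontr)
        assume ne: "h1 * h2' \<noteq> h2 * h1'"
        have "1 \<le> \<bar>int (h1 * h2') - int (h2 * h1')\<bar>" using ne by linarith
        hence "1 \<le> \<bar>real (h1 * h2') - real (h2 * h1')\<bar>" by linarith
        have "\<bar>real h1 / real h1' - real h2 / real h2'\<bar> = \<bar>real (h1 * h2') - real (h2 * h1')\<bar> / (real h1' * real h2')"
        proof -
          have "real h1 / real h1' - real h2 / real h2' = (real (h1 * h2') - real (h2 * h1')) / (real h1' * real h2')"
            using p by (simp add: field_simps)
          thus ?thesis using p by (simp add: abs_divide abs_mult)
        qed
        also have "\<dots> \<ge> 1 / (real h1' * real h2')" using \<open>1 \<le> \<bar>real (h1 * h2') - real (h2 * h1')\<bar>\<close> p by (intro divide_right_mono) auto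
        moreover have "1 / (real h1' * real h2') \<ge> 1 / (real H)^2"
          unfolding power2_eq_square using p by (intro frac_le mult_mono) auto
        ultimately have "1 / (real H)^2 \<le> \<bar>real h1 / real h1' - real h2 / real h2'\<bar>" by linarith
        also have "\<dots> \<le> \<epsilon> / real h1' + \<epsilon> / real h2'" using ratio[OF S1(1)] ratio[OF S2(1)] by linarith
        also have "\<dots> \<le> \<epsilon> / 1 + \<epsilon> / 1" using p \<epsilon> by (intro add_mono divide_left_mono) auto
        also have "\<dots> = 1 / N powr (2 * \<gamma>)" by (simp add: \<epsilon>_def powr_minus_divide)
        also have "\<dots> < 1 / (real H)^2" using H N by (intro divide_strict_left_mono mult_pos_pos) auto
        finally show False by simp
      qed
      from cross_product_gcd_eq[OF this] S1 S2 d show "h1 = h2 \<and> h1' = h2'" by auto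
    qed
    moreover have "f ` Sde d e \<subseteq> M \<times> M"
      using apos by (auto simp: f_def Sde_def M_def S_def)
    ultimately have "card (Sde d e) \<le> card (M \<times> M)" using finM by (intro card_inj_on_le) auto
    hence "real (card (Sde d e)) \<le> (real (card M))^2" by (simp add: card_cartesian_product power2_eq_square flip: of_nat_mult)
    also have "\<dots> \<le> (N / real e)^2" using cM by (intro power_mono) auto
    finally show ?thesis .
  qed
  \<comment> \<open>For fixed \<open>h\<close>, \<open>h'\<close>, \<open>e\<close> the ratios
    \<open>a' / a\<close> lie in a short interval, since their powers are near
    \<open>h / h'\<close>, whereas distinct ones differ by at least \<open>e^2 / N^2\<close> because
    \<open>e\<close> divides all four entries.\<close>
  have fib: "real (card {(a, a'). (h, a, h', a') \<in> S \<and> gcd a a' = e}) \<le> 1 + Z / (real h' * real e ^ 2)"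
    if e: "e > 0" and h': "h' > 0" for h h' e
  proof -
    define A where "A = {(a, a'). (h, a, h', a') \<in> S \<and> gcd a a' = e}"
    have "A \<subseteq> {..n} \<times> {..n}" using an by (auto simp: A_def S_def)
    hence finA: "finite A" by (rule finite_subset) auto
    define r where "r = (\<lambda>(a::nat, a'::nat). real a' / real a)"
    have sp: "real e ^ 2 / N ^ 2 \<le> \<bar>r p - r q\<bar>" if pq: "p \<in> A" "q \<in> A" "p \<noteq> q" for p q
    proof -
      obtain a a' where p: "p = (a, a')" by (cases p) blast
      obtain b b' where q: "q = (b, b')" by (cases q) blast
      have A1: "(h, a, h', a') \<in> S" "gcd a a' = e" and A2: "(h, b, h', b') \<in> S" "gcd b b' = e" using pq by (auto simp: A_def p q)
      have pos: "0 < a" "0 < b" "real a < N" "real b < N" using apos[OF A1(1)] apos[OF A2(1)] A1 A2 by (auto simp: S_def)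
      have ne: "a' * b \<noteq> b' * a"
      proof
        assume "a' * b = b' * a"
        hence "a * b' = b * a'" by (simp add: mult.commute)
        from cross_product_gcd_eq[OF this] A1 A2 e have "a = b" "a' = b'" by auto
        thus False using pq by (simp add: p q)
      qed
      have "e dvd a" "e dvd a'" "e dvd b" "e dvd b'" using A1(2) A2(2) gcd_dvd1 gcd_dvd2 by metis+
      hence "int (e * e) dvd int (a' * b) - int (b' * a)"
        by (intro dvd_diff) (auto simp only: of_nat_dvd_iff intro!: mult_dvd_mono)
      moreover have "int (a' * b) - int (b' * a) \<noteq> 0" using ne by linarith
      ultimately have "int (e * e) \<le> \<bar>int (a' * b) - int (b' * a)\<bar>" by (metis dvd_imp_le_int abs_of_nat)
      hence "real (e * e) \<le> \<bar>real (a' * b) - real (b' * a)\<bar>" by linarith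
      hence 1: "real e ^ 2 \<le> \<bar>real (a' * b) - real (b' * a)\<bar>" by (simp add: power2_eq_square)
      have "r p - r q = (real (a' * b) - real (b' * a)) / (real a * real b)"
        using pos by (simp add: r_def p q field_simps)
      hence "\<bar>r p - r q\<bar> = \<bar>real (a' * b) - real (b' * a)\<bar> / (real a * real b)"
        using pos by (simp add: abs_divide abs_mult)
      also have "\<dots> \<ge> real e ^ 2 / N ^ 2"
        using 1 pos N unfolding power2_eq_square[of N] by (intro frac_le mult_mono) auto
      finally show ?thesis .
    qed
    have diam: "\<bar>r p - r q\<bar> \<le> 4 * \<epsilon> / (\<gamma> * real h')" if pq: "p \<in> A" "q \<in> A" for p q
    proof -
      obtain a a' where p: "p = (a, a')" by (cases p) blast
      obtain b b' where q: "q = (b, b')" by (cases q) blast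
      have A1: "(h, a, h', a') \<in> S" and A2: "(h, b, h', b') \<in> S" using pq by (auto simp: A_def p q)
      have rp: "0 < r p" "r p \<le> 2" using A1 apos[OF A1] by (auto simp: r_def p S_def field_simps)
      have rq: "0 < r q" "r q \<le> 2" using A2 apos[OF A2] by (auto simp: r_def q S_def field_simps)
      have "\<gamma> / 2 * \<bar>r p - r q\<bar> \<le> \<bar>r p powr \<gamma> - r q powr \<gamma>\<bar>" using \<gamma> rp rq by (intro powr_diff_lower) auto
      also have "\<dots> \<le> \<epsilon> / real h' + \<epsilon> / real h'" using ratio[OF A1] ratio[OF A2] by (auto simp: r_def p q)
      finally have "\<bar>r p - r q\<bar> * \<gamma> \<le> 4 * (\<epsilon> / real h')" by (simp add: field_simps)
      hence "\<bar>r p - r q\<bar> \<le> 4 * (\<epsilon> / real h') / \<gamma>" using \<gamma> by (subst pos_le_divide_eq) auto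
      thus ?thesis by (simp add: mult.commute)
    qed
    have injr: "inj_on r A"
    proof (rule inj_onI, rule ccontr)
      fix p q assume "p \<in> A" "q \<in> A" "r p = r q" "p \<noteq> q"
      moreover have "real e ^ 2 / N ^ 2 > 0" using e N by (intro divide_pos_pos) auto
      ultimately show False using sp[of p q] by simp
    qed
    have "real (card (r ` A)) \<le> 1 + (4 * \<epsilon> / (\<gamma> * real h')) / (real e ^ 2 / N ^ 2)"
    proof (rule card_spaced_le)
      show "real e ^ 2 / N ^ 2 \<le> \<bar>x - y\<bar>" if "x \<in> r ` A" "y \<in> r ` A" "x \<noteq> y" for x y
        using that sp by blast
      show "\<bar>x - y\<bar> \<le> 4 * \<epsilon> / (\<gamma> * real h')" if "x \<in> r ` A" "y \<in> r ` A" for x y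
        using that diam by blast
    qed (use finA e N \<epsilon> \<gamma> in auto)
    also have "(4 * \<epsilon> / (\<gamma> * real h')) / (real e ^ 2 / N ^ 2) = Z / (real h' * real e ^ 2)"
    proof -
      have "N powr (2 - 2 * \<gamma>) = N ^ 2 * N powr (- 2 * \<gamma>)"
        using N by (simp add: powr_diff powr_minus_divide powr_numeral)
      thus ?thesis by (simp add: Z_def \<epsilon>_def mult_ac)
    qed
    finally show ?thesis using card_image[OF injr] by (simp add: A_def)
  qed
  have b2: "real (card (Sde d e)) \<le> (real H / real d)^2 + (real H / real d) * (Z * harm H / real e)" if d: "d > 0" and e: "e > 0" for d e
  proof -
    define Hd where "Hd = {h::nat. d dvd h \<and> 0 < h \<and> real h \<le> real H}"
    have finH: "finite Hd" and cH: "real (card Hd) \<le> real H / real d" using card_multiples_le[OF d, of "real H"] by (auto simp: Hd_def)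
    have HdH: "Hd \<subseteq> {1..H}" by (auto simp: Hd_def)
    define fibre where "fibre = (\<lambda>(h, h'). (\<lambda>(a, a'). (h, a, h', a')) ` {(a, a'). (h, a, h', a') \<in> S \<and> gcd a a' = e})"
    have sub: "Sde d e \<subseteq> (\<Union>p\<in>Hd \<times> Hd. fibre p)"
    proof
      fix t assume t: "t \<in> Sde d e"
      obtain h a h' a' where q: "t = (h, a, h', a')" by (cases t) auto
      have q1: "(h, a, h', a') \<in> S" "gcd h h' = d" "gcd a a' = e" using t by (auto simp: Sde_def q)
      have "(h, h') \<in> Hd \<times> Hd" using q1 by (auto simp: Hd_def S_def)
      moreover have "t \<in> fibre (h, h')" using q1 by (auto simp: fibre_def q)
      ultimately show "t \<in> (\<Union>p\<in>Hd \<times> Hd. fibre p)" by blast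
    qed
    have finf: "finite {(a, a'). (h, a, h', a') \<in> S \<and> gcd a a' = e}" for h h'
      by (rule finite_subset[of _ "{..n} \<times> {..n}"]) (use an in \<open>auto simp: S_def\<close>)
    have "card (Sde d e) \<le> card (\<Union>p\<in>Hd \<times> Hd. fibre p)"
      by (rule card_mono[OF _ sub]) (use finH finf in \<open>auto simp: fibre_def\<close>)
    also have "\<dots> \<le> (\<Sum>p\<in>Hd \<times> Hd. card (fibre p))" using finH by (intro card_UN_le) auto
    finally have "real (card (Sde d e)) \<le> (\<Sum>p\<in>Hd \<times> Hd. real (card (fibre p)))" by (simp flip: of_nat_sum)
    also have "\<dots> \<le> (\<Sum>p\<in>Hd \<times> Hd. 1 + Z / (real (snd p) * real e ^ 2))"
    proof (rule sum_mono)
      fix p assume p: "p \<in> Hd \<times> Hd"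
      obtain h h' where hh: "p = (h, h')" by (cases p) blast
      have "card (fibre p) \<le> card {(a, a'). (h, a, h', a') \<in> S \<and> gcd a a' = e}"
        unfolding fibre_def hh by (simp add: card_image_le[OF finf])
      hence "real (card (fibre p)) \<le> real (card {(a, a'). (h, a, h', a') \<in> S \<and> gcd a a' = e})" by simp
      also have "\<dots> \<le> 1 + Z / (real h' * real e ^ 2)" using p by (intro fib[OF e]) (auto simp: hh Hd_def)
      finally show "real (card (fibre p)) \<le> 1 + Z / (real (snd p) * real e ^ 2)" by (simp add: hh)
    qed
    also have "\<dots> = real (card Hd) * (\<Sum>h'\<in>Hd. 1 + Z / (real h' * real e ^ 2))"
      by (simp add: sum.cartesian_product' case_prod_unfold)
    also have "(\<Sum>h'\<in>Hd. 1 + Z / (real h' * real e ^ 2)) = real (card Hd) + Z / real e ^ 2 * (\<Sum>h'\<in>Hd. 1 / real h')"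
    proof -
      have "Z / (real h' * real e ^ 2) = Z / real e ^ 2 * (1 / real h')" for h' :: nat by simp
      thus ?thesis by (simp only: sum.distrib sum_distrib_left[symmetric]) simp
    qed
    also have "real (card Hd) * \<dots> \<le> (real H / real d) * (real H / real d + Z / real e * harm H)"
    proof (intro mult_mono add_mono cH)
      have "(\<Sum>h'\<in>Hd. 1 / real h') \<le> (\<Sum>h'\<in>{1..H}. 1 / real h')" using HdH by (intro sum_mono2) auto
      thus "(\<Sum>h'\<in>Hd. 1 / real h') \<le> harm H" by (simp add: harm_def inverse_eq_divide)
      have "real e * 1 \<le> real e * real e" using e by (intro mult_left_mono) auto
      thus "Z / real e ^ 2 \<le> Z / real e" using Z e by (intro divide_left_mono) (auto simp: power2_eq_square)
    qed (use Z in \<open>auto intro!: sum_nonneg add_nonneg_nonneg mult_nonneg_nonneg divide_nonneg_nonneg simp: harm_nonneg\<close>)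
    finally show ?thesis by (simp add: power2_eq_square algebra_simps)
  qed
  \<comment> \<open>The smaller of \<open>(H / d)^2\<close> and \<open>(N / e)^2\<close> is at most
    the product \<open>H * N / (d * e)\<close>, and summing \<open>1 / (d * e)\<close> costs only
    harmonic numbers.\<close>
  have de: "real (card (Sde d e)) \<le> (real H * N + real H * Z * harm H) * (1 / real d * (1 / real e))" if d: "d > 0" and e: "e > 0" for d e
  proof -
    define A where "A = real H / real d"
    define B where "B = N / real e"
    define Y where "Y = A * (Z * harm H / real e)"
    have pos: "A \<ge> 0" "B \<ge> 0" "Y \<ge> 0" using N Z by (auto simp: A_def B_def Y_def harm_nonneg)
    have "real (card (Sde d e)) \<le> A * B + Y"
    proof (cases "A \<le> B")
      case True
      have "A * A \<le> A * B" using True pos by (intro mult_left_mono) auto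
      thus ?thesis using b2[OF d e] by (simp add: A_def Y_def power2_eq_square)
    next
      case False
      have "B * B \<le> A * B" using False pos by (intro mult_right_mono) auto
      thus ?thesis using b1[OF d e] pos by (simp add: B_def power2_eq_square)
    qed
    also have "\<dots> = (real H * N + real H * Z * harm H) * (1 / real d * (1 / real e))"
      by (simp add: A_def B_def Y_def add_divide_distrib distrib_right mult_ac)
    finally show ?thesis .
  qed
  have "S \<subseteq> (\<Union>p\<in>{1..H} \<times> {1..n}. Sde (fst p) (snd p))"
  proof
    fix t assume t: "t \<in> S"
    obtain h a h' a' where q: "t = (h, a, h', a')" by (cases t) auto
    have S: "(h, a, h', a') \<in> S" using t q by simp
    have "gcd h h' \<in> {1..H}" using apos[OF S] S le_trans[OF gcd_le1_nat[of h h'], of H] by (auto simp: S_def Suc_le_eq)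
    moreover have "gcd a a' \<in> {1..n}" using apos[OF S] S le_trans[OF gcd_le1_nat[of a a'], of n] an[of a] by (auto simp: S_def Suc_le_eq)
    ultimately show "t \<in> (\<Union>p\<in>{1..H} \<times> {1..n}. Sde (fst p) (snd p))" using S by (force simp: Sde_def q)
  qed
  hence "card S \<le> card (\<Union>p\<in>{1..H} \<times> {1..n}. Sde (fst p) (snd p))" using finde by (intro card_mono) auto
  also have "\<dots> \<le> (\<Sum>p\<in>{1..H} \<times> {1..n}. card (Sde (fst p) (snd p)))" by (intro card_UN_le) auto
  finally have "real (card S) \<le> (\<Sum>p\<in>{1..H} \<times> {1..n}. real (card (Sde (fst p) (snd p))))" by (simp flip: of_nat_sum)
  also have "\<dots> \<le> (\<Sum>p\<in>{1..H} \<times> {1..n}. (real H * N + real H * Z * harm H) * (1 / real (fst p) * (1 / real (snd p))))"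
    by (intro sum_mono de) auto
  also have "\<dots> = (real H * N + real H * Z * harm H) * (harm H * harm n)"
  proof -
    have "(\<Sum>p\<in>{1..H} \<times> {1..n}. 1 / real (fst p) * (1 / real (snd p))) = (\<Sum>d\<in>{1..H}. \<Sum>e\<in>{1..n}. 1 / real d * (1 / real e))"
      by (simp add: sum.cartesian_product case_prod_unfold)
    also have "\<dots> = harm H * harm n" by (simp add: sum_product harm_def inverse_eq_divide)
    finally show ?thesis by (simp only: sum_distrib_left[symmetric])
  qed
  also have "\<dots> \<le> (5 * (real H * N) * harm H) * (harm H * harm n)"
  proof (intro mult_right_mono)
    have h1: "harm H \<ge> (1::real)" using harm_mono[OF H(1), where 'a = real] by (simp add: harm_expand)
    have "N powr (2 - 2 * \<gamma>) \<le> N powr 1" using N \<gamma> by (intro powr_mono) auto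
    hence "2 * N powr (2 - 2 * \<gamma>) / \<gamma> \<le> 2 * N / (1/2)" using N \<gamma> by (intro frac_le) auto
    hence ZN: "Z \<le> 4 * N" by (simp add: Z_def)
    have "real H * N * 1 + real H * Z * harm H \<le> real H * N * harm H + real H * (4 * N) * harm H"
      using h1 ZN N by (intro add_mono mult_left_mono mult_right_mono) (auto simp: harm_nonneg)
    thus "real H * N + real H * Z * harm H \<le> 5 * (real H * N) * harm H" by (simp add: algebra_simps)
  qed (auto simp: harm_nonneg)
  also have "\<dots> = 5 * (harm H)^2 * harm (nat \<lfloor>N\<rfloor>) * (real H * N)" by (simp add: n_def power2_eq_square mult_ac)
  finally show "real (card S) \<le> 5 * (harm H)^2 * harm (nat \<lfloor>N\<rfloor>) * (real H * N)" .
qed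

section \<open>The double large sieve\<close>

lemma square_integral_le:
  fixes f :: "real \<Rightarrow> real"
  assumes ab: "a \<le> b" and f: "continuous_on {a..b} f"
  shows "(integral {a..b} f)\<^sup>2 \<le> (b - a) * integral {a..b} (\<lambda>x. (f x)\<^sup>2)"
proof (cases "a = b")
  case False
  define I where "I = integral {a..b} f"
  define m where "m = I / (b - a)"
  have i1: "f integrable_on {a..b}" and i2: "(\<lambda>x. (f x)\<^sup>2) integrable_on {a..b}"
    by (auto intro!: integrable_continuous_real continuous_intros f)
  have hi: "((\<lambda>x. (f x)\<^sup>2 - 2 * m * f x + m\<^sup>2) has_integral (integral {a..b} (\<lambda>x. (f x)\<^sup>2) - 2 * m * I + m\<^sup>2 * (b - a))) {a..b}"
    unfolding I_def
    using has_integral_const_real[of "m\<^sup>2" a b] ab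
    by (intro has_integral_add has_integral_diff has_integral_mult_right integrable_integral i1 i2) (simp add: mult.commute)
  have nn: "0 \<le> (f x)\<^sup>2 - 2 * m * f x + m\<^sup>2" for x
    using zero_le_power2[of "f x - m"] by (simp only: power2_diff) (simp add: algebra_simps)
  have "0 \<le> integral {a..b} (\<lambda>x. (f x)\<^sup>2) - 2 * m * I + m\<^sup>2 * (b - a)"
    by (rule has_integral_nonneg[OF hi]) (rule nn)
  moreover have "m * (b - a) = I" using False by (simp add: m_def)
  hence "m\<^sup>2 * (b - a) = m * I" by (simp add: power2_eq_square)
  ultimately have "m * I \<le> integral {a..b} (\<lambda>x. (f x)\<^sup>2)" by linarith
  hence "(b - a) * (m * I) \<le> (b - a) * integral {a..b} (\<lambda>x. (f x)\<^sup>2)" using ab by (intro mult_left_mono) auto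
  moreover have "(b - a) * (m * I) = I\<^sup>2" using False by (simp add: m_def power2_eq_square)
  ultimately show ?thesis by (simp add: I_def)
qed simp

text \<open>Integrating the exponential over a window of radius \<open>\<Delta>\<close> reproduces
  its value at the centre times \<open>I = sin (2 * pi * \<Delta> * f) / (pi * f)\<close>. The
  condition \<open>4 * \<Delta> * f \<le> 1\<close> keeps the argument of the sine at most
  \<open>pi / 2\<close>, hence \<open>I \<ge> \<Delta>\<close>. The factor \<open>I\<close> is
  independent of the centre.\<close>

lemma local_average:
  fixes \<Delta> f :: real
  assumes f: "f > 0" and \<Delta>: "\<Delta> > 0" "4 * \<Delta> * f \<le> 1"
  obtains I :: real where "\<And>x. ((\<lambda>t. ec (t * f)) has_integral of_real I * ec (x * f)) {x-\<Delta>..x+\<Delta>}" "I \<ge> \<Delta>"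
proof
  define I where "I = sin (2 * pi * (\<Delta> * f)) / (pi * f)"
  have "pi * 2 * (\<Delta> * f) \<le> pi / 2" using \<Delta>(2) mult_left_mono[of "4 * (\<Delta> * f)" 1 pi] by simp
  hence "2 * pi * (\<Delta> * f) / 2 \<le> sin (2 * pi * (\<Delta> * f))" using f \<Delta> by (intro sin_ge_half) auto
  hence "(2 * pi * (\<Delta> * f) / 2) / (pi * f) \<le> I" unfolding I_def using f by (intro divide_right_mono) auto
  thus "I \<ge> \<Delta>" using f by simp
  show "((\<lambda>t. ec (t * f)) has_integral of_real I * ec (x * f)) {x-\<Delta>..x+\<Delta>}" for x
  proof -
    have "((\<lambda>t. ec (t * f)) has_integral (ec ((x + \<Delta>) * f) / (2 * pi * \<i> * f) - ec ((x - \<Delta>) * f) / (2 * pi * \<i> * f))) {x-\<Delta>..x+\<Delta>}"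
    proof (rule fundamental_theorem_of_calculus)
      fix t
      have "((\<lambda>t. t * f) has_real_derivative f) (at t within {x-\<Delta>..x+\<Delta>})" by (auto intro!: derivative_eq_intros)
      from has_vector_derivative_divide[OF ec_has_vector_derivative[OF this], of "2 * pi * \<i> * f"]
      show "((\<lambda>t. ec (t * f) / (2 * pi * \<i> * f)) has_vector_derivative ec (t * f)) (at t within {x-\<Delta>..x+\<Delta>})" using f by simp
    qed (use \<Delta> in simp)
    moreover have "ec ((x + \<Delta>) * f) / (2 * pi * \<i> * f) - ec ((x - \<Delta>) * f) / (2 * pi * \<i> * f) = of_real I * ec (x * f)"
    proof -
      have "ec ((x + \<Delta>) * f) = ec (x * f) * ec (\<Delta> * f)" "ec ((x - \<Delta>) * f) = ec (x * f) * cnj (ec (\<Delta> * f))"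
        by (simp_all only: distrib_right left_diff_distrib ec_add ec_diff)
      moreover have "ec (\<Delta> * f) - cnj (ec (\<Delta> * f)) = 2 * \<i> * sin (2 * pi * (\<Delta> * f))"
        by (simp add: ec_def complex_eq_iff)
      ultimately have "ec ((x + \<Delta>) * f) - ec ((x - \<Delta>) * f) = ec (x * f) * (2 * \<i> * sin (2 * pi * (\<Delta> * f)))"
        by (simp only: right_diff_distrib[symmetric])
      thus ?thesis using f unfolding diff_divide_distrib[symmetric] by (simp add: I_def)
    qed
    ultimately show ?thesis by simp
  qed
qed

lemma quad_energy_mono_set:
  assumes "finite I" "B \<subseteq> I"
  shows "quad_energy \<phi> B X \<le> quad_energy \<phi> I X"
  using quad_energy_disjoint_family[of I "{()}" "\<lambda>_. B" \<phi> X] assms by simp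

lemma integral_cells:
  fixes f :: "real \<Rightarrow> real"
  assumes f: "\<And>S. continuous_on S f" and \<Delta>: "\<Delta> > 0"
  shows "integral {s..s + real n * \<Delta>} f = (\<Sum>i<n. integral {s + real i * \<Delta>..s + real (i + 1) * \<Delta>} f)"
proof (induction n)
  case (Suc n)
  have "integral {s..s + real n * \<Delta>} f + integral {s + real n * \<Delta>..s + real (n + 1) * \<Delta>} f = integral {s..s + real (n + 1) * \<Delta>} f"
    by (rule Henstock_Kurzweil_Integration.integral_combine)
       (use \<Delta> in \<open>auto intro!: integrable_continuous_real f mult_right_mono\<close>)
  thus ?case using Suc by simp
qed simp

text \<open>Each squared value of the sum is bounded by a local mean square, and the points are
  sorted into cells of length \<open>\<Delta>\<close>. Cauchy-Schwarz over the cells separates the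
  two sides: the squared occupation numbers count pairs of points in a common cell, and the squared
  local integrals are controlled by a fourth moment over a window of length about \<open>X\<close>,
  hence by the energy.\<close>

lemma double_large_sieve:
  fixes x :: "'a \<Rightarrow> real" and \<phi> :: "'b \<Rightarrow> real"
  assumes finP: "finite P" and finB: "finite B"
    and x: "\<And>p. p \<in> P \<Longrightarrow> 0 \<le> x p \<and> x p \<le> X"
    and \<phi>: "\<And>b. b \<in> B \<Longrightarrow> 0 < \<phi> b \<and> 4 * \<Delta> * \<phi> b \<le> 1" and \<Delta>: "\<Delta> > 0" and X: "X > 0"
  shows "(\<Sum>p\<in>P. (norm (\<Sum>b\<in>B. ec (x p * \<phi> b)))\<^sup>2)
    \<le> 12 * sqrt (real (card {(p, p'). p \<in> P \<and> p' \<in> P \<and> \<bar>x p - x p'\<bar> \<le> \<Delta>}) * ((X + 3 * \<Delta>) / \<Delta>) * quad_energy \<phi> B X)"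
proof -
  have "\<exists>I. \<forall>b\<in>B. (\<forall>y. ((\<lambda>t. ec (t * \<phi> b)) has_integral of_real (I b) * ec (y * \<phi> b)) {y-\<Delta>..y+\<Delta>}) \<and> I b \<ge> \<Delta>"
  proof (rule bchoice, rule ballI)
    fix b assume b: "b \<in> B"
    show "\<exists>I. (\<forall>y. ((\<lambda>t. ec (t * \<phi> b)) has_integral of_real I * ec (y * \<phi> b)) {y-\<Delta>..y+\<Delta>}) \<and> I \<ge> \<Delta>"
      by (rule local_average[of "\<phi> b" \<Delta>]) (use \<phi>[OF b] \<Delta> in blast)+
  qed
  then obtain I where I: "\<And>b y. b \<in> B \<Longrightarrow> ((\<lambda>t. ec (t * \<phi> b)) has_integral of_real (I b) * ec (y * \<phi> b)) {y-\<Delta>..y+\<Delta>}"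
    "\<And>b. b \<in> B \<Longrightarrow> I b \<ge> \<Delta>" by blast
  have I0: "I b > 0" if "b \<in> B" for b using I(2)[OF that] \<Delta> by linarith
  \<comment> \<open>The coefficients \<open>1 / I b\<close> undo the damping of each frequency, so
    that integrating \<open>F\<close> over the window of radius \<open>\<Delta>\<close> returns the
    original sum at its centre.\<close>
  define F where "F = (\<lambda>t. \<Sum>b\<in>B. of_real (1 / I b) * ec (t * \<phi> b))"
  have cF: "continuous_on S F" for S unfolding F_def by (intro continuous_intros)
  define f where "f = (\<lambda>t. (norm (F t))\<^sup>2)"
  have cf: "continuous_on S f" for S unfolding f_def by (intro continuous_intros cF)
  have f0: "f t \<ge> 0" for t by (simp add: f_def)
  have rep: "(norm (\<Sum>b\<in>B. ec (y * \<phi> b)))\<^sup>2 \<le> 2 * \<Delta> * integral {y-\<Delta>..y+\<Delta>} f" for y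
  proof -
    have "(F has_integral (\<Sum>b\<in>B. of_real (1 / I b) * (of_real (I b) * ec (y * \<phi> b)))) {y-\<Delta>..y+\<Delta>}"
      unfolding F_def by (intro has_integral_sum finB has_integral_mult_right I)
    also have "(\<Sum>b\<in>B. of_real (1 / I b) * (of_real (I b) * ec (y * \<phi> b))) = (\<Sum>b\<in>B. ec (y * \<phi> b))"
      using I0 by (intro sum.cong refl) force
    finally have "norm (\<Sum>b\<in>B. ec (y * \<phi> b)) = norm (integral {y-\<Delta>..y+\<Delta>} F)" by (simp add: integral_unique)
    also have "\<dots> \<le> integral {y-\<Delta>..y+\<Delta>} (\<lambda>t. norm (F t))"
      by (rule integral_norm_bound_integral) (auto intro!: integrable_continuous_real continuous_intros cF)
    finally have "(norm (\<Sum>b\<in>B. ec (y * \<phi> b)))\<^sup>2 \<le> (integral {y-\<Delta>..y+\<Delta>} (\<lambda>t. norm (F t)))\<^sup>2" by (intro power_mono) auto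
    also have "\<dots> \<le> ((y + \<Delta>) - (y - \<Delta>)) * integral {y-\<Delta>..y+\<Delta>} (\<lambda>t. (norm (F t))\<^sup>2)"
      by (rule square_integral_le) (use \<Delta> in \<open>auto intro!: continuous_intros cF\<close>)
    finally show ?thesis by (simp add: f_def)
  qed
  define k where "k = (\<lambda>p. nat \<lfloor>x p / \<Delta>\<rfloor>)"
  define m where "m = nat \<lfloor>X / \<Delta>\<rfloor>"
  have kx: "real (k p) * \<Delta> \<le> x p" "x p < (real (k p) + 1) * \<Delta>" "k p \<le> m" if "p \<in> P" for p
  proof -
    have q: "x p / \<Delta> \<ge> 0" using x[OF that] \<Delta> by simp
    have "real (k p) \<le> x p / \<Delta>" "x p / \<Delta> < real (k p) + 1" unfolding k_def using q by linarith+
    thus "real (k p) * \<Delta> \<le> x p" "x p < (real (k p) + 1) * \<Delta>" using \<Delta> by (simp_all add: field_simps)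
    have "x p / \<Delta> \<le> X / \<Delta>" using x[OF that] \<Delta> by (intro divide_right_mono) auto
    thus "k p \<le> m" unfolding k_def m_def by (intro nat_mono floor_mono)
  qed
  \<comment> \<open>The grid starts one cell to the left of 0: the window of radius
    \<open>\<Delta>\<close> around a point with cell number \<open>i\<close> then lies in the three
    cells forming \<open>w i\<close>.\<close>
  define s where "s = - \<Delta>"
  define w where "w = (\<lambda>i::nat. integral {s + real i * \<Delta>..s + real (i + 3) * \<Delta>} f)"
  have w0: "w i \<ge> 0" for i unfolding w_def by (intro integral_nonneg integrable_continuous_real cf f0)
  have xw: "integral {x p-\<Delta>..x p+\<Delta>} f \<le> w (k p)" if "p \<in> P" for p
    unfolding w_def s_def using kx[OF that]
    by (intro integral_subset_le integrable_continuous_real cf) (auto simp: f0 algebra_simps)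
  have "(\<Sum>p\<in>P. (norm (\<Sum>b\<in>B. ec (x p * \<phi> b)))\<^sup>2) \<le> (\<Sum>p\<in>P. 2 * \<Delta> * w (k p))"
    by (intro sum_mono order_trans[OF rep] mult_left_mono xw) (use \<Delta> in auto)
  also have "\<dots> = 2 * \<Delta> * (\<Sum>i\<le>m. real (card {p\<in>P. k p = i}) * w i)"
  proof -
    have "(\<Sum>p\<in>P. w (k p)) = (\<Sum>i\<le>m. \<Sum>p\<in>{p\<in>P. k p = i}. w (k p))"
      by (rule sum.group[symmetric]) (use finP kx in auto)
    also have "\<dots> = (\<Sum>i\<le>m. real (card {p\<in>P. k p = i}) * w i)"
      by (intro sum.cong refl) (simp add: sum_constant)
    finally show ?thesis by (simp add: sum_distrib_left[symmetric])
  qed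
  finally have b1: "(\<Sum>p\<in>P. (norm (\<Sum>b\<in>B. ec (x p * \<phi> b)))\<^sup>2) \<le> 2 * \<Delta> * (\<Sum>i\<le>m. real (card {p\<in>P. k p = i}) * w i)" .
  have b2: "(\<Sum>i\<le>m. real (card {p\<in>P. k p = i}) * w i) \<le> sqrt ((\<Sum>i\<le>m. (real (card {p\<in>P. k p = i}))\<^sup>2) * (\<Sum>i\<le>m. (w i)\<^sup>2))"
    by (rule real_le_rsqrt) (rule Cauchy_Schwarz_ineq_sum)
  have b3: "(\<Sum>i\<le>m. (real (card {p\<in>P. k p = i}))\<^sup>2) \<le> real (card {(p, p'). p \<in> P \<and> p' \<in> P \<and> \<bar>x p - x p'\<bar> \<le> \<Delta>})"
  proof -
    have "(\<Sum>i\<le>m. (real (card {p\<in>P. k p = i}))\<^sup>2) = (\<Sum>i\<le>m. real (card ({p\<in>P. k p = i} \<times> {p\<in>P. k p = i})))"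
      by (simp add: card_cartesian_product power2_eq_square)
    also have "\<dots> = real (card (\<Union>i\<in>{..m}. {p\<in>P. k p = i} \<times> {p\<in>P. k p = i}))"
      using finP by (subst card_UN_disjoint) auto
    also have "\<dots> \<le> real (card {(p, p'). p \<in> P \<and> p' \<in> P \<and> \<bar>x p - x p'\<bar> \<le> \<Delta>})"
    proof (intro of_nat_mono card_mono)
      show "finite {(p, p'). p \<in> P \<and> p' \<in> P \<and> \<bar>x p - x p'\<bar> \<le> \<Delta>}"
        by (rule finite_subset[of _ "P \<times> P"]) (use finP in auto)
      have "\<bar>x p - x p'\<bar> \<le> \<Delta>" if "p \<in> P" "p' \<in> P" "k p = k p'" for p p'
        using kx[OF that(1)] kx[OF that(2)] that(3) by (auto simp: distrib_right)
      thus "(\<Union>i\<in>{..m}. {p\<in>P. k p = i} \<times> {p\<in>P. k p = i}) \<subseteq> {(p, p'). p \<in> P \<and> p' \<in> P \<and> \<bar>x p - x p'\<bar> \<le> \<Delta>}" by auto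
    qed
    finally show ?thesis .
  qed
  \<comment> \<open>By Cauchy-Schwarz the square of \<open>w i\<close> is at most
    \<open>3 * \<Delta>\<close> times the fourth moment over its three cells, and summation over
    \<open>i\<close> uses each cell at most three times; together this is
    \<open>9 * \<Delta>\<close>.\<close>
  have b4: "(\<Sum>i\<le>m. (w i)\<^sup>2) \<le> 36 * ((X + 3 * \<Delta>) / \<Delta> ^ 3) * quad_energy \<phi> B X"
  proof -
    define cell where "cell = (\<lambda>i. integral {s + real i * \<Delta>..s + real (i + 1) * \<Delta>} (\<lambda>t. norm (F t) ^ 4))"
    have c4: "continuous_on S (\<lambda>t. norm (F t) ^ 4)" for S by (intro continuous_intros cF)
    have cell0: "cell i \<ge> 0" for i unfolding cell_def by (intro integral_nonneg integrable_continuous_real c4) auto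
    have w2: "(w i)\<^sup>2 \<le> 3 * \<Delta> * (cell i + cell (i + 1) + cell (i + 2))" for i
    proof -
      have "(w i)\<^sup>2 \<le> ((s + real (i + 3) * \<Delta>) - (s + real i * \<Delta>)) * integral {s + real i * \<Delta>..s + real (i + 3) * \<Delta>} (\<lambda>t. (f t)\<^sup>2)"
        unfolding w_def by (rule square_integral_le) (use \<Delta> cf in \<open>auto intro!: mult_right_mono\<close>)
      also have "(\<lambda>t. (f t)\<^sup>2) = (\<lambda>t. norm (F t) ^ 4)" by (simp add: f_def fun_eq_iff flip: power_mult)
      also have "integral {s + real i * \<Delta>..s + real (i + 3) * \<Delta>} (\<lambda>t. norm (F t) ^ 4) = cell i + cell (i + 1) + cell (i + 2)"
      proof -
        have "integral {(s + real i * \<Delta>)..(s + real i * \<Delta>) + real 3 * \<Delta>} (\<lambda>t. norm (F t) ^ 4)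
           = (\<Sum>l<3. integral {(s + real i * \<Delta>) + real l * \<Delta>..(s + real i * \<Delta>) + real (l + 1) * \<Delta>} (\<lambda>t. norm (F t) ^ 4))"
          by (rule integral_cells[OF c4 \<Delta>])
        also have "\<dots> = cell i + cell (i + 1) + cell (i + 2)"
          by (simp add: cell_def eval_nat_numeral algebra_simps)
        finally show ?thesis by (simp add: algebra_simps)
      qed
      finally show ?thesis by (simp add: algebra_simps)
    qed
    have "(\<Sum>i\<le>m. (w i)\<^sup>2) \<le> (\<Sum>i\<le>m. 3 * \<Delta> * (cell i + cell (i + 1) + cell (i + 2)))" by (rule sum_mono) (rule w2)
    also have "\<dots> = 3 * \<Delta> * ((\<Sum>i\<le>m. cell i) + (\<Sum>i\<le>m. cell (i + 1)) + (\<Sum>i\<le>m. cell (i + 2)))"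
      by (simp only: sum_distrib_left[symmetric] sum.distrib)
    also have "\<dots> \<le> 3 * \<Delta> * ((\<Sum>i<m+3. cell i) + (\<Sum>i<m+3. cell i) + (\<Sum>i<m+3. cell i))"
    proof (intro mult_left_mono add_mono)
      show "(\<Sum>i\<le>m. cell i) \<le> (\<Sum>i<m+3. cell i)" by (intro sum_mono2) (auto simp: cell0)
      have "(\<Sum>i\<le>m. cell (i + 1)) = (\<Sum>i\<in>(\<lambda>i. i + 1) ` {..m}. cell i)" by (subst sum.reindex) (auto simp: inj_on_def)
      also have "\<dots> \<le> (\<Sum>i<m+3. cell i)" by (intro sum_mono2) (auto simp: cell0)
      finally show "(\<Sum>i\<le>m. cell (i + 1)) \<le> (\<Sum>i<m+3. cell i)" .
      have "(\<Sum>i\<le>m. cell (i + 2)) = (\<Sum>i\<in>(\<lambda>i. i + 2) ` {..m}. cell i)" by (subst sum.reindex) (auto simp: inj_on_def)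
      also have "\<dots> \<le> (\<Sum>i<m+3. cell i)" by (intro sum_mono2) (auto simp: cell0)
      finally show "(\<Sum>i\<le>m. cell (i + 2)) \<le> (\<Sum>i<m+3. cell i)" .
    qed (use \<Delta> in auto)
    also have "\<dots> = 9 * \<Delta> * (\<Sum>i<m+3. cell i)" by simp
    finally have c1: "(\<Sum>i\<le>m. (w i)\<^sup>2) \<le> 9 * \<Delta> * (\<Sum>i<m+3. cell i)" .
    have "(\<Sum>i<m+3. cell i) = integral {s..s + real (m + 3) * \<Delta>} (\<lambda>t. norm (F t) ^ 4)"
      unfolding cell_def by (rule integral_cells[OF c4 \<Delta>, symmetric])
    also have "\<dots> \<le> 4 * (real (m + 3) * \<Delta>) * (1 / \<Delta>) ^ 4 * quad_energy \<phi> B (real (m + 3) * \<Delta>)"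
      unfolding F_def
    proof (rule fourth_moment_window)
      show "norm (complex_of_real (1 / I b)) \<le> 1 / \<Delta>" if "b \<in> B" for b
        using I(2)[OF that] I0[OF that] \<Delta> by (simp add: norm_divide frac_le)
    qed (use \<Delta> in simp)
    also have "\<dots> \<le> 4 * (X + 3 * \<Delta>) * (1 / \<Delta>) ^ 4 * quad_energy \<phi> B X"
    proof -
      have q: "X / \<Delta> \<ge> 0" using X \<Delta> by simp
      have "real m \<le> X / \<Delta>" "X / \<Delta> < real m + 1" unfolding m_def using q by linarith+
      hence mm: "real m * \<Delta> \<le> X" "X < (real m + 1) * \<Delta>" using \<Delta> by (simp_all add: field_simps)
      have 1: "real (m + 3) * \<Delta> \<le> X + 3 * \<Delta>" using mm by (simp add: distrib_right)
      have 2: "X \<le> real (m + 3) * \<Delta>" using mm \<Delta> by (simp add: distrib_right)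
      show ?thesis using 1 2 X \<Delta>
        by (intro mult_mono quad_energy_antimono quad_energy_nonneg) (auto intro!: mult_nonneg_nonneg)
    qed
    finally have "9 * \<Delta> * (\<Sum>i<m+3. cell i) \<le> 9 * \<Delta> * (4 * (X + 3 * \<Delta>) * (1 / \<Delta>) ^ 4 * quad_energy \<phi> B X)"
      by (rule mult_left_mono) (use \<Delta> in simp)
    also have "9 * \<Delta> * (4 * (X + 3 * \<Delta>) * (1 / \<Delta>) ^ 4 * quad_energy \<phi> B X) = 36 * ((X + 3 * \<Delta>) / \<Delta> ^ 3) * quad_energy \<phi> B X"
      using \<Delta> by (simp add: field_simps eval_nat_numeral)
    finally show ?thesis by (rule order_trans[OF c1])
  qed
  have fin: "(\<Sum>p\<in>P. (norm (\<Sum>b\<in>B. ec (x p * \<phi> b)))\<^sup>2) \<le> 2 * \<Delta> * sqrt (real (card {(p, p'). p \<in> P \<and> p' \<in> P \<and> \<bar>x p - x p'\<bar> \<le> \<Delta>}) * (36 * ((X + 3 * \<Delta>) / \<Delta> ^ 3) * quad_energy \<phi> B X))"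
  proof -
    have "sqrt ((\<Sum>i\<le>m. (real (card {p\<in>P. k p = i}))\<^sup>2) * (\<Sum>i\<le>m. (w i)\<^sup>2)) \<le> sqrt (real (card {(p, p'). p \<in> P \<and> p' \<in> P \<and> \<bar>x p - x p'\<bar> \<le> \<Delta>}) * (36 * ((X + 3 * \<Delta>) / \<Delta> ^ 3) * quad_energy \<phi> B X))"
      by (intro real_sqrt_le_mono mult_mono b3 b4 sum_nonneg) auto
    from mult_left_mono[OF order_trans[OF b2 this], of "2 * \<Delta>"] \<Delta> show ?thesis by (intro order_trans[OF b1]) simp
  qed
  define P2 where "P2 = real (card {(p, p'). p \<in> P \<and> p' \<in> P \<and> \<bar>x p - x p'\<bar> \<le> \<Delta>})"
  define Z where "Z = P2 * ((X + 3 * \<Delta>) / \<Delta>) * quad_energy \<phi> B X"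
  have eq: "P2 * (36 * ((X + 3 * \<Delta>) / \<Delta> ^ 3) * quad_energy \<phi> B X) = (6 / \<Delta>)\<^sup>2 * Z"
    unfolding Z_def using \<Delta> by (simp add: field_simps eval_nat_numeral)
  have "sqrt ((6 / \<Delta>)\<^sup>2 * Z) = 6 / \<Delta> * sqrt Z" using \<Delta> by (simp add: real_sqrt_mult)
  hence "2 * \<Delta> * sqrt ((6 / \<Delta>)\<^sup>2 * Z) = 12 * sqrt Z" using \<Delta> by simp
  thus ?thesis using fin unfolding P2_def[symmetric] eq unfolding Z_def by simp
qed

section \<open>Gaps modulo one force large exponential sums\<close>

text \<open>These are the coefficients of the \<open>k\<close>-th power of
  \<open>1 + z + ... + z^(L-1)\<close>; the sum over \<open>j < k * L\<close> pads the degree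
  \<open>k * (L - 1)\<close> with zeros.\<close>

lemma power_kernel_coefficients:
  assumes "L \<ge> 1" "k \<ge> 1"
  obtains c :: "nat \<Rightarrow> real" where "\<And>j. c j \<ge> 0" "(\<Sum>j<k * L. c j) = real L ^ k"
    "\<And>t. (\<Sum>j<k * L. of_real (c j) * ec (real j * t)) = (\<Sum>i<L. ec (real i * t)) ^ k"
proof -
  have "\<exists>c :: nat \<Rightarrow> real. (\<forall>j. c j \<ge> 0) \<and> (\<Sum>j<k * L. c j) = real L ^ k \<and>
    (\<forall>t. (\<Sum>j<k * L. of_real (c j) * ec (real j * t)) = (\<Sum>i<L. ec (real i * t)) ^ k)"
    using assms(2)
  proof (induction k rule: nat_induct_at_least)
    case base
    show ?case by (intro exI[of _ "\<lambda>_. 1"]) auto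
  next
    case (Suc k)
    then obtain c :: "nat \<Rightarrow> real" where c: "\<And>j. c j \<ge> 0" "(\<Sum>j<k * L. c j) = real L ^ k"
      "\<And>t. (\<Sum>j<k * L. of_real (c j) * ec (real j * t)) = (\<Sum>i<L. ec (real i * t)) ^ k" by blast
    define c' where "c' = (\<lambda>n. \<Sum>j<k * L. \<Sum>i<L. if j + i = n then c j else 0)"
    \<comment> \<open>The convolution is tested against a function \<open>h\<close> additive in its
      first argument; one exchange of summations then serves both the total mass and the exponential
      identity.\<close>
    have gen: "(\<Sum>n<Suc k * L. h (c' n) n) = (\<Sum>j<k * L. \<Sum>i<L. h (c j) (j + i))"
      if h: "\<And>x y n. h (x + y) n = h x n + h y n" "\<And>n. h 0 n = 0" for h :: "real \<Rightarrow> nat \<Rightarrow> 'z::comm_monoid_add"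
    proof -
      have hs: "h (sum f A) n = (\<Sum>a\<in>A. h (f a) n)" for f :: "nat \<Rightarrow> real" and A n
        by (induction A rule: infinite_finite_induct) (auto simp: h)
      have "(\<Sum>n<Suc k * L. h (c' n) n) = (\<Sum>n<Suc k * L. \<Sum>j<k * L. \<Sum>i<L. h (if j + i = n then c j else 0) n)"
        by (simp add: c'_def hs)
      also have "\<dots> = (\<Sum>j<k * L. \<Sum>i<L. \<Sum>n<Suc k * L. h (if j + i = n then c j else 0) n)"
        by (subst sum.swap, rule sum.cong[OF refl], rule sum.swap)
      also have "\<dots> = (\<Sum>j<k * L. \<Sum>i<L. h (c j) (j + i))"
      proof (intro sum.cong refl)
        fix j i assume ji: "j \<in> {..<k * L}" "i \<in> {..<L}"
        have "(\<Sum>n<Suc k * L. h (if j + i = n then c j else 0) n) = (\<Sum>n<Suc k * L. if n = j + i then h (c j) (j + i) else 0)"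
          by (intro sum.cong refl) (auto simp: h)
        thus "(\<Sum>n<Suc k * L. h (if j + i = n then c j else 0) n) = h (c j) (j + i)" using ji by simp
      qed
      finally show ?thesis .
    qed
    show ?case
    proof (intro exI[of _ c'] conjI allI)
      show "c' j \<ge> 0" for j unfolding c'_def using c(1) by (intro sum_nonneg) auto
      have "(\<Sum>n<Suc k * L. c' n) = (\<Sum>j<k * L. \<Sum>i<L. c j)" using gen[of "\<lambda>x n. x"] by simp
      also have "\<dots> = real L * (\<Sum>j<k * L. c j)" by (simp add: sum_distrib_left)
      finally show "(\<Sum>n<Suc k * L. c' n) = real L ^ Suc k" by (simp add: c(2))
      show "(\<Sum>j<Suc k * L. of_real (c' j) * ec (real j * t)) = (\<Sum>i<L. ec (real i * t)) ^ Suc k" for t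
      proof -
        have "(\<Sum>n<Suc k * L. of_real (c' n) * ec (real n * t)) = (\<Sum>j<k * L. \<Sum>i<L. of_real (c j) * ec (real (j + i) * t))"
          by (rule gen) (auto simp: distrib_right)
        also have "\<dots> = (\<Sum>j<k * L. \<Sum>i<L. (of_real (c j) * ec (real j * t)) * ec (real i * t))"
          by (intro sum.cong refl) (simp add: distrib_right ec_add mult.assoc)
        also have "\<dots> = (\<Sum>j<k * L. of_real (c j) * ec (real j * t)) * (\<Sum>i<L. ec (real i * t))"
          by (simp only: sum_product)
        finally show ?thesis by (simp only: c(3) power_Suc2)
      qed
    qed
  qed
  thus ?thesis using that by blast
qed

text \<open>The geometric series is at most \<open>2 / norm (ec t - 1)\<close>, and
  \<open>norm (ec t - 1) = 2 * \<bar>sin (pi * r)\<bar>\<close> is at least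
  \<open>2 * \<bar>r\<bar>\<close> for the offset \<open>r\<close> of \<open>t\<close> from the
  nearest integer.\<close>

lemma geometric_ec_bound:
  assumes w: "w > 0" and far: "\<And>n::int. w / 2 \<le> \<bar>t - of_int n\<bar>"
  shows "norm (\<Sum>i<L. ec (real i * t)) \<le> 2 / w"
proof -
  define n where "n = round t"
  define r where "r = t - of_int n"
  have r: "\<bar>r\<bar> \<le> 1/2" using of_int_round_abs_le[of t] by (simp add: r_def n_def abs_minus_commute)
  have rw: "w / 2 \<le> \<bar>r\<bar>" using far[of n] by (simp add: r_def)
  have et: "ec t = ec r"
  proof -
    have "ec t = ec (r + of_int n)" by (simp add: r_def)
    thus ?thesis by (simp only: ec_add ec_of_int mult_1_right)
  qed
  have n1: "norm (ec r - 1) = 2 * \<bar>sin (pi * r)\<bar>"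
  proof -
    have "(norm (ec r - 1))\<^sup>2 = (cos (2 * pi * r) - 1)\<^sup>2 + (sin (2 * pi * r))\<^sup>2"
      by (simp add: cmod_power2 ec_def)
    also have "\<dots> = 2 - 2 * cos (2 * pi * r)"
      using sin_cos_squared_add[of "2 * pi * r"] by (simp add: power2_eq_square algebra_simps)
    also have "\<dots> = (2 * \<bar>sin (pi * r)\<bar>)\<^sup>2"
      using cos_double_sin[of "pi * r"] by (simp add: power_mult_distrib mult.assoc)
    finally show ?thesis by (rule power2_eq_imp_eq) auto
  qed
  have ge: "w \<le> norm (ec t - 1)" unfolding et n1 using abs_sin_pi_ge[OF r] rw by linarith
  hence ne: "ec t \<noteq> 1" using w by auto
  have "(\<Sum>i<L. ec (real i * t)) = (\<Sum>i<L. ec t ^ i)" by (simp add: ec_mult_of_nat)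
  also have "\<dots> = (ec t ^ L - 1) / (ec t - 1)" using geometric_sum[OF ne] by simp
  finally have "norm (\<Sum>i<L. ec (real i * t)) = norm (ec t ^ L - 1) / norm (ec t - 1)" by (simp add: norm_divide)
  also have "\<dots> \<le> 2 / w"
  proof (rule frac_le)
    show "norm (ec t ^ L - 1) \<le> 2" using norm_triangle_ineq4[of "ec t ^ L" 1] by (simp add: norm_power)
  qed (use w ge in auto)
  finally show ?thesis .
qed

text \<open>The kernel power \<open>D\<close> is small at every \<open>\<theta> p\<close>, as these
  avoid the integers, while its diagonal mass \<open>E\<close> is large by Cauchy-Schwarz. The
  average of the squared modulus of \<open>D\<close> over \<open>P\<close> can be small only if the
  off-diagonal terms cancel the diagonal, and these are exponential sums over \<open>P\<close> with
  frequencies up to \<open>k * L\<close>. Taking a \<open>k\<close>-th power allows \<open>L\<close>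
  to exceed \<open>1 / w\<close> by a small power of the parameter only, at the price of a large
  \<open>k\<close>.\<close>

lemma gap_forces_exponential_sum:
  fixes \<theta> :: "'a \<Rightarrow> real"
  assumes fin: "finite P" and w: "w > 0" and L: "L \<ge> 1" and k: "k \<ge> 1"
    and far: "\<And>p (n::int). p \<in> P \<Longrightarrow> w / 2 \<le> \<bar>\<theta> p - of_int n\<bar>"
    and big: "2 * real (k * L) \<le> (real L * w / 2) ^ (2 * k)"
  shows "real (card P) \<le> 4 * (\<Sum>h\<in>{1..k * L}. norm (\<Sum>p\<in>P. ec (real h * \<theta> p)))"
proof -
  obtain c :: "nat \<Rightarrow> real" where c: "\<And>j. c j \<ge> 0" "(\<Sum>j<k * L. c j) = real L ^ k"
    "\<And>t. (\<Sum>j<k * L. of_real (c j) * ec (real j * t)) = (\<Sum>i<L. ec (real i * t)) ^ k"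
    using power_kernel_coefficients[OF L k] by blast
  define J where "J = k * L"
  have J: "J \<ge> 1" using L k by (simp add: J_def)
  define D where "D = (\<lambda>t. \<Sum>j<J. of_real (c j) * ec (real j * t))"
  define E where "E = (\<Sum>j<J. (c j)\<^sup>2)"
  define M where "M = real (card P)"
  define S where "S = (\<lambda>h::nat. norm (\<Sum>p\<in>P. ec (real h * \<theta> p)))"
  have upper: "(\<Sum>p\<in>P. (norm (D (\<theta> p)))\<^sup>2) \<le> M * (2 / w) ^ (2 * k)"
  proof -
    have "(norm (D (\<theta> p)))\<^sup>2 \<le> (2 / w) ^ (2 * k)" if p: "p \<in> P" for p
    proof -
      have "norm (D (\<theta> p)) = norm (\<Sum>i<L. ec (real i * \<theta> p)) ^ k" by (simp add: D_def J_def c(3) norm_power)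
      also have "\<dots> \<le> (2 / w) ^ k" by (intro power_mono geometric_ec_bound w far p) auto
      finally have "(norm (D (\<theta> p)))\<^sup>2 \<le> ((2 / w) ^ k)\<^sup>2" by (intro power_mono) auto
      thus ?thesis by (simp add: power_mult[symmetric] mult.commute)
    qed
    hence "(\<Sum>p\<in>P. (norm (D (\<theta> p)))\<^sup>2) \<le> of_nat (card P) * (2 / w) ^ (2 * k)" by (rule sum_bounded_above)
    thus ?thesis by (simp add: M_def)
  qed
  have E: "real L ^ (2 * k) / real J \<le> E"
  proof -
    have "(\<Sum>j<J. c j)\<^sup>2 \<le> E * real (card {..<J})"
      unfolding E_def by (rule sum_squared_le_sum_of_squares)
    hence "real L ^ (2 * k) \<le> E * real J" by (simp add: c(2)[folded J_def] power_mult[symmetric] mult.commute)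
    thus ?thesis using J by (simp add: divide_le_eq)
  qed
  have "0 < real L ^ (2 * k) / real J" using J L by simp
  hence E0: "E > 0" using E by linarith
  have S_sym: "norm (\<Sum>p\<in>P. ec (\<theta> p * (real j - real i))) = S (if i \<le> j then j - i else i - j)" for i j
  proof (cases "i \<le> j")
    case True thus ?thesis by (simp add: S_def of_nat_diff mult.commute)
  next
    case False
    hence "(\<Sum>p\<in>P. ec (\<theta> p * (real j - real i))) = cnj (\<Sum>p\<in>P. ec (real (i - j) * \<theta> p))"
      by (simp add: of_nat_diff ec_minus[symmetric] algebra_simps)
    thus ?thesis using False by (simp only: complex_mod_cnj S_def if_False)
  qed
  have eq: "complex_of_real (\<Sum>p\<in>P. (norm (D (\<theta> p)))\<^sup>2) = (\<Sum>j<J. \<Sum>i<J. of_real (c j * c i) * (\<Sum>p\<in>P. ec (\<theta> p * (real j - real i))))"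
  proof -
    have "complex_of_real ((norm (D t))\<^sup>2) = (\<Sum>j<J. \<Sum>i<J. of_real (c j * c i) * ec (t * (real j - real i)))" for t
    proof -
      have "D t = (\<Sum>j<J. of_real (c j) * ec (t * real j))" by (simp add: D_def mult.commute)
      thus ?thesis using norm_sum_ec_square[of "\<lambda>j. of_real (c j)" t real "{..<J}"] by simp
    qed
    hence "complex_of_real (\<Sum>p\<in>P. (norm (D (\<theta> p)))\<^sup>2) = (\<Sum>p\<in>P. \<Sum>j<J. \<Sum>i<J. of_real (c j * c i) * ec (\<theta> p * (real j - real i)))"
      by simp
    also have "\<dots> = (\<Sum>j<J. \<Sum>i<J. \<Sum>p\<in>P. of_real (c j * c i) * ec (\<theta> p * (real j - real i)))"
      by (subst sum.swap, rule sum.cong[OF refl], rule sum.swap)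
    finally show ?thesis by (simp only: sum_distrib_left)
  qed
  have lower: "E * M - 2 * E * (\<Sum>h\<in>{1..J}. S h) \<le> (\<Sum>p\<in>P. (norm (D (\<theta> p)))\<^sup>2)"
  proof -
    define T where "T = (\<lambda>j i. of_real (c j * c i) * (\<Sum>p\<in>P. ec (\<theta> p * (real j - real i))))"
    have "(\<Sum>j<J. \<Sum>i<J. T j i) = (\<Sum>j<J. T j j + (\<Sum>i\<in>{..<J} - {j}. T j i))"
      by (intro sum.cong refl) (simp add: sum.remove)
    also have "\<dots> = (\<Sum>j<J. T j j) + (\<Sum>j<J. \<Sum>i\<in>{..<J} - {j}. T j i)" by (rule sum.distrib)
    also have "(\<Sum>j<J. T j j) = of_real (E * M)"
      by (simp add: T_def E_def M_def sum_distrib_right power2_eq_square)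
    finally have "complex_of_real (\<Sum>p\<in>P. (norm (D (\<theta> p)))\<^sup>2) = of_real (E * M) + (\<Sum>j<J. \<Sum>i\<in>{..<J} - {j}. T j i)"
      unfolding eq by (simp only: T_def)
    hence "complex_of_real (E * M - (\<Sum>p\<in>P. (norm (D (\<theta> p)))\<^sup>2)) = - (\<Sum>j<J. \<Sum>i\<in>{..<J} - {j}. T j i)" by simp
    from arg_cong[OF this, of norm]
    have "\<bar>E * M - (\<Sum>p\<in>P. (norm (D (\<theta> p)))\<^sup>2)\<bar> = norm (\<Sum>j<J. \<Sum>i\<in>{..<J} - {j}. T j i)"
      by (simp only: norm_minus_cancel norm_of_real)
    also have "\<dots> \<le> (\<Sum>j<J. \<Sum>i\<in>{..<J} - {j}. c j * c i * S (if i \<le> j then j - i else i - j))"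
      unfolding T_def
      by (intro order_trans[OF norm_sum] sum_mono) (simp add: norm_mult S_sym c(1))
    \<comment> \<open>Replacing \<open>c j * c i\<close> by the mean of the squares and exchanging
      \<open>j\<close> and \<open>i\<close> leaves, for each \<open>j\<close>, the weight
      \<open>(c j)\<^sup>2\<close> times a sum of \<open>S\<close> in which every frequency occurs
      at most twice.\<close>
    also have "\<dots> \<le> (\<Sum>j<J. \<Sum>i\<in>{..<J} - {j}. ((c j)\<^sup>2 + (c i)\<^sup>2) / 2 * S (if i \<le> j then j - i else i - j))"
    proof (intro sum_mono mult_right_mono)
      show "c j * c i \<le> ((c j)\<^sup>2 + (c i)\<^sup>2) / 2" for j i using sum_squares_bound[of "c j" "c i"] by simp
    qed (simp add: S_def)
    also have "\<dots> = (\<Sum>j<J. \<Sum>i\<in>{..<J} - {j}. (c j)\<^sup>2 / 2 * S (if i \<le> j then j - i else i - j)) + (\<Sum>j<J. \<Sum>i\<in>{..<J} - {j}. (c i)\<^sup>2 / 2 * S (if i \<le> j then j - i else i - j))"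
      by (simp add: sum.distrib[symmetric] add_divide_distrib distrib_right)
    also have "(\<Sum>j<J. \<Sum>i\<in>{..<J} - {j}. (c i)\<^sup>2 / 2 * S (if i \<le> j then j - i else i - j)) = (\<Sum>j<J. \<Sum>i\<in>{..<J} - {j}. (c j)\<^sup>2 / 2 * S (if i \<le> j then j - i else i - j))"
    proof -
      have sw: "(\<Sum>j<J. \<Sum>i\<in>{..<J} - {j}. h j i) = (\<Sum>j<J. \<Sum>i\<in>{..<J} - {j}. h i j)" for h :: "nat \<Rightarrow> nat \<Rightarrow> real"
      proof -
        have a: "(\<Sum>i\<in>{..<J} - {j}. g i) = (\<Sum>i<J. if i = j then 0 else g i)" for g :: "nat \<Rightarrow> real" and j
          by (rule sum.mono_neutral_cong_left) auto
        have "(\<Sum>j<J. \<Sum>i<J. if i = j then 0 else h j i) = (\<Sum>i<J. \<Sum>j<J. if i = j then 0 else h j i)" by (rule sum.swap)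
        also have "\<dots> = (\<Sum>j<J. \<Sum>i<J. if i = j then 0 else h i j)" by (intro sum.cong refl) auto
        finally show ?thesis unfolding a .
      qed
      have sy: "S (if j \<le> i then i - j else j - i) = S (if i \<le> j then j - i else i - j)" for i j
        by (cases "i = j") (auto simp: not_le)
      show ?thesis by (subst sw) (simp only: sy)
    qed
    finally have l1: "\<bar>E * M - (\<Sum>p\<in>P. (norm (D (\<theta> p)))\<^sup>2)\<bar> \<le> (\<Sum>j<J. \<Sum>i\<in>{..<J} - {j}. (c j)\<^sup>2 / 2 * S (if i \<le> j then j - i else i - j)) + (\<Sum>j<J. \<Sum>i\<in>{..<J} - {j}. (c j)\<^sup>2 / 2 * S (if i \<le> j then j - i else i - j))" .
    have "(\<Sum>j<J. \<Sum>i\<in>{..<J} - {j}. (c j)\<^sup>2 / 2 * S (if i \<le> j then j - i else i - j)) \<le> (\<Sum>j<J. (c j)\<^sup>2 / 2 * (2 * (\<Sum>h\<in>{1..J}. S h)))"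
    proof (rule sum_mono)
      fix j assume j: "j \<in> {..<J}"
      have "(\<Sum>i\<in>{..<J} - {j}. S (if i \<le> j then j - i else i - j)) = (\<Sum>i\<in>{..<j}. S (j - i)) + (\<Sum>i\<in>{j<..<J}. S (i - j))"
      proof -
        have "{..<J} - {j} = {..<j} \<union> {j<..<J}" using j by auto
        moreover have "(\<Sum>i\<in>{..<j} \<union> {j<..<J}. S (if i \<le> j then j - i else i - j)) = (\<Sum>i\<in>{..<j}. S (if i \<le> j then j - i else i - j)) + (\<Sum>i\<in>{j<..<J}. S (if i \<le> j then j - i else i - j))"
          by (rule sum.union_disjoint) auto
        ultimately show ?thesis by simp
      qed
      also have "\<dots> \<le> (\<Sum>h\<in>{1..J}. S h) + (\<Sum>h\<in>{1..J}. S h)"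
      proof (rule add_mono)
        have "(\<Sum>i\<in>{..<j}. S (j - i)) = (\<Sum>h\<in>(\<lambda>i. j - i) ` {..<j}. S h)"
          by (subst sum.reindex) (auto simp: inj_on_def)
        also have "\<dots> \<le> (\<Sum>h\<in>{1..J}. S h)" using j by (intro sum_mono2) (auto simp: S_def)
        finally show "(\<Sum>i\<in>{..<j}. S (j - i)) \<le> (\<Sum>h\<in>{1..J}. S h)" .
        have "(\<Sum>i\<in>{j<..<J}. S (i - j)) = (\<Sum>h\<in>(\<lambda>i. i - j) ` {j<..<J}. S h)"
          by (subst sum.reindex) (auto simp: inj_on_def)
        also have "\<dots> \<le> (\<Sum>h\<in>{1..J}. S h)" by (intro sum_mono2) (auto simp: S_def)
        finally show "(\<Sum>i\<in>{j<..<J}. S (i - j)) \<le> (\<Sum>h\<in>{1..J}. S h)" .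
      qed
      finally have "(\<Sum>i\<in>{..<J} - {j}. S (if i \<le> j then j - i else i - j)) \<le> 2 * (\<Sum>h\<in>{1..J}. S h)" by simp
      hence "(c j)\<^sup>2 / 2 * (\<Sum>i\<in>{..<J} - {j}. S (if i \<le> j then j - i else i - j)) \<le> (c j)\<^sup>2 / 2 * (2 * (\<Sum>h\<in>{1..J}. S h))"
        by (intro mult_left_mono) auto
      thus "(\<Sum>i\<in>{..<J} - {j}. (c j)\<^sup>2 / 2 * S (if i \<le> j then j - i else i - j)) \<le> (c j)\<^sup>2 / 2 * (2 * (\<Sum>h\<in>{1..J}. S h))"
        by (simp only: sum_distrib_left)
    qed
    also have "(\<Sum>j<J. (c j)\<^sup>2 / 2 * (2 * (\<Sum>h\<in>{1..J}. S h))) = E * (\<Sum>h\<in>{1..J}. S h)"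
      by (simp add: E_def sum_distrib_right)
    finally have "(\<Sum>j<J. \<Sum>i\<in>{..<J} - {j}. (c j)\<^sup>2 / 2 * S (if i \<le> j then j - i else i - j)) \<le> E * (\<Sum>h\<in>{1..J}. S h)" .
    thus ?thesis using l1 by linarith
  qed
  \<comment> \<open>Here \<open>big\<close> enters: the pointwise bound for the squared modulus of
    \<open>D\<close> is at most half of the diagonal mass \<open>E\<close>.\<close>
  have half: "(2 / w) ^ (2 * k) \<le> E / 2"
  proof -
    have "2 * real J * (2 / w) ^ (2 * k) \<le> (real L * w / 2) ^ (2 * k) * (2 / w) ^ (2 * k)"
      using big w by (intro mult_right_mono) (auto simp: J_def)
    also have "\<dots> = real L ^ (2 * k)" using w by (simp flip: power_mult_distrib)
    finally have "2 * (2 / w) ^ (2 * k) \<le> real L ^ (2 * k) / real J" using J by (simp add: field_simps)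
    thus ?thesis using E by linarith
  qed
  have "E * M - 2 * E * (\<Sum>h\<in>{1..J}. S h) \<le> M * (E / 2)"
    using lower upper mult_left_mono[OF half, of M] M_def by linarith
  hence "E * (M / 2) \<le> E * (2 * (\<Sum>h\<in>{1..J}. S h))" by (simp add: algebra_simps)
  hence "M / 2 \<le> 2 * (\<Sum>h\<in>{1..J}. S h)" using E0 by (simp only: mult_le_cancel_left_pos)
  thus ?thesis by (simp add: M_def S_def J_def)
qed

section \<open>The main theorem\<close>

lemma eventually_powr_less:
  fixes C D p q :: real
  assumes "p < q" "D > 0"
  shows "eventually (\<lambda>N. C * N powr p < D * N powr q) at_top"
proof -
  have "((\<lambda>N. C * N powr (p - q)) \<longlongrightarrow> C * 0) at_top"
    by (intro tendsto_mult tendsto_const tendsto_neg_powr filterlim_ident) (use assms in simp)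
  hence "eventually (\<lambda>N. C * N powr (p - q) < D) at_top" using assms by (intro order_tendstoD(2)) auto
  thus ?thesis using eventually_gt_at_top[of 0]
  proof eventually_elim
    case (elim N)
    hence "C * N powr (p - q) * N powr q < D * N powr q" by (intro mult_strict_right_mono) auto
    moreover have "N powr (p - q) * N powr q = N powr p" by (simp flip: powr_add)
    ultimately show ?case by (simp only: mult.assoc)
  qed
qed

lemma powr_succ_diff_ge:
  fixes \<gamma> m M :: real
  assumes \<gamma>: "0 < \<gamma>" "\<gamma> < 1" and m: "0 < m" "m + 1 \<le> M"
  shows "\<gamma> * M powr (\<gamma> - 1) \<le> (m + 1) powr \<gamma> - m powr \<gamma>"
proof -
  have "((\<lambda>x. x powr \<gamma>) has_real_derivative \<gamma> * x powr (\<gamma> - 1)) (at x)" if "m \<le> x" for x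
    using that m by (auto intro!: derivative_eq_intros)
  hence "\<exists>z>m. z < m + 1 \<and> (m + 1) powr \<gamma> - m powr \<gamma> = (m + 1 - m) * (\<gamma> * z powr (\<gamma> - 1))"
    by (intro MVT2) auto
  then obtain z where z: "m < z" "z < m + 1" "(m + 1) powr \<gamma> - m powr \<gamma> = (m + 1 - m) * (\<gamma> * z powr (\<gamma> - 1))" by blast
  have "M powr (\<gamma> - 1) \<le> z powr (\<gamma> - 1)" using z m \<gamma> by (intro powr_mono2') auto
  thus ?thesis using z \<gamma> by simp
qed

text \<open>An integer \<open>k\<close> strictly between \<open>m powr (1 / c)\<close> and
  \<open>(m + 1) powr (1 / c)\<close> would satisfy \<open>m < k powr c < m + 1\<close>, so
  \<open>m\<close> would be the integer part of \<open>k powr c\<close>. The shift by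
  \<open>w / 2\<close> moves to the middle of an integer-free interval of length
  \<open>w\<close>.\<close>

lemma no_power_value_gap:
  fixes c w :: real and m :: nat
  assumes c: "c > 1" and m: "m > 0" and w: "w \<le> (real m + 1) powr (1 / c) - real m powr (1 / c)"
    and no: "\<And>n::nat. n > 0 \<Longrightarrow> int m \<noteq> \<lfloor>real n powr c\<rfloor>"
  shows "w / 2 \<le> \<bar>real m powr (1 / c) + w / 2 - of_int k\<bar>"
proof (rule ccontr)
  assume "\<not> ?thesis"
  hence k: "real m powr (1 / c) < of_int k" "of_int k < (real m + 1) powr (1 / c)" using w by linarith+
  have "0 < real m powr (1 / c)" using m by simp
  hence kpos: "(0::real) < of_int k" using k(1) by linarith
  define n where "n = nat k"
  have n: "real n = of_int k" "n > 0" using kpos by (auto simp: n_def)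
  have "(real m powr (1 / c)) powr c < real n powr c" using k(1) n c by (intro powr_less_mono2) auto
  hence 1: "real m < real n powr c" using c m by (simp add: powr_powr)
  have "real n powr c < ((real m + 1) powr (1 / c)) powr c" using k(2) n c by (intro powr_less_mono2) auto
  hence 2: "real n powr c < real m + 1" using c by (simp add: powr_powr)
  have "\<lfloor>real n powr c\<rfloor> = int m" using 1 2 by (intro floor_unique) auto
  thus False using no[OF n(2)] by simp
qed

lemma card_nat_below:
  fixes N :: real
  assumes A: "A \<subseteq> {m. 0 < m \<and> N / 2 \<le> real m \<and> real m < N}" and N: "N \<ge> 0"
  shows "finite A" "real (card A) \<le> N"
proof -
  have sub: "A \<subseteq> {1..nat \<lfloor>N\<rfloor>}" using A by (auto simp: le_nat_iff le_floor_iff)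
  show "finite A" by (rule finite_subset[OF sub]) simp
  have "card A \<le> nat \<lfloor>N\<rfloor>" using card_mono[OF _ sub] by simp
  thus "real (card A) \<le> N" using N by linarith
qed

text \<open>The sieve is applied to the points \<open>h * a powr \<gamma>\<close> and the
  frequencies \<open>b powr \<gamma>\<close>. The lower bound on \<open>H\<close> makes
  \<open>X = H * N powr \<gamma>\<close> at least \<open>N powr (2 - \<gamma>)\<close>, so the
  energy is needed only at the scale of \<open>block_energy\<close>; the upper bound on
  \<open>H\<close> is the condition of the near-product count.\<close>

lemma bilinear_block_bound:
  fixes \<gamma> N \<kappa> K :: real and H j :: nat and A B :: "nat set"
  assumes N: "N \<ge> 2" and \<gamma>: "1/2 \<le> \<gamma>" "\<gamma> < 1" and \<kappa>: "\<kappa> > 0"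
    and K: "K > 0" "block_energy \<gamma> j \<le> K * (2 ^ j) powr (2 + \<kappa>)"
    and H: "N powr (2 - 2 * \<gamma>) \<le> real H" "real H ^ 2 < N powr (2 * \<gamma>)"
    and A: "A \<subseteq> {m. 0 < m \<and> N / 2 \<le> real m \<and> real m < N}"
    and B: "B \<subseteq> {2^j..<2^(j+1)}" "\<And>b. b \<in> B \<Longrightarrow> real b < N" and j: "2 ^ j \<le> N"
    and log: "(1 + ln N) ^ 3 \<le> N powr \<kappa>"
  shows "(\<Sum>p\<in>{1..H} \<times> A. norm (\<Sum>b\<in>B. ec (real (fst p) * real (snd p) powr \<gamma> * real b powr \<gamma>)))
    \<le> sqrt (12 * sqrt (35 * K)) * (real H * N powr (5/4 + \<gamma>/2 + \<kappa>/2))"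
proof -
  \<comment> \<open>The largest radius allowed by
    \<open>4 * \<Delta> * b powr \<gamma> \<le> 1\<close> for all \<open>b\<close> up to
    \<open>N\<close>; it also meets the tolerance of the near-product count.\<close>
  define \<Delta> where "\<Delta> = 1 / (4 * N powr \<gamma>)"
  define X where "X = real H * N powr \<gamma>"
  define P where "P = {1..H} \<times> A"
  define x where "x = (\<lambda>p::nat \<times> nat. real (fst p) * real (snd p) powr \<gamma>)"
  define \<phi> where "\<phi> = (\<lambda>m::nat. real m powr \<gamma>)"
  have Af: "finite A" "real (card A) \<le> N" using card_nat_below[OF A] N by auto
  have finP: "finite P" using Af(1) by (simp add: P_def)
  have finB: "finite B" using B(1) by (rule finite_subset) simp
  have "1 \<le> N powr (2 - 2 * \<gamma>)" using N \<gamma> by (intro ge_one_powr_ge_zero) auto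
  hence H1: "real H \<ge> 1" using H(1) by linarith
  hence H1': "H \<ge> 1" by simp
  have HN: "real H \<le> N"
  proof -
    have "real H ^ 2 < N powr 2" by (rule less_le_trans[OF H(2)]) (use N \<gamma> in \<open>intro powr_mono, auto\<close>)
    hence "real H ^ 2 < N ^ 2" using N by simp
    hence "real H < N" by (rule power2_less_imp_less) (use N in simp)
    thus ?thesis by simp
  qed
  have N\<gamma>: "N powr \<gamma> > 0" using N by simp
  have \<Delta>0: "\<Delta> > 0" using N by (simp add: \<Delta>_def)
  have X0: "X > 0" using N H1 by (simp add: X_def)
  have cP: "real (card P) \<le> real H * N"
    unfolding P_def card_cartesian_product using Af(2) by (auto intro!: mult_left_mono)
  define Q where "Q = real (card {(p, p'). p \<in> P \<and> p' \<in> P \<and> \<bar>x p - x p'\<bar> \<le> \<Delta>})"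
  define q where "q = quad_energy \<phi> B X"
  define F where "F = (\<lambda>p. norm (\<Sum>b\<in>B. ec (x p * \<phi> b)))"
  have dls: "(\<Sum>p\<in>P. (F p)\<^sup>2) \<le> 12 * sqrt (Q * ((X + 3 * \<Delta>) / \<Delta>) * q)"
    unfolding F_def Q_def q_def
  proof (rule double_large_sieve[OF finP finB _ _ \<Delta>0 X0])
    fix p assume p: "p \<in> P"
    hence "real (fst p) \<le> real H" "real (snd p) < N" using A by (auto simp: P_def)
    thus "0 \<le> x p \<and> x p \<le> X" unfolding x_def X_def using \<gamma> by (auto intro!: mult_mono powr_mono2)
  next
    fix b assume b: "b \<in> B"
    hence "2 ^ j \<le> b" using B(1) by auto
    hence b0: "real b > 0" by (metis le_zero_eq of_nat_0_less_iff power_not_zero zero_less_iff_neq_zero zero_neq_numeral)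
    have "\<phi> b \<le> N powr \<gamma>" unfolding \<phi>_def using B(2)[OF b] \<gamma> by (intro powr_mono2) auto
    hence "\<Delta> * \<phi> b \<le> \<Delta> * N powr \<gamma>" using \<Delta>0 by (intro mult_left_mono) auto
    thus "0 < \<phi> b \<and> 4 * \<Delta> * \<phi> b \<le> 1" using b0 N by (simp add: \<phi>_def \<Delta>_def)
  qed
  have Qb: "Q \<le> 5 * N powr \<kappa> * (real H * N)"
  proof -
    define S where "S = {(h, a, h', a'). h \<in> {1..H} \<and> h' \<in> {1..H} \<and> N / 2 \<le> real a \<and> real a < N \<and> N / 2 \<le> real a' \<and> real a' < N \<and>
      \<bar>real h * real a powr \<gamma> - real h' * real a' powr \<gamma>\<bar> \<le> \<Delta>}"
    have S: "finite S" "real (card S) \<le> 5 * (harm H)^2 * harm (nat \<lfloor>N\<rfloor>) * (real H * N)"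
      unfolding S_def using N \<gamma> H1' H(2) by (intro near_products_count; simp add: \<Delta>_def)+
    have "card {(p, p'). p \<in> P \<and> p' \<in> P \<and> \<bar>x p - x p'\<bar> \<le> \<Delta>} \<le> card S"
    proof (rule card_inj_on_le[OF _ _ S(1)])
      show "inj_on (\<lambda>(p, p'). (fst p, snd p, fst p', snd p')) {(p, p'). p \<in> P \<and> p' \<in> P \<and> \<bar>x p - x p'\<bar> \<le> \<Delta>}"
        by (auto simp: inj_on_def)
      show "(\<lambda>(p, p'). (fst p, snd p, fst p', snd p')) ` {(p, p'). p \<in> P \<and> p' \<in> P \<and> \<bar>x p - x p'\<bar> \<le> \<Delta>} \<subseteq> S"
        using A by (auto simp: S_def P_def x_def)
    qed
    hence "Q \<le> real (card S)" by (simp add: Q_def)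
    also note S(2)
    also have "5 * (harm H)^2 * harm (nat \<lfloor>N\<rfloor>) * (real H * N) \<le> 5 * (1 + ln N)^2 * (1 + ln N) * (real H * N)"
    proof (intro mult_mono power_mono order_refl)
      show "harm H \<le> 1 + ln N"
        by (rule order_trans[OF harm_le_ln]) (use H1 HN in auto)
      have "real (nat \<lfloor>N\<rfloor>) \<le> N" "real (nat \<lfloor>N\<rfloor>) \<ge> 1" using N by linarith+
      thus "harm (nat \<lfloor>N\<rfloor>) \<le> 1 + ln N"
        by (intro order_trans[OF harm_le_ln]) auto
    qed (use N H1 in \<open>auto simp: harm_nonneg\<close>)
    also have "\<dots> = 5 * (1 + ln N) ^ 3 * (real H * N)" by (simp add: eval_nat_numeral)
    also have "\<dots> \<le> 5 * N powr \<kappa> * (real H * N)"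
      using log N H1 by (intro mult_right_mono mult_left_mono) auto
    finally show ?thesis .
  qed
  have qb: "q \<le> K * N powr (2 + \<kappa>)"
  proof -
    have "q \<le> quad_energy \<phi> {2^j..<2^(j+1)} X" unfolding q_def by (rule quad_energy_mono_set) (use B in auto)
    also have "\<dots> \<le> quad_energy \<phi> {2^j..<2^(j+1)} ((2^j) powr (2 - \<gamma>))"
    proof (rule quad_energy_antimono)
      have "(2^j) powr (2 - \<gamma>) \<le> N powr (2 - \<gamma>)" using j \<gamma> by (intro powr_mono2) auto
      also have "\<dots> = N powr (2 - 2 * \<gamma>) * N powr \<gamma>" by (simp flip: powr_add)
      also have "\<dots> \<le> X" unfolding X_def using H(1) by (intro mult_right_mono) auto
      finally show "(2^j) powr (2 - \<gamma>) \<le> X" .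
    qed simp
    also have "\<dots> = block_energy \<gamma> j" by (simp add: block_energy_def \<phi>_def)
    also note K(2)
    also have "K * (2 ^ j) powr (2 + \<kappa>) \<le> K * N powr (2 + \<kappa>)"
      using K(1) j \<kappa> by (intro mult_left_mono powr_mono2) auto
    finally show ?thesis .
  qed
  have Xb: "(X + 3 * \<Delta>) / \<Delta> \<le> 7 * real H * N powr (2 * \<gamma>)"
  proof -
    have "(X + 3 * \<Delta>) / \<Delta> = X / \<Delta> + 3" using \<Delta>0 by (simp add: add_divide_distrib)
    also have "X / \<Delta> = 4 * real H * (N powr \<gamma> * N powr \<gamma>)" by (simp add: X_def \<Delta>_def)
    also have "N powr \<gamma> * N powr \<gamma> = N powr (2 * \<gamma>)" by (simp flip: powr_add)
    finally have "(X + 3 * \<Delta>) / \<Delta> = 4 * (real H * N powr (2 * \<gamma>)) + 3" by simp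
    moreover have "1 * 1 \<le> real H * N powr (2 * \<gamma>)"
      using H1 N \<gamma> by (intro mult_mono ge_one_powr_ge_zero) auto
    ultimately show ?thesis by simp
  qed
  define Y where "Y = real H * N powr (3/2 + \<gamma> + \<kappa>)"
  have Y0: "Y \<ge> 0" by (simp add: Y_def)
  have "Q * ((X + 3 * \<Delta>) / \<Delta>) * q \<le> (5 * N powr \<kappa> * (real H * N)) * (7 * real H * N powr (2 * \<gamma>)) * (K * N powr (2 + \<kappa>))"
    using Qb Xb qb X0 \<Delta>0 N by (intro mult_mono) (auto simp: Q_def q_def quad_energy_nonneg)
  also have "\<dots> = 35 * K * (real H ^ 2 * (N powr \<kappa> * N powr 1 * N powr (2 * \<gamma>) * N powr (2 + \<kappa>)))"
    using N by (simp add: power2_eq_square)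
  also have "N powr \<kappa> * N powr 1 * N powr (2 * \<gamma>) * N powr (2 + \<kappa>) = (N powr (3/2 + \<gamma> + \<kappa>)) ^ 2"
    unfolding power2_eq_square powr_add[symmetric] by (simp add: algebra_simps)
  finally have "sqrt (Q * ((X + 3 * \<Delta>) / \<Delta>) * q) \<le> sqrt (35 * K * Y ^ 2)"
    by (intro real_sqrt_le_mono) (simp add: Y_def power_mult_distrib)
  also have "\<dots> = sqrt (35 * K) * Y" using Y0 by (simp add: real_sqrt_mult)
  finally have sq: "(\<Sum>p\<in>P. (F p)\<^sup>2) \<le> 12 * sqrt (35 * K) * Y" using dls by linarith
  have "(\<Sum>p\<in>P. F p)\<^sup>2 \<le> (\<Sum>p\<in>P. (F p)\<^sup>2) * real (card P)" by (rule sum_squared_le_sum_of_squares)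
  also have "\<dots> \<le> (12 * sqrt (35 * K) * Y) * (real H * N)"
    using sq cP Y0 K by (intro mult_mono) auto
  also have "\<dots> = 12 * sqrt (35 * K) * (real H ^ 2 * (N powr (3/2 + \<gamma> + \<kappa>) * N powr 1))"
    using N by (simp add: Y_def power2_eq_square)
  also have "N powr (3/2 + \<gamma> + \<kappa>) * N powr 1 = (N powr (5/4 + \<gamma>/2 + \<kappa>/2)) ^ 2"
    unfolding power2_eq_square powr_add[symmetric] by (simp add: algebra_simps)
  finally have "(\<Sum>p\<in>P. F p)\<^sup>2 \<le> 12 * sqrt (35 * K) * (real H * N powr (5/4 + \<gamma>/2 + \<kappa>/2)) ^ 2"
    by (simp only: power_mult_distrib)
  hence "(\<Sum>p\<in>P. F p) \<le> sqrt (12 * sqrt (35 * K) * (real H * N powr (5/4 + \<gamma>/2 + \<kappa>/2)) ^ 2)"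
    by (rule real_le_rsqrt)
  also have "\<dots> = sqrt (12 * sqrt (35 * K)) * (real H * N powr (5/4 + \<gamma>/2 + \<kappa>/2))"
    unfolding real_sqrt_mult[of "12 * sqrt (35 * K)"] real_sqrt_abs by simp
  finally show ?thesis by (simp only: P_def F_def x_def \<phi>_def)
qed

text \<open>The interval from \<open>N / 2\<close> to \<open>N\<close> meets at most two dyadic
  blocks, whence the factor \<open>2\<close>. The shift \<open>t\<close> contributes a factor of
  modulus 1 for each \<open>h\<close>.\<close>

lemma bilinear_sum_bound:
  fixes \<gamma> N \<kappa> K t :: real and H :: nat and A B :: "nat set"
  assumes N: "N \<ge> 2" and \<gamma>: "1/2 \<le> \<gamma>" "\<gamma> < 1" and \<kappa>: "\<kappa> > 0"
    and K: "K > 0" "\<And>j. block_energy \<gamma> j \<le> K * (2 ^ j) powr (2 + \<kappa>)"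
    and H: "N powr (2 - 2 * \<gamma>) \<le> real H" "real H ^ 2 < N powr (2 * \<gamma>)"
    and A: "A \<subseteq> {m. 0 < m \<and> N / 2 \<le> real m \<and> real m < N}"
    and B: "B \<subseteq> {m. 0 < m \<and> N / 2 \<le> real m \<and> real m < N}"
    and log: "(1 + ln N) ^ 3 \<le> N powr \<kappa>"
  shows "(\<Sum>h\<in>{1..H}. norm (\<Sum>p\<in>A \<times> B. ec (real h * (real (fst p * snd p) powr \<gamma> + t))))
    \<le> 2 * sqrt (12 * sqrt (35 * K)) * (real H * N powr (5/4 + \<gamma>/2 + \<kappa>/2))"
proof -
  have Bf: "finite B" using card_nat_below(1)[OF B] N by simp
  have "1 \<le> nat \<lfloor>N / 2\<rfloor>" using N by linarith
  from ex_power_ivl1[OF order_refl this] obtain j where "2 ^ j \<le> nat \<lfloor>N / 2\<rfloor>" "nat \<lfloor>N / 2\<rfloor> < 2 ^ (j + 1)" by auto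
  hence "real (2 ^ j) \<le> real (nat \<lfloor>N / 2\<rfloor>)" "real (nat \<lfloor>N / 2\<rfloor> + 1) \<le> real (2 ^ (j + 1))"
    unfolding of_nat_le_iff by auto
  moreover have "real (nat \<lfloor>N / 2\<rfloor>) \<le> N / 2" "N / 2 < real (nat \<lfloor>N / 2\<rfloor> + 1)" using N by linarith+
  ultimately have "real (2 ^ j) \<le> N / 2" "N / 2 < real (2 ^ (j + 1))" by linarith+
  hence j: "2 ^ j \<le> N / 2" "N / 2 < 2 ^ (j + 1)" by simp_all
  define Bl where "Bl = B \<inter> {2 ^ j..<2 ^ (j + 1)}"
  \<comment> \<open>The second block starts above \<open>N / 2\<close>, so it may run past
    \<open>N\<close>; the bound only needs its starting point to be at most \<open>N\<close> and
    \<open>B\<close> to stay below \<open>N\<close>.\<close>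
  define Bu where "Bu = B \<inter> {2 ^ (j + 1)..<2 ^ (j + 1 + 1)}"
  have Bun: "B = Bl \<union> Bu"
  proof -
    have "2 ^ j \<le> b" "b < 2 ^ (j + 1 + 1)" if "b \<in> B" for b
    proof -
      have "N / 2 \<le> real b" using B that by auto
      moreover have "real (2 ^ j) = 2 ^ j" by simp
      ultimately have "real (2 ^ j) \<le> real b" using j(1) by linarith
      thus "2 ^ j \<le> b" by (simp only: of_nat_le_iff)
      have "real b < real (2 ^ (j + 1 + 1))" using B that j(2) by auto
      thus "b < 2 ^ (j + 1 + 1)" by (simp only: of_nat_less_iff)
    qed
    thus ?thesis unfolding Bl_def Bu_def by (auto simp: not_less)
  qed
  define G where "G = (\<lambda>C p. norm (\<Sum>b\<in>C. ec (real (fst p) * real (snd p) powr \<gamma> * real b powr \<gamma>)))"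
  define R where "R = sqrt (12 * sqrt (35 * K)) * (real H * N powr (5/4 + \<gamma>/2 + \<kappa>/2))"
  have l: "(\<Sum>p\<in>{1..H} \<times> A. G Bl p) \<le> R" unfolding G_def R_def
    by (rule bilinear_block_bound[OF N \<gamma> \<kappa> K(1) K(2)[of j] H A]) (use B j N log in \<open>auto simp: Bl_def\<close>)
  have u: "(\<Sum>p\<in>{1..H} \<times> A. G Bu p) \<le> R" unfolding G_def R_def
    by (rule bilinear_block_bound[OF N \<gamma> \<kappa> K(1) K(2)[of "j + 1"] H A]) (use B j N log in \<open>auto simp: Bu_def\<close>)
  have "norm (\<Sum>p\<in>A \<times> B. ec (real h * (real (fst p * snd p) powr \<gamma> + t))) \<le> (\<Sum>a\<in>A. G Bl (h, a) + G Bu (h, a))" for h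
  proof -
    have "(\<Sum>p\<in>A \<times> B. ec (real h * (real (fst p * snd p) powr \<gamma> + t))) = (\<Sum>p\<in>A \<times> B. ec (real h * real (fst p) powr \<gamma> * real (snd p) powr \<gamma>)) * ec (real h * t)"
      unfolding sum_distrib_right ec_add[symmetric] by (intro sum.cong refl) (simp add: powr_mult algebra_simps)
    also have "(\<Sum>p\<in>A \<times> B. ec (real h * real (fst p) powr \<gamma> * real (snd p) powr \<gamma>)) = (\<Sum>a\<in>A. \<Sum>b\<in>B. ec (real h * real a powr \<gamma> * real b powr \<gamma>))"
      by (simp add: sum.cartesian_product split_def)
    finally have "norm (\<Sum>p\<in>A \<times> B. ec (real h * (real (fst p * snd p) powr \<gamma> + t))) = norm (\<Sum>a\<in>A. \<Sum>b\<in>B. ec (real h * real a powr \<gamma> * real b powr \<gamma>))"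
      by (simp add: norm_mult)
    also have "\<dots> \<le> (\<Sum>a\<in>A. G Bl (h, a) + G Bu (h, a))"
    proof (rule sum_norm_le)
      fix a
      have "(\<Sum>b\<in>B. ec (real h * real a powr \<gamma> * real b powr \<gamma>)) = (\<Sum>b\<in>Bl. ec (real h * real a powr \<gamma> * real b powr \<gamma>)) + (\<Sum>b\<in>Bu. ec (real h * real a powr \<gamma> * real b powr \<gamma>))"
        unfolding Bun by (rule sum.union_disjoint) (use Bf in \<open>auto simp: Bl_def Bu_def\<close>)
      thus "norm (\<Sum>b\<in>B. ec (real h * real a powr \<gamma> * real b powr \<gamma>)) \<le> G Bl (h, a) + G Bu (h, a)"
        by (simp add: G_def norm_triangle_ineq)
    qed
    finally show ?thesis .
  qed
  hence "(\<Sum>h\<in>{1..H}. norm (\<Sum>p\<in>A \<times> B. ec (real h * (real (fst p * snd p) powr \<gamma> + t)))) \<le> (\<Sum>h\<in>{1..H}. \<Sum>a\<in>A. G Bl (h, a) + G Bu (h, a))"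
    by (rule sum_mono)
  also have "\<dots> = (\<Sum>p\<in>{1..H} \<times> A. G Bl p) + (\<Sum>p\<in>{1..H} \<times> A. G Bu p)"
    by (simp add: sum.cartesian_product sum.distrib split_def)
  also have "\<dots> \<le> R + R" by (intro add_mono l u)
  finally show ?thesis by (simp only: R_def mult_2 distrib_right)
qed

text \<open>The constant implicit in the lower bound for the cardinalities is the variable
  \<open>C\<close>: \<open>\<delta>\<close> is chosen before it and depends on \<open>c\<close>
  alone, the threshold for \<open>N\<close> after it.\<close>

theorem theorem1:
  fixes c :: real
  assumes "1 < c" and "c < 6 / 5"
  shows "\<exists>\<delta>>0. \<forall>C>0. \<exists>N\<^sub>0>0. \<forall>N::real. N > N\<^sub>0 \<longrightarrow>
           (\<forall>A B :: nat set.
              A \<subseteq> {m. 0 < m \<and> N / 2 \<le> real m \<and> real m < N} \<longrightarrow>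
              B \<subseteq> {m. 0 < m \<and> N / 2 \<le> real m \<and> real m < N} \<longrightarrow>
              real (card A) * real (card B) \<ge> C * N powr (2 - 2 * \<delta>) \<longrightarrow>
              (\<exists>a\<in>A. \<exists>b\<in>B. \<exists>n::nat. 0 < n \<and> int (a * b) = \<lfloor>real n powr c\<rfloor>))"
proof -
  define \<gamma> where "\<gamma> = 1 / c"
  have \<gamma>: "5/6 < \<gamma>" "\<gamma> < 1" using assms by (auto simp: \<gamma>_def field_simps)
  \<comment> \<open>The final exponent is \<open>2 - 3 * \<tau> / 2 + 3 * \<epsilon> / 2\<close>;
    with \<open>\<epsilon> = \<tau> / 3\<close> this is \<open>2 - \<tau>\<close>. Taking
    \<open>\<delta> = \<tau> / 4\<close> asks for \<open>2 - \<tau> / 2\<close>, and the spare power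
    of \<open>N\<close> beats any constant \<open>C\<close>.\<close>
  define \<tau> where "\<tau> = \<gamma> - 5/6"
  define \<epsilon> where "\<epsilon> = \<tau> / 3"
  have \<epsilon>: "0 < \<epsilon>" "\<epsilon> < 1/18" and \<tau>: "0 < \<tau>" using \<gamma> by (auto simp: \<tau>_def \<epsilon>_def)
  obtain K where K: "K > 0" "\<And>j. block_energy \<gamma> j \<le> K * (2 ^ j) powr (2 + \<epsilon>)"
    using block_energy_bound[of \<gamma> \<epsilon>] \<gamma> \<epsilon> by auto
  \<comment> \<open>With \<open>k * \<epsilon> \<ge> 1\<close> the power
    \<open>(N powr \<epsilon>) ^ (2 * k)\<close> is at least \<open>N^2\<close>, which dominates the
    number \<open>k * L\<close> of frequencies.\<close>
  define k where "k = nat \<lceil>1 / \<epsilon>\<rceil>"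
  have "1 / \<epsilon> \<le> real k" using \<epsilon> by (simp add: k_def)
  hence k\<epsilon>: "1 \<le> real k * \<epsilon>" using \<epsilon> by (simp add: field_simps)
  have k: "k \<ge> 1" using k\<epsilon> by (cases k) auto
  define D where "D = 4 * (2 * sqrt (12 * sqrt (35 * K))) * (2 * real k)"
  have main: "\<exists>a\<in>A. \<exists>b\<in>B. \<exists>n::nat. 0 < n \<and> int (a * b) = \<lfloor>real n powr c\<rfloor>"
    if N: "N \<ge> 2" and log: "(1 + ln N) ^ 3 \<le> N powr \<epsilon>"
      and n1: "4 * real k * N powr 1 < (\<gamma> / 4) ^ (2 * k) * N powr 2"
      and n2: "(2 * real k) ^ 2 * N powr (2 * (2 - 2 * \<gamma> + \<epsilon>)) < 1 * N powr (2 * \<gamma>)"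
      and n3: "D * N powr (2 - \<tau>) < C * N powr (2 - 2 * (\<tau> / 4))"
      and A: "A \<subseteq> {m. 0 < m \<and> N / 2 \<le> real m \<and> real m < N}"
      and B: "B \<subseteq> {m. 0 < m \<and> N / 2 \<le> real m \<and> real m < N}"
      and card: "real (card A) * real (card B) \<ge> C * N powr (2 - 2 * (\<tau> / 4))" for C N A B
  proof (rule ccontr)
    assume no: "\<not> ?thesis"
    \<comment> \<open>Larger than \<open>1 / w\<close> by about \<open>N powr \<epsilon>\<close>,
      since \<open>w\<close> has order \<open>N powr (2 * \<gamma> - 2)\<close>.\<close>
    define L where "L = nat \<lceil>N powr (2 - 2 * \<gamma> + \<epsilon>)\<rceil>"
    have "1 \<le> N powr (2 - 2 * \<gamma> + \<epsilon>)" using N \<gamma> \<epsilon> by (intro ge_one_powr_ge_zero) auto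
    hence L: "N powr (2 - 2 * \<gamma> + \<epsilon>) \<le> real L" "real L \<le> 2 * N powr (2 - 2 * \<gamma> + \<epsilon>)" "L \<ge> 1"
      unfolding L_def by linarith+
    \<comment> \<open>The mean value bound for the gap after \<open>m = a * b\<close>, taken at
      \<open>2 * N^2 \<ge> m + 1\<close> so that one \<open>w\<close> serves all products.\<close>
    define w where "w = \<gamma> * (2 * N powr 2) powr (\<gamma> - 1)"
    have w0: "w > 0" using \<gamma> N by (simp add: w_def)
    have far: "w / 2 \<le> \<bar>real (fst p * snd p) powr \<gamma> + w / 2 - of_int n\<bar>" if p: "p \<in> A \<times> B" for p and n :: int
      unfolding \<gamma>_def
    proof (rule no_power_value_gap)
      show p0: "0 < fst p * snd p" using p A B by auto
      have "real (fst p * snd p) \<le> N * N" unfolding of_nat_mult using p A B by (intro mult_mono) auto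
      moreover have "2 * 2 \<le> N * N" using N by (intro mult_mono) auto
      moreover have "N powr 2 = N * N" using N by (simp add: power2_eq_square)
      ultimately have "real (fst p * snd p) + 1 \<le> 2 * N powr 2" by linarith
      thus "w \<le> (real (fst p * snd p) + 1) powr (1 / c) - real (fst p * snd p) powr (1 / c)"
        unfolding w_def \<gamma>_def[symmetric] using \<gamma> p0 by (intro powr_succ_diff_ge) (auto simp del: of_nat_mult)
      show "int (fst p * snd p) \<noteq> \<lfloor>real m powr c\<rfloor>" if "m > 0" for m :: nat
        using no that p by (metis mem_Times_iff)
    qed (use assms in auto)
    have Lw: "\<gamma> / 4 * N powr \<epsilon> \<le> real L * w / 2"
    proof -
      have "(1/2) * N powr (2 * \<gamma> - 2) \<le> (2 * N powr 2) powr (\<gamma> - 1)"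
      proof -
        have "(2::real) powr (-1) \<le> 2 powr (\<gamma> - 1)" using \<gamma> by (intro powr_mono) auto
        moreover have "(2 * N powr 2) powr (\<gamma> - 1) = 2 powr (\<gamma> - 1) * N powr (2 * \<gamma> - 2)"
          by (simp add: powr_mult powr_powr algebra_simps)
        ultimately show ?thesis
          using mult_right_mono[of "1/2" "2 powr (\<gamma> - 1)" "N powr (2 * \<gamma> - 2)"] by (simp add: powr_minus)
      qed
      hence "\<gamma> * ((1/2) * N powr (2 * \<gamma> - 2)) \<le> w" unfolding w_def using \<gamma> by (intro mult_left_mono) auto
      hence "N powr (2 - 2 * \<gamma> + \<epsilon>) * (\<gamma> * ((1/2) * N powr (2 * \<gamma> - 2))) \<le> real L * w"
        using L(1) \<gamma> by (intro mult_mono) auto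
      moreover have "N powr (2 - 2 * \<gamma> + \<epsilon>) * N powr (2 * \<gamma> - 2) = N powr \<epsilon>" by (simp flip: powr_add)
      hence "N powr (2 - 2 * \<gamma> + \<epsilon>) * (\<gamma> * ((1/2) * N powr (2 * \<gamma> - 2))) = \<gamma> * (1/2) * N powr \<epsilon>"
        by (metis mult.assoc mult.left_commute)
      ultimately have "\<gamma> * (1/2) * N powr \<epsilon> \<le> real L * w" by (simp only:)
      thus ?thesis by simp
    qed
    have big: "2 * real (k * L) \<le> (real L * w / 2) ^ (2 * k)"
    proof -
      have "N powr (2 - 2 * \<gamma> + \<epsilon>) \<le> N powr 1" using N \<gamma> \<epsilon> by (intro powr_mono) auto
      hence "real L \<le> 2 * N powr 1" using L(2) by linarith
      hence "2 * real k * real L \<le> 2 * real k * (2 * N powr 1)" by (intro mult_left_mono) auto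
      hence "2 * real (k * L) \<le> (\<gamma> / 4) ^ (2 * k) * N powr 2" using n1 unfolding of_nat_mult by linarith
      also have "N powr 2 \<le> (N powr \<epsilon>) ^ (2 * k)"
      proof -
        have "(N powr \<epsilon>) ^ (2 * k) = N powr (\<epsilon> * real (2 * k))" using N by (simp add: powr_realpow[symmetric] powr_powr)
        moreover have "N powr 2 \<le> N powr (\<epsilon> * real (2 * k))" using N k\<epsilon> by (intro powr_mono) (auto simp: mult.commute)
        ultimately show ?thesis by (simp only:)
      qed
      also have "(\<gamma> / 4) ^ (2 * k) * (N powr \<epsilon>) ^ (2 * k) = (\<gamma> / 4 * N powr \<epsilon>) ^ (2 * k)" by (simp only: power_mult_distrib)
      also have "\<dots> \<le> (real L * w / 2) ^ (2 * k)" using Lw \<gamma> by (intro power_mono) auto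
      finally show ?thesis using \<gamma> by simp
    qed
    define H where "H = k * L"
    have H1: "N powr (2 - 2 * \<gamma>) \<le> real H"
    proof -
      have "N powr (2 - 2 * \<gamma>) \<le> N powr (2 - 2 * \<gamma> + \<epsilon>)" using N \<epsilon> by (intro powr_mono) auto
      also have "\<dots> \<le> 1 * real L" using L(1) by simp
      also have "\<dots> \<le> real k * real L" using k by (intro mult_right_mono) auto
      finally show ?thesis by (simp add: H_def)
    qed
    have H2: "real H \<le> 2 * real k * N powr (2 - 2 * \<gamma> + \<epsilon>)"
      using mult_left_mono[OF L(2), of "real k"] by (simp add: H_def)
    have H3: "real H ^ 2 < N powr (2 * \<gamma>)"
    proof -
      have "real H ^ 2 \<le> (2 * real k * N powr (2 - 2 * \<gamma> + \<epsilon>)) ^ 2" by (rule power_mono[OF H2]) simp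
      also have "\<dots> = (2 * real k) ^ 2 * N powr (2 * (2 - 2 * \<gamma> + \<epsilon>))"
        unfolding power_mult_distrib mult_2 powr_add power2_eq_square by simp
      finally show ?thesis using n2 by simp
    qed
    have fin: "finite (A \<times> B)" using card_nat_below(1)[OF A] card_nat_below(1)[OF B] N by simp
    have "real (card (A \<times> B)) \<le> 4 * (\<Sum>h\<in>{1..H}. norm (\<Sum>p\<in>A \<times> B. ec (real h * (real (fst p * snd p) powr \<gamma> + w / 2))))"
      unfolding H_def by (rule gap_forces_exponential_sum[OF fin w0 L(3) k far big])
    also have "\<dots> \<le> 4 * (2 * sqrt (12 * sqrt (35 * K)) * (real H * N powr (5/4 + \<gamma>/2 + \<epsilon>/2)))"
      by (intro mult_left_mono bilinear_sum_bound N \<epsilon> K H1 H3 A B log) (use \<gamma> in auto)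
    also have "\<dots> \<le> 4 * (2 * sqrt (12 * sqrt (35 * K)) * ((2 * real k * N powr (2 - 2 * \<gamma> + \<epsilon>)) * N powr (5/4 + \<gamma>/2 + \<epsilon>/2)))"
      using H2 K by (intro mult_left_mono mult_right_mono) auto
    also have "\<dots> = D * (N powr (2 - 2 * \<gamma> + \<epsilon>) * N powr (5/4 + \<gamma>/2 + \<epsilon>/2))" by (simp add: D_def)
    also have "N powr (2 - 2 * \<gamma> + \<epsilon>) * N powr (5/4 + \<gamma>/2 + \<epsilon>/2) = N powr (2 - \<tau>)"
      unfolding powr_add[symmetric] by (simp add: \<epsilon>_def \<tau>_def algebra_simps)
    finally show False using n3 card by (simp add: card_cartesian_product)
  qed
  show ?thesis
  proof (rule exI[of _ "\<tau> / 4"], intro conjI allI impI)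
    show "\<tau> / 4 > 0" using \<tau> by simp
    fix C :: real assume C: "C > 0"
    have e1: "eventually (\<lambda>N. (1 + ln N) ^ 3 \<le> N powr \<epsilon>) at_top" using \<epsilon>(1) by real_asymp
    have e2: "eventually (\<lambda>N. 4 * real k * N powr 1 < (\<gamma> / 4) ^ (2 * k) * N powr 2) at_top"
      by (rule eventually_powr_less) (use \<gamma> in auto)
    have e3: "eventually (\<lambda>N. (2 * real k) ^ 2 * N powr (2 * (2 - 2 * \<gamma> + \<epsilon>)) < 1 * N powr (2 * \<gamma>)) at_top"
      by (rule eventually_powr_less) (use \<gamma> \<epsilon> in auto)
    have e4: "eventually (\<lambda>N. D * N powr (2 - \<tau>) < C * N powr (2 - 2 * (\<tau> / 4))) at_top"
      by (rule eventually_powr_less) (use \<tau> C in auto)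
    from eventually_conj[OF eventually_ge_at_top[of 2] eventually_conj[OF e1 eventually_conj[OF e2 eventually_conj[OF e3 e4]]]]
    obtain N0 where N0: "\<And>N. N \<ge> N0 \<Longrightarrow> 2 \<le> N \<and> (1 + ln N) ^ 3 \<le> N powr \<epsilon> \<and> 4 * real k * N powr 1 < (\<gamma> / 4) ^ (2 * k) * N powr 2
        \<and> (2 * real k) ^ 2 * N powr (2 * (2 - 2 * \<gamma> + \<epsilon>)) < 1 * N powr (2 * \<gamma>) \<and> D * N powr (2 - \<tau>) < C * N powr (2 - 2 * (\<tau> / 4))"
      unfolding eventually_at_top_linorder by blast
    show "\<exists>N\<^sub>0>0. \<forall>N::real. N > N\<^sub>0 \<longrightarrow>
           (\<forall>A B :: nat set.
              A \<subseteq> {m. 0 < m \<and> N / 2 \<le> real m \<and> real m < N} \<longrightarrow>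
              B \<subseteq> {m. 0 < m \<and> N / 2 \<le> real m \<and> real m < N} \<longrightarrow>
              real (card A) * real (card B) \<ge> C * N powr (2 - 2 * (\<tau> / 4)) \<longrightarrow>
              (\<exists>a\<in>A. \<exists>b\<in>B. \<exists>n::nat. 0 < n \<and> int (a * b) = \<lfloor>real n powr c\<rfloor>))"
    proof (rule exI[of _ "max N0 1"], intro conjI allI impI)
      fix N :: real and A B :: "nat set"
      assume "N > max N0 1" and AB: "A \<subseteq> {m. 0 < m \<and> N / 2 \<le> real m \<and> real m < N}"
        "B \<subseteq> {m. 0 < m \<and> N / 2 \<le> real m \<and> real m < N}"
        "real (card A) * real (card B) \<ge> C * N powr (2 - 2 * (\<tau> / 4))"
      hence "N \<ge> N0" by simp
      from N0[OF this] show "\<exists>a\<in>A. \<exists>b\<in>B. \<exists>n::nat. 0 < n \<and> int (a * b) = \<lfloor>real n powr c\<rfloor>"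
        using AB by (intro main[of N C A B]) blast+
    qed simp
  qed
qed

end
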